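(* Let $m\ge 1$ and let $T$ be an $m$-linear Calderón–Zygmund operator on $\mathbb{R}^n$. Then there are constants $\alpha,c>0$, depending only on $n$, $m$ and $T$, such that for every cube $Q$ and every vector $\vec f=(f_1,\dots,f_m)$ of functions $f_j\in L^\infty_c(\mathbb{R}^n)$ with $\operatorname{supp}(f_j)\subseteq Q$ for $1\le j\le m$, $$|\{x\in Q: |T\vec f(x)|>t\,\mathcal{M}\vec f(x)\}|\le c\,e^{-\alpha t}|Q|,\qquad t>0.$$
   Context: Cubes have sides parallel to the axes; $L^\infty_c(\mathbb{R}^n)$ is the space of bounded compactly supported functions. The multilinear maximal function is $$\mathcal{M}(\vec f)(x)=\sup_{Q\ni x}\prod_{i=1}^m\frac1{|Q|}\int_Q|f_i(y_i)|\,dy_i,$$ the supremum over all cubes $Q$ containing $x$. An $m$-linear Calderón–Zygmund operator is an $m$-linear operator $T:\mathcal{S}(\mathbb{R}^n)\times\cdots\times\mathcal{S}(\mathbb{R}^n)\to\mathcal{S}'(\mathbb{R}^n)$ which, for some $1\le q_j<\infty$, extends to a bounded multilinear operator from $L^{q_1}\times\cdots\times L^{q_m}$ to $L^q$, where $\frac1q=\frac1{q_1}+\cdots+\frac1{q_m}$, and for which there is a function $K$ defined off the diagonal $x=y_1=\cdots=y_m$ in $(\mathbb{R}^n)^{m+1}$ with $$T(f_1,\dots,f_m)(x)=\int_{(\mathbb{R}^n)^m}K(x,y_1,\dots,y_m)f_1(y_1)\cdots f_m(y_m)\,dy_1\cdots dy_m$$ for all $x\notin\bigcap_{j=1}^m\operatorname{supp}f_j$.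 As is standard, writing $y_0=x$, the kernel is required to satisfy, for some $A,\varepsilon>0$, the size estimate $|K(y_0,y_1,\dots,y_m)|\le A\big(\sum_{k,l=0}^m|y_k-y_l|\big)^{-mn}$ and the regularity estimate $$|K(y_0,\dots,y_j,\dots,y_m)-K(y_0,\dots,y_j',\dots,y_m)|\le \frac{A|y_j-y_j'|^\varepsilon}{\big(\sum_{k,l=0}^m|y_k-y_l|\big)^{mn+\varepsilon}}$$ for each $0\le j\le m$, whenever $|y_j-y_j'|\le\frac12\max_{0\le k\le m}|y_j-y_k|$. *)

theory Defs
  imports "HOL-Analysis.Analysis"
begin

text \<open>
  Throughout, the type \<open>'m\<close> indexes the \<open>m\<close> arguments of a multilinear operator and
  \<open>real^'n\<close> is the underlying Euclidean space. Measurability and measure refer to Lebesgue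
  measure, and functions are complex valued.
\<close>

definition is_cube :: "(real^'n) set \<Rightarrow> bool" where
  "is_cube Q \<longleftrightarrow> (\<exists>a l. l > 0 \<and> Q = cbox a (\<chi> i. a $ i + l))"

definition multi_maximal :: "('m::finite \<Rightarrow> real^'n \<Rightarrow> complex) \<Rightarrow> real^'n \<Rightarrow> ennreal" where
  "multi_maximal f x =
     (SUP Q \<in> {Q. is_cube Q \<and> x \<in> Q}.
        \<Prod>j\<in>UNIV. (\<integral>\<^sup>+y\<in>Q. ennreal (norm (f j y)) \<partial>lebesgue) / emeasure lebesgue Q)"

text \<open>
  The support of a function defined up to null sets: the complement of the largest open set
  on which it vanishes almost everywhere. For continuous functions this is the usual support.
\<close>

definition ess_supp :: "(real^'n \<Rightarrow> complex) \<Rightarrow> (real^'n) set" where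
  "ess_supp f = - \<Union>{U. open U \<and> (AE x in lebesgue. x \<in> U \<longrightarrow> f x = 0)}"

lemma ess_supp_continuous:
  fixes f :: "real^'n \<Rightarrow> complex"
  assumes "continuous_on UNIV f"
  shows "ess_supp f = closure {x. f x \<noteq> 0}"
proof -
  have op: "open {x. f x \<noteq> 0}"
    by (intro open_Collect_neq assms continuous_on_const)
  have "x \<in> U \<longrightarrow> f x = 0"
    if U: "open U" and ae: "AE x in lebesgue. x \<in> U \<longrightarrow> f x = 0" for U x
  proof -
    have o: "open (U \<inter> {x. f x \<noteq> 0})" using U op by blast
    from ae obtain N where N: "N \<in> null_sets lebesgue"
      "{x \<in> space lebesgue. \<not> (x \<in> U \<longrightarrow> f x = 0)} \<subseteq> N"
      unfolding eventually_ae_filter by blast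
    have "negligible N" using N(1) by (simp add: negligible_iff_null_sets)
    moreover have "U \<inter> {x. f x \<noteq> 0} \<subseteq> N" using N(2) by (simp add: subset_iff)
    ultimately have "negligible (U \<inter> {x. f x \<noteq> 0})" by (rule negligible_subset)
    thus ?thesis using open_not_negligible[OF o] by blast
  qed
  hence "{U. open U \<and> (AE x in lebesgue. x \<in> U \<longrightarrow> f x = 0)} = {U. open U \<and> U \<subseteq> {x. f x = 0}}"
    by (intro Collect_cong conj_cong refl iffI) (blast, rule AE_I2, blast)
  moreover have "interior {x. f x = 0} = \<Union>{U. open U \<and> U \<subseteq> {x. f x = 0}}"
    unfolding interior_def by blast
  moreover have "closure {x. f x \<noteq> 0} = - interior {x. f x = 0}"
    unfolding closure_interior by (simp add: Compl_eq)
  ultimately show ?thesis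
    unfolding ess_supp_def by simp
qed

definition Linfty_c :: "(real^'n \<Rightarrow> complex) set" where
  "Linfty_c = {f. f \<in> borel_measurable lebesgue \<and>
                  (\<exists>B. AE x in lebesgue. norm (f x) \<le> B) \<and> compact (ess_supp f)}"

text \<open>The exponent may be smaller than 1; \<open>Lp_norm\<close> is then only a quasinorm.\<close>

definition Lp_space :: "real \<Rightarrow> (real^'n \<Rightarrow> complex) set" where
  "Lp_space p = {f. f \<in> borel_measurable lebesgue \<and>
                    integrable lebesgue (\<lambda>x. norm (f x) powr p)}"

definition Lp_norm :: "real \<Rightarrow> (real^'n \<Rightarrow> complex) \<Rightarrow> real" where
  "Lp_norm p f = (LINT x|lebesgue. norm (f x) powr p) powr (1 / p)"

text \<open>
  The list of indices \<open>[i\<^sub>1, \<dots>, i\<^sub>k]\<close> stands for the differential operator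
  \<open>\<partial>\<^bsub>i\<^sub>1\<^esub> \<dots> \<partial>\<^bsub>i\<^sub>k\<^esub>\<close>. Requiring all iterated partial derivatives to be
  differentiable amounts to smoothness.
\<close>

fun partial_deriv :: "'n list \<Rightarrow> (real^'n \<Rightarrow> complex) \<Rightarrow> real^'n \<Rightarrow> complex" where
  "partial_deriv [] f = f"
| "partial_deriv (i # is) f = (\<lambda>x. frechet_derivative (partial_deriv is f) (at x) (axis i 1))"

definition schwartz :: "(real^'n \<Rightarrow> complex) set" where
  "schwartz = {f. \<forall>is. (\<forall>x. partial_deriv is f differentiable (at x)) \<and>
                       (\<forall>k. bounded (range (\<lambda>x. (1 + norm x) ^ k * norm (partial_deriv is f x))))}"

definition schwartz_seminorm :: "nat \<Rightarrow> (real^'n \<Rightarrow> complex) \<Rightarrow> real" where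
  "schwartz_seminorm N f =
     (\<Sum>is | length is \<le> N. SUP x. (1 + norm x) ^ N * norm (partial_deriv is f x))"

text \<open>Only the values of a tempered distribution on Schwartz functions are meaningful.\<close>

definition tempered_distribution :: "((real^'n \<Rightarrow> complex) \<Rightarrow> complex) \<Rightarrow> bool" where
  "tempered_distribution u \<longleftrightarrow>
     (\<forall>\<phi>\<in>schwartz. \<forall>\<psi>\<in>schwartz. \<forall>a b. u (\<lambda>x. a * \<phi> x + b * \<psi> x) = a * u \<phi> + b * u \<psi>) \<and>
     (\<exists>C N. \<forall>\<phi>\<in>schwartz. norm (u \<phi>) \<le> C * schwartz_seminorm N \<phi>)"

text \<open>
  Multilinearity of an operator on \<open>\<Prod>\<^sub>j V j\<close>, where \<open>eqv\<close> is equality in the target space: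
  equality on Schwartz functions for distributions, equality almost everywhere for functions.
\<close>

definition multilinear_op ::
  "(('z \<Rightarrow> complex) \<Rightarrow> ('z \<Rightarrow> complex) \<Rightarrow> bool) \<Rightarrow> ('m \<Rightarrow> ('x \<Rightarrow> complex) set)
    \<Rightarrow> (('m \<Rightarrow> 'x \<Rightarrow> complex) \<Rightarrow> 'z \<Rightarrow> complex) \<Rightarrow> bool" where
  "multilinear_op eqv V T \<longleftrightarrow>
     (\<forall>f j. \<forall>g\<in>V j. \<forall>h\<in>V j. \<forall>a b. (\<forall>i. f i \<in> V i) \<longrightarrow>
        eqv (T (f(j := \<lambda>x. a * g x + b * h x)))
            (\<lambda>z. a * T (f(j := g)) z + b * T (f(j := h)) z))"

definition distributional_multilinear_op ::
  "(('m::finite \<Rightarrow> real^'n \<Rightarrow> complex) \<Rightarrow> (real^'n \<Rightarrow> complex) \<Rightarrow> complex) \<Rightarrow> bool" where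
  "distributional_multilinear_op T \<longleftrightarrow>
     multilinear_op (\<lambda>u v. \<forall>\<phi>\<in>schwartz. u \<phi> = v \<phi>) (\<lambda>j. schwartz) T \<and>
     (\<forall>f. (\<forall>j. f j \<in> schwartz) \<longrightarrow> tempered_distribution (T f))"

text \<open>
  \<open>E\<close> extends \<open>T\<close> to a bounded operator from \<open>L\<^bsup>q\<^sub>1\<^esup> \<times> \<dots> \<times> L\<^bsup>q\<^sub>m\<^esup>\<close> to \<open>L\<^bsup>q\<^esup>\<close>: on Schwartz
  functions, \<open>T f\<close> is the distribution given by integration against the function \<open>E f\<close>.
\<close>

definition bounded_extension ::
  "(('m::finite \<Rightarrow> real^'n \<Rightarrow> complex) \<Rightarrow> (real^'n \<Rightarrow> complex) \<Rightarrow> complex)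
    \<Rightarrow> ('m \<Rightarrow> real) \<Rightarrow> real \<Rightarrow> (('m \<Rightarrow> real^'n \<Rightarrow> complex) \<Rightarrow> real^'n \<Rightarrow> complex) \<Rightarrow> bool" where
  "bounded_extension T qs q E \<longleftrightarrow>
     (\<forall>j. 1 \<le> qs j) \<and> 1 / q = (\<Sum>j\<in>UNIV. 1 / qs j) \<and>
     multilinear_op (\<lambda>u v. AE x in lebesgue. u x = v x) (\<lambda>j. Lp_space (qs j)) E \<and>
     (\<exists>C. \<forall>f. (\<forall>j. f j \<in> Lp_space (qs j)) \<longrightarrow>
        E f \<in> Lp_space q \<and> Lp_norm q (E f) \<le> C * (\<Prod>j\<in>UNIV. Lp_norm (qs j) (f j))) \<and>
     (\<forall>f. (\<forall>j. f j \<in> schwartz) \<longrightarrow>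
        (\<forall>\<phi>\<in>schwartz. integrable lebesgue (\<lambda>x. E f x * \<phi> x) \<and>
                       T f \<phi> = (LINT x|lebesgue. E f x * \<phi> x)))"

text \<open>
  A point \<open>(y\<^sub>0, y\<^sub>1, \<dots>, y\<^sub>m)\<close> of \<open>(\<real>\<^sup>n)\<^bsup>m+1\<^esup>\<close> is a function on \<open>'m option\<close>, with \<open>y None = y\<^sub>0\<close>
  and \<open>y (Some j) = y\<^sub>j\<close>. The restriction in the regularity estimate ensures that \<open>y(j := z)\<close>
  is off the diagonal whenever \<open>y\<close> is.
\<close>

definition off_diagonal :: "('m option \<Rightarrow> real^'n) \<Rightarrow> bool" where
  "off_diagonal y \<longleftrightarrow> (\<exists>j. y (Some j) \<noteq> y None)"

definition kernel_dist :: "('m::finite option \<Rightarrow> real^'n) \<Rightarrow> real" where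
  "kernel_dist y = (\<Sum>k\<in>UNIV. \<Sum>l\<in>UNIV. norm (y k - y l))"

definition CZ_kernel :: "(('m::finite option \<Rightarrow> real^'n) \<Rightarrow> complex) \<Rightarrow> bool" where
  "CZ_kernel K \<longleftrightarrow>
     (\<exists>A>0. \<exists>\<epsilon>>0.
        (\<forall>y. off_diagonal y \<longrightarrow>
           norm (K y) \<le> A / kernel_dist y ^ (CARD('m) * CARD('n))) \<and>
        (\<forall>y j z. off_diagonal y \<longrightarrow>
           norm (y j - z) \<le> 1/2 * (MAX k\<in>UNIV. norm (y j - y k)) \<longrightarrow>
           norm (K y - K (y(j := z)))
             \<le> A * norm (y j - z) powr \<epsilon>
                 / kernel_dist y powr (real (CARD('m) * CARD('n)) + \<epsilon>)))"

text \<open>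
  The extension \<open>E\<close> serves to give \<open>T f\<close> a value at almost every point for Schwartz \<open>f\<close>.
\<close>

definition CZ_operator ::
  "(('m::finite \<Rightarrow> real^'n \<Rightarrow> complex) \<Rightarrow> (real^'n \<Rightarrow> complex) \<Rightarrow> complex) \<Rightarrow> bool" where
  "CZ_operator T \<longleftrightarrow>
     distributional_multilinear_op T \<and>
     (\<exists>qs q E K. bounded_extension T qs q E \<and> CZ_kernel K \<and>
        (\<forall>f. (\<forall>j. f j \<in> schwartz) \<longrightarrow>
           (AE x in lebesgue. x \<notin> (\<Inter>j. ess_supp (f j)) \<longrightarrow>
              E f x = (LINT y::real^'n^'m|lebesgue.
                         K (case_option x (\<lambda>j. y $ j)) * (\<Prod>j\<in>UNIV. f j (y $ j))))))"

end

theory Submission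
  imports Defs
begin

text \<open>
  The constant in the weak-type estimate comes from a Calderon--Zygmund decomposition of one
  argument at a time, which yields the endpoint bound from \<open>L\<^sup>1 \<times> \<dots> \<times> L\<^sup>1\<close> to weak
  \<open>L\<^bsup>1/m\<^esup>\<close>. On a cube \<open>R\<close>, the part of \<open>T f\<close> in which all arguments are localised near \<open>R\<close> is
  controlled by this estimate, and kernel regularity summed over dyadic shells bounds the oscillation
  of the remaining parts. Hence \<open>T f\<close> differs from a constant by at most
  \<open>C inf\<^sub>R M f\<close> outside a set occupying a small fraction of \<open>R\<close>. Covering the exceptional set
  by dyadic stopping cubes and iterating, as in the proof of the John--Nirenberg inequality, halves
  the measure at the price of increasing the level by \<open>2 C M f\<close>. No constant depends on the
  extension of \<open>T\<close>, since approximation by Schwartz functions shows that any two bounded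
  extensions agree on bounded functions of bounded support.
\<close>

section \<open>Smooth bump functions and Schwartz approximation\<close>

text \<open>\<open>E\<close> is additive in each argument only up to null sets and for finite sums,
  and the kernel formula is given for Schwartz arguments alone. So the formula is first carried to
  bounded Borel functions of bounded support, by smooth approximants whose supports cannot spread,
  and the decomposition is done for dyadic step functions, where finitely many cubes stop and no
  differentiation theorem is needed. As \<open>q\<close> may be below 1, limits use integrals of
  q-th powers. The maximal function bounds products of averages, never a single average, so the
  weak-type estimate is normalised in each argument separately. It enters through its infimum over a
  cube R: larger concentric cubes contain all of R, so their products of averages stay below that
  infimum. On the starting cube the subtracted constant is 0, because all arguments live there and
  have no far part; oscillation thus controls \<open>E f\<close> itself. Exceptional sets of
  relative measure 2^(-n-3) leave room to pass to an open set and to stop at density 2^(-n-1). Since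
  N halvings reach level (2 N + 1) C, the exponent is ln 2 / (2 C).\<close>

definition flat_exp :: "nat \<Rightarrow> real \<Rightarrow> real" where
  "flat_exp k t = (if t > 0 then exp (- (1 / t)) / t ^ k else 0)"

lemma flat_exp_nonneg: "flat_exp k t \<ge> 0"
  by (simp add: flat_exp_def)

lemma flat_exp_0_eq_0_iff: "flat_exp 0 t = 0 \<longleftrightarrow> t \<le> 0"
  by (auto simp: flat_exp_def)

text \<open>exp (1/t) exceeds the single term (1/t)^(k+1) / (k+1)! of its series, which beats the
  pole 1/t^k with one power of t to spare. Tending to 0 at 0 is all that the derivative at 0 will
  need.\<close>

lemma flat_exp_le: "flat_exp k t \<le> fact (Suc k) * \<bar>t\<bar>"
proof (cases "t > 0")
  case True
  have "(\<Sum>j\<in>{Suc k}. (1 / t) ^ j /\<^sub>R fact j) \<le> exp (1 / t)"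
    unfolding exp_def using True by (intro sum_le_suminf summable_exp_generic) auto
  hence "(1 / t) ^ Suc k / fact (Suc k) \<le> exp (1 / t)"
    by (simp add: divide_inverse mult.commute del: fact_Suc)
  hence "1 / t ^ Suc k \<le> exp (1 / t) * fact (Suc k)"
    by (simp only: pos_divide_le_eq fact_gt_zero power_one_over)
  hence "exp (- (1 / t)) * (1 / t ^ Suc k) \<le> exp (- (1 / t)) * (exp (1 / t) * fact (Suc k))"
    by (intro mult_left_mono) auto
  also have "\<dots> = (fact (Suc k) :: real)"
    by (simp add: mult.assoc[symmetric] exp_add[symmetric] del: fact_Suc)
  finally have "exp (- (1 / t)) / t ^ Suc k \<le> fact (Suc k)" by simp
  hence "exp (- (1 / t)) / t ^ Suc k * t \<le> fact (Suc k) * t"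
    using True by (intro mult_right_mono) auto
  thus ?thesis using True by (simp add: flat_exp_def del: fact_Suc)
next
  case False
  have "0 \<le> fact (Suc k) * \<bar>t\<bar>" by (intro mult_nonneg_nonneg) auto
  thus ?thesis using False unfolding flat_exp_def by (simp only: if_False)
qed

lemma flat_exp_Suc_mult: "flat_exp k t = t * flat_exp (Suc k) t"
  by (simp add: flat_exp_def)

text \<open>Differentiating exp (-1/t) / t^k only raises the power of 1/t; hence the index
  \<open>k\<close>, which makes the family closed under differentiation up to linear combinations.
  At 0 the difference quotient of \<open>flat_exp k\<close> is exactly
  \<open>flat_exp (Suc k)\<close>, which tends to 0.\<close>

lemma has_real_derivative_flat_exp:
  "(flat_exp k has_real_derivative (flat_exp (k + 2) t - real k * flat_exp (k + 1) t)) (at t)"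
proof -
  consider "t > 0" | "t < 0" | "t = 0" by linarith
  thus ?thesis
  proof cases
    case 1
    have "((\<lambda>t. exp (- (1 / t)) / t ^ k) has_real_derivative
            (exp (- (1 / t)) / t ^ (k + 2) - real k * (exp (- (1 / t)) / t ^ (k + 1)))) (at t)"
    proof (cases k)
      case 0
      thus ?thesis using 1
        by (auto intro!: derivative_eq_intros simp: field_simps power2_eq_square)
    next
      case (Suc j)
      have "((\<lambda>t. exp (- (1 / t)) * (1 / t) ^ Suc j) has_real_derivative
          exp (- (1 / t)) * (1 / t\<^sup>2) * (1 / t) ^ Suc j +
          real (Suc j) * ((1 / t) ^ j * (- (1 / t\<^sup>2))) * exp (- (1 / t))) (at t)"
        using 1
        by (auto intro!: derivative_eq_intros simp: power2_eq_square divide_inverse simp del: power_Suc)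
      thus ?thesis
        by (simp add: Suc power_one_over power2_eq_square divide_inverse algebra_simps power_inverse)
    qed
    hence "(flat_exp k has_real_derivative
            (exp (- (1 / t)) / t ^ (k + 2) - real k * (exp (- (1 / t)) / t ^ (k + 1)))) (at t)"
      by (rule has_field_derivative_transform_within_open[where S = "{0<..}"])
        (use 1 in \<open>auto simp: flat_exp_def\<close>)
    thus ?thesis using 1 by (simp add: flat_exp_def)
  next
    case 2
    have "((\<lambda>t. 0) has_real_derivative 0) (at t)" by simp
    hence "(flat_exp k has_real_derivative 0) (at t)"
      by (rule has_field_derivative_transform_within_open[where S = "{..<0}"])
        (use 2 in \<open>auto simp: flat_exp_def\<close>)
    thus ?thesis using 2 by (simp add: flat_exp_def)
  next
    case 3
    have "((\<lambda>h. flat_exp (Suc k) h) \<longlongrightarrow> 0) (at 0)"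
    proof (rule Lim_null_comparison)
      show "\<forall>\<^sub>F h in at 0. norm (flat_exp (Suc k) h) \<le> fact (Suc (Suc k)) * \<bar>h\<bar>"
        by (intro always_eventually allI)
          (use flat_exp_le[of "Suc k"] flat_exp_nonneg[of "Suc k"] in \<open>simp del: fact_Suc\<close>)
      show "((\<lambda>h::real. fact (Suc (Suc k)) * \<bar>h\<bar>) \<longlongrightarrow> 0) (at 0)"
        by (auto intro!: tendsto_eq_intros simp del: fact_Suc)
    qed
    moreover have "\<forall>\<^sub>F h in at 0. flat_exp (Suc k) h = (flat_exp k (0 + h) - flat_exp k 0) / h"
      unfolding eventually_at_topological
      by (intro exI[of _ UNIV])
        (auto simp: flat_exp_Suc_mult[of k] flat_exp_def)
    ultimately have "((\<lambda>h. (flat_exp k (0 + h) - flat_exp k 0) / h) \<longlongrightarrow> 0) (at 0)"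
      by (simp cong: filterlim_cong)
    hence "(flat_exp k has_real_derivative 0) (at 0)"
      by (simp add: DERIV_def)
    thus ?thesis using 3 by (simp add: flat_exp_def)
  qed
qed

text \<open>An algebra large enough to contain all polynomials (for Stone-Weierstrass) and bumps
  supported in boxes, yet generated so simply that one induction shows closure under directional
  derivatives. Smoothness in the sense of \<open>partial_deriv\<close> follows by iteration.\<close>

inductive_set flat_smooth :: "(real^'n \<Rightarrow> complex) set" where
  const: "(\<lambda>x. c) \<in> flat_smooth"
| coord: "(\<lambda>x. of_real (x $ i)) \<in> flat_smooth"
| flat: "(\<lambda>x. of_real (flat_exp k (s * x $ i + d))) \<in> flat_smooth"
| add: "f \<in> flat_smooth \<Longrightarrow> g \<in> flat_smooth \<Longrightarrow> (\<lambda>x. f x + g x) \<in> flat_smooth"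
| mult: "f \<in> flat_smooth \<Longrightarrow> g \<in> flat_smooth \<Longrightarrow> (\<lambda>x. f x * g x) \<in> flat_smooth"

lemma flat_smooth_sum:
  "finite A \<Longrightarrow> (\<And>i. i \<in> A \<Longrightarrow> f i \<in> flat_smooth) \<Longrightarrow> (\<lambda>x. \<Sum>i\<in>A. f i x) \<in> flat_smooth"
  by (induction rule: finite_induct) (auto intro: flat_smooth.intros)

lemma flat_smooth_prod:
  "finite A \<Longrightarrow> (\<And>i. i \<in> A \<Longrightarrow> f i \<in> flat_smooth) \<Longrightarrow> (\<lambda>x. \<Prod>i\<in>A. f i x) \<in> flat_smooth"
  by (induction rule: finite_induct) (auto intro: flat_smooth.intros)

text \<open>Derivative and membership of its directional values are proved together: the product
  rule multiplies derivatives by the functions themselves, and \<open>partial_deriv\<close> can be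
  iterated only inside the class.\<close>

lemma flat_smooth_has_derivative:
  assumes "f \<in> flat_smooth"
  shows "\<exists>D. (\<forall>x. (f has_derivative D x) (at x)) \<and> (\<forall>v. (\<lambda>x. D x v) \<in> flat_smooth)"
  using assms
proof induction
  case (const c)
  show ?case
    by (rule exI[of _ "\<lambda>x v. 0"]) (auto intro: flat_smooth.intros)
next
  case (coord i)
  show ?case
    by (rule exI[of _ "\<lambda>x v. of_real (v $ i)"])
      (auto intro!: flat_smooth.intros derivative_eq_intros bounded_linear.has_derivative[OF bounded_linear_vec_nth])
next
  case (flat k s i d)
  let ?D = "\<lambda>x v. of_real ((flat_exp (k + 2) (s * x $ i + d)
      - real k * flat_exp (k + 1) (s * x $ i + d)) * (s * v $ i)) :: complex"
  have "((\<lambda>x. flat_exp k (s * x $ i + d)) has_derivative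
     (\<lambda>v. (flat_exp (k + 2) (s * x $ i + d)
      - real k * flat_exp (k + 1) (s * x $ i + d)) * (s * v $ i))) (at x)" for x
    by (rule has_derivative_compose[OF _
          has_real_derivative_flat_exp[unfolded has_field_derivative_def]])
      (auto intro!: derivative_eq_intros bounded_linear.has_derivative[OF bounded_linear_vec_nth])
  hence "((\<lambda>x. of_real (flat_exp k (s * x $ i + d)) :: complex) has_derivative ?D x) (at x)" for x
    by (intro has_derivative_of_real)
  moreover have "(\<lambda>x. ?D x v) \<in> flat_smooth" for v
  proof -
    have "(\<lambda>x. of_real (flat_exp (k + 2) (s * x $ i + d)) * of_real (s * v $ i)
       + of_real (flat_exp (k + 1) (s * x $ i + d)) * of_real (- real k * (s * v $ i))) \<in> flat_smooth"
      by (intro flat_smooth.intros)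
    thus ?thesis by (simp add: algebra_simps)
  qed
  ultimately show ?case by (intro exI[of _ ?D]) auto
next
  case (add f g)
  then obtain D E where "\<forall>x. (f has_derivative D x) (at x)" "\<forall>v. (\<lambda>x. D x v) \<in> flat_smooth"
    "\<forall>x. (g has_derivative E x) (at x)" "\<forall>v. (\<lambda>x. E x v) \<in> flat_smooth" by blast
  thus ?case
    by (intro exI[of _ "\<lambda>x v. D x v + E x v"]) (auto intro!: flat_smooth.intros derivative_intros)
next
  case (mult f g)
  then obtain D E where "\<forall>x. (f has_derivative D x) (at x)" "\<forall>v. (\<lambda>x. D x v) \<in> flat_smooth"
    "\<forall>x. (g has_derivative E x) (at x)" "\<forall>v. (\<lambda>x. E x v) \<in> flat_smooth" by blast
  thus ?case using mult.hyps
    by (intro exI[of _ "\<lambda>x v. f x * E x v + D x v * g x"])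
      (auto intro!: flat_smooth.intros has_derivative_mult)
qed

lemma flat_smooth_differentiable: "f \<in> flat_smooth \<Longrightarrow> f differentiable (at x)"
  using flat_smooth_has_derivative unfolding differentiable_def by blast

lemma flat_smooth_continuous_on: "f \<in> flat_smooth \<Longrightarrow> continuous_on A f"
  by (meson continuous_at_imp_continuous_on differentiable_imp_continuous_within flat_smooth_differentiable)

lemma partial_deriv_flat_smooth: "f \<in> flat_smooth \<Longrightarrow> partial_deriv is f \<in> flat_smooth"
proof (induction "is")
  case (Cons i "is")
  then obtain D where D: "\<forall>x. (partial_deriv is f has_derivative D x) (at x)"
      "\<forall>v. (\<lambda>x. D x v) \<in> flat_smooth"
    using flat_smooth_has_derivative by blast
  have "partial_deriv (i # is) f = (\<lambda>x. D x (axis i 1))"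
  proof
    fix x
    from D(1) have "D x = frechet_derivative (partial_deriv is f) (at x)"
      by (intro frechet_derivative_at) blast
    thus "partial_deriv (i # is) f x = D x (axis i 1)" by simp
  qed
  thus ?case using D(2) by simp
qed simp

lemma partial_deriv_zero_on_open:
  assumes "open U" "\<And>x. x \<in> U \<Longrightarrow> f x = 0" "x \<in> U"
  shows "partial_deriv is f x = 0"
  using assms(3)
proof (induction "is" arbitrary: x)
  case (Cons i "is")
  have "((\<lambda>x. 0 :: complex) has_derivative (\<lambda>v. 0)) (at x)" by simp
  hence "(partial_deriv is f has_derivative (\<lambda>v. 0)) (at x)"
    by (rule has_derivative_transform_within_open[OF _ assms(1) Cons.prems]) (simp add: Cons.IH)
  thus ?case using frechet_derivative_at by (metis partial_deriv.simps(2))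
qed (use assms in auto)

lemma flat_smooth_bounded_range:
  assumes "f \<in> flat_smooth" "bounded {x. f x \<noteq> 0}"
  shows "bounded (range f)"
proof -
  have "compact (f ` closure {x. f x \<noteq> 0})"
    using assms by (intro compact_continuous_image flat_smooth_continuous_on) (auto simp: compact_closure)
  moreover have "range f \<subseteq> insert 0 (f ` closure {x. f x \<noteq> 0})"
    using closure_subset[of "{x. f x \<noteq> 0}"] by force
  ultimately show ?thesis
    by (meson bounded_insert bounded_subset compact_imp_bounded)
qed

text \<open>Outside the closure of the support every partial derivative is 0, and on that compact
  set every weighted derivative is continuous, hence bounded.\<close>

lemma flat_smooth_schwartz:
  assumes f: "f \<in> flat_smooth" and b: "bounded {x. f x \<noteq> 0}"
  shows "f \<in> schwartz"
  unfolding schwartz_def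
proof (intro CollectI allI conjI)
  fix "is" :: "'a list" and k :: nat and x
  show "partial_deriv is f differentiable (at x)"
    by (intro flat_smooth_differentiable partial_deriv_flat_smooth f)
  define C where "C = closure {x. f x \<noteq> 0}"
  have z: "partial_deriv is f x = 0" if "x \<notin> C" for x
    by (rule partial_deriv_zero_on_open[of "- C"])
      (use that closure_subset[of "{x. f x \<noteq> 0}"] in \<open>auto simp: C_def\<close>)
  have "compact ((\<lambda>x. (1 + norm x) ^ k * norm (partial_deriv is f x)) ` C)"
    using b by (intro compact_continuous_image continuous_intros flat_smooth_continuous_on
        partial_deriv_flat_smooth f) (auto simp: C_def compact_closure)
  moreover have "range (\<lambda>x. (1 + norm x) ^ k * norm (partial_deriv is f x)) \<subseteq>
      insert 0 ((\<lambda>x. (1 + norm x) ^ k * norm (partial_deriv is f x)) ` C)"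
    using z by force
  ultimately show "bounded (range (\<lambda>x. (1 + norm x) ^ k * norm (partial_deriv is f x)))"
    by (meson bounded_insert bounded_subset compact_imp_bounded)
qed

section \<open>Polynomials, bumps and approximation with prescribed zeros\<close>

lemma real_polynomial_function_flat_smooth:
  fixes p :: "real^'n \<Rightarrow> real"
  assumes "real_polynomial_function p"
  shows "(\<lambda>x. of_real (p x)) \<in> flat_smooth"
  using assms
proof induction
  case (linear f)
  have expand: "f x = (\<Sum>i\<in>UNIV. x $ i * f (axis i 1))" for x
  proof -
    interpret bounded_linear f by fact
    have "x = (\<Sum>i\<in>UNIV. x $ i *\<^sub>R axis i 1)"
      by (rule basis_expansion[of x, unfolded scalar_mult_eq_scaleR, symmetric])
    hence "f x = f (\<Sum>i\<in>UNIV. x $ i *\<^sub>R axis i 1)" by (rule arg_cong)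
    also have "\<dots> = (\<Sum>i\<in>UNIV. f (x $ i *\<^sub>R axis i 1))" by (rule sum)
    also have "\<dots> = (\<Sum>i\<in>UNIV. x $ i * f (axis i 1))" by (simp only: scaleR real_scaleR_def)
    finally show ?thesis .
  qed
  have "(\<lambda>x. of_real (f x) :: complex) = (\<lambda>x. \<Sum>i\<in>UNIV. of_real (x $ i) * of_real (f (axis i 1)))"
    by (rule ext, subst expand) (simp only: of_real_mult of_real_sum)
  also have "\<dots> \<in> flat_smooth"
    by (intro flat_smooth_sum flat_smooth.mult flat_smooth.coord flat_smooth.const finite_class.finite_UNIV)
  finally show ?case .
next
  case (const c)
  show ?case by (rule flat_smooth.const)
next
  case (add f g)
  from flat_smooth.add[OF add.IH] show ?case by (simp only: of_real_add)
next
  case (mult f g)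
  from flat_smooth.mult[OF mult.IH] show ?case by (simp only: of_real_mult)
qed

lemma polynomial_function_flat_smooth:
  fixes p :: "real^'n \<Rightarrow> complex"
  assumes "polynomial_function p"
  shows "p \<in> flat_smooth"
proof -
  have "real_polynomial_function (\<lambda>x. Re (p x))" "real_polynomial_function (\<lambda>x. Im (p x))"
    using assms by (auto simp: polynomial_function_iff_Basis_inner Basis_complex_def)
  note re_im = this[THEN real_polynomial_function_flat_smooth]
  have "p = (\<lambda>x. of_real (Re (p x)) + \<i> * of_real (Im (p x)))"
    using complex_eq by blast
  also have "\<dots> \<in> flat_smooth"
    using flat_smooth.add[OF re_im(1) flat_smooth.mult[OF flat_smooth.const re_im(2)]] .
  finally show ?thesis .
qed

text \<open>A product of one-sided flat functions, two per coordinate. The exact nonvanishing set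
  matters, because approximants will be required to vanish wherever the bump does.\<close>

lemma flat_smooth_bump_box:
  "\<exists>\<eta>\<in>flat_smooth. {x::real^'n. \<eta> x \<noteq> 0} = box a b"
proof -
  \<comment> \<open>The arguments have the shape \<open>s * x $ i + d\<close> with s = 1 and s = -1,
    so that the generator \<open>flat\<close> applies literally.\<close>
  define \<eta> :: "real^'n \<Rightarrow> complex" where "\<eta> x = (\<Prod>i\<in>UNIV. of_real (flat_exp 0 (1 * x $ i + - a $ i)) *
      of_real (flat_exp 0 (- 1 * x $ i + b $ i)))" for x
  have "\<eta> \<in> flat_smooth"
    unfolding \<eta>_def by (intro flat_smooth_prod flat_smooth.mult flat_smooth.flat finite_class.finite_UNIV)
  moreover have "\<eta> x \<noteq> 0 \<longleftrightarrow> x \<in> box a b" for x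
    unfolding \<eta>_def
    by (simp only: prod_zero_iff finite_class.finite_UNIV mult_eq_0_iff of_real_eq_0_iff
        flat_exp_0_eq_0_iff mem_box_cart) (auto simp: not_le)
  ultimately show ?thesis by (intro bexI[of _ \<eta>]) auto
qed

text \<open>A sum of nonnegative flat functions vanishes only if every term does, so
  \<open>\<zeta>\<close> has zero set exactly \<open>cbox c d\<close>. Such bumps carry functions
  supported outside a cube, which makes the kernel formula available inside it.\<close>

lemma flat_smooth_bump_box_diff:
  "\<exists>\<eta>\<in>flat_smooth. {x::real^'n. \<eta> x \<noteq> 0} = box a b - cbox c d"
proof -
  obtain \<eta> :: "real^'n \<Rightarrow> complex" where \<eta>: "\<eta> \<in> flat_smooth" "{x. \<eta> x \<noteq> 0} = box a b"
    using flat_smooth_bump_box by blast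
  define \<zeta> :: "real^'n \<Rightarrow> complex" where "\<zeta> x = (\<Sum>i\<in>UNIV. of_real (flat_exp 0 (- 1 * x $ i + c $ i)) +
      of_real (flat_exp 0 (1 * x $ i + - d $ i)))" for x
  have "\<zeta> x = 0 \<longleftrightarrow> x \<in> cbox c d" for x
  proof -
    have "\<zeta> x = of_real (\<Sum>i\<in>UNIV. flat_exp 0 (- 1 * x $ i + c $ i) + flat_exp 0 (1 * x $ i + - d $ i))"
      by (simp add: \<zeta>_def)
    hence "\<zeta> x = 0 \<longleftrightarrow> (\<Sum>i\<in>UNIV. flat_exp 0 (- 1 * x $ i + c $ i) + flat_exp 0 (1 * x $ i + - d $ i)) = 0"
      by (metis of_real_eq_0_iff)
    also have "\<dots> \<longleftrightarrow> (\<forall>i\<in>UNIV. flat_exp 0 (- 1 * x $ i + c $ i) + flat_exp 0 (1 * x $ i + - d $ i) = 0)"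
      by (intro sum_nonneg_eq_0_iff) (auto simp: flat_exp_nonneg add_nonneg_nonneg)
    also have "\<dots> \<longleftrightarrow> x \<in> cbox c d"
      by (auto simp: add_nonneg_eq_0_iff[OF flat_exp_nonneg flat_exp_nonneg] flat_exp_0_eq_0_iff mem_box_cart)
    finally show ?thesis .
  qed
  hence "{x. \<eta> x * \<zeta> x \<noteq> 0} = box a b - cbox c d" using \<eta>(2) by auto
  moreover have "\<zeta> \<in> flat_smooth"
    unfolding \<zeta>_def by (intro flat_smooth_sum flat_smooth.add flat_smooth.flat finite_class.finite_UNIV)
  ultimately show ?thesis
    using \<eta>(1) by (intro bexI[of _ "\<lambda>x. \<eta> x * \<zeta> x"] flat_smooth.mult) auto
qed

text \<open>Density with control of zeros: an approximant must vanish wherever \<open>\<eta>\<close>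
  does, so that its support cannot spread. Continuous approximants are therefore divided by
  \<open>\<eta>\<close> away from its zeros, the quotient is approximated by a polynomial, and the
  result is multiplied by \<open>\<eta>\<close> again.\<close>

lemma flat_smooth_approx:
  fixes f \<eta> :: "real^'n \<Rightarrow> complex"
  assumes \<eta>: "\<eta> \<in> flat_smooth" "bounded {x. \<eta> x \<noteq> 0}"
    and f: "f \<in> borel_measurable borel" "\<And>x. norm (f x) \<le> B" "\<And>x. \<eta> x = 0 \<Longrightarrow> f x = 0"
  shows "\<exists>F B'. (\<forall>k. F k \<in> flat_smooth) \<and> (\<forall>k x. \<eta> x = 0 \<longrightarrow> F k x = 0) \<and>
     (\<forall>k x. norm (F k x) \<le> B') \<and> (AE x in lebesgue. (\<lambda>k. F k x) \<longlonglongrightarrow> f x)"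
proof -
  have "f measurable_on UNIV"
    using f(1) by (intro lebesgue_measurable_imp_measurable_on measurable_completion) auto
  then obtain N g where N: "negligible N" and g: "\<And>k::nat. continuous_on UNIV (g k)"
    and lim: "\<And>x. x \<notin> N \<Longrightarrow> (\<lambda>k. g k x) \<longlonglongrightarrow> f x"
    unfolding measurable_on_def by (simp only: UNIV_I if_True) blast
  have B: "B \<ge> 0" using f(2)[of undefined] norm_ge_zero order_trans by blast
  \<comment> \<open>Projection to the ball of radius \<open>B\<close> keeps continuity and the
    limit, and makes the sequence uniformly bounded.\<close>
  define c where "c k = closest_point (cball 0 B) \<circ> g k" for k
  have c_cont: "continuous_on UNIV (c k)" for k
    unfolding c_def using B
    by (intro continuous_on_compose g continuous_on_closest_point) auto
  have c_bd: "norm (c k x) \<le> B" for k x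
    using closest_point_in_set[of "cball 0 B" "g k x"] B by (auto simp: c_def)
  have c_lim: "(\<lambda>k. c k x) \<longlonglongrightarrow> f x" if "x \<notin> N" for x
  proof -
    have "(\<lambda>k. closest_point (cball 0 B) (g k x)) \<longlonglongrightarrow> closest_point (cball 0 B) (f x)"
      by (rule continuous_on_tendsto_compose[OF continuous_on_closest_point[of "cball 0 B" UNIV]])
        (use B lim[OF that] in auto)
    moreover have "closest_point (cball 0 B) (f x) = f x"
      using f(2)[of x] by (intro closest_point_self) auto
    ultimately show ?thesis by (simp add: c_def)
  qed
  \<comment> \<open>The cutoff is 0 where |\<eta>| is at most 1/(k+1) and 1 where it is at least
    2/(k+1). The quotient \<open>u k\<close> of the cut-off function by \<eta> is written with cnj
    \<eta> / |\<eta>|^2, the denominator being kept away from 0 so that \<open>u k\<close> is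
    continuous everywhere.\<close>
  define \<phi> where "\<phi> k x = min 1 (max 0 (real (Suc k) * norm (\<eta> x) - 1))" for k x
  define u where "u k x = c k x * of_real (\<phi> k x) * cnj (\<eta> x)
      / of_real ((max (1 / real (Suc k)) (norm (\<eta> x)))\<^sup>2)" for k x
  note [continuous_intros] = flat_smooth_continuous_on[OF \<eta>(1)] continuous_on_subset[OF c_cont]
  have mpos: "max (1 / real (Suc k)) (norm (\<eta> x)) > 0" for k x
    by (rule less_le_trans[of _ "1 / real (Suc k)"]) auto
  have u_cont: "continuous_on A (u k)" for k A
    unfolding u_def \<phi>_def using mpos[of k]
    by (intro continuous_intros) (auto simp: less_le)
  have u\<eta>: "u k x * \<eta> x = c k x * of_real (\<phi> k x)" for k x
  proof (cases "norm (\<eta> x) \<le> 1 / real (Suc k)")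
    case True
    hence "\<phi> k x = 0" by (simp add: \<phi>_def field_simps)
    thus ?thesis by (simp add: u_def)
  next
    case False
    hence "max (1 / real (Suc k)) (norm (\<eta> x)) = norm (\<eta> x)" by simp
    moreover have "norm (\<eta> x) \<noteq> 0" using False by auto
    moreover have "\<eta> x * cnj (\<eta> x) = of_real ((norm (\<eta> x))\<^sup>2)"
      by (simp only: complex_norm_square)
    ultimately show ?thesis
      by (simp add: u_def field_simps)
  qed
  let ?C = "closure {x. \<eta> x \<noteq> 0}"
  \<comment> \<open>Uniform approximation on the closed support suffices, since the factor \<eta> is
    0 elsewhere.\<close>
  have "compact ?C" using \<eta>(2) by (simp add: compact_closure)
  hence "\<exists>p. polynomial_function p \<and> (\<forall>x\<in>?C. norm (u k x - p x) < 1 / real (Suc k))" for k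
    by (intro Stone_Weierstrass_polynomial_function u_cont) auto
  then obtain p where p: "\<And>k. polynomial_function (p k)"
    and pu: "\<And>k x. x \<in> ?C \<Longrightarrow> norm (u k x - p k x) < 1 / real (Suc k)" by metis
  define F where "F k x = p k x * \<eta> x" for k x
  obtain M where M: "\<And>x. norm (\<eta> x) \<le> M"
    using flat_smooth_bounded_range[OF \<eta>] by (auto simp: bounded_iff)
  have M0: "M \<ge> 0" using M[of undefined] norm_ge_zero order_trans by blast
  have F: "norm (F k x - c k x * of_real (\<phi> k x)) \<le> 1 / real (Suc k) * M" for k x
  proof (cases "\<eta> x = 0")
    case True
    have "F k x - c k x * of_real (\<phi> k x) = 0"
      by (simp only: F_def u\<eta>[symmetric] True mult_zero_right diff_self)
    thus ?thesis using M0 by (simp only: norm_zero) simp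
  next
    case False
    hence x: "x \<in> ?C" by (intro subsetD[OF closure_subset]) simp
    have "F k x - c k x * of_real (\<phi> k x) = (p k x - u k x) * \<eta> x"
      by (simp add: F_def u\<eta>[symmetric] algebra_simps)
    also have "norm \<dots> \<le> 1 / real (Suc k) * M"
      unfolding norm_mult by (intro mult_mono M)
        (use pu[OF x, of k] in \<open>auto simp: norm_minus_commute\<close>)
    finally show ?thesis .
  qed
  have \<phi>01: "0 \<le> \<phi> k x" "\<phi> k x \<le> 1" for k x by (auto simp: \<phi>_def)
  show ?thesis
  proof (intro exI conjI allI impI)
    show "F k \<in> flat_smooth" for k
      unfolding F_def by (intro flat_smooth.mult polynomial_function_flat_smooth p \<eta>)
    show "F k x = 0" if "\<eta> x = 0" for k x using that by (simp add: F_def)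
    show "norm (F k x) \<le> B + M" for k x
    proof -
      have "norm (F k x) \<le> norm (c k x * of_real (\<phi> k x)) + norm (F k x - c k x * of_real (\<phi> k x))"
        by (rule norm_triangle_sub)
      also have "norm (c k x * of_real (\<phi> k x)) \<le> B * 1"
        unfolding norm_mult using \<phi>01 B by (intro mult_mono c_bd) auto
      also have "norm (F k x - c k x * of_real (\<phi> k x)) \<le> 1 * M"
        by (rule order_trans[OF F]) (use M0 in \<open>intro mult_right_mono, auto\<close>)
      finally show ?thesis by simp
    qed
    have "(\<lambda>k. F k x) \<longlonglongrightarrow> f x" if x: "x \<notin> N" for x
    proof -
      have "(\<lambda>k. c k x * of_real (\<phi> k x)) \<longlonglongrightarrow> f x"
      proof (cases "\<eta> x = 0")
        case True
        thus ?thesis using f(3)[of x] by (simp add: \<phi>_def)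
      next
        case False
        obtain k0 where "2 / norm (\<eta> x) < real k0" using reals_Archimedean2 by blast
        hence k0: "2 < real k0 * norm (\<eta> x)" using False by (simp add: field_simps)
        have "\<forall>\<^sub>F k in sequentially. \<phi> k x = 1"
          using eventually_ge_at_top[of k0]
        proof eventually_elim
          case (elim k)
          have "real k0 * norm (\<eta> x) \<le> real (Suc k) * norm (\<eta> x)"
            using elim by (intro mult_right_mono) auto
          thus ?case using k0 by (simp add: \<phi>_def)
        qed
        hence "\<forall>\<^sub>F k in sequentially. c k x = c k x * of_real (\<phi> k x)"
          by eventually_elim simp
        from Lim_transform_eventually[OF c_lim[OF x] this] show ?thesis .
      qed
      moreover have "(\<lambda>k. F k x - c k x * of_real (\<phi> k x)) \<longlonglongrightarrow> 0"
      proof (rule Lim_null_comparison)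
        show "\<forall>\<^sub>F k in sequentially. norm (F k x - c k x * of_real (\<phi> k x)) \<le> 1 / real (Suc k) * M"
          using F by auto
        have "(\<lambda>k. 1 / real (Suc k)) \<longlonglongrightarrow> 0"
          using LIMSEQ_inverse_real_of_nat by (simp add: inverse_eq_divide)
        from tendsto_mult_left_zero[OF this] show "(\<lambda>k. 1 / real (Suc k) * M) \<longlonglongrightarrow> 0" .
      qed
      ultimately have "(\<lambda>k. c k x * of_real (\<phi> k x) + (F k x - c k x * of_real (\<phi> k x))) \<longlonglongrightarrow> f x + 0"
        by (rule tendsto_add)
      thus ?thesis by simp
    qed
    moreover have "AE x in lebesgue. x \<notin> N"
      using N by (metis AE_not_in negligible_iff_null_sets)
    ultimately show "AE x in lebesgue. (\<lambda>k. F k x) \<longlonglongrightarrow> f x" by auto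
  qed
qed

section \<open>Bounded multilinear extensions\<close>

text \<open>\<open>Linfty_c\<close> is insensitive to null sets, whereas pointwise decompositions
  and kernel integrals over (R^n)^m call for Borel functions bounded and supported in the strict
  pointwise sense. \<open>bdd_supp_representative\<close> supplies them.\<close>

definition bdd_supp :: "(real^'n \<Rightarrow> complex) set" where
  "bdd_supp = {f. f \<in> borel_measurable borel \<and> bounded (range f) \<and> bounded {x. f x \<noteq> 0}}"

lemma bdd_suppI:
  assumes "f \<in> borel_measurable borel" "\<And>x. norm (f x) \<le> B" "\<And>x. f x \<noteq> 0 \<Longrightarrow> norm x \<le> r"
  shows "f \<in> bdd_supp"
  using assms unfolding bdd_supp_def by (auto simp: bounded_iff)

lemma bdd_suppE:
  assumes "f \<in> bdd_supp"
  obtains B r where "B > 0" "r > 0" "\<And>x. norm (f x) \<le> B" "\<And>x. f x \<noteq> 0 \<Longrightarrow> norm x \<le> r"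
proof -
  obtain B r where "\<And>x. norm (f x) \<le> B" "\<And>x. f x \<noteq> 0 \<Longrightarrow> norm x \<le> r"
    using assms unfolding bdd_supp_def by (auto simp: bounded_iff)
  thus ?thesis by (intro that[of "max 1 B" "max 1 r"]) (auto simp: le_max_iff_disj)
qed

lemma bdd_supp_measurable: "f \<in> bdd_supp \<Longrightarrow> f \<in> borel_measurable borel"
  by (simp add: bdd_supp_def)

lemma bdd_supp_common_bound:
  fixes f :: "'m::finite \<Rightarrow> real^'n \<Rightarrow> complex"
  assumes "\<And>j. f j \<in> bdd_supp"
  obtains B r where "B > 0" "r > 0" "\<And>j x. norm (f j x) \<le> B" "\<And>j x. f j x \<noteq> 0 \<Longrightarrow> norm x \<le> r"
proof -
  have "\<exists>B r. B > 0 \<and> r > 0 \<and> (\<forall>x. norm (f j x) \<le> B) \<and> (\<forall>x. f j x \<noteq> 0 \<longrightarrow> norm x \<le> r)" for j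
    by (rule bdd_suppE[OF assms[of j]]) blast
  then obtain B r where *: "\<And>j. B j > 0" "\<And>j. r j > 0" "\<And>j x. norm (f j x) \<le> B j"
      "\<And>j x. f j x \<noteq> 0 \<Longrightarrow> norm x \<le> r j" by metis
  have le: "B j \<le> sum B UNIV" "r j \<le> sum r UNIV" for j
    using less_imp_le[OF *(1)] less_imp_le[OF *(2)] by (auto intro!: member_le_sum)
  show ?thesis
  proof (rule that[of "sum B UNIV" "sum r UNIV"])
    show "sum B UNIV > 0" "sum r UNIV > 0" using *(1,2) by (auto intro!: sum_pos)
    show "norm (f j x) \<le> sum B UNIV" for j x using *(3) le(1) order_trans by blast
    show "f j x \<noteq> 0 \<Longrightarrow> norm x \<le> sum r UNIV" for j x using *(4) le(2) order_trans by blast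
  qed
qed

lemma bdd_supp_restrict:
  assumes "f \<in> bdd_supp" "S \<in> sets borel"
  shows "(\<lambda>x. if x \<in> S then f x else 0) \<in> bdd_supp"
proof -
  obtain B r where "B > 0" "r > 0" "\<And>x. norm (f x) \<le> B" "\<And>x. f x \<noteq> 0 \<Longrightarrow> norm x \<le> r"
    by (rule bdd_suppE[OF assms(1)]) blast
  thus ?thesis using assms bdd_supp_measurable[OF assms(1)]
    by (intro bdd_suppI[of _ B r]) (auto split: if_splits intro!: measurable_If_set)
qed

lemma bdd_supp_diff:
  assumes "f \<in> bdd_supp" "g \<in> bdd_supp"
  shows "(\<lambda>x. f x - g x) \<in> bdd_supp"
proof -
  obtain B r where f: "B > 0" "r > 0" "\<And>x. norm (f x) \<le> B" "\<And>x. f x \<noteq> 0 \<Longrightarrow> norm x \<le> r"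
    by (rule bdd_suppE[OF assms(1)]) blast
  obtain B' r' where g: "B' > 0" "r' > 0" "\<And>x. norm (g x) \<le> B'" "\<And>x. g x \<noteq> 0 \<Longrightarrow> norm x \<le> r'"
    by (rule bdd_suppE[OF assms(2)]) blast
  show ?thesis
  proof (rule bdd_suppI[of _ "B + B'" "max r r'"])
    show "(\<lambda>x. f x - g x) \<in> borel_measurable borel"
      using assms by (intro borel_measurable_diff bdd_supp_measurable)
    show "norm (f x - g x) \<le> B + B'" for x
      using f(3)[of x] g(3)[of x] norm_triangle_ineq4[of "f x" "g x"] by linarith
    show "norm x \<le> max r r'" if "f x - g x \<noteq> 0" for x
      using that f(4)[of x] g(4)[of x] by (cases "f x = 0") (auto simp: le_max_iff_disj)
  qed
qed

lemma integrable_bdd_supp: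
  assumes "f \<in> bdd_supp"
  shows "integrable lborel f"
proof -
  obtain B r where f: "B > 0" "r > 0" "\<And>x. norm (f x) \<le> B" "\<And>x. f x \<noteq> 0 \<Longrightarrow> norm x \<le> r"
    by (rule bdd_suppE[OF assms(1)]) blast
  show ?thesis
  proof (rule integrableI_bounded_set[where A = "cball 0 r" and B = B])
    show "emeasure lborel (cball 0 r :: (real^'a) set) < \<infinity>"
      by (rule emeasure_bounded_finite[OF bounded_cball])
    show "AE x in lborel. x \<in> cball 0 r \<longrightarrow> norm (f x) \<le> B" using f by auto
    show "AE x in lborel. x \<notin> cball 0 r \<longrightarrow> f x = 0" using f by auto
  qed (use bdd_supp_measurable[OF assms] in auto)
qed

lemma Lp_space_bdd_supp:
  fixes f :: "real^'n \<Rightarrow> complex"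
  assumes "f \<in> bdd_supp" "p > 0"
  shows "f \<in> Lp_space p"
proof -
  obtain B r where f: "B > 0" "r > 0" "\<And>x. norm (f x) \<le> B" "\<And>x. f x \<noteq> 0 \<Longrightarrow> norm x \<le> r"
    by (rule bdd_suppE[OF assms(1)]) blast
  have [measurable]: "f \<in> borel_measurable borel" by (rule bdd_supp_measurable[OF assms(1)])
  have "integrable lborel (\<lambda>x. norm (f x) powr p)"
  proof (rule integrableI_bounded_set[where A = "cball 0 r" and B = "B powr p"])
    show "emeasure lborel (cball 0 r :: (real^'n) set) < \<infinity>"
      by (rule emeasure_bounded_finite[OF bounded_cball])
    show "AE x in lborel. x \<in> cball 0 r \<longrightarrow> norm (norm (f x) powr p) \<le> B powr p"
      using f assms by (auto intro!: powr_mono2)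
    show "AE x in lborel. x \<notin> cball 0 r \<longrightarrow> norm (f x) powr p = 0" using f by auto
  qed auto
  thus ?thesis by (simp add: Lp_space_def integrable_completion measurable_completion)
qed

text \<open>|a - b| is at most 2 max (|a|, |b|), which works for every p > 0; the factor 2^p
  replaces the subadditivity that p-th powers lack for p > 1.\<close>

lemma norm_diff_powr_le:
  fixes a b :: "'a::real_normed_vector"
  assumes "p > 0"
  shows "norm (a - b) powr p \<le> 2 powr p * (norm a powr p + norm b powr p)"
proof -
  have "norm (a - b) \<le> 2 * max (norm a) (norm b)"
    using norm_triangle_ineq4[of a b] by linarith
  hence "norm (a - b) powr p \<le> (2 * max (norm a) (norm b)) powr p"
    using assms by (intro powr_mono2) auto
  also have "\<dots> = 2 powr p * max (norm a) (norm b) powr p"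
    by (simp add: powr_mult)
  also have "max (norm a) (norm b) powr p \<le> norm a powr p + norm b powr p"
    by (simp add: max_def)
  finally show ?thesis by simp
qed

lemma Lp_space_diff:
  assumes "f \<in> Lp_space p" "g \<in> Lp_space p" "p > 0"
  shows "(\<lambda>x. f x - g x) \<in> Lp_space p"
  unfolding Lp_space_def
proof (intro CollectI conjI)
  have [measurable]: "f \<in> borel_measurable lebesgue" "g \<in> borel_measurable lebesgue"
    using assms by (auto simp: Lp_space_def)
  show "(\<lambda>x. f x - g x) \<in> borel_measurable lebesgue" by measurable
  have "integrable lebesgue (\<lambda>x. 2 powr p * (norm (f x) powr p + norm (g x) powr p))"
    using assms by (auto simp: Lp_space_def)
  thus "integrable lebesgue (\<lambda>x. norm (f x - g x) powr p)"
    by (rule Bochner_Integration.integrable_bound)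
      (use norm_diff_powr_le[OF assms(3)] in auto)
qed

lemma powr_tendsto_0D:
  assumes "(\<lambda>k. norm (a k) powr p) \<longlonglongrightarrow> 0" "p > 0"
  shows "a \<longlonglongrightarrow> 0"
proof -
  have "(\<lambda>k. (norm (a k) powr p) powr (1 / p)) \<longlonglongrightarrow> 0"
    using assms(2) by (intro tendsto_zero_powrI[OF assms(1) tendsto_const]) auto
  moreover have "(norm (a k) powr p) powr (1 / p) = norm (a k)" for k
    using assms(2) by (simp add: powr_powr)
  ultimately have "(\<lambda>k. norm (a k)) \<longlonglongrightarrow> 0" by (simp only:)
  thus ?thesis by (rule tendsto_norm_zero_cancel)
qed

section \<open>Continuity of a bounded multilinear extension along subsequences\<close>

locale multilinear_Lp =
  fixes E :: "('m::finite \<Rightarrow> real^'n \<Rightarrow> complex) \<Rightarrow> real^'n \<Rightarrow> complex"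
    and qs :: "'m \<Rightarrow> real" and q C :: real
  assumes qs: "\<And>j. 1 \<le> qs j" and q_eq: "1 / q = (\<Sum>j\<in>UNIV. 1 / qs j)"
    and multilin: "multilinear_op (\<lambda>u v. AE x in lebesgue. u x = v x) (\<lambda>j. Lp_space (qs j)) E"
    and bdd: "\<And>f. (\<And>j. f j \<in> Lp_space (qs j)) \<Longrightarrow>
      E f \<in> Lp_space q \<and> Lp_norm q (E f) \<le> C * (\<Prod>j\<in>UNIV. Lp_norm (qs j) (f j))"
    and C: "C \<ge> 0"
begin

lemma qs_pos: "qs j > 0" using qs[of j] by linarith

lemma q_pos: "q > 0"
proof -
  have "(\<Sum>j\<in>UNIV. 1 / qs j) > 0" using qs_pos by (intro sum_pos) auto
  thus ?thesis by (simp flip: q_eq)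
qed

lemma E_measurable: "(\<And>j. f j \<in> Lp_space (qs j)) \<Longrightarrow> E f \<in> borel_measurable lebesgue"
  using bdd by (auto simp: Lp_space_def)

text \<open>The q-th power of the norm inequality. It avoids \<open>Lp_norm q\<close>, which is no
  norm for q < 1, and speaks of integrals, where convergence in L^1 can be applied.\<close>

lemma E_integral_le:
  assumes "\<And>j. f j \<in> Lp_space (qs j)"
  shows "(LINT x|lebesgue. norm (E f x) powr q)
    \<le> C powr q * (\<Prod>j\<in>UNIV. (LINT x|lebesgue. norm (f j x) powr qs j) powr (q / qs j))"
proof -
  let ?I = "LINT x|lebesgue. norm (E f x) powr q"
  have "?I \<ge> 0" by simp
  hence "?I = Lp_norm q (E f) powr q"
    using q_pos by (simp add: Lp_norm_def powr_powr)
  also have "\<dots> \<le> (C * (\<Prod>j\<in>UNIV. Lp_norm (qs j) (f j))) powr q"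
    using bdd[OF assms] q_pos by (intro powr_mono2) (auto simp: Lp_norm_def)
  also have "\<dots> = C powr q * (\<Prod>j\<in>UNIV. Lp_norm (qs j) (f j) powr q)"
    using C by (simp add: powr_mult prod_powr_distrib)
  also have "(\<Prod>j\<in>UNIV. Lp_norm (qs j) (f j) powr q) =
      (\<Prod>j\<in>UNIV. (LINT x|lebesgue. norm (f j x) powr qs j) powr (q / qs j))"
    by (intro prod.cong) (auto simp: Lp_norm_def powr_powr)
  finally show ?thesis .
qed

lemma E_diff:
  assumes "\<And>j. f j \<in> Lp_space (qs j)" "g \<in> Lp_space (qs i)"
  shows "AE x in lebesgue. E (f(i := \<lambda>x. g x - f i x)) x = E (f(i := g)) x - E f x"
proof -
  have "AE x in lebesgue. E (f(i := \<lambda>x. 1 * g x + (-1) * f i x)) x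
      = 1 * E (f(i := g)) x + (-1) * E (f(i := f i)) x"
    using multilin assms unfolding multilinear_op_def by blast
  thus ?thesis by simp
qed

text \<open>Arguments are exchanged one at a time. Two consecutive tuples differ in slot i only, so
  multilinearity turns the difference into \<open>E\<close> of a tuple whose slot i tends to 0 while
  the other slots stay bounded; its q-th powers tend to 0 in L^1, hence almost everywhere along a
  further subsequence.\<close>

lemma E_AE_subseq_finite:
  assumes F: "\<And>k j. F k j \<in> Lp_space (qs j)" and f: "\<And>j. f j \<in> Lp_space (qs j)"
    and lim: "\<And>j. (\<lambda>k. LINT x|lebesgue. norm (F k j x - f j x) powr qs j) \<longlonglongrightarrow> 0"
    and B: "\<And>k j. (LINT x|lebesgue. norm (F k j x) powr qs j) \<le> B"
    and "finite I"
  shows "\<exists>r. strict_mono r \<and>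
    (AE x in lebesgue. (\<lambda>k. E (\<lambda>j. if j \<in> I then F (r k) j else f j) x) \<longlonglongrightarrow> E f x)"
  using \<open>finite I\<close>
proof induction
  case empty
  show ?case by (intro exI[of _ id]) (auto simp: strict_mono_def)
next
  case (insert i I)
  then obtain r where r: "strict_mono r"
    "AE x in lebesgue. (\<lambda>k. E (\<lambda>j. if j \<in> I then F (r k) j else f j) x) \<longlonglongrightarrow> E f x" by blast
  \<comment> \<open>\<open>G k\<close> has the slots in \<open>I\<close> already exchanged;
    \<open>D k\<close> is the same tuple with the difference in slot \<open>i\<close>.\<close>
  define G where "G k = (\<lambda>j. if j \<in> I then F (r k) j else f j)" for k
  define D where "D k = (G k)(i := \<lambda>x. F (r k) i x - f i x)" for k
  have Gi: "G k i = f i" for k using insert by (simp add: G_def)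
  have G: "G k j \<in> Lp_space (qs j)" for k j using F f by (simp add: G_def)
  have D: "D k j \<in> Lp_space (qs j)" for k j
    unfolding D_def using G F f qs_pos[of i] by (auto intro!: Lp_space_diff)
  have eq: "AE x in lebesgue. E (D k) x = E ((G k)(i := F (r k) i)) x - E (G k) x" for k
    using E_diff[where f = "G k" and i = i, OF G F] by (simp add: Gi D_def)
  define N where "N g j = (LINT x|lebesgue. norm (g x) powr qs j)" for g :: "real^'n \<Rightarrow> complex" and j
  \<comment> \<open>One bound for all slots other than \<open>i\<close>, exchanged or not.\<close>
  define B' where "B' = max B (Max (range (\<lambda>j. N (f j) j)))"
  have NB: "N (D k j) j \<le> B'" if "j \<noteq> i" for k j
  proof (cases "j \<in> I")
    case True
    thus ?thesis using that B[of "r k" j] by (auto simp: B'_def D_def G_def N_def le_max_iff_disj)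
  next
    case False
    hence "D k j = f j" using that by (simp add: D_def G_def)
    moreover have "N (f j) j \<le> Max (range (\<lambda>j. N (f j) j))" by (intro Max_ge) auto
    ultimately show ?thesis unfolding B'_def by (simp only: max.coboundedI2)
  qed
  have Nnn: "N g j \<ge> 0" for g j by (simp add: N_def)
  have q0: "q / qs j \<ge> 0" for j using q_pos qs_pos[of j] by simp
  let ?P = "C powr q * (\<Prod>j\<in>UNIV - {i}. B' powr (q / qs j))"
  have le: "(LINT x|lebesgue. norm (norm (E (D k) x) powr q)) \<le> ?P * N (D k i) i powr (q / qs i)" for k
  proof -
    have "(\<Prod>j\<in>UNIV. N (D k j) j powr (q / qs j))
       = N (D k i) i powr (q / qs i) * (\<Prod>j\<in>UNIV - {i}. N (D k j) j powr (q / qs j))"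
      by (subst prod.remove[of _ i]) auto
    also have "\<dots> \<le> N (D k i) i powr (q / qs i) * (\<Prod>j\<in>UNIV - {i}. B' powr (q / qs j))"
      using NB Nnn q0 by (intro mult_left_mono prod_mono conjI powr_mono2) auto
    finally have "C powr q * (\<Prod>j\<in>UNIV. N (D k j) j powr (q / qs j))
        \<le> C powr q * (N (D k i) i powr (q / qs i) * (\<Prod>j\<in>UNIV - {i}. B' powr (q / qs j)))"
      by (rule mult_left_mono) simp
    moreover have "(LINT x|lebesgue. norm (norm (E (D k) x) powr q))
        \<le> C powr q * (\<Prod>j\<in>UNIV. N (D k j) j powr (q / qs j))"
      using E_integral_le[OF D] by (simp add: N_def)
    ultimately show ?thesis by (simp add: mult_ac)
  qed
  have "(\<lambda>k. N (D k i) i) \<longlonglongrightarrow> 0"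
    using LIMSEQ_subseq_LIMSEQ[OF lim[of i] r(1)] by (simp add: N_def D_def o_def)
  hence "(\<lambda>k. ?P * N (D k i) i powr (q / qs i)) \<longlonglongrightarrow> 0"
    using q_pos qs_pos[of i] Nnn by (intro tendsto_mult_right_zero tendsto_zero_powrI[OF _ tendsto_const]) auto
  hence "(\<lambda>k. LINT x|lebesgue. norm (norm (E (D k) x) powr q)) \<longlonglongrightarrow> 0"
    by (rule Lim_null_comparison[rotated]) (use le in auto)
  moreover have "integrable lebesgue (\<lambda>x. norm (E (D k) x) powr q)" for k
    using bdd[OF D[of k]] by (simp add: Lp_space_def)
  ultimately obtain r' where r': "strict_mono r'"
      "AE x in lebesgue. (\<lambda>k. norm (E (D (r' k)) x) powr q) \<longlonglongrightarrow> 0"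
    using tendsto_L1_AE_subseq[where M = lebesgue and u = "\<lambda>k x. norm (E (D k) x) powr q"] by blast
  have "AE x in lebesgue. \<forall>k. E (D k) x = E ((G k)(i := F (r k) i)) x - E (G k) x"
    unfolding AE_all_countable using eq by blast
  with r(2) r'(2) have "AE x in lebesgue. (\<lambda>k. E ((G (r' k))(i := F (r (r' k)) i)) x) \<longlonglongrightarrow> E f x"
  proof eventually_elim
    case (elim x)
    have "(\<lambda>k. E (G (r' k)) x) \<longlonglongrightarrow> E f x"
      using LIMSEQ_subseq_LIMSEQ[OF elim(1) r'(1)] by (simp add: G_def o_def)
    from tendsto_add[OF this powr_tendsto_0D[OF elim(2) q_pos]]
    show ?case using elim(3) by simp
  qed
  moreover have "(G (r' k))(i := F (r (r' k)) i) = (\<lambda>j. if j \<in> insert i I then F (r (r' k)) j else f j)" for k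
    by (auto simp: G_def fun_eq_iff)
  ultimately show ?case
    using strict_mono_o[OF r(1) r'(1)] by (intro exI[of _ "r \<circ> r'"]) (simp only: o_def simp_thms)
qed

text \<open>Uniform bounds and a common bounded support turn almost-everywhere convergence of the
  arguments into convergence in each L^(q_j), by dominated convergence, whatever the exponents
  are.\<close>

lemma E_AE_subseq:
  assumes F: "\<And>k j. F k j \<in> bdd_supp" and f: "\<And>j. f j \<in> bdd_supp"
    and B: "\<And>k j x. norm (F k j x) \<le> B" and r: "\<And>k j x. F k j x \<noteq> 0 \<Longrightarrow> norm x \<le> r"
    and lim: "\<And>j. AE x in lebesgue. (\<lambda>k. F k j x) \<longlonglongrightarrow> f j x"
  shows "\<exists>s. strict_mono s \<and> (AE x in lebesgue. (\<lambda>k. E (F (s k)) x) \<longlonglongrightarrow> E f x)"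
proof -
  obtain B0 r0 where f0: "B0 > 0" "r0 > 0" "\<And>j x. norm (f j x) \<le> B0" "\<And>j x. f j x \<noteq> 0 \<Longrightarrow> norm x \<le> r0"
    by (rule bdd_supp_common_bound[of f, OF f]) blast
  have B': "B \<ge> 0" using B[of 0 undefined undefined] norm_ge_zero order_trans by blast
  define R where "R = max r r0"
  let ?w = "\<lambda>j (x::real^'n). (B + B0) powr qs j * indicator (cball 0 R) x :: real"
  have meas: "F k j \<in> borel_measurable lebesgue" "f j \<in> borel_measurable lebesgue" for k j
    by (intro measurable_completion bdd_supp_measurable F f; simp)+
  note [measurable] = meas
  have int: "integrable lebesgue (?w j)" for j
    by (intro integrable_mult_right integrable_real_indicator)
      (use emeasure_bounded_finite[OF bounded_cball] in auto)
  have cb: "norm (F k j x - f j x) powr qs j \<le> ?w j x" for k j x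
  proof (cases "norm x \<le> R")
    case True
    have "norm (F k j x - f j x) \<le> B + B0"
      using B[of k j x] f0(3)[of j x] norm_triangle_ineq4[of "F k j x" "f j x"] by linarith
    thus ?thesis using True qs_pos[of j] by (auto intro!: powr_mono2)
  next
    case False
    hence "F k j x = 0" "f j x = 0"
      using r[of k j x] f0(4)[of j x] unfolding R_def by linarith+
    thus ?thesis by simp
  qed
  have cb2: "norm (F k j x) powr qs j \<le> ?w j x" for k j x
  proof (cases "norm x \<le> R")
    case True
    have "norm (F k j x) \<le> B + B0"
      using B[of k j x] f0(1) by linarith
    thus ?thesis using True qs_pos[of j] by (auto intro!: powr_mono2)
  next
    case False
    hence "F k j x = 0" using r[of k j x] unfolding R_def by linarith
    thus ?thesis by simp
  qed
  have "\<exists>s. strict_mono s \<and>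
    (AE x in lebesgue. (\<lambda>k. E (\<lambda>j. if j \<in> UNIV then F (s k) j else f j) x) \<longlonglongrightarrow> E f x)"
  proof (rule E_AE_subseq_finite)
    show "F k j \<in> Lp_space (qs j)" "f j \<in> Lp_space (qs j)" for k j
      using F f qs_pos by (auto intro: Lp_space_bdd_supp)
    show "(\<lambda>k. LINT x|lebesgue. norm (F k j x - f j x) powr qs j) \<longlonglongrightarrow> 0" for j
    proof -
      have "(\<lambda>k. LINT x|lebesgue. norm (F k j x - f j x) powr qs j) \<longlonglongrightarrow> (LINT (x::real^'n)|lebesgue. (0::real))"
      proof (rule integral_dominated_convergence[where w = "?w j"])
        show "AE x in lebesgue. (\<lambda>k. norm (F k j x - f j x) powr qs j) \<longlonglongrightarrow> 0"
          using lim[of j]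
        proof eventually_elim
          case (elim x)
          from tendsto_diff[OF elim tendsto_const[of "f j x"]]
          have "(\<lambda>k. norm (F k j x - f j x)) \<longlonglongrightarrow> 0" by (simp add: tendsto_norm_zero)
          thus ?case using qs_pos[of j] by (intro tendsto_zero_powrI[OF _ tendsto_const]) auto
        qed
        show "AE x in lebesgue. norm (norm (F k j x - f j x) powr qs j) \<le> ?w j x" for k
          using cb by auto
      qed (use int in auto)
      thus ?thesis by simp
    qed
    show "(LINT x|lebesgue. norm (F k j x) powr qs j) \<le> (\<Sum>j\<in>UNIV. LINT x|lebesgue. ?w j x)" for k j
    proof -
      have "(LINT x|lebesgue. norm (F k j x) powr qs j) \<le> (LINT x|lebesgue. ?w j x)"
        using F qs_pos[of j] Lp_space_bdd_supp[of "F k j" "qs j"] cb2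
        by (intro integral_mono int) (auto simp: Lp_space_def)
      also have "\<dots> \<le> (\<Sum>j\<in>UNIV. LINT x|lebesgue. ?w j x)"
        by (rule member_le_sum) auto
      finally show ?thesis .
    qed
  qed auto
  thus ?thesis by simp
qed

text \<open>\<open>E\<close> acts on functions, and its definition does not postulate that it
  respects null sets. Boundedness yields this: the constant sequence \<open>f\<close> converges to
  \<open>g\<close> in each space.\<close>

lemma E_AE_cong:
  assumes f: "\<And>j. f j \<in> Lp_space (qs j)" and g: "\<And>j. g j \<in> Lp_space (qs j)"
    and eq: "\<And>j. AE x in lebesgue. f j x = g j x"
  shows "AE x in lebesgue. E f x = E g x"
proof -
  have "(LINT x|lebesgue. norm (f j x - g j x) powr qs j) = 0" for j
    by (rule integral_eq_zero_AE) (use eq[of j] in \<open>eventually_elim, simp\<close>)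
  hence *: "\<And>j. (\<lambda>k::nat. LINT x|lebesgue. norm (f j x - g j x) powr qs j) \<longlonglongrightarrow> 0" by simp
  have "\<exists>s::nat\<Rightarrow>nat. strict_mono s \<and>
    (AE x in lebesgue. (\<lambda>k. E (\<lambda>j. if j \<in> UNIV then f j else g j) x) \<longlonglongrightarrow> E g x)"
    by (rule E_AE_subseq_finite[where F = "\<lambda>k. f" and
        B = "\<Sum>j\<in>UNIV. LINT x|lebesgue. norm (f j x) powr qs j"])
      (use f g * in \<open>auto intro!: member_le_sum\<close>)
  then obtain s :: "nat \<Rightarrow> nat" where "AE x in lebesgue. (\<lambda>k::nat. E f x) \<longlonglongrightarrow> E g x"
    by auto
  thus ?thesis by eventually_elim (simp add: LIMSEQ_const_iff)
qed

end

section \<open>Kernel representation on bounded functions\<close>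

lemma vec_nth_measurable [measurable]:
  "(\<lambda>y :: 'a::euclidean_space^'m::finite. y $ j) \<in> borel_measurable borel"
  by (intro borel_measurable_continuous_onI continuous_intros)

lemma vec_lambda_measurable_PiM:
  "(\<lambda>f. \<chi> j. f j) \<in> (\<Pi>\<^sub>M j\<in>(UNIV::'m::finite set). (borel :: 'a::euclidean_space measure)) \<rightarrow>\<^sub>M borel"
proof (subst borel_measurable_euclidean_space, intro ballI)
  fix b :: "'a^'m" assume "b \<in> Basis"
  then obtain j c where b: "b = axis j c" by (auto simp: Basis_vec_def)
  have "(\<lambda>f. f j \<bullet> c) \<in> borel_measurable (\<Pi>\<^sub>M j\<in>(UNIV::'m set). (borel :: 'a measure))"
    by measurable
  thus "(\<lambda>f. (\<chi> j. f j) \<bullet> b) \<in> borel_measurable (\<Pi>\<^sub>M j\<in>(UNIV::'m set). (borel :: 'a measure))"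
    by (simp add: b inner_axis)
qed

text \<open>Both measures agree on boxes, which determines Lebesgue measure. The identification
  opens the Fubini theorems for product measures to integrals over vectors of vectors, the form of
  the kernel integral.\<close>

lemma lborel_vec_eq:
  "lborel = distr (\<Pi>\<^sub>M j\<in>(UNIV::'m::finite set). (lborel :: 'a::euclidean_space measure)) borel (\<lambda>f. \<chi> j. f j)"
proof (rule lborel_eqI)
  fix l u :: "'a^'m"
  assume le: "\<And>b. b \<in> Basis \<Longrightarrow> l \<bullet> b \<le> u \<bullet> b"
  interpret product_sigma_finite "\<lambda>_::'m. lborel :: 'a measure"
    by standard
  let ?P = "\<Pi>\<^sub>M j\<in>(UNIV::'m set). (lborel :: 'a measure)"
  have le': "l $ j \<bullet> c \<le> u $ j \<bullet> c" if "c \<in> Basis" for j c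
    using le[of "axis j c"] that by (simp add: axis_in_Basis_iff inner_axis)
  have meas: "(\<lambda>f. \<chi> j. f j) \<in> ?P \<rightarrow>\<^sub>M borel"
    using vec_lambda_measurable_PiM by (simp cong: measurable_cong_sets sets_PiM_cong)
  have "(\<lambda>f. \<chi> j. f j) -` box l u \<inter> space ?P = (\<Pi>\<^sub>E j\<in>UNIV. box (l $ j) (u $ j))"
    by (auto simp: space_PiM PiE_def Pi_def mem_box Basis_vec_def inner_axis)
  hence "emeasure (distr ?P borel (\<lambda>f. \<chi> j. f j)) (box l u)
      = emeasure ?P (\<Pi>\<^sub>E j\<in>UNIV. box (l $ j) (u $ j))"
    using meas by (simp add: emeasure_distr)
  also have "\<dots> = (\<Prod>j\<in>UNIV. emeasure lborel (box (l $ j) (u $ j)))"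
    by (rule emeasure_PiM) auto
  also have "\<dots> = (\<Prod>j\<in>UNIV. ennreal (\<Prod>c\<in>Basis. (u $ j - l $ j) \<bullet> c))"
    by (intro prod.cong refl emeasure_lborel_box) (use le' in auto)
  also have "\<dots> = ennreal (\<Prod>j\<in>UNIV. \<Prod>c\<in>Basis. (u $ j - l $ j) \<bullet> c)"
    using le' by (intro prod_ennreal prod_nonneg) (auto simp: inner_diff_left)
  also have "(\<Prod>j\<in>UNIV. \<Prod>c\<in>Basis. (u $ j - l $ j) \<bullet> c) = (\<Prod>b\<in>Basis. (u - l) \<bullet> b)"
  proof -
    have "(\<Prod>b\<in>Basis. (u - l) \<bullet> b) = (\<Prod>j\<in>UNIV. \<Prod>b\<in>(\<Union>c\<in>Basis. {axis j c}). (u - l) \<bullet> b)"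
      unfolding Basis_vec_def
      by (rule prod.UNION_disjoint) (auto simp: axis_eq_axis nonzero_Basis)
    also have "\<dots> = (\<Prod>j\<in>UNIV. \<Prod>c\<in>Basis. (u - l) \<bullet> axis j c)"
    proof (intro prod.cong refl)
      fix j :: 'm
      have "(\<Union>c\<in>Basis. {axis j c}) = axis j ` (Basis :: 'a set)" by auto
      thus "(\<Prod>b\<in>(\<Union>c\<in>Basis. {axis j c}). (u - l) \<bullet> b) = (\<Prod>c\<in>Basis. (u - l) \<bullet> axis j c)"
        by (simp add: prod.reindex inj_on_def axis_eq_axis)
    qed
    finally show ?thesis by (simp add: inner_axis)
  qed
  finally show "emeasure (distr ?P borel (\<lambda>f. \<chi> j. f j)) (box l u) = ennreal (\<Prod>b\<in>Basis. (u - l) \<bullet> b)" .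
qed simp

lemma vec_lambda_measurable_PiM_lborel:
  "(\<lambda>f. \<chi> j. f j) \<in> (\<Pi>\<^sub>M j\<in>(UNIV::'m::finite set). (lborel :: 'a::euclidean_space measure)) \<rightarrow>\<^sub>M borel"
  using vec_lambda_measurable_PiM by (simp cong: measurable_cong_sets sets_PiM_cong)

lemma nn_integral_lborel_vec_prod:
  fixes u :: "'m::finite \<Rightarrow> 'a::euclidean_space \<Rightarrow> ennreal"
  assumes [measurable]: "\<And>j. u j \<in> borel_measurable borel"
  shows "(\<integral>\<^sup>+y. (\<Prod>j\<in>UNIV. u j (y $ j)) \<partial>lborel) = (\<Prod>j\<in>UNIV. \<integral>\<^sup>+x. u j x \<partial>lborel)"
proof -
  interpret product_sigma_finite "\<lambda>_::'m. lborel :: 'a measure"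
    by standard
  have "(\<integral>\<^sup>+y. (\<Prod>j\<in>UNIV. u j (y $ j)) \<partial>lborel) =
      (\<integral>\<^sup>+f. (\<Prod>j\<in>UNIV. u j (f j)) \<partial>(\<Pi>\<^sub>M j\<in>(UNIV::'m set). (lborel :: 'a measure)))"
    by (subst lborel_vec_eq, subst nn_integral_distr[OF vec_lambda_measurable_PiM_lborel]) auto
  also have "\<dots> = (\<Prod>j\<in>UNIV. \<integral>\<^sup>+x. u j x \<partial>lborel)"
    by (rule product_nn_integral_prod) auto
  finally show ?thesis .
qed

lemma integrable_lborel_vec_prod:
  fixes u :: "'m::finite \<Rightarrow> 'a::euclidean_space \<Rightarrow> complex"
  assumes "\<And>j. integrable lborel (u j)"
  shows "integrable lborel (\<lambda>y. \<Prod>j\<in>UNIV. u j (y $ j))"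
proof (rule integrableI_bounded)
  have [measurable]: "u j \<in> borel_measurable borel" for j
    using borel_measurable_integrable[OF assms[of j]] by simp
  show "(\<lambda>y. \<Prod>j\<in>UNIV. u j (y $ j)) \<in> borel_measurable lborel" by measurable
  have "(\<integral>\<^sup>+ y. ennreal (norm (\<Prod>j\<in>UNIV. u j (y $ j))) \<partial>lborel)
      = (\<integral>\<^sup>+ y. (\<Prod>j\<in>UNIV. ennreal (norm (u j (y $ j)))) \<partial>lborel)"
    by (simp add: prod_norm[symmetric] prod_ennreal)
  also have "\<dots> = (\<Prod>j\<in>UNIV. \<integral>\<^sup>+x. ennreal (norm (u j x)) \<partial>lborel)"
    by (rule nn_integral_lborel_vec_prod) auto
  also have "\<dots> < \<infinity>"
    using assms by (simp add: less_top[symmetric] ennreal_prod_eq_top integrable_iff_bounded)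
  finally show "(\<integral>\<^sup>+ y. ennreal (norm (\<Prod>j\<in>UNIV. u j (y $ j))) \<partial>lborel) < \<infinity>" .
qed

text \<open>Fubini with the variable \<open>y $ i\<close> innermost: \<open>G\<close> is constant in
  it, so the inner integral is a multiple of the integral of \<open>b\<close>. This is the
  cancellation of a mean-zero argument against a kernel frozen in that slot.\<close>

lemma integral_lborel_vec_eq_0:
  fixes G :: "'a::euclidean_space^'m::finite \<Rightarrow> complex"
  assumes b: "integrable lborel b" "(LINT x|lborel. b x) = 0"
    and int: "integrable lborel (\<lambda>y. G y * b (y $ i))"
    and indep: "\<And>y z. (\<And>j. j \<noteq> i \<Longrightarrow> y $ j = z $ j) \<Longrightarrow> G y = G z"
  shows "(LINT y|lborel. G y * b (y $ i)) = 0"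
proof -
  interpret product_sigma_finite "\<lambda>_::'m. lborel :: 'a measure"
    by standard
  let ?P = "\<lambda>I. \<Pi>\<^sub>M j\<in>I. (lborel :: 'a measure)"
  define H where "H f = G (\<chi> j. f j) * b (f i)" for f :: "'m \<Rightarrow> 'a"
  have meas: "(\<lambda>y. G y * b (y $ i)) \<in> borel_measurable borel"
    using borel_measurable_integrable[OF int] by simp
  have UNIV_eq: "(UNIV :: 'm set) = insert i (UNIV - {i})" by auto
  have "integrable (distr (?P UNIV) borel (\<lambda>f. \<chi> j. f j)) (\<lambda>y. G y * b (y $ i))"
    using int by (subst lborel_vec_eq[symmetric])
  hence "integrable (?P UNIV) H"
    using meas by (subst (asm) integrable_distr_eq[OF vec_lambda_measurable_PiM_lborel]) (auto simp: H_def[abs_def])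
  hence H: "integrable (?P (insert i (UNIV - {i}))) H" by (simp flip: UNIV_eq)
  have "(LINT y|lborel. G y * b (y $ i)) = integral\<^sup>L (?P UNIV) H"
    by (subst lborel_vec_eq, subst integral_distr[OF vec_lambda_measurable_PiM_lborel meas])
      (simp add: H_def[abs_def])
  also have "\<dots> = (\<integral>x. (\<integral>y. H (x(i := y)) \<partial>lborel) \<partial>?P (UNIV - {i}))"
    using product_integral_insert[OF _ _ H] by (simp flip: UNIV_eq)
  also have "\<dots> = (\<integral>x. 0 \<partial>?P (UNIV - {i}))"
  proof (intro Bochner_Integration.integral_cong refl)
    fix x :: "'m \<Rightarrow> 'a"
    have "H (x(i := y)) = G (\<chi> j. x j) * b y" for y
      unfolding H_def by (subst indep[of "\<chi> j. (x(i := y)) j" "\<chi> j. x j"]) auto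
    thus "(\<integral>y. H (x(i := y)) \<partial>lborel) = 0" using b by simp
  qed
  finally show ?thesis by simp
qed

lemma completion_ex_complex:
  fixes g :: "'a \<Rightarrow> complex"
  assumes g: "g \<in> borel_measurable (completion M)"
  shows "\<exists>g'\<in>borel_measurable M. (AE x in M. g x = g' x)"
proof -
  have "(\<lambda>x. Re (g x)) \<in> borel_measurable (completion M)" "(\<lambda>x. Im (g x)) \<in> borel_measurable (completion M)"
    using g by measurable
  from this[THEN completion_ex_borel_measurable_real]
  obtain a b where [measurable]: "a \<in> borel_measurable M" "b \<in> borel_measurable M"
    and "AE x in M. Re (g x) = a x" "AE x in M. Im (g x) = b x" by blast
  hence "AE x in M. g x = Complex (a x) (b x)" by (auto simp: complex_eq_iff)
  moreover have "(\<lambda>x. Complex (a x) (b x)) \<in> borel_measurable M"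
    unfolding Complex_eq by measurable
  ultimately show ?thesis by (intro bexI[of _ "\<lambda>x. Complex (a x) (b x)"])
qed

text \<open>The cylinder over a null set is null: its indicator is a product with one factor of
  integral 0, which wins over the infinite integrals of the other factors.\<close>

lemma AE_vec_nth:
  fixes P :: "'a::euclidean_space \<Rightarrow> bool"
  assumes "AE x in lborel. P x"
  shows "AE y in (lborel :: ('a^'m::finite) measure). P (y $ i)"
proof -
  obtain N where N: "N \<in> null_sets lborel" "{x. \<not> P x} \<subseteq> N"
    using assms unfolding eventually_ae_filter by auto
  have [measurable]: "N \<in> sets borel" using N(1) by auto
  have "emeasure lborel {y :: 'a^'m. y $ i \<in> N} = (\<integral>\<^sup>+y. indicator {y :: 'a^'m. y $ i \<in> N} y \<partial>lborel)"
    by (subst nn_integral_indicator) auto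
  also have "\<dots> = (\<integral>\<^sup>+y. (\<Prod>j\<in>UNIV. (if j = i then indicator N ((y :: 'a^'m) $ j) else 1)) \<partial>lborel)"
    by (intro nn_integral_cong) (auto simp: prod.delta' indicator_def split: if_splits)
  also have "\<dots> = (\<Prod>j\<in>UNIV. \<integral>\<^sup>+x. (if j = i then indicator N x else 1) \<partial>lborel)"
    by (rule nn_integral_lborel_vec_prod) auto
  also have "\<dots> = 0"
    by (rule prod_zero[OF finite_class.finite_UNIV], rule bexI[of _ i])
      (use N(1) in \<open>auto simp: null_sets_def\<close>)
  finally have "{y :: 'a^'m. y $ i \<in> N} \<in> null_sets lborel" by (auto simp: null_sets_def)
  thus ?thesis by (rule AE_I') (use N(2) in auto)
qed

section \<open>Schwartz approximation of tuples and uniqueness of the extension\<close>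

lemma bdd_supp_bump:
  fixes h :: "real^'n \<Rightarrow> complex"
  assumes "h \<in> bdd_supp"
  shows "\<exists>\<eta>\<in>flat_smooth. bounded {x. \<eta> x \<noteq> 0} \<and> (\<forall>x. \<eta> x = 0 \<longrightarrow> h x = 0)"
proof -
  obtain B r where h: "B > 0" "r > 0" "\<And>x. norm (h x) \<le> B" "\<And>x. h x \<noteq> 0 \<Longrightarrow> norm x \<le> r"
    by (rule bdd_suppE[OF assms]) blast
  obtain \<eta> :: "real^'n \<Rightarrow> complex" where \<eta>: "\<eta> \<in> flat_smooth"
      "{x. \<eta> x \<noteq> 0} = box (\<chi> i. - (r + 1)) (\<chi> i. r + 1)"
    using flat_smooth_bump_box by blast
  have "h x = 0" if "\<eta> x = 0" for x
  proof (rule ccontr)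
    assume "h x \<noteq> 0"
    hence "norm x \<le> r" by (rule h(4))
    hence "- (r + 1) < x $ i \<and> x $ i < r + 1" for i using component_le_norm_cart[of x i] by linarith
    hence "x \<in> box (\<chi> i. - (r + 1)) (\<chi> i. r + 1)" by (simp add: mem_box_cart)
    thus False using \<eta>(2) that by blast
  qed
  thus ?thesis using \<eta> by (intro bexI[of _ \<eta>]) auto
qed

text \<open>\<open>\<theta> j\<close> prescribes where slot \<open>j\<close> may be nonzero. The
  approximants inherit this, so a slot living away from a point keeps living away from it, as the
  kernel formula demands.\<close>

lemma bdd_supp_approx:
  fixes h \<theta> :: "'m::finite \<Rightarrow> real^'n \<Rightarrow> complex"
  assumes \<theta>: "\<And>j. \<theta> j \<in> flat_smooth" "\<And>j. bounded {x. \<theta> j x \<noteq> 0}"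
    and h: "\<And>j. h j \<in> bdd_supp" "\<And>j x. \<theta> j x = 0 \<Longrightarrow> h j x = 0"
  obtains F :: "nat \<Rightarrow> 'm \<Rightarrow> real^'n \<Rightarrow> complex" and B r where
    "\<And>k j. F k j \<in> flat_smooth" "\<And>k j. F k j \<in> schwartz" "\<And>k j. F k j \<in> bdd_supp"
    "\<And>k j x. norm (F k j x) \<le> B" "\<And>k j x. F k j x \<noteq> 0 \<Longrightarrow> norm x \<le> r"
    "\<And>k j x. \<theta> j x = 0 \<Longrightarrow> F k j x = 0"
    "\<And>j. AE x in lebesgue. (\<lambda>k. F k j x) \<longlonglongrightarrow> h j x"
proof -
  define Q where "Q j F B \<longleftrightarrow> (\<forall>k. F k \<in> flat_smooth) \<and> (\<forall>k x. \<theta> j x = 0 \<longrightarrow> F k x = 0) \<and>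
     (\<forall>k x. norm (F k x) \<le> B) \<and> (AE x in lebesgue. (\<lambda>k. F k x) \<longlonglongrightarrow> h j x)"
    for j F and B :: real
  have "\<exists>F B. Q j F B" for j
  proof -
    obtain B where B: "\<And>x. norm (h j x) \<le> B" by (rule bdd_suppE[OF h(1)[of j]]) (rule that)
    show ?thesis unfolding Q_def
      by (rule flat_smooth_approx[OF \<theta>(1,2) bdd_supp_measurable[OF h(1)] B h(2)])
  qed
  hence "\<forall>j. \<exists>F B. Q j F B" by (rule allI)
  from choice[OF this] obtain F where "\<forall>j. \<exists>B. Q j (F j) B" by (rule exE)
  from choice[OF this] obtain B where Q: "\<forall>j. Q j (F j) (B j)" by (rule exE)
  have F: "\<And>j k. F j k \<in> flat_smooth" "\<And>j k x. \<theta> j x = 0 \<Longrightarrow> F j k x = 0"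
     "\<And>j k x. norm (F j k x) \<le> B j" "\<And>j. AE x in lebesgue. (\<lambda>k. F j k x) \<longlonglongrightarrow> h j x"
    using Q unfolding Q_def by auto
  have B0: "B j \<ge> 0" for j by (rule order_trans[OF norm_ge_zero F(3)])
  have "\<exists>r. \<forall>x. \<theta> j x \<noteq> 0 \<longrightarrow> norm x \<le> r" for j using \<theta>(2)[of j] by (auto simp: bounded_iff)
  then obtain r where r: "\<And>j x. \<theta> j x \<noteq> 0 \<Longrightarrow> norm x \<le> r j" by metis
  have bd: "norm (F j k x) \<le> sum B UNIV" for j k x
  proof (rule order_trans[OF F(3)])
    show "B j \<le> sum B UNIV" by (rule member_le_sum) (auto simp: B0)
  qed
  have supp: "norm x \<le> (\<Sum>j\<in>UNIV. \<bar>r j\<bar>)" if "F j k x \<noteq> 0" for j k x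
  proof -
    have "\<theta> j x \<noteq> 0" using F(2)[of j x k] that by blast
    hence "norm x \<le> \<bar>r j\<bar>" using r[of j x] by linarith
    also have "\<dots> \<le> (\<Sum>j\<in>UNIV. \<bar>r j\<bar>)" by (rule member_le_sum) auto
    finally show ?thesis .
  qed
  show ?thesis
  proof (rule that[of "\<lambda>k j. F j k"])
    show "F j k \<in> schwartz" for k j
    proof (rule flat_smooth_schwartz[OF F(1)])
      show "bounded {x. F j k x \<noteq> 0}" using supp[of j k] unfolding bounded_iff by blast
    qed
    show "F j k \<in> bdd_supp" for k j
      by (rule bdd_suppI[OF _ bd supp])
        (auto intro: borel_measurable_continuous_onI flat_smooth_continuous_on F)
    show "F j k \<in> flat_smooth" for k j by (rule F(1))
    show "norm (F j k x) \<le> sum B UNIV" for k j x by (rule bd)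
    show "norm x \<le> (\<Sum>j\<in>UNIV. \<bar>r j\<bar>)" if "F j k x \<noteq> 0" for k j x using that by (rule supp)
    show "F j k x = 0" if "\<theta> j x = 0" for k j x using that by (rule F(2))
    show "AE x in lebesgue. (\<lambda>k. F j k x) \<longlonglongrightarrow> h j x" for j by (rule F(4))
  qed
qed

lemma mult_cnj_sgn: "v * cnj (sgn v) = of_real (norm v)"
proof -
  have "v * cnj (sgn v) = (v * cnj v) / of_real (norm v)" by (simp add: sgn_eq)
  also have "v * cnj v = of_real ((norm v)\<^sup>2)" by (simp only: complex_norm_square)
  finally show ?thesis by (simp add: power2_eq_square)
qed

text \<open>Integrability is known only for products with Schwartz functions, so \<open>u\<close> is
  first multiplied by a bump \<open>\<eta>\<close>. Test functions \<open>\<eta> * F k\<close>, with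
  \<open>F k\<close> tending to the conjugate sign of \<open>u * \<eta>\<close>, then force the L^1
  norm of \<open>u * \<eta>\<close> to be 0.\<close>

lemma AE_eq_0_if_schwartz_integral_eq_0:
  fixes u :: "real^'n \<Rightarrow> complex"
  assumes u: "u \<in> borel_measurable lebesgue"
    and int: "\<And>\<phi>. \<phi> \<in> schwartz \<Longrightarrow> integrable lebesgue (\<lambda>x. u x * \<phi> x)"
    and zero: "\<And>\<phi>. \<phi> \<in> schwartz \<Longrightarrow> (LINT x|lebesgue. u x * \<phi> x) = 0"
  shows "AE x in lebesgue. u x = 0"
proof -
  note [measurable] = u
  have box: "AE x in lebesgue. x \<in> box a b \<longrightarrow> u x = 0" for a b :: "real^'n"
  proof -
    obtain \<eta> :: "real^'n \<Rightarrow> complex" where \<eta>: "\<eta> \<in> flat_smooth" "{x. \<eta> x \<noteq> 0} = box a b"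
      using flat_smooth_bump_box by blast
    have b\<eta>: "bounded {x. \<eta> x \<noteq> 0}" by (simp add: \<eta> bounded_box)
    have int\<eta>: "integrable lebesgue (\<lambda>x. u x * \<eta> x)"
      using int[OF flat_smooth_schwartz[OF \<eta>(1) b\<eta>]] .
    have meas\<eta> [measurable]: "\<eta> \<in> borel_measurable lebesgue"
      by (intro measurable_completion) (simp add: borel_measurable_continuous_onI flat_smooth_continuous_on \<eta>)
    let ?v = "\<lambda>x. u x * \<eta> x"
    have "(\<lambda>x. cnj (sgn (?v x))) \<in> borel_measurable lebesgue"
      by (intro measurable_compose[OF _ borel_measurable_continuous_onI[of cnj]] continuous_intros)
        (simp add: sgn_div_norm)
    then obtain w where w: "w \<in> borel_measurable lborel" "AE x in lborel. cnj (sgn (?v x)) = w x"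
      using completion_ex_complex by blast
    \<comment> \<open>The Borel version of the conjugate sign is correct only up to a null set;
      truncation restores the bound 1 and the vanishing off the box at every point, as the
      approximation lemma requires.\<close>
    define w' where "w' x = (if x \<in> box a b \<and> norm (w x) \<le> 1 then w x else 0)" for x
    have w'_meas: "w' \<in> borel_measurable borel"
      using w(1) unfolding w'_def by measurable
    have w'_eq: "AE x in lebesgue. ?v x * w' x = of_real (norm (?v x))"
      using AE_completion[OF w(2)]
    proof eventually_elim
      case (elim x)
      show ?case
      proof (cases "?v x = 0")
        case False
        hence "\<eta> x \<noteq> 0" by simp
        hence "x \<in> box a b" using \<eta>(2) by blast
        moreover have "norm (w x) \<le> 1" unfolding elim[symmetric] by (simp add: norm_sgn)
        ultimately have "w' x = cnj (sgn (?v x))" unfolding w'_def elim by (simp only: simp_thms if_True)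
        thus ?thesis by (simp only: mult_cnj_sgn)
      qed auto
    qed
    have "norm (w' x) \<le> 1" for x by (simp add: w'_def)
    moreover have "w' x = 0" if "\<eta> x = 0" for x
      using that \<eta>(2) by (auto simp: w'_def)
    ultimately have "\<exists>F B. (\<forall>k. F k \<in> flat_smooth) \<and> (\<forall>k x. \<eta> x = 0 \<longrightarrow> F k x = 0) \<and>
        (\<forall>k x. norm (F k x) \<le> B) \<and> (AE x in lebesgue. (\<lambda>k. F k x) \<longlonglongrightarrow> w' x)"
      by (rule flat_smooth_approx[OF \<eta>(1) b\<eta> w'_meas])
    then obtain F B where "(\<forall>k. F k \<in> flat_smooth) \<and> (\<forall>k x. \<eta> x = 0 \<longrightarrow> F k x = 0) \<and>
        (\<forall>k x. norm (F k x) \<le> B) \<and> (AE x in lebesgue. (\<lambda>k. F k x) \<longlonglongrightarrow> w' x)"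
      by (elim exE)
    hence F: "\<And>k. F k \<in> flat_smooth" "\<And>k x. \<eta> x = 0 \<Longrightarrow> F k x = 0"
      "\<And>k x. norm (F k x) \<le> B" "AE x in lebesgue. (\<lambda>k. F k x) \<longlonglongrightarrow> w' x"
      by auto
    have F_meas [measurable]: "F k \<in> borel_measurable lebesgue" for k
      by (intro measurable_completion) (simp add: borel_measurable_continuous_onI flat_smooth_continuous_on F)
    have [measurable]: "w' \<in> borel_measurable lebesgue"
      by (intro measurable_completion) (simp add: w'_meas)
    have "(\<lambda>k. LINT x|lebesgue. ?v x * F k x) \<longlonglongrightarrow> (LINT x|lebesgue. ?v x * w' x)"
    proof (rule integral_dominated_convergence[where w = "\<lambda>x. norm (?v x) * B"])
      show "integrable lebesgue (\<lambda>x. norm (?v x) * B)"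
        using int\<eta> by (intro integrable_mult_left integrable_norm)
      show "AE x in lebesgue. (\<lambda>k. ?v x * F k x) \<longlonglongrightarrow> ?v x * w' x"
        using F(4) by eventually_elim (intro tendsto_mult tendsto_const)
      show "AE x in lebesgue. norm (?v x * F k x) \<le> norm (?v x) * B" for k
        using F(3) by (auto simp: norm_mult intro!: mult_left_mono)
    qed measurable
    moreover have "(LINT x|lebesgue. ?v x * F k x) = 0" for k
    proof -
      have "(\<lambda>x. \<eta> x * F k x) \<in> schwartz"
        by (intro flat_smooth_schwartz flat_smooth.mult \<eta> F)
          (rule bounded_subset[OF b\<eta>], auto)
      from zero[OF this] show ?thesis by (simp add: mult_ac)
    qed
    ultimately have "(LINT x|lebesgue. ?v x * w' x) = 0" by (simp add: LIMSEQ_const_iff)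
    also have "(LINT x|lebesgue. ?v x * w' x) = (LINT x|lebesgue. of_real (norm (?v x)))"
      by (rule Bochner_Integration.integral_cong_AE) (use w'_eq in measurable)
    finally have "(LINT x|lebesgue. norm (?v x)) = 0" by simp
    hence "AE x in lebesgue. norm (?v x) = 0"
      using int\<eta> by (subst (asm) integral_nonneg_eq_0_iff_AE) auto
    thus ?thesis by eventually_elim (use \<eta>(2) in auto)
  qed
  have "AE x in lebesgue. \<forall>k::nat. x \<in> box (\<chi> i. - real k) (\<chi> i. real k) \<longrightarrow> u x = 0"
    unfolding AE_all_countable using box by blast
  thus ?thesis
  proof eventually_elim
    case (elim x)
    obtain k :: nat where "norm x < real k" using reals_Archimedean2 by blast
    hence "- real k < x $ i \<and> x $ i < real k" for i using component_le_norm_cart[of x i] by linarith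
    hence "x \<in> box (\<chi> i. - real k) (\<chi> i. real k)" by (simp add: mem_box_cart)
    thus ?case using elim by blast
  qed
qed

text \<open>The constant of the definition may be negative; its absolute value serves as well,
  because the norms are nonnegative, and can be raised to the power q.\<close>

lemma bounded_extension_multilinear_Lp:
  assumes "bounded_extension T qs q E"
  shows "\<exists>C. multilinear_Lp E qs q C"
proof -
  obtain C where C: "\<And>f. (\<And>j. f j \<in> Lp_space (qs j)) \<Longrightarrow>
        E f \<in> Lp_space q \<and> Lp_norm q (E f) \<le> C * (\<Prod>j\<in>UNIV. Lp_norm (qs j) (f j))"
    using assms unfolding bounded_extension_def by blast
  have "C * (\<Prod>j\<in>UNIV. Lp_norm (qs j) (f j)) \<le> \<bar>C\<bar> * (\<Prod>j\<in>UNIV. Lp_norm (qs j) (f j))" for f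
    by (intro mult_right_mono prod_nonneg) (auto simp: Lp_norm_def)
  hence le: "Lp_norm q (E f) \<le> \<bar>C\<bar> * (\<Prod>j\<in>UNIV. Lp_norm (qs j) (f j))"
    if "\<And>j. f j \<in> Lp_space (qs j)" for f
    using C[of f, OF that] order_trans by blast
  have "multilinear_Lp E qs q \<bar>C\<bar>"
  proof
    show "1 \<le> qs j" "1 / q = (\<Sum>j\<in>UNIV. 1 / qs j)"
      "multilinear_op (\<lambda>u v. AE x in lebesgue. u x = v x) (\<lambda>j. Lp_space (qs j)) E" for j
      using assms unfolding bounded_extension_def by blast+
    show "E f \<in> Lp_space q \<and> Lp_norm q (E f) \<le> \<bar>C\<bar> * (\<Prod>j\<in>UNIV. Lp_norm (qs j) (f j))"
      if "\<And>j. f j \<in> Lp_space (qs j)" for f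
      using C[of f, OF that] le[of f, OF that] by (intro conjI) simp_all
  qed simp
  thus ?thesis by (rule exI)
qed

text \<open>On Schwartz tuples of bounded support both extensions represent the same distribution,
  hence agree almost everywhere. The exponents may differ, but both extensions pass to the limit
  along one common subsequence.\<close>

lemma bounded_extension_unique:
  fixes f :: "'m::finite \<Rightarrow> real^'n \<Rightarrow> complex"
  assumes 1: "bounded_extension T qs q E" and 2: "bounded_extension T qs' q' E'"
    and f: "\<And>j. f j \<in> bdd_supp"
  shows "AE x in lebesgue. E f x = E' f x"
proof -
  obtain C where "multilinear_Lp E qs q C" using bounded_extension_multilinear_Lp[OF 1] by blast
  then interpret e1: multilinear_Lp E qs q C .
  obtain C' where "multilinear_Lp E' qs' q' C'" using bounded_extension_multilinear_Lp[OF 2] by blast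
  then interpret e2: multilinear_Lp E' qs' q' C' .
  have "\<forall>j. \<exists>\<eta>. \<eta> \<in> flat_smooth \<and> bounded {x. \<eta> x \<noteq> 0} \<and> (\<forall>x. \<eta> x = 0 \<longrightarrow> f j x = 0)"
    using bdd_supp_bump[OF f] by blast
  then obtain \<theta> where \<theta>: "\<And>j. \<theta> j \<in> flat_smooth" "\<And>j. bounded {x. \<theta> j x \<noteq> 0}"
      "\<And>j x. \<theta> j x = 0 \<Longrightarrow> f j x = 0" by metis
  obtain F B r where "\<And>k j. F k j \<in> flat_smooth" and
    F: "\<And>k j. F k j \<in> schwartz" "\<And>k j. F k j \<in> bdd_supp"
    "\<And>k j x. norm (F k j x) \<le> B" "\<And>k j x. F k j x \<noteq> 0 \<Longrightarrow> norm x \<le> r" and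
    "\<And>k j x. \<theta> j x = 0 \<Longrightarrow> F k j x = 0" and
    lim: "\<And>j. AE x in lebesgue. (\<lambda>k. F k j x) \<longlonglongrightarrow> f j x"
    by (rule bdd_supp_approx[of \<theta> f, OF \<theta>(1,2) f \<theta>(3)], assumption, rule that)
  have eq: "AE x in lebesgue. E g x - E' g x = 0" if g: "\<And>j. g j \<in> schwartz" "\<And>j. g j \<in> bdd_supp" for g
  proof (rule AE_eq_0_if_schwartz_integral_eq_0)
    have "E g \<in> borel_measurable lebesgue"
      by (rule e1.E_measurable) (intro Lp_space_bdd_supp g e1.qs_pos)
    moreover have "E' g \<in> borel_measurable lebesgue"
      by (rule e2.E_measurable) (intro Lp_space_bdd_supp g e2.qs_pos)
    ultimately show "(\<lambda>x. E g x - E' g x) \<in> borel_measurable lebesgue" by measurable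
    fix \<phi> :: "real^'n \<Rightarrow> complex" assume \<phi>: "\<phi> \<in> schwartz"
    have "integrable lebesgue (\<lambda>x. E g x * \<phi> x)" "T g \<phi> = (LINT x|lebesgue. E g x * \<phi> x)"
      "integrable lebesgue (\<lambda>x. E' g x * \<phi> x)" "T g \<phi> = (LINT x|lebesgue. E' g x * \<phi> x)"
      using 1 2 g \<phi> unfolding bounded_extension_def by blast+
    thus "integrable lebesgue (\<lambda>x. (E g x - E' g x) * \<phi> x)"
      "(LINT x|lebesgue. (E g x - E' g x) * \<phi> x) = 0"
      by (simp_all add: left_diff_distrib)
  qed
  have "\<exists>s. strict_mono s \<and> (AE x in lebesgue. (\<lambda>k. E (F (s k)) x) \<longlonglongrightarrow> E f x)"
    by (rule e1.E_AE_subseq[of F f B r]) (fact F f lim)+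
  then obtain s where s: "strict_mono s" "AE x in lebesgue. (\<lambda>k. E (F (s k)) x) \<longlonglongrightarrow> E f x"
    by blast
  \<comment> \<open>The second extraction is made inside the first, so that both limits run along
    the same sequence.\<close>
  have "\<exists>s'. strict_mono s' \<and> (AE x in lebesgue. (\<lambda>k. E' (F (s (s' k))) x) \<longlonglongrightarrow> E' f x)"
  proof (rule e2.E_AE_subseq[of "\<lambda>k. F (s k)" f B r, OF F(2) f F(3)])
    show "norm x \<le> r" if "F (s k) j x \<noteq> 0" for k j x using that by (rule F(4))
    show "AE x in lebesgue. (\<lambda>k. F (s k) j x) \<longlonglongrightarrow> f j x" for j
      using lim[of j] by eventually_elim (use LIMSEQ_subseq_LIMSEQ[OF _ s(1)] in \<open>simp add: o_def\<close>)
  qed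
  then obtain s' where s': "strict_mono s'" "AE x in lebesgue. (\<lambda>k. E' (F (s (s' k))) x) \<longlonglongrightarrow> E' f x"
    by blast
  have "AE x in lebesgue. \<forall>k. E (F k) x - E' (F k) x = 0"
    unfolding AE_all_countable by (intro allI eq F(1,2))
  with s(2) s'(2) show ?thesis
  proof eventually_elim
    case (elim x)
    have "(\<lambda>k. E (F (s (s' k))) x) \<longlonglongrightarrow> E f x"
      using LIMSEQ_subseq_LIMSEQ[OF elim(1) s'(1)] by (simp add: o_def)
    moreover have "(\<lambda>k. E (F (s (s' k))) x) \<longlonglongrightarrow> E' f x" using elim(2,3) by simp
    ultimately show ?case by (rule LIMSEQ_unique)
  qed
qed

section \<open>The kernel: continuity off the diagonal and the integral formula\<close>

lemma kernel_dist_ge: "norm (y k - y l) \<le> kernel_dist y"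
proof -
  have "norm (y k - y l) \<le> (\<Sum>l\<in>UNIV. norm (y k - y l))" by (rule member_le_sum) auto
  also have "\<dots> \<le> kernel_dist y"
    unfolding kernel_dist_def by (rule member_le_sum) (auto intro: sum_nonneg)
  finally show ?thesis .
qed

lemma kernel_dist_pos: "off_diagonal y \<Longrightarrow> kernel_dist y > 0"
  unfolding off_diagonal_def using kernel_dist_ge by (metis less_le_trans right_minus_eq zero_less_norm_iff)

lemma kernel_dist_tendsto:
  "(\<And>l. (\<lambda>k. Y k l) \<longlonglongrightarrow> y l) \<Longrightarrow> (\<lambda>k. kernel_dist (Y k)) \<longlonglongrightarrow> kernel_dist y"
  unfolding kernel_dist_def by (intro tendsto_intros)

abbreviation kernel_pt :: "'a \<Rightarrow> 'a^'m \<Rightarrow> 'm option \<Rightarrow> 'a" where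
  "kernel_pt x y \<equiv> case_option x (\<lambda>j. y $ j)"

lemma kernel_pt_tendsto: "(X \<longlonglongrightarrow> x) \<Longrightarrow> (Y \<longlonglongrightarrow> y) \<Longrightarrow> (\<lambda>k. kernel_pt (X k) (Y k) l) \<longlonglongrightarrow> kernel_pt x y l"
  by (cases l) (auto intro: tendsto_vec_nth)

locale CZ_data = multilinear_Lp E qs q C
  for E :: "('m::finite \<Rightarrow> real^'n \<Rightarrow> complex) \<Rightarrow> real^'n \<Rightarrow> complex" and qs q C +
  fixes K :: "('m option \<Rightarrow> real^'n) \<Rightarrow> complex" and A \<epsilon> :: real
  assumes A: "A > 0" and eps: "\<epsilon> > 0"
    and size: "\<And>y. off_diagonal y \<Longrightarrow> norm (K y) \<le> A / kernel_dist y ^ (CARD('m) * CARD('n))"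
    and reg: "\<And>y j z. off_diagonal y \<Longrightarrow> norm (y j - z) \<le> 1/2 * (MAX k. norm (y j - y k)) \<Longrightarrow>
      norm (K y - K (y(j := z)))
        \<le> A * norm (y j - z) powr \<epsilon> / kernel_dist y powr (real (CARD('m) * CARD('n)) + \<epsilon>)"
    and rep: "\<And>f. (\<And>j. f j \<in> schwartz) \<Longrightarrow>
      AE x in lebesgue. x \<notin> (\<Inter>j. ess_supp (f j)) \<longrightarrow>
        E f x = (LINT y::real^'n^'m|lebesgue. K (kernel_pt x y) * (\<Prod>j\<in>UNIV. f j (y $ j)))"
begin

text \<open>Any single distance may stand for the maximum in the regularity condition, being the
  smaller one.\<close>

lemma reg':
  assumes "off_diagonal y" "norm (y j - z) \<le> 1/2 * norm (y j - y l)"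
  shows "norm (K y - K (y(j := z)))
        \<le> A * norm (y j - z) powr \<epsilon> / kernel_dist y powr (real (CARD('m) * CARD('n)) + \<epsilon>)"
proof (rule reg[OF assms(1)])
  have "norm (y j - y l) \<le> (MAX k. norm (y j - y k))" by (intro Max_ge) auto
  thus "norm (y j - z) \<le> 1/2 * (MAX k. norm (y j - y k))" using assms(2) by linarith
qed

text \<open>Points are moved one at a time. Each shift eventually falls within the range of the
  regularity estimate, since the moving point keeps a positive distance from some other point, and
  the bound of that estimate tends to 0.\<close>

lemma K_tendsto_finite:
  assumes y: "off_diagonal y" and Y: "\<And>l. (\<lambda>k. Y k l) \<longlonglongrightarrow> y l" and "finite I"
  shows "(\<lambda>k. K (\<lambda>l. if l \<in> I then Y k l else y l)) \<longlonglongrightarrow> K y"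
  using \<open>finite I\<close>
proof induction
  case (insert i I)
  define W where "W k = (\<lambda>l. if l \<in> I then Y k l else y l)" for k
  have W: "(\<lambda>k. W k l) \<longlonglongrightarrow> y l" for l using Y[of l] by (cases "l \<in> I") (simp_all add: W_def)
  have Wi: "W k i = y i" for k using insert by (simp add: W_def)
  obtain j where j: "y (Some j) \<noteq> y None" using y by (auto simp: off_diagonal_def)
  have "(\<lambda>k. W k (Some j) - W k None) \<longlonglongrightarrow> y (Some j) - y None" by (intro tendsto_diff W)
  hence "\<forall>\<^sub>F k in sequentially. W k (Some j) - W k None \<noteq> 0"
    using j by (intro tendsto_imp_eventually_ne) auto
  hence off: "\<forall>\<^sub>F k in sequentially. off_diagonal (W k)"
    by eventually_elim (auto simp: off_diagonal_def)
  \<comment> \<open>Off the diagonal the points are not all equal, so \<open>y i\<close> has a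
    partner different from it.\<close>
  obtain l where l: "y l \<noteq> y i" using j by metis
  have "(\<lambda>k. 1/2 * norm (W k i - W k l) - norm (W k i - Y k i)) \<longlonglongrightarrow> 1/2 * norm (y i - y l) - norm (y i - y i)"
    by (intro tendsto_intros W Y)
  hence "\<forall>\<^sub>F k in sequentially. 1/2 * norm (W k i - W k l) - norm (W k i - Y k i) > 0"
    by (rule order_tendstoD) (use l in auto)
  with off have ev: "\<forall>\<^sub>F k in sequentially. norm (K (W k) - K ((W k)(i := Y k i)))
       \<le> A * norm (W k i - Y k i) powr \<epsilon> / kernel_dist (W k) powr (real (CARD('m) * CARD('n)) + \<epsilon>)"
    by eventually_elim (rule reg'[where l = l], auto)
  have "(\<lambda>k. norm (W k i - Y k i)) \<longlonglongrightarrow> norm (y i - y i)"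
    by (intro tendsto_intros W Y)
  hence "(\<lambda>k. norm (W k i - Y k i) powr \<epsilon>) \<longlonglongrightarrow> 0"
    using eps by (intro tendsto_zero_powrI[OF _ tendsto_const]) auto
  moreover have "(\<lambda>k. kernel_dist (W k) powr (real (CARD('m) * CARD('n)) + \<epsilon>))
      \<longlonglongrightarrow> kernel_dist y powr (real (CARD('m) * CARD('n)) + \<epsilon>)"
    using kernel_dist_pos[OF y] by (intro tendsto_powr kernel_dist_tendsto W tendsto_const) auto
  ultimately have "(\<lambda>k. A * norm (W k i - Y k i) powr \<epsilon> / kernel_dist (W k) powr (real (CARD('m) * CARD('n)) + \<epsilon>))
      \<longlonglongrightarrow> A * 0 / kernel_dist y powr (real (CARD('m) * CARD('n)) + \<epsilon>)"
    using kernel_dist_pos[OF y] by (intro tendsto_divide tendsto_mult tendsto_const) auto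
  hence "(\<lambda>k. A * norm (W k i - Y k i) powr \<epsilon> / kernel_dist (W k) powr (real (CARD('m) * CARD('n)) + \<epsilon>)) \<longlonglongrightarrow> 0"
    by simp
  from Lim_null_comparison[OF ev this]
  have "(\<lambda>k. K (W k) - K ((W k)(i := Y k i))) \<longlonglongrightarrow> 0" .
  from tendsto_diff[OF insert.IH[folded W_def] this]
  have "(\<lambda>k. K ((W k)(i := Y k i))) \<longlonglongrightarrow> K y" by simp
  moreover have "(W k)(i := Y k i) = (\<lambda>l. if l \<in> insert i I then Y k l else y l)" for k
    by (auto simp: W_def fun_eq_iff)
  ultimately show ?case by simp
qed simp

lemma K_tendsto:
  assumes "off_diagonal y" "\<And>l. (\<lambda>k. Y k l) \<longlonglongrightarrow> y l"
  shows "(\<lambda>k. K (Y k)) \<longlonglongrightarrow> K y"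
  using K_tendsto_finite[of y Y UNIV, OF assms] by simp

text \<open>For fixed \<open>x\<close> the diagonal is the single point with all coordinates equal
  to \<open>x\<close>; elsewhere the kernel is continuous, and one point cannot spoil
  measurability.\<close>

lemma K_measurable [measurable]: "(\<lambda>y. K (kernel_pt x y)) \<in> borel_measurable borel"
proof -
  let ?p = "(\<chi> j. x) :: real^'n^'m"
  let ?f = "\<lambda>y. K (kernel_pt x y)"
  have "continuous_on (- {?p}) ?f"
  proof (rule continuous_on_sequentiallyI)
    fix u :: "nat \<Rightarrow> real^'n^'m" and y assume "y \<in> - {?p}" "u \<longlonglongrightarrow> y"
    thus "(\<lambda>k. ?f (u k)) \<longlonglongrightarrow> ?f y"
      by (intro K_tendsto kernel_pt_tendsto tendsto_const) (auto simp: off_diagonal_def vec_eq_iff)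
  qed
  hence "(\<lambda>y. if y \<in> - {?p} then ?f y else ?f ?p) \<in> borel_measurable borel"
    by (intro borel_measurable_continuous_on_if continuous_on_const) auto
  moreover have "(\<lambda>y. if y \<in> - {?p} then ?f y else ?f ?p) = ?f" by auto
  ultimately show ?thesis by (simp only:)
qed

lemma off_diagonal_kernel_pt: "y $ j \<noteq> x \<Longrightarrow> off_diagonal (kernel_pt x y)"
  by (auto simp: off_diagonal_def)

lemma K_le:
  assumes "d > 0" "norm (y $ j - x) \<ge> d"
  shows "norm (K (kernel_pt x y)) \<le> A / d ^ (CARD('m) * CARD('n))"
proof -
  have "d \<le> kernel_dist (kernel_pt x y)"
    using kernel_dist_ge[of "kernel_pt x y" "Some j" None] assms by simp
  hence "A / kernel_dist (kernel_pt x y) ^ (CARD('m) * CARD('n)) \<le> A / d ^ (CARD('m) * CARD('n))"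
    using assms A by (intro divide_left_mono power_mono mult_pos_pos zero_less_power) auto
  moreover have "off_diagonal (kernel_pt x y)"
    using assms by (intro off_diagonal_kernel_pt[of _ j]) auto
  ultimately show ?thesis using size by (meson order_trans)
qed

lemma K_prod_measurable:
  "(\<And>j. h j \<in> bdd_supp) \<Longrightarrow> (\<lambda>y. K (kernel_pt x y) * (\<Prod>j\<in>UNIV. h j (y $ j))) \<in> borel_measurable borel"
  by (intro borel_measurable_times borel_measurable_prod K_measurable
      measurable_compose[OF vec_nth_measurable] bdd_supp_measurable)

text \<open>One slot away from \<open>x\<close> suffices: it bounds the kernel on the whole support
  of the product.\<close>

lemma K_prod_integrable:
  assumes h: "\<And>j. h j \<in> bdd_supp" and d: "d > 0" "\<And>y. h i y \<noteq> 0 \<Longrightarrow> norm (y - x) \<ge> d"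
  shows "integrable lborel (\<lambda>y. K (kernel_pt x y) * (\<Prod>j\<in>UNIV. h j (y $ j)))"
proof (rule Bochner_Integration.integrable_bound)
  show "integrable lborel (\<lambda>y. of_real (A / d ^ (CARD('m) * CARD('n))) * (\<Prod>j\<in>UNIV. h j (y $ j)))"
    by (intro integrable_mult_right integrable_lborel_vec_prod integrable_bdd_supp h)
  show "(\<lambda>y. K (kernel_pt x y) * (\<Prod>j\<in>UNIV. h j (y $ j))) \<in> borel_measurable lborel"
    using K_prod_measurable[of h, OF h] by simp
  have "norm (K (kernel_pt x y) * (\<Prod>j\<in>UNIV. h j (y $ j))) \<le>
      norm (of_real (A / d ^ (CARD('m) * CARD('n))) * (\<Prod>j\<in>UNIV. h j (y $ j)))" for y
  proof (cases "h i (y $ i) = 0")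
    case True
    hence "(\<Prod>j\<in>UNIV. h j (y $ j)) = 0" by (intro prod_zero) auto
    thus ?thesis by (simp only: mult_zero_right norm_zero)
  next
    case False
    have "norm (K (kernel_pt x y)) \<le> A / d ^ (CARD('m) * CARD('n))"
      by (rule K_le[OF d(1) d(2)[OF False]])
    also have "\<dots> = norm (of_real (A / d ^ (CARD('m) * CARD('n))) :: complex)"
      using A d(1) by (simp only: norm_of_real) simp
    finally show ?thesis unfolding norm_mult by (rule mult_right_mono) auto
  qed
  thus "AE y in lborel. norm (K (kernel_pt x y) * (\<Prod>j\<in>UNIV. h j (y $ j))) \<le>
      norm (of_real (A / d ^ (CARD('m) * CARD('n))) * (\<Prod>j\<in>UNIV. h j (y $ j)))" by auto
qed

text \<open>Approximants of \<open>h i\<close> vanish wherever \<open>\<eta>\<close> does, so a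
  point outside the closed support of \<open>\<eta>\<close> lies off the common support of every
  approximating Schwartz tuple. There the left side converges along a subsequence and the right side
  by dominated convergence.\<close>

lemma kernel_rep:
  assumes h: "\<And>j. h j \<in> bdd_supp"
    and \<eta>: "\<eta> \<in> flat_smooth" "bounded {x. \<eta> x \<noteq> 0}" "\<And>x. \<eta> x = 0 \<Longrightarrow> h i x = 0"
  shows "AE x in lebesgue. x \<notin> closure {x. \<eta> x \<noteq> 0} \<longrightarrow>
    E h x = (LINT y|lborel. K (kernel_pt x y) * (\<Prod>j\<in>UNIV. h j (y $ j)))"
proof -
  have "\<forall>j. \<exists>\<eta>. \<eta> \<in> flat_smooth \<and> bounded {x. \<eta> x \<noteq> 0} \<and> (\<forall>x. \<eta> x = 0 \<longrightarrow> h j x = 0)"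
    using bdd_supp_bump[OF h] by blast
  then obtain \<theta>' where \<theta>': "\<And>j. \<theta>' j \<in> flat_smooth" "\<And>j. bounded {x. \<theta>' j x \<noteq> 0}"
      "\<And>j x. \<theta>' j x = 0 \<Longrightarrow> h j x = 0" by metis
  \<comment> \<open>Slot \<open>i\<close> gets the given bump; any bump covering the support will do
    for the others.\<close>
  define \<theta> where "\<theta> = \<theta>'(i := \<eta>)"
  have \<theta>: "\<And>j. \<theta> j \<in> flat_smooth" "\<And>j. bounded {x. \<theta> j x \<noteq> 0}" "\<And>j x. \<theta> j x = 0 \<Longrightarrow> h j x = 0"
    using \<theta>' \<eta> by (auto simp: \<theta>_def split: if_splits)
  obtain F B r where F: "\<And>k j. F k j \<in> flat_smooth" "\<And>k j. F k j \<in> schwartz" "\<And>k j. F k j \<in> bdd_supp"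
    "\<And>k j x. norm (F k j x) \<le> B" "\<And>k j x. F k j x \<noteq> 0 \<Longrightarrow> norm x \<le> r"
    "\<And>k j x. \<theta> j x = 0 \<Longrightarrow> F k j x = 0"
    "\<And>j. AE x in lebesgue. (\<lambda>k. F k j x) \<longlonglongrightarrow> h j x"
    by (rule bdd_supp_approx[of \<theta> h, OF \<theta>(1,2) h \<theta>(3)], assumption, rule that)
  have "\<exists>s. strict_mono s \<and> (AE x in lebesgue. (\<lambda>k. E (F (s k)) x) \<longlonglongrightarrow> E h x)"
    by (rule E_AE_subseq[of F h B r]) (fact F h)+
  then obtain s where s: "strict_mono s" "AE x in lebesgue. (\<lambda>k. E (F (s k)) x) \<longlonglongrightarrow> E h x"
    by blast
  let ?Z = "closure {x. \<eta> x \<noteq> 0}"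
  let ?I = "\<lambda>f x. LINT y|lborel. K (kernel_pt x y) * (\<Prod>j\<in>UNIV. f j (y $ j))"
  have supp: "ess_supp (F k i) \<subseteq> ?Z" for k
  proof -
    have "ess_supp (F k i) = closure {x. F k i x \<noteq> 0}"
      by (intro ess_supp_continuous flat_smooth_continuous_on F)
    also have "\<dots> \<subseteq> ?Z" using F(6)[of i _ k] by (intro closure_mono) (auto simp: \<theta>_def)
    finally show ?thesis .
  qed
  have "AE x in lebesgue. \<forall>k. x \<notin> (\<Inter>j. ess_supp (F k j)) \<longrightarrow>
        E (F k) x = (LINT y::real^'n^'m|lebesgue. K (kernel_pt x y) * (\<Prod>j\<in>UNIV. F k j (y $ j)))"
    unfolding AE_all_countable by (intro allI rep F(2))
  with s(2) show ?thesis
  proof eventually_elim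
    case (elim x)
    show ?case
    proof
      assume x: "x \<notin> ?Z"
      have EF: "E (F k) x = ?I (F k) x" for k
      proof -
        have "x \<notin> (\<Inter>j. ess_supp (F k j))" using x supp[of k] by blast
        with elim(2) have "E (F k) x = (LINT y::real^'n^'m|lebesgue. K (kernel_pt x y) * (\<Prod>j\<in>UNIV. F k j (y $ j)))"
          by blast
        also have "\<dots> = ?I (F k) x"
          by (rule integral_completion) (use K_prod_measurable[of "F k", OF F(3)] in simp)
        finally show ?thesis .
      qed
      obtain d where d: "d > 0" "ball x d \<inter> ?Z = {}"
        using x by (metis closed_closure open_Compl open_contains_ball ComplI disjoint_eq_subset_Compl inf_commute)
      have dist: "norm (y - x) \<ge> d" if "\<eta> y \<noteq> 0" for y
      proof (rule ccontr)
        assume "\<not> norm (y - x) \<ge> d"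
        hence "y \<in> ball x d" by (simp add: dist_norm norm_minus_commute)
        moreover have "y \<in> ?Z" using that by (intro subsetD[OF closure_subset]) simp
        ultimately show False using d(2) by blast
      qed
      \<comment> \<open>Dominating function: the kernel bound at distance \<open>d\<close> times
        constants on balls.\<close>
      define w where "w y = A / d ^ (CARD('m) * CARD('n)) * (\<Prod>j\<in>UNIV. norm (if y $ j \<in> cball 0 r then of_real B else 0 :: complex))" for y :: "real^'n^'m"
      have B0: "B \<ge> 0" using F(4)[of 0 undefined undefined] norm_ge_zero order_trans by blast
      have "(\<lambda>k. ?I (F (s k)) x) \<longlonglongrightarrow> ?I h x"
      proof (rule integral_dominated_convergence[where w = w])
        show "(\<lambda>y. K (kernel_pt x y) * (\<Prod>j\<in>UNIV. h j (y $ j))) \<in> borel_measurable lborel"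
          using K_prod_measurable[of h, OF h] by simp
        show "(\<lambda>y. K (kernel_pt x y) * (\<Prod>j\<in>UNIV. F (s k) j (y $ j))) \<in> borel_measurable lborel" for k
          using K_prod_measurable[of "F (s k)", OF F(3)] by simp
        have "integrable lborel (\<lambda>y::real^'n^'m. norm (\<Prod>j\<in>UNIV. (if y $ j \<in> cball 0 r then of_real B else 0 :: complex)))"
          by (intro integrable_norm integrable_lborel_vec_prod integrable_bdd_supp bdd_suppI[of _ "\<bar>B\<bar>" r]) 
            (auto split: if_splits)
        thus "integrable lborel w" unfolding w_def prod_norm by (intro integrable_mult_right)
        show "AE y in lborel. norm (K (kernel_pt x y) * (\<Prod>j\<in>UNIV. F (s k) j (y $ j))) \<le> w y" for k
        proof (rule AE_I2)
          fix y :: "real^'n^'m"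
          show "norm (K (kernel_pt x y) * (\<Prod>j\<in>UNIV. F (s k) j (y $ j))) \<le> w y"
          proof (cases "F (s k) i (y $ i) = 0")
            case True
            hence "(\<Prod>j\<in>UNIV. F (s k) j (y $ j)) = 0" by (intro prod_zero) auto
            hence "norm (K (kernel_pt x y) * (\<Prod>j\<in>UNIV. F (s k) j (y $ j))) = 0"
              by (simp only: mult_zero_right norm_zero)
            also have "0 \<le> w y" unfolding w_def
              using A d(1) by (intro mult_nonneg_nonneg prod_nonneg) auto
            finally show ?thesis .
          next
            case False
            hence "\<eta> (y $ i) \<noteq> 0" using F(6)[of i "y $ i" "s k"] by (auto simp: \<theta>_def)
            hence "norm (K (kernel_pt x y)) \<le> A / d ^ (CARD('m) * CARD('n))"
              by (intro K_le[OF d(1)] dist)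
            moreover have "norm (\<Prod>j\<in>UNIV. F (s k) j (y $ j)) \<le> (\<Prod>j\<in>UNIV. norm (if y $ j \<in> cball 0 r then of_real B else 0 :: complex))"
              unfolding prod_norm[symmetric]
            proof (intro prod_mono conjI norm_ge_zero)
              fix j
              show "norm (F (s k) j (y $ j)) \<le> norm (if y $ j \<in> cball 0 r then of_real B else 0 :: complex)"
                using F(4)[of "s k" j "y $ j"] F(5)[of "s k" j "y $ j"] B0
                by (cases "F (s k) j (y $ j) = 0") auto
            qed
            ultimately show ?thesis unfolding w_def norm_mult
              using A d(1) by (intro mult_mono) auto
          qed
        qed
        have "AE y in lborel. \<forall>j. (\<lambda>k. F k j (y $ j)) \<longlonglongrightarrow> h j (y $ j)"
          unfolding AE_all_countable
          by (intro allI AE_vec_nth) (use F(7) in \<open>simp add: AE_completion_iff\<close>)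
        thus "AE y in lborel. (\<lambda>k. K (kernel_pt x y) * (\<Prod>j\<in>UNIV. F (s k) j (y $ j)))
            \<longlonglongrightarrow> K (kernel_pt x y) * (\<Prod>j\<in>UNIV. h j (y $ j))"
        proof eventually_elim
          case (elim y)
          have "(\<lambda>k. F (s k) j (y $ j)) \<longlonglongrightarrow> h j (y $ j)" for j
            using LIMSEQ_subseq_LIMSEQ[OF elim[rule_format, of j] s(1)] by (simp add: o_def)
          thus ?case by (intro tendsto_mult tendsto_const tendsto_prod)
        qed
      qed
      hence "(\<lambda>k. E (F (s k)) x) \<longlonglongrightarrow> ?I h x" by (simp only: EF)
      with elim(1) show "E h x = ?I h x" by (rule LIMSEQ_unique)
    qed
  qed
qed

end

section \<open>Kernel estimates on cubes\<close>

text \<open>Centre and half side, that is, a ball of the maximum norm: concentric dilation is a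
  change of \<open>\<rho>\<close>.\<close>

definition cube :: "real^'n \<Rightarrow> real \<Rightarrow> (real^'n) set" where
  "cube w \<rho> = cbox (\<chi> i. w $ i - \<rho>) (\<chi> i. w $ i + \<rho>)"

lemma mem_cube: "y \<in> cube w \<rho> \<longleftrightarrow> (\<forall>i. \<bar>y $ i - w $ i\<bar> \<le> \<rho>)"
  by (auto simp: cube_def mem_box_cart abs_le_iff algebra_simps)

lemma cube_measurable [measurable]: "cube w \<rho> \<in> sets borel"
  by (simp add: cube_def)

lemma emeasure_cube: "\<rho> \<ge> 0 \<Longrightarrow> emeasure lborel (cube (w :: real^'n) \<rho>) = ennreal ((2 * \<rho>) ^ CARD('n))"
proof -
  assume \<rho>: "\<rho> \<ge> 0"
  hence "cube w \<rho> \<noteq> {}" unfolding cube_def by (subst interval_ne_empty_cart) auto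
  hence "measure lborel (cube w \<rho>) = (2 * \<rho>) ^ CARD('n)"
    unfolding cube_def by (subst content_cbox_cart) auto
  moreover have "emeasure lborel (cube w \<rho>) = ennreal (measure lborel (cube w \<rho>))"
    by (rule emeasure_eq_ennreal_measure) (simp add: cube_def emeasure_lborel_cbox_eq)
  ultimately show ?thesis by simp
qed

lemma norm_le_imp_mem_cube: "norm (y - w) \<le> \<rho> \<Longrightarrow> y \<in> cube w \<rho>"
  unfolding mem_cube vector_minus_component[symmetric] by (blast intro: order_trans[OF component_le_norm_cart])

text \<open>The dimensional factor is n because the Euclidean norm is estimated by the l^1 norm. It
  is the origin of the dilations by 2 n used later.\<close>

lemma mem_cube_imp_norm_le: "y \<in> cube (w :: real^'n) \<rho> \<Longrightarrow> norm (y - w) \<le> real CARD('n) * \<rho>"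
proof -
  assume y: "y \<in> cube w \<rho>"
  have "norm (y - w) \<le> (\<Sum>i\<in>UNIV. \<bar>(y - w) $ i\<bar>)" by (rule norm_le_l1_cart)
  also have "\<dots> \<le> (\<Sum>i\<in>(UNIV :: 'n set). \<rho>)" using y by (intro sum_mono) (simp add: mem_cube)
  finally show ?thesis by simp
qed

lemma is_cube_cube: "\<rho> > 0 \<Longrightarrow> is_cube (cube w \<rho>)"
  unfolding is_cube_def cube_def
  by (intro exI[of _ "\<chi> i. w $ i - \<rho>"] exI[of _ "2 * \<rho>"]) (auto simp: algebra_simps)

lemma is_cubeE:
  assumes "is_cube Q"
  obtains w \<rho> where "\<rho> > 0" "Q = cube w \<rho>"
proof -
  obtain a l where al: "l > 0" "Q = cbox a (\<chi> i. a $ i + l)" using assms by (auto simp: is_cube_def)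
  have "Q = cube (\<chi> i. a $ i + l / 2) (l / 2)"
  proof -
    have "(\<chi> i. (\<chi> i. a $ i + l / 2) $ i - l / 2) = a" "(\<chi> i. (\<chi> i. a $ i + l / 2) $ i + l / 2) = (\<chi> i. a $ i + l)"
      by (simp_all add: vec_eq_iff)
    thus ?thesis unfolding al(2) cube_def by (simp only:)
  qed
  thus ?thesis using al(1) by (intro that[of "l / 2"]) auto
qed

section \<open>Summation over dyadic shells\<close>

lemma geometric_scale_exists:
  assumes "r > 0" "r \<le> (t :: real)"
  shows "\<exists>s::nat. 2 ^ s * r \<le> t \<and> t < 2 ^ Suc s * r"
proof -
  obtain k :: nat where "t / r < real k" using reals_Archimedean2 by blast
  also have "real k < 2 ^ k" by (rule of_nat_less_two_power)
  finally have ex: "t < 2 ^ k * r" using assms by (simp add: divide_less_eq)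
  define k0 where "k0 = (LEAST k. t < 2 ^ k * r)"
  have k0: "t < 2 ^ k0 * r" unfolding k0_def by (rule LeastI[of _ k]) (rule ex)
  have "k0 \<noteq> 0" using k0 assms by (intro notI) simp
  then obtain s where s: "k0 = Suc s" using not0_implies_Suc by blast
  have "\<not> t < 2 ^ s * r" using not_less_Least[of s "\<lambda>k. t < 2 ^ k * r"] by (simp add: k0_def[symmetric] s)
  thus ?thesis using k0 s by (intro exI[of _ s]) auto
qed

text \<open>On the shell where D lies between 2^s r and 2^(s+1) r the weight is at most (2^s r)^(-e)
  and the mass at most \<kappa> (2^(s+1) r)^d, so the shells form a geometric series of ratio at
  most 2^(-\<delta>). The abstract \<open>D\<close> serves both kernel distances on (R^n)^m and
  Euclidean distances on R^n.\<close>

lemma shell_estimate: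
  fixes D :: "'a \<Rightarrow> real" and u :: "'a \<Rightarrow> ennreal"
  assumes [measurable]: "D \<in> borel_measurable M" "u \<in> borel_measurable M"
    and r: "r > 0" and \<kappa>: "\<kappa> \<ge> 0" and \<delta>: "\<delta> > 0" and de: "d + \<delta> \<le> e" and e: "e \<ge> 0"
    and le: "\<And>\<rho>. \<rho> \<ge> r \<Longrightarrow> (\<integral>\<^sup>+x. u x * indicator {x. D x \<le> \<rho>} x \<partial>M) \<le> ennreal (\<kappa> * \<rho> powr d)"
  shows "(\<integral>\<^sup>+x. u x * (indicator {x. r \<le> D x} x * ennreal (D x powr - e)) \<partial>M)
      \<le> ennreal (\<kappa> * 2 powr d / (1 - 2 powr - \<delta>) * r powr (d - e))"
proof -
  let ?t = "\<lambda>s::nat. \<lambda>x. u x * indicator {x. D x \<le> 2 ^ Suc s * r} x * ennreal ((2 ^ s * r) powr - e)"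
  let ?c = "\<kappa> * 2 powr d * r powr (d - e)"
  have pw: "u x * (indicator {x. r \<le> D x} x * ennreal (D x powr - e)) \<le> (\<Sum>s. ?t s x)" for x
  proof (cases "r \<le> D x")
    case True
    then obtain s where s: "2 ^ s * r \<le> D x" "D x < 2 ^ Suc s * r"
      using geometric_scale_exists[OF r True] by blast
    have "D x powr - e \<le> (2 ^ s * r) powr - e"
      using s r e by (intro powr_mono2') auto
    hence "u x * (indicator {x. r \<le> D x} x * ennreal (D x powr - e)) \<le> ?t s x"
      using True s(2) by (auto intro!: mult_left_mono ennreal_leI)
    also have "\<dots> = (\<Sum>s\<in>{s}. ?t s x)" by simp
    also have "\<dots> \<le> (\<Sum>s. ?t s x)" by (intro sum_le_suminf) auto
    finally show ?thesis .
  qed simp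
  have q: "(2::real) powr - \<delta> < 1" using \<delta> by (simp add: powr_less_one)
  have term_le: "(\<integral>\<^sup>+x. ?t s x \<partial>M) \<le> ennreal (?c * (2 powr - \<delta>) ^ s)" for s
  proof -
    have "(\<integral>\<^sup>+x. ?t s x \<partial>M) = (\<integral>\<^sup>+x. u x * indicator {x. D x \<le> 2 ^ Suc s * r} x \<partial>M) * ennreal ((2 ^ s * r) powr - e)"
      by (rule nn_integral_multc) measurable
    also have "\<dots> \<le> ennreal (\<kappa> * (2 ^ Suc s * r) powr d) * ennreal ((2 ^ s * r) powr - e)"
    proof (intro mult_right_mono le)
      have "1 * r \<le> 2 ^ Suc s * r" using r by (intro mult_right_mono one_le_power) auto
      thus "r \<le> 2 ^ Suc s * r" by simp
    qed simp
    also have "\<dots> = ennreal (\<kappa> * (2 ^ Suc s * r) powr d * (2 ^ s * r) powr - e)"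
      using \<kappa> by (subst ennreal_mult) auto
    also have "\<dots> \<le> ennreal (?c * (2 powr - \<delta>) ^ s)"
    proof (rule ennreal_leI)
      have 1: "(2 ^ Suc s * r) powr d = 2 powr d * (2 ^ s * r) powr d"
        using r by (simp add: powr_mult)
      have 2: "(2 ^ s * r) powr d * (2 ^ s * r) powr - e = (2 ^ s * r) powr (d - e)"
        using r by (simp add: powr_add[symmetric])
      have 3: "(2 ^ s * r) powr (d - e) = (2 ^ s) powr (d - e) * r powr (d - e)"
        using r by (simp add: powr_mult)
      have "(2 ^ s :: real) powr (d - e) = (2 powr real s) powr (d - e)"
        by (simp only: powr_realpow[of 2] zero_less_numeral)
      also have "\<dots> = (2 powr (d - e)) powr real s" by (simp only: powr_powr mult.commute)
      also have "\<dots> = (2 powr (d - e)) ^ s" by (rule powr_realpow) simp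
      finally have 4: "(2 ^ s :: real) powr (d - e) = (2 powr (d - e)) ^ s" .
      have 5: "(2 powr (d - e)) ^ s \<le> ((2::real) powr - \<delta>) ^ s"
        using de by (intro power_mono powr_mono) auto
      have "\<kappa> * (2 ^ Suc s * r) powr d * (2 ^ s * r) powr - e
          = \<kappa> * 2 powr d * ((2 ^ s * r) powr d * (2 ^ s * r) powr - e)" unfolding 1 by (simp only: mult_ac)
      also have "\<dots> = ?c * (2 powr (d - e)) ^ s" unfolding 2 3 4 by (simp only: mult_ac)
      also have "\<dots> \<le> ?c * (2 powr - \<delta>) ^ s" using \<kappa> 5 by (intro mult_left_mono) auto
      finally show "\<kappa> * (2 ^ Suc s * r) powr d * (2 ^ s * r) powr - e \<le> ?c * (2 powr - \<delta>) ^ s" .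
    qed
    finally show ?thesis .
  qed
  have "(\<Sum>s. \<integral>\<^sup>+x. ?t s x \<partial>M) \<le> (\<Sum>s. ennreal (?c * (2 powr - \<delta>) ^ s))"
    by (intro suminf_le term_le summableI)
  also have "\<dots> = ennreal (\<Sum>s. ?c * (2 powr - \<delta>) ^ s)"
    using q \<kappa> by (intro suminf_ennreal2 mult_nonneg_nonneg summable_mult summable_geometric) auto
  also have "(\<Sum>s. ?c * (2 powr - \<delta>) ^ s) = ?c * (1 / (1 - 2 powr - \<delta>))"
    using q by (subst suminf_mult) (auto simp: suminf_geometric intro!: summable_geometric)
  also have "\<dots> = \<kappa> * 2 powr d / (1 - 2 powr - \<delta>) * r powr (d - e)" by simp
  finally have fin: "(\<Sum>s. \<integral>\<^sup>+x. ?t s x \<partial>M) \<le> ennreal (\<kappa> * 2 powr d / (1 - 2 powr - \<delta>) * r powr (d - e))" .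
  have "(\<integral>\<^sup>+x. u x * (indicator {x. r \<le> D x} x * ennreal (D x powr - e)) \<partial>M) \<le> (\<integral>\<^sup>+x. (\<Sum>s. ?t s x) \<partial>M)"
    by (intro nn_integral_mono pw)
  also have "\<dots> = (\<Sum>s. \<integral>\<^sup>+x. ?t s x \<partial>M)"
    by (rule nn_integral_suminf) measurable
  finally show ?thesis using fin by (rule order_trans)
qed

text \<open>Names for mn and n as real numbers, since both occur as exponents of
  \<open>powr\<close>.\<close>

locale CZ_data_dim = CZ_data E qs q C K A \<epsilon>
  for E :: "('m::finite \<Rightarrow> real^'n \<Rightarrow> complex) \<Rightarrow> real^'n \<Rightarrow> complex" and qs q C K A \<epsilon> +
  fixes MN nn :: real
  assumes MN: "MN = real (CARD('m) * CARD('n))" and nn_eq: "nn = real CARD('n)"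
begin

text \<open>What shell summation makes of the regularity estimate, at the worst mass exponent d =
  mn.\<close>

definition ker_const :: real where "ker_const = A * 2 powr MN / (1 - 2 powr - \<epsilon>)"

lemma geometric_pos: "1 - (2::real) powr - \<epsilon> > 0"
proof -
  have "(2::real) powr - \<epsilon> < 1"
  proof (rule powr_less_one)
    show "- \<epsilon> < 0" using eps by (simp only: neg_less_0_iff_less)
  qed simp
  thus ?thesis by (simp only: diff_gt_0_iff_gt)
qed

lemma ker_const_pos: "ker_const > 0"
proof -
  have "(2::real) powr MN > 0" by simp
  thus ?thesis unfolding ker_const_def by (rule divide_pos_pos[OF mult_pos_pos[OF A] geometric_pos])
qed

lemma kernel_dist_measurable [measurable]: "(\<lambda>y::real^'n^'m. kernel_dist (kernel_pt x y)) \<in> borel_measurable borel"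
proof (rule borel_measurable_continuous_onI, rule continuous_on_sequentiallyI)
  fix u :: "nat \<Rightarrow> real^'n^'m" and y assume "u \<longlonglongrightarrow> y"
  thus "(\<lambda>k. kernel_dist (kernel_pt x (u k))) \<longlonglongrightarrow> kernel_dist (kernel_pt x y)"
    by (intro kernel_dist_tendsto kernel_pt_tendsto tendsto_const)
qed

lemma norm_le_kernel_dist: "norm (y $ j - x) \<le> kernel_dist (kernel_pt x (y :: real^'n^'m))"
  using kernel_dist_ge[of "kernel_pt x y" "Some j" None] by simp

text \<open>A kernel difference obeying the regularity bound is integrated against the product of
  the arguments. Within kernel distance \<rho> of \<open>x\<close> all points y_j lie in the cube of
  half side \<rho>, so the mass is at most the product of the local integrals, and shells are summed
  with weight exponent mn + \<epsilon>. The exponent \<open>d\<close> is mn when \<open>x\<close>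
  moves and mn - n when a mean-zero slot is exploited.\<close>

lemma kernel_integral_le:
  fixes h :: "'m \<Rightarrow> real^'n \<Rightarrow> complex"
  assumes h: "\<And>j. h j \<in> bdd_supp" and r: "r > 0" and \<kappa>: "\<kappa> \<ge> 0" and d: "d \<le> MN"
    and le: "\<And>\<rho>. \<rho> \<ge> r \<Longrightarrow> (\<Prod>j\<in>UNIV. \<integral>\<^sup>+y. ennreal (norm (h j y)) * indicator (cube x \<rho>) y \<partial>lborel) \<le> ennreal (\<kappa> * \<rho> powr d)"
    and F: "integrable lborel F"
    and FD: "\<And>y. (\<Prod>j\<in>UNIV. h j (y $ j)) \<noteq> 0 \<Longrightarrow> r \<le> kernel_dist (kernel_pt x y) \<and>
       norm (F y) \<le> A * s powr \<epsilon> / kernel_dist (kernel_pt x y) powr (MN + \<epsilon>) * norm (\<Prod>j\<in>UNIV. h j (y $ j))"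
    and F0: "\<And>y. (\<Prod>j\<in>UNIV. h j (y $ j)) = 0 \<Longrightarrow> F y = 0"
  shows "norm (LINT y|lborel. F y) \<le> ker_const * \<kappa> * s powr \<epsilon> * r powr (d - MN - \<epsilon>)"
proof -
  let ?D = "\<lambda>y::real^'n^'m. kernel_dist (kernel_pt x y)"
  define u where "u y = (\<Prod>j\<in>UNIV. ennreal (norm (h j (y $ j))))" for y :: "real^'n^'m"
  have [measurable]: "h j \<in> borel_measurable borel" for j by (rule bdd_supp_measurable[OF h])
  have u_meas [measurable]: "u \<in> borel_measurable lborel" unfolding u_def by measurable
  have u_eq: "u y = ennreal (norm (\<Prod>j\<in>UNIV. h j (y $ j)))" for y
    by (simp only: u_def prod_norm[symmetric] prod_ennreal norm_ge_zero)
  have shell: "(\<integral>\<^sup>+y. u y * (indicator {y. r \<le> ?D y} y * ennreal (?D y powr - (MN + \<epsilon>))) \<partial>lborel)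
      \<le> ennreal (\<kappa> * 2 powr d / (1 - 2 powr - \<epsilon>) * r powr (d - (MN + \<epsilon>)))"
  proof (rule shell_estimate)
    fix \<rho> assume \<rho>: "r \<le> \<rho>"
    have "u y * indicator {y. ?D y \<le> \<rho>} y \<le> (\<Prod>j\<in>UNIV. ennreal (norm (h j (y $ j))) * indicator (cube x \<rho>) (y $ j))" for y
    proof (cases "?D y \<le> \<rho>")
      case True
      hence "y $ j \<in> cube x \<rho>" for j
        by (intro norm_le_imp_mem_cube order_trans[OF norm_le_kernel_dist])
      thus ?thesis using True by (simp add: u_def)
    qed simp
    hence "(\<integral>\<^sup>+y. u y * indicator {y. ?D y \<le> \<rho>} y \<partial>lborel)
      \<le> (\<integral>\<^sup>+y. (\<Prod>j\<in>UNIV. ennreal (norm (h j (y $ j))) * indicator (cube x \<rho>) (y $ j)) \<partial>lborel)"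
      by (intro nn_integral_mono) auto
    also have "\<dots> = (\<Prod>j\<in>UNIV. \<integral>\<^sup>+y. ennreal (norm (h j y)) * indicator (cube x \<rho>) y \<partial>lborel)"
      by (rule nn_integral_lborel_vec_prod) measurable
    also have "\<dots> \<le> ennreal (\<kappa> * \<rho> powr d)" by (rule le[OF \<rho>])
    finally show "(\<integral>\<^sup>+y. u y * indicator {y. ?D y \<le> \<rho>} y \<partial>lborel) \<le> ennreal (\<kappa> * \<rho> powr d)" .
  qed (use r \<kappa> eps d in \<open>auto simp: MN\<close>)
  have pw: "ennreal (norm (F y)) \<le> ennreal (A * s powr \<epsilon>) * (u y * (indicator {y. r \<le> ?D y} y * ennreal (?D y powr - (MN + \<epsilon>))))" for y
  proof (cases "(\<Prod>j\<in>UNIV. h j (y $ j)) = 0")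
    case True
    show ?thesis unfolding F0[OF True] by simp
  next
    case False
    note * = FD[OF False]
    have "norm (F y) \<le> A * s powr \<epsilon> * (norm (\<Prod>j\<in>UNIV. h j (y $ j)) * ?D y powr - (MN + \<epsilon>))"
      using conjunct2[OF *] by (simp only: powr_minus divide_inverse mult_ac)
    hence "ennreal (norm (F y)) \<le> ennreal (A * s powr \<epsilon>) * (u y * ennreal (?D y powr - (MN + \<epsilon>)))"
      unfolding u_eq using A by (subst ennreal_mult[symmetric], simp, simp)+ (rule ennreal_leI)
    thus ?thesis using conjunct1[OF *] by simp
  qed
  have c0: "A * s powr \<epsilon> \<ge> 0" using A by simp
  have "ennreal (norm (LINT y|lborel. F y)) \<le> (\<integral>\<^sup>+y. ennreal (norm (F y)) \<partial>lborel)"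
    by (rule integral_norm_bound_ennreal[OF F])
  also have "\<dots> \<le> (\<integral>\<^sup>+y. ennreal (A * s powr \<epsilon>) * (u y * (indicator {y. r \<le> ?D y} y * ennreal (?D y powr - (MN + \<epsilon>)))) \<partial>lborel)"
    by (intro nn_integral_mono pw)
  also have "\<dots> = ennreal (A * s powr \<epsilon>) * (\<integral>\<^sup>+y. u y * (indicator {y. r \<le> ?D y} y * ennreal (?D y powr - (MN + \<epsilon>))) \<partial>lborel)"
    by (rule nn_integral_cmult) measurable
  also have "\<dots> \<le> ennreal (A * s powr \<epsilon>) * ennreal (\<kappa> * 2 powr d / (1 - 2 powr - \<epsilon>) * r powr (d - (MN + \<epsilon>)))"
    by (rule mult_left_mono[OF shell]) simp
  also have "\<dots> = ennreal (A * s powr \<epsilon> * (\<kappa> * 2 powr d / (1 - 2 powr - \<epsilon>) * r powr (d - (MN + \<epsilon>))))"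
    using c0 by (rule ennreal_mult'[symmetric])
  finally have "norm (LINT y|lborel. F y) \<le> A * s powr \<epsilon> * (\<kappa> * 2 powr d / (1 - 2 powr - \<epsilon>) * r powr (d - (MN + \<epsilon>)))"
    using c0 \<kappa> geometric_pos by (subst (asm) ennreal_le_iff) auto
  also have "\<dots> = (A * \<kappa> * s powr \<epsilon> / (1 - 2 powr - \<epsilon>) * r powr (d - MN - \<epsilon>)) * 2 powr d"
    by (simp add: diff_diff_eq)
  also have "\<dots> \<le> (A * \<kappa> * s powr \<epsilon> / (1 - 2 powr - \<epsilon>) * r powr (d - MN - \<epsilon>)) * 2 powr MN"
    using d A \<kappa> geometric_pos by (intro mult_left_mono powr_mono mult_nonneg_nonneg divide_nonneg_pos) auto
  also have "\<dots> = ker_const * \<kappa> * s powr \<epsilon> * r powr (d - MN - \<epsilon>)"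
    by (simp add: ker_const_def)
  finally show ?thesis .
qed

lemma prod_neq_0_D: "(\<Prod>j\<in>UNIV. h j (y $ j)) \<noteq> (0 :: complex) \<Longrightarrow> h i ((y :: real^'n^'m) $ i) \<noteq> 0"
  by (metis UNIV_I finite_class.finite_UNIV prod_zero)

text \<open>Regularity in the variable y_0. The gain |x - z|^\<epsilon> is compensated by the factor
  r^(-\<epsilon>), so the bound is independent of the scale.\<close>

lemma kernel_diff_far:
  assumes h: "\<And>j. h j \<in> bdd_supp" and r: "r > 0" and \<kappa>: "\<kappa> \<ge> 0"
    and le: "\<And>\<rho>. \<rho> \<ge> r \<Longrightarrow> (\<Prod>j\<in>UNIV. \<integral>\<^sup>+y. ennreal (norm (h j y)) * indicator (cube z \<rho>) y \<partial>lborel) \<le> ennreal (\<kappa> * \<rho> powr MN)"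
    and xz: "norm (x - z) \<le> r / 2" and hi: "\<And>y. h i y \<noteq> 0 \<Longrightarrow> norm (y - z) \<ge> r"
  shows "norm ((LINT y|lborel. K (kernel_pt x y) * (\<Prod>j\<in>UNIV. h j (y $ j)))
            - (LINT y|lborel. K (kernel_pt z y) * (\<Prod>j\<in>UNIV. h j (y $ j)))) \<le> ker_const * \<kappa>"
proof -
  let ?h = "\<lambda>y. \<Prod>j\<in>UNIV. h j (y $ j)"
  \<comment> \<open>The support of \<open>h i\<close> stays away from \<open>x\<close> too, so both
    integrals exist and may be subtracted.\<close>
  have hx: "norm (y - x) \<ge> r / 2" if "h i y \<noteq> 0" for y
    using hi[OF that] xz norm_triangle_ineq[of "y - x" "x - z"] by simp
  have ix: "integrable lborel (\<lambda>y. K (kernel_pt x y) * ?h y)"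
    by (rule K_prod_integrable[where d = "r / 2" and i = i]) (use h r hx in auto)
  have iz: "integrable lborel (\<lambda>y. K (kernel_pt z y) * ?h y)"
    by (rule K_prod_integrable[where d = r and i = i]) (use h r hi in auto)
  have "norm (LINT y|lborel. K (kernel_pt x y) * ?h y - K (kernel_pt z y) * ?h y)
      \<le> ker_const * \<kappa> * norm (x - z) powr \<epsilon> * r powr (MN - MN - \<epsilon>)"
  proof (rule kernel_integral_le[where x = z and h = h, OF h r \<kappa> order_refl le])
    show "integrable lborel (\<lambda>y. K (kernel_pt x y) * ?h y - K (kernel_pt z y) * ?h y)"
      using ix iz by simp
    fix y :: "real^'n^'m"
    show "K (kernel_pt x y) * ?h y - K (kernel_pt z y) * ?h y = 0" if "?h y = 0"
      using that by (simp only: mult_zero_right diff_self)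
    assume nz: "?h y \<noteq> 0"
    have yi: "norm (y $ i - z) \<ge> r" by (rule hi[OF prod_neq_0_D[of h, OF nz]])
    have D: "r \<le> kernel_dist (kernel_pt z y)" by (rule order_trans[OF yi norm_le_kernel_dist])
    have pt: "(kernel_pt z y)(None := x) = kernel_pt x y" by (auto simp: fun_eq_iff split: option.splits)
    have "norm (K (kernel_pt z y) - K ((kernel_pt z y)(None := x)))
        \<le> A * norm (kernel_pt z y None - x) powr \<epsilon> / kernel_dist (kernel_pt z y) powr (MN + \<epsilon>)"
    proof (rule reg'[folded MN, where l = "Some i"])
      show "off_diagonal (kernel_pt z y)" by (rule off_diagonal_kernel_pt[of y i]) (use yi r in auto)
      show "norm (kernel_pt z y None - x) \<le> 1 / 2 * norm (kernel_pt z y None - kernel_pt z y (Some i))"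
        using xz yi by (simp add: norm_minus_commute)
    qed
    hence "norm (K (kernel_pt x y) - K (kernel_pt z y)) \<le> A * norm (x - z) powr \<epsilon> / kernel_dist (kernel_pt z y) powr (MN + \<epsilon>)"
      by (simp add: pt norm_minus_commute)
    hence "norm (K (kernel_pt x y) * ?h y - K (kernel_pt z y) * ?h y)
       \<le> A * norm (x - z) powr \<epsilon> / kernel_dist (kernel_pt z y) powr (MN + \<epsilon>) * norm (?h y)"
      unfolding left_diff_distrib[symmetric] norm_mult by (rule mult_right_mono) simp
    with D show "r \<le> kernel_dist (kernel_pt z y) \<and> norm (K (kernel_pt x y) * ?h y - K (kernel_pt z y) * ?h y)
       \<le> A * norm (x - z) powr \<epsilon> / kernel_dist (kernel_pt z y) powr (MN + \<epsilon>) * norm (?h y)" ..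
  qed
  also have "\<dots> = ker_const * \<kappa> * (norm (x - z) powr \<epsilon> * r powr - \<epsilon>)" by simp
  also have "\<dots> \<le> ker_const * \<kappa> * (r powr \<epsilon> * r powr - \<epsilon>)"
    using xz r eps ker_const_pos \<kappa> by (intro mult_left_mono mult_right_mono powr_mono2 mult_nonneg_nonneg) auto
  also have "r powr \<epsilon> * r powr - \<epsilon> = 1" using r by (simp add: powr_add[symmetric])
  finally show ?thesis unfolding Bochner_Integration.integral_diff[OF ix iz] by simp
qed

text \<open>As \<open>h i\<close> has mean zero, the kernel with its i-th point frozen at
  \<open>c\<close> integrates to 0 and may be subtracted; regularity in y_i then yields the gain
  s^\<epsilon> and additional decay in |x - c|. The distance 3 s ensures that |y_i - c| is at most
  half of |y_i - x|, the range of the regularity estimate.\<close>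

lemma kernel_cancel:
  assumes h: "\<And>j. h j \<in> bdd_supp" and s: "s > 0" and \<kappa>: "\<kappa> \<ge> 0" and d: "d \<le> MN"
    and le: "\<And>\<rho>. \<rho> > 0 \<Longrightarrow> (\<Prod>j\<in>UNIV. \<integral>\<^sup>+y. ennreal (norm (h j y)) * indicator (cube x \<rho>) y \<partial>lborel) \<le> ennreal (\<kappa> * \<rho> powr d)"
    and hi: "\<And>y. h i y \<noteq> 0 \<Longrightarrow> norm (y - c) \<le> s" and h0: "(LINT y|lborel. h i y) = 0"
    and xc: "norm (x - c) \<ge> 3 * s"
  shows "norm (LINT y|lborel. K (kernel_pt x y) * (\<Prod>j\<in>UNIV. h j (y $ j)))
      \<le> ker_const * \<kappa> * s powr \<epsilon> * (norm (x - c) / 2) powr (d - MN - \<epsilon>)"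
proof -
  let ?h = "\<lambda>y. \<Prod>j\<in>UNIV. h j (y $ j)"
  \<comment> \<open>Half the distance to the centre bounds |y_i - x| from below on the support of
    \<open>h i\<close>.\<close>
  define r where "r = norm (x - c) / 2"
  have r: "r > 0" unfolding r_def using xc s by linarith
  define S :: "real^'n^'m \<Rightarrow> real^'n^'m" where "S y = (\<chi> j. if j = i then c else y $ j)" for y
  have S_meas [measurable]: "S \<in> borel_measurable borel"
  proof (rule borel_measurable_continuous_onI)
    show "continuous_on UNIV S" unfolding S_def
    proof (rule continuous_on_vec_lambda)
      show "continuous_on UNIV (\<lambda>y::real^'n^'m. if j = i then c else y $ j)" for j
        by (cases "j = i") (simp_all add: continuous_on_component)
    qed
  qed
  have far: "norm (y - x) \<ge> 2 * s" "norm (y - x) \<ge> r" if "h i y \<noteq> 0" for y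
  proof -
    have "norm (x - c) \<le> norm (y - x) + norm (y - c)"
      using norm_triangle_ineq[of "x - y" "y - c"] by (simp add: norm_minus_commute)
    thus "norm (y - x) \<ge> 2 * s" "norm (y - x) \<ge> r" using hi[OF that] xc s unfolding r_def by linarith+
  qed
  have int1: "integrable lborel (\<lambda>y. K (kernel_pt x y) * ?h y)"
    by (rule K_prod_integrable[where d = r and i = i]) (use h r far in auto)
  have KS: "(\<lambda>y. K (kernel_pt x (S y))) \<in> borel_measurable borel"
    by (rule measurable_compose[OF S_meas K_measurable])
  have KS_le: "norm (K (kernel_pt x (S y))) \<le> A / (3 * s) ^ (CARD('m) * CARD('n))" for y
    by (rule K_le[where j = i]) (use s xc in \<open>auto simp: S_def norm_minus_commute\<close>)
  have int2: "integrable lborel (\<lambda>y. K (kernel_pt x (S y)) * ?h y)"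
  proof (rule Bochner_Integration.integrable_bound)
    show "integrable lborel (\<lambda>y. of_real (A / (3 * s) ^ (CARD('m) * CARD('n))) * ?h y)"
      by (intro integrable_mult_right integrable_lborel_vec_prod integrable_bdd_supp h)
    have "?h \<in> borel_measurable borel"
      by (intro borel_measurable_prod measurable_compose[OF vec_nth_measurable] bdd_supp_measurable h)
    thus "(\<lambda>y. K (kernel_pt x (S y)) * ?h y) \<in> borel_measurable lborel" using KS by simp
    have "norm (K (kernel_pt x (S y)) * ?h y) \<le> norm (of_real (A / (3 * s) ^ (CARD('m) * CARD('n))) * ?h y)" for y
      unfolding norm_mult norm_of_real by (intro mult_right_mono order_trans[OF KS_le abs_ge_self] norm_ge_zero)
    thus "AE y in lborel. norm (K (kernel_pt x (S y)) * ?h y) \<le> norm (of_real (A / (3 * s) ^ (CARD('m) * CARD('n))) * ?h y)"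
      by auto
  qed
  have h_split: "?h y = (\<Prod>j\<in>UNIV - {i}. h j (y $ j)) * h i (y $ i)" for y
    by (subst prod.remove[of _ i]) auto
  have "(LINT y|lborel. (K (kernel_pt x (S y)) * (\<Prod>j\<in>UNIV - {i}. h j (y $ j))) * h i (y $ i)) = 0"
  proof (rule integral_lborel_vec_eq_0[OF integrable_bdd_supp[OF h] h0])
    show "integrable lborel (\<lambda>y. (K (kernel_pt x (S y)) * (\<Prod>j\<in>UNIV - {i}. h j (y $ j))) * h i (y $ i))"
      using int2 by (simp only: h_split mult.assoc)
    fix y z :: "real^'n^'m" assume eq: "\<And>j. j \<noteq> i \<Longrightarrow> y $ j = z $ j"
    hence "S y = S z" by (simp add: S_def vec_eq_iff)
    moreover have "(\<Prod>j\<in>UNIV - {i}. h j (y $ j)) = (\<Prod>j\<in>UNIV - {i}. h j (z $ j))"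
      by (intro prod.cong) (use eq in auto)
    ultimately show "K (kernel_pt x (S y)) * (\<Prod>j\<in>UNIV - {i}. h j (y $ j)) =
        K (kernel_pt x (S z)) * (\<Prod>j\<in>UNIV - {i}. h j (z $ j))" by simp
  qed
  hence zero: "(LINT y|lborel. K (kernel_pt x (S y)) * ?h y) = 0"
    by (simp only: h_split mult.assoc)
  have "norm (LINT y|lborel. K (kernel_pt x y) * ?h y - K (kernel_pt x (S y)) * ?h y)
      \<le> ker_const * \<kappa> * s powr \<epsilon> * r powr (d - MN - \<epsilon>)"
  proof (rule kernel_integral_le[where x = x and h = h, OF h r \<kappa> d])
    show "(\<Prod>j\<in>UNIV. \<integral>\<^sup>+y. ennreal (norm (h j y)) * indicator (cube x \<rho>) y \<partial>lborel) \<le> ennreal (\<kappa> * \<rho> powr d)"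
      if "r \<le> \<rho>" for \<rho> using le that r by simp
    show "integrable lborel (\<lambda>y. K (kernel_pt x y) * ?h y - K (kernel_pt x (S y)) * ?h y)"
      using int1 int2 by simp
    fix y :: "real^'n^'m"
    show "K (kernel_pt x y) * ?h y - K (kernel_pt x (S y)) * ?h y = 0" if "?h y = 0"
      using that by (simp only: mult_zero_right diff_self)
    assume nz: "?h y \<noteq> 0"
    have nzi: "h i (y $ i) \<noteq> 0" by (rule prod_neq_0_D[of h, OF nz])
    note yi = far[OF nzi]
    have D: "r \<le> kernel_dist (kernel_pt x y)" by (rule order_trans[OF yi(2) norm_le_kernel_dist])
    have pt: "(kernel_pt x y)(Some i := c) = kernel_pt x (S y)"
      by (auto simp: fun_eq_iff S_def split: option.splits)
    have "norm (K (kernel_pt x y) - K ((kernel_pt x y)(Some i := c)))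
        \<le> A * norm (kernel_pt x y (Some i) - c) powr \<epsilon> / kernel_dist (kernel_pt x y) powr (MN + \<epsilon>)"
    proof (rule reg'[folded MN, where l = None])
      show "off_diagonal (kernel_pt x y)" by (rule off_diagonal_kernel_pt[of y i]) (use yi r in auto)
      show "norm (kernel_pt x y (Some i) - c) \<le> 1 / 2 * norm (kernel_pt x y (Some i) - kernel_pt x y None)"
        using yi hi[OF nzi] by simp
    qed
    also have "\<dots> \<le> A * s powr \<epsilon> / kernel_dist (kernel_pt x y) powr (MN + \<epsilon>)"
      using A eps hi[OF nzi] by (intro divide_right_mono mult_left_mono powr_mono2) auto
    finally have "norm (K (kernel_pt x y) - K (kernel_pt x (S y))) \<le> A * s powr \<epsilon> / kernel_dist (kernel_pt x y) powr (MN + \<epsilon>)"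
      by (simp only: pt)
    hence "norm (K (kernel_pt x y) * ?h y - K (kernel_pt x (S y)) * ?h y)
       \<le> A * s powr \<epsilon> / kernel_dist (kernel_pt x y) powr (MN + \<epsilon>) * norm (?h y)"
      unfolding left_diff_distrib[symmetric] norm_mult by (rule mult_right_mono) simp
    with D show "r \<le> kernel_dist (kernel_pt x y) \<and> norm (K (kernel_pt x y) * ?h y - K (kernel_pt x (S y)) * ?h y)
       \<le> A * s powr \<epsilon> / kernel_dist (kernel_pt x y) powr (MN + \<epsilon>) * norm (?h y)" ..
  qed
  thus ?thesis unfolding Bochner_Integration.integral_diff[OF int1 int2] zero r_def diff_zero .
qed

end

section \<open>Dyadic cubes and the Calderon--Zygmund decomposition\<close>

text \<open>Cells of side L / 2^k counted from the corner \<open>a\<close>. The floor makes them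
  half-open, so those of one generation partition the space.\<close>

definition dindex :: "real^'n \<Rightarrow> real \<Rightarrow> nat \<Rightarrow> real^'n \<Rightarrow> 'n \<Rightarrow> int" where
  "dindex a L k x = (\<lambda>i. \<lfloor>(x $ i - a $ i) * 2 ^ k / L\<rfloor>)"

definition dcube :: "real^'n \<Rightarrow> real \<Rightarrow> nat \<Rightarrow> real^'n \<Rightarrow> (real^'n) set" where
  "dcube a L k x = {y. dindex a L k y = dindex a L k x}"

lemma mem_dcube_self: "x \<in> dcube a L k x"
  by (simp add: dcube_def)

lemma dcube_cong: "y \<in> dcube a L k x \<Longrightarrow> dcube a L k y = dcube a L k x"
  by (simp add: dcube_def)

text \<open>Halving the side doubles the number under the floor, so the parent has the index divided
  by 2. This is the nesting of dyadic cubes.\<close>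

lemma dindex_Suc: "dindex a L k x i = dindex a L (Suc k) x i div 2"
proof -
  have "(x $ i - a $ i) * 2 ^ k / L = (x $ i - a $ i) * 2 ^ Suc k / L / real_of_int 2" by simp
  thus ?thesis unfolding dindex_def
    using floor_divide_real_eq_div[of 2 "(x $ i - a $ i) * 2 ^ Suc k / L"] by (simp only:)
qed

lemma dcube_antimono: "k \<le> k' \<Longrightarrow> dcube a L k' x \<subseteq> dcube a L k x"
proof (induction rule: dec_induct)
  case (step k')
  have "dcube a L (Suc k') x \<subseteq> dcube a L k' x"
    by (auto simp: dcube_def fun_eq_iff dindex_Suc[of a L k'])
  thus ?case using step.IH by blast
qed simp

lemma mem_dcube_iff:
  assumes "L > 0"
  shows "y \<in> dcube a L k x \<longleftrightarrow> (\<forall>i. a $ i + L / 2 ^ k * dindex a L k x i \<le> y $ i \<and>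
    y $ i < a $ i + L / 2 ^ k * dindex a L k x i + L / 2 ^ k)"
proof -
  have "\<lfloor>(y $ i - a $ i) * 2 ^ k / L\<rfloor> = n \<longleftrightarrow> a $ i + L / 2 ^ k * of_int n \<le> y $ i \<and>
      y $ i < a $ i + L / 2 ^ k * of_int n + L / 2 ^ k" for i n
    using assms by (simp add: floor_eq_iff field_simps)
  thus ?thesis by (simp add: dcube_def dindex_def[of a L k y] fun_eq_iff)
qed

lemma dcube_measurable [measurable]: "dcube a L k x \<in> sets borel"
proof -
  have "dcube a L k x = {y \<in> space borel. \<forall>i. dindex a L k y i = dindex a L k x i}"
    by (auto simp: dcube_def fun_eq_iff)
  also have "\<dots> \<in> sets borel" unfolding dindex_def by measurable
  finally show ?thesis .
qed

text \<open>The half-open cell lies between an open and a closed box of equal volume.\<close>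

lemma dcube_cube:
  fixes a :: "real^'n"
  assumes "L > 0"
  shows "\<exists>w. dcube a L k x \<subseteq> cube w (L / 2 ^ k / 2) \<and>
    emeasure lborel (dcube a L k x) = ennreal ((L / 2 ^ k) ^ CARD('n))"
proof -
  define s where "s = L / 2 ^ k"
  have s: "s > 0" using assms by (simp add: s_def)
  define w :: "real^'n" where "w = (\<chi> i. a $ i + s * dindex a L k x i + s / 2)"
  have mem: "y \<in> dcube a L k x \<longleftrightarrow> (\<forall>i. w $ i - s / 2 \<le> y $ i \<and> y $ i < w $ i + s / 2)" for y
    unfolding mem_dcube_iff[OF assms] s_def[symmetric] by (simp add: w_def add.assoc)
  have sub: "dcube a L k x \<subseteq> cube w (s / 2)"
    unfolding cube_def by (simp add: subset_iff mem mem_box_cart less_imp_le)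
  have sup: "box (\<chi> i. w $ i - s / 2) (\<chi> i. w $ i + s / 2) \<subseteq> dcube a L k x"
    by (simp add: subset_iff mem mem_box_cart less_imp_le)
  have "emeasure lborel (box (\<chi> i. w $ i - s / 2) (\<chi> i. w $ i + s / 2)) = emeasure lborel (cube w (s / 2))"
    unfolding cube_def emeasure_lborel_box_eq emeasure_lborel_cbox_eq ..
  also have "\<dots> = ennreal (s ^ CARD('n))" using s by (simp add: emeasure_cube)
  finally have "ennreal (s ^ CARD('n)) \<le> emeasure lborel (dcube a L k x)"
    using emeasure_mono[OF sup, of lborel] by simp
  moreover have "emeasure lborel (dcube a L k x) \<le> ennreal (s ^ CARD('n))"
    using emeasure_mono[OF sub, of lborel] s by (simp add: emeasure_cube)
  ultimately show ?thesis using sub unfolding s_def by (intro exI[of _ w] conjI antisym)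
qed

lemma emeasure_dcube:
  "L > 0 \<Longrightarrow> emeasure lborel (dcube (a :: real^'n) L k x) = ennreal ((L / 2 ^ k) ^ CARD('n))"
  using dcube_cube by blast

lemma norm_dcube_le:
  fixes a :: "real^'n"
  assumes "L > 0" "y \<in> dcube a L k x"
  shows "norm (y - x) \<le> real CARD('n) * (L / 2 ^ k)"
proof -
  have "\<bar>(y - x) $ i\<bar> \<le> L / 2 ^ k" for i
  proof -
    have "y $ i < x $ i + L / 2 ^ k" "x $ i < y $ i + L / 2 ^ k"
      using assms(2) mem_dcube_self[of x a L k] unfolding mem_dcube_iff[OF assms(1)] by (smt (verit))+
    thus ?thesis by simp
  qed
  hence "y \<in> cube x (L / 2 ^ k)" by (simp add: mem_cube)
  thus ?thesis by (rule mem_cube_imp_norm_le)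
qed

lemma dcube_subset_ball:
  fixes a :: "real^'n"
  assumes "L > 0" "e > 0"
  shows "\<exists>k. \<forall>x. dcube a L k x \<subseteq> ball x e"
proof -
  obtain k :: nat where "real CARD('n) * L / e < real k" using reals_Archimedean2 by blast
  also have "real k < 2 ^ k" by (rule of_nat_less_two_power)
  finally have k: "real CARD('n) * (L / 2 ^ k) < e" using assms by (simp add: field_simps)
  show ?thesis
  proof (intro exI allI subsetI)
    fix x y assume "y \<in> dcube a L k x"
    from norm_dcube_le[OF assms(1) this] k have "norm (y - x) < e" by linarith
    thus "y \<in> ball x e" by (simp add: dist_norm norm_minus_commute)
  qed
qed

lemma countable_dcubes: "countable {dcube a L k x |k x. Q k x}"
proof -
  have "{dcube a L k x |k x. Q k x} \<subseteq> (\<lambda>(k, n). {y. dindex a L k y = n}) ` (UNIV :: (nat \<times> ('a \<Rightarrow> int)) set)"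
    by (auto simp: dcube_def)
  thus ?thesis by (rule countable_subset) simp
qed

text \<open>The maximal bad cubes: generations are tried from the coarsest, \<open>k = 0\<close>
  with side \<open>L\<close>, and the first bad one is kept. As a set of sets it counts a cube once,
  whichever of its points names it.\<close>

definition stopping :: "real^'n \<Rightarrow> real \<Rightarrow> ((real^'n) set \<Rightarrow> bool) \<Rightarrow> (real^'n) set set" where
  "stopping a L Bad = {dcube a L k x |k x. Bad (dcube a L k x) \<and> (\<forall>j<k. \<not> Bad (dcube a L j x))}"

lemma countable_stopping: "countable (stopping a L Bad)"
  unfolding stopping_def by (rule countable_dcubes)

lemma stopping_measurable: "P \<in> stopping a L Bad \<Longrightarrow> P \<in> sets borel"
  unfolding stopping_def using dcube_measurable by blast

text \<open>Two cubes with a common point z are both dyadic cubes of z. Were their generations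
  different, the coarser one would be a bad ancestor of the finer one, which then would not be the
  first.\<close>

lemma stopping_disjoint: "disjoint_family_on (\<lambda>P. P) (stopping a L Bad)"
proof -
  have eq: "P = P'" if "P \<in> stopping a L Bad" "P' \<in> stopping a L Bad" "z \<in> P" "z \<in> P'" for P P' z
  proof -
    have "\<exists>k x. P = dcube a L k x \<and> Bad P \<and> (\<forall>j<k. \<not> Bad (dcube a L j x))"
      using that(1) unfolding stopping_def by auto
    then obtain k x where P: "P = dcube a L k x" "Bad P" "\<forall>j<k. \<not> Bad (dcube a L j x)"
      by (elim exE conjE)
    have "\<exists>k x. P' = dcube a L k x \<and> Bad P' \<and> (\<forall>j<k. \<not> Bad (dcube a L j x))"
      using that(2) unfolding stopping_def by auto
    then obtain k' x' where P': "P' = dcube a L k' x'" "Bad P'" "\<forall>j<k'. \<not> Bad (dcube a L j x')"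
      by (elim exE conjE)
    have Pz: "dcube a L j x = dcube a L j z" if "j \<le> k" for j
      using dcube_cong[of z a L j x] dcube_antimono[OF that, of a L x] \<open>z \<in> P\<close> P(1) by blast
    have Pz': "dcube a L j x' = dcube a L j z" if "j \<le> k'" for j
      using dcube_cong[of z a L j x'] dcube_antimono[OF that, of a L x'] \<open>z \<in> P'\<close> P'(1) by blast
    have "\<not> k < k'" using P'(3) P(2) Pz[of k] Pz'[of k] P(1) by (metis less_imp_le order_refl)
    moreover have "\<not> k' < k" using P(3) P'(2) Pz[of k'] Pz'[of k'] P'(1) by (metis less_imp_le order_refl)
    ultimately have "k = k'" by simp
    thus ?thesis using P(1) P'(1) Pz[of k] Pz'[of k'] by simp
  qed
  show ?thesis unfolding disjoint_family_on_def using eq by blast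
qed

lemma Union_stopping: "\<Union> (stopping a L Bad) = {x. \<exists>k. Bad (dcube a L k x)}"
proof (intro set_eqI iffI)
  fix x assume "x \<in> \<Union> (stopping a L Bad)"
  then obtain k y where "x \<in> dcube a L k y" "Bad (dcube a L k y)"
    unfolding stopping_def by blast
  thus "x \<in> {x. \<exists>k. Bad (dcube a L k x)}"
    using dcube_cong[of x a L k y] by (intro CollectI exI[of _ k]) simp
next
  fix x assume "x \<in> {x. \<exists>k. Bad (dcube a L k x)}"
  then obtain k where k: "Bad (dcube a L k x)" by blast
  define k0 where "k0 = (LEAST k. Bad (dcube a L k x))"
  have "Bad (dcube a L k0 x)" unfolding k0_def by (rule LeastI[of _ k]) (rule k)
  moreover have "\<forall>j<k0. \<not> Bad (dcube a L j x)" unfolding k0_def using not_less_Least by blast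
  ultimately have "dcube a L k0 x \<in> stopping a L Bad" unfolding stopping_def by blast
  thus "x \<in> \<Union> (stopping a L Bad)" using mem_dcube_self[of x a L k0] by blast
qed

section \<open>Decomposition of one function at height \<open>h\<close>\<close>

lemma nn_integral_disjoint_sum_le:
  fixes v :: "'a \<Rightarrow> ennreal"
  assumes "finite G" "disjoint_family_on (\<lambda>P. P) G" "\<And>P. P \<in> G \<Longrightarrow> P \<in> sets M" "\<And>P. P \<in> G \<Longrightarrow> P \<subseteq> S"
    and v: "v \<in> borel_measurable M"
  shows "(\<Sum>P\<in>G. \<integral>\<^sup>+y. v y * indicator P y \<partial>M) \<le> (\<integral>\<^sup>+y. v y * indicator S y \<partial>M)"
proof -
  have "(\<Sum>P\<in>G. \<integral>\<^sup>+y. v y * indicator P y \<partial>M) = (\<integral>\<^sup>+y. (\<Sum>P\<in>G. v y * indicator P y) \<partial>M)"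
    using assms by (intro nn_integral_sum[symmetric]) auto
  also have "\<dots> \<le> (\<integral>\<^sup>+y. v y * indicator S y \<partial>M)"
  proof (rule nn_integral_mono)
    fix y
    have "(\<Sum>P\<in>G. v y * indicator P y) = v y * indicator (\<Union>P\<in>G. P) y"
      by (subst indicator_UN_disjoint[OF assms(1,2)]) (rule sum_distrib_left[symmetric])
    also have "\<dots> \<le> v y * indicator S y"
      using assms(4) by (intro mult_left_mono) (auto simp: indicator_def)
    finally show "(\<Sum>P\<in>G. v y * indicator P y) \<le> v y * indicator S y" .
  qed
  finally show ?thesis .
qed

text \<open>\<open>step\<close> stands in for the differentiation theorem and makes the stopping
  family finite, as needed for expanding \<open>E\<close>; \<open>small\<close> says that averages
  over cubes of side \<open>L\<close> do not exceed \<open>h\<close>, so no cube of generation 0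
  stops.\<close>

locale cz_step =
  fixes f :: "real^'n \<Rightarrow> complex" and a :: "real^'n" and L h :: real and K0 :: nat
  assumes L: "L > 0" and h: "h > 0" and f: "f \<in> bdd_supp"
    and step: "\<And>x y. y \<in> dcube a L K0 x \<Longrightarrow> f y = f x"
    and small: "(LINT x|lborel. norm (f x)) \<le> h * L ^ CARD('n)"
begin

abbreviation "u \<equiv> (\<lambda>y. ennreal (norm (f y)))"

definition "I P = (\<integral>\<^sup>+y. u y * indicator P y \<partial>lborel)"

definition "F = stopping a L (\<lambda>P. I P > ennreal h * emeasure lborel P)"

lemma f_meas [measurable]: "f \<in> borel_measurable borel" by (rule bdd_supp_measurable[OF f])

lemma nn_f: "(\<integral>\<^sup>+y. u y \<partial>lborel) = ennreal (LINT x|lborel. norm (f x))"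
  by (rule nn_integral_eq_integral) (use integrable_bdd_supp[OF f] in auto)

lemma I_le: "I P \<le> (\<integral>\<^sup>+y. u y \<partial>lborel)"
  unfolding I_def by (intro nn_integral_mono) (auto simp: indicator_def)

lemma I_const: "k \<ge> K0 \<Longrightarrow> I (dcube a L k x) = u x * emeasure lborel (dcube a L k x)"
proof -
  assume k: "k \<ge> K0"
  have "I (dcube a L k x) = (\<integral>\<^sup>+y. u x * indicator (dcube a L k x) y \<partial>lborel)"
    unfolding I_def using step dcube_antimono[OF k, of a L x]
    by (intro nn_integral_cong) (auto simp: indicator_def)
  thus ?thesis by (simp add: nn_integral_cmult_indicator)
qed

lemma not_bad_0: "I (dcube a L 0 x) \<le> ennreal h * emeasure lborel (dcube a L 0 x)"
proof -
  have "I (dcube a L 0 x) \<le> ennreal (h * L ^ CARD('n))"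
    using I_le[of "dcube a L 0 x"] small unfolding nn_f by (meson ennreal_leI order_trans)
  thus ?thesis using h L by (simp add: emeasure_dcube ennreal_mult)
qed

text \<open>Stopping happens between generations 1 and \<open>K0\<close>: from \<open>K0\<close> on,
  the average of |f| over a cube is its constant value there and no longer changes. The upper bound
  comes from the parent, which did not stop and has 2^n times the volume.\<close>

lemma F_D:
  assumes "P \<in> F"
  shows "\<exists>w s. s > 0 \<and> s \<ge> L / 2 ^ K0 \<and> P \<subseteq> cube w (s / 2) \<and> emeasure lborel P = ennreal (s ^ CARD('n))
    \<and> ennreal (h * s ^ CARD('n)) \<le> I P \<and> I P \<le> ennreal (2 ^ CARD('n) * h * s ^ CARD('n))"
proof -
  obtain k x where P: "P = dcube a L k x" and bad: "I P > ennreal h * emeasure lborel P"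
    and first: "\<And>j. j < k \<Longrightarrow> \<not> I (dcube a L j x) > ennreal h * emeasure lborel (dcube a L j x)"
    using assms unfolding F_def stopping_def by blast
  define s where "s = L / 2 ^ k"
  have s: "s > 0" using L by (simp add: s_def)
  have k0: "k \<noteq> 0"
  proof
    assume "k = 0"
    thus False using bad not_bad_0[of x] unfolding P by simp
  qed
  have kK: "k \<le> K0"
  proof (rule ccontr)
    assume "\<not> k \<le> K0"
    hence kK: "K0 < k" by simp
    have "ennreal h * emeasure lborel P < u x * emeasure lborel P"
      using bad I_const[of k x] kK by (simp add: P)
    hence "ennreal h < u x" by (metis mult_right_mono not_le zero_le)
    hence "ennreal h * emeasure lborel (dcube a L K0 x) < u x * emeasure lborel (dcube a L K0 x)"
      using L by (intro ennreal_mult_strict_right_mono) (auto simp: emeasure_dcube)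
    thus False using first[OF kK] I_const[of K0 x] by simp
  qed
  have em: "emeasure lborel P = ennreal (s ^ CARD('n))" unfolding P s_def by (rule emeasure_dcube[OF L])
  obtain w where w: "P \<subseteq> cube w (s / 2)" using dcube_cube[OF L, of a k x] unfolding P s_def by blast
  have "s \<ge> L / 2 ^ K0" unfolding s_def using kK L by (intro divide_left_mono power_increasing) auto
  moreover have "ennreal (h * s ^ CARD('n)) \<le> I P"
    using bad h s em by (simp add: ennreal_mult less_imp_le)
  moreover have "I P \<le> ennreal (2 ^ CARD('n) * h * s ^ CARD('n))"
  proof -
    obtain k' where k': "k = Suc k'" using k0 not0_implies_Suc by blast
    have "I P \<le> I (dcube a L k' x)"
      unfolding I_def P using dcube_antimono[of k' k a L x] k'
      by (intro nn_integral_mono mult_left_mono) (auto simp: indicator_def)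
    also have "\<dots> \<le> ennreal h * emeasure lborel (dcube a L k' x)"
      using first[of k'] k' by (simp add: not_less)
    also have "\<dots> = ennreal h * ennreal ((2 * s) ^ CARD('n))"
      by (simp add: emeasure_dcube[OF L] s_def k')
    also have "\<dots> = ennreal (2 ^ CARD('n) * h * s ^ CARD('n))"
      using h s by (subst ennreal_mult[symmetric]) (auto simp: power_mult_distrib mult_ac)
    finally show ?thesis .
  qed
  ultimately show ?thesis using s em w by blast
qed

text \<open>Valid at every point: on the cube of generation \<open>K0\<close> the average is the
  value itself, so a larger value would have made this cube bad.\<close>

lemma f_le_off_F: "x \<notin> \<Union>F \<Longrightarrow> norm (f x) \<le> h"
proof (rule ccontr)
  assume x: "x \<notin> \<Union>F" and "\<not> norm (f x) \<le> h"
  hence "ennreal h < u x" using h by (simp add: ennreal_less_iff)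
  hence "ennreal h * emeasure lborel (dcube a L K0 x) < u x * emeasure lborel (dcube a L K0 x)"
    using L by (intro ennreal_mult_strict_right_mono) (auto simp: emeasure_dcube)
  hence "I (dcube a L K0 x) > ennreal h * emeasure lborel (dcube a L K0 x)" by (simp add: I_const)
  thus False using x unfolding F_def Union_stopping by blast
qed

lemma F_measurable: "P \<in> F \<Longrightarrow> P \<in> sets lborel"
  unfolding F_def using stopping_measurable by auto

lemma F_disjoint: "disjoint_family_on (\<lambda>P. P) F"
  unfolding F_def by (rule stopping_disjoint)

lemma F_disjointD: "P \<in> F \<Longrightarrow> P' \<in> F \<Longrightarrow> x \<in> P \<Longrightarrow> x \<in> P' \<Longrightarrow> P = P'"
  using F_disjoint unfolding disjoint_family_on_def by blast

lemma sum_I_le: "finite G \<Longrightarrow> G \<subseteq> F \<Longrightarrow> (\<Sum>P\<in>G. I P) \<le> (\<integral>\<^sup>+y. u y \<partial>lborel)"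
proof -
  assume G: "finite G" "G \<subseteq> F"
  have "(\<Sum>P\<in>G. I P) \<le> (\<integral>\<^sup>+y. u y * indicator UNIV y \<partial>lborel)"
    unfolding I_def
    by (intro nn_integral_disjoint_sum_le G disjoint_family_on_mono[OF G(2) F_disjoint])
      (use G F_measurable in auto)
  thus ?thesis by simp
qed

text \<open>A stopping cube has side at least L / 2^K0 and average at least \<open>h\<close>, so
  each of these disjoint cubes consumes a fixed amount of the finite integral of |f|.\<close>

lemma finite_F: "finite F"
proof -
  define t where "t = h * (L / 2 ^ K0) ^ CARD('n)"
  have t: "t > 0" using h L by (simp add: t_def)
  have tI: "ennreal t \<le> I P" if "P \<in> F" for P
  proof -
    obtain w s where s: "s \<ge> L / 2 ^ K0" "ennreal (h * s ^ CARD('n)) \<le> I P" using F_D[OF \<open>P \<in> F\<close>] by blast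
    have "t \<le> h * s ^ CARD('n)" unfolding t_def using h L s by (intro mult_left_mono power_mono) auto
    thus ?thesis using s(2) by (meson ennreal_leI order_trans)
  qed
  have card_le: "card G \<le> nat \<lceil>(LINT x|lborel. norm (f x)) / t\<rceil>" if G: "G \<subseteq> F" "finite G" for G
  proof -
    have "ennreal (real (card G) * t) = (\<Sum>P\<in>G. ennreal t)" using t by (simp add: ennreal_mult ennreal_of_nat_eq_real_of_nat)
    also have "\<dots> \<le> (\<Sum>P\<in>G. I P)" using tI G by (intro sum_mono) auto
    also have "\<dots> \<le> ennreal (LINT x|lborel. norm (f x))" using sum_I_le[OF G(2,1)] by (simp add: nn_f)
    finally have "real (card G) * t \<le> (LINT x|lborel. norm (f x))" by (subst (asm) ennreal_le_iff) auto
    hence "real (card G) \<le> (LINT x|lborel. norm (f x)) / t" using t by (simp add: field_simps)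
    thus ?thesis by linarith
  qed
  show ?thesis
  proof (rule ccontr)
    assume "infinite F"
    then obtain G where "G \<subseteq> F" "finite G" "card G = Suc (nat \<lceil>(LINT x|lborel. norm (f x)) / t\<rceil>)"
      using infinite_arbitrarily_large by blast
    thus False using card_le[of G] by simp
  qed
qed

definition "mean P = (LINT y|lborel. (if y \<in> P then f y else 0)) / of_real (measure lborel P)"

definition "bad P y = (if y \<in> P then f y - mean P else 0)"

lemma mean_le:
  assumes P: "P \<in> F"
  shows "ennreal (norm (mean P)) * emeasure lborel P \<le> I P" "norm (mean P) \<le> 2 ^ CARD('n) * h"
proof -
  obtain w s where s: "s > 0" "emeasure lborel P = ennreal (s ^ CARD('n))"
    "I P \<le> ennreal (2 ^ CARD('n) * h * s ^ CARD('n))" using F_D[OF P] by blast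
  have m: "measure lborel P = s ^ CARD('n)" using s by (simp add: measure_def)
  have "(\<lambda>y. if y \<in> P then f y else 0) \<in> bdd_supp" using F_measurable[OF P] by (intro bdd_supp_restrict f) auto
  hence "ennreal (norm (LINT y|lborel. (if y \<in> P then f y else 0))) \<le> (\<integral>\<^sup>+y. ennreal (norm (if y \<in> P then f y else 0)) \<partial>lborel)"
    by (intro integral_norm_bound_ennreal integrable_bdd_supp)
  also have "\<dots> = I P" unfolding I_def by (intro nn_integral_cong) (auto simp: indicator_def)
  finally have le: "ennreal (norm (LINT y|lborel. (if y \<in> P then f y else 0))) \<le> I P" .
  have eq: "norm (mean P) * s ^ CARD('n) = norm (LINT y|lborel. (if y \<in> P then f y else 0))"
    using s(1) by (simp add: mean_def m norm_divide norm_power)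
  show "ennreal (norm (mean P)) * emeasure lborel P \<le> I P"
    using le s(1) unfolding s(2) by (subst ennreal_mult[symmetric]) (auto simp: eq)
  have "ennreal (norm (mean P) * s ^ CARD('n)) \<le> ennreal (2 ^ CARD('n) * h * s ^ CARD('n))"
    unfolding eq using le s(3) by (rule order_trans)
  hence "norm (mean P) * s ^ CARD('n) \<le> 2 ^ CARD('n) * h * s ^ CARD('n)"
    using h s(1) by (subst (asm) ennreal_le_iff) auto
  thus "norm (mean P) \<le> 2 ^ CARD('n) * h" using s(1) by simp
qed

lemma bad_bdd_supp: "P \<in> F \<Longrightarrow> bad P \<in> bdd_supp"
proof -
  assume P: "P \<in> F"
  obtain w s where ws: "P \<subseteq> cube w (s / 2)" using F_D[OF P] by blast
  have "bounded P" by (rule bounded_subset[OF _ ws]) (simp add: cube_def bounded_cbox)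
  then obtain r where "\<And>x. x \<in> P \<Longrightarrow> norm x \<le> r" unfolding bounded_iff by blast
  moreover obtain B where B: "\<And>x. norm (f x) \<le> B" by (rule bdd_suppE[OF f]) (rule that)
  moreover have "(\<lambda>y. if y \<in> P then f y - mean P else 0) \<in> borel_measurable borel"
    using F_measurable[OF P] by (intro measurable_If_set) auto
  moreover have "norm (f x - mean P) \<le> \<bar>B\<bar> + norm (mean P)" for x
    using B[of x] norm_triangle_ineq4[of "f x" "mean P"] by linarith
  ultimately show ?thesis
    unfolding bad_def[abs_def] by (intro bdd_suppI[of _ "\<bar>B\<bar> + norm (mean P)" r]) (auto split: if_splits)
qed

lemma bad_integral_0: "P \<in> F \<Longrightarrow> (LINT y|lborel. bad P y) = 0"
proof -
  assume P: "P \<in> F"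
  obtain w s where s: "s > 0" "emeasure lborel P = ennreal (s ^ CARD('n))" using F_D[OF P] by blast
  have m: "measure lborel P = s ^ CARD('n)" using s by (simp add: measure_def)
  have i1: "integrable lborel (\<lambda>y. if y \<in> P then f y else 0)"
    using F_measurable[OF P] by (intro integrable_bdd_supp bdd_supp_restrict f) auto
  have i2: "integrable lborel (\<lambda>y. mean P * of_real (indicator P y))"
    using F_measurable[OF P] s
    by (intro integrable_mult_right integrable_of_real integrable_real_indicator) auto
  have "(LINT y|lborel. bad P y) = (LINT y|lborel. (if y \<in> P then f y else 0) - mean P * of_real (indicator P y))"
    by (intro Bochner_Integration.integral_cong) (auto simp: bad_def)
  also have "\<dots> = (LINT y|lborel. (if y \<in> P then f y else 0)) - mean P * of_real (measure lborel P)"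
    using F_measurable[OF P] s(2) by (subst Bochner_Integration.integral_diff[OF i1 i2]) simp
  also have "\<dots> = 0" using s(1) by (simp add: mean_def m)
  finally show ?thesis .
qed

lemma bad_nn_integral_le: "P \<in> F \<Longrightarrow> (\<integral>\<^sup>+y. ennreal (norm (bad P y)) \<partial>lborel) \<le> 2 * I P"
proof -
  assume P: "P \<in> F"
  have [measurable]: "P \<in> sets borel" using F_measurable[OF P] by simp
  have "(\<integral>\<^sup>+y. ennreal (norm (bad P y)) \<partial>lborel)
      \<le> (\<integral>\<^sup>+y. u y * indicator P y + ennreal (norm (mean P)) * indicator P y \<partial>lborel)"
  proof (intro nn_integral_mono)
    fix y
    have "ennreal (norm (f y - mean P)) \<le> ennreal (norm (f y) + norm (mean P))"
      by (rule ennreal_leI[OF norm_triangle_ineq4])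
    also have "\<dots> = u y + ennreal (norm (mean P))" by (rule ennreal_plus) simp_all
    finally have "ennreal (norm (f y - mean P)) \<le> u y + ennreal (norm (mean P))" .
    thus "ennreal (norm (bad P y)) \<le> u y * indicator P y + ennreal (norm (mean P)) * indicator P y"
      by (simp add: bad_def)
  qed
  also have "\<dots> = I P + ennreal (norm (mean P)) * emeasure lborel P"
    unfolding I_def by (subst nn_integral_add) (auto simp: nn_integral_cmult_indicator)
  also have "\<dots> \<le> I P + I P" by (intro add_left_mono mean_le[OF P])
  finally show ?thesis by (simp add: mult_2)
qed

lemma good_le: "norm (f x - (\<Sum>P\<in>F. bad P x)) \<le> 2 ^ CARD('n) * h"
proof (cases "x \<in> \<Union>F")
  case True
  then obtain P where P: "P \<in> F" "x \<in> P" by blast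
  have "(\<Sum>P\<in>F - {P}. bad P x) = 0"
    by (intro sum.neutral ballI) (use F_disjointD[OF _ P(1) _ P(2)] in \<open>auto simp: bad_def\<close>)
  hence "(\<Sum>P\<in>F. bad P x) = f x - mean P"
    using P by (subst sum.remove[OF finite_F P(1)]) (simp add: bad_def)
  thus ?thesis using mean_le(2)[OF P(1)] by simp
next
  case False
  hence "(\<Sum>P\<in>F. bad P x) = 0" by (intro sum.neutral) (auto simp: bad_def)
  hence "norm (f x - (\<Sum>P\<in>F. bad P x)) \<le> 1 * h" using f_le_off_F[OF False] by simp
  also have "\<dots> \<le> 2 ^ CARD('n) * h" using h by (intro mult_right_mono) auto
  finally show ?thesis .
qed

text \<open>Controls the averages of the undecomposed function at all scales, so that one argument
  can be treated while the others keep their bad parts. A stopping cube meeting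
  \<open>cube x \<rho>\<close> has side at most 2 \<rho>, because \<open>x\<close> avoids its
  dilate, and hence lies in \<open>cube x (3 * \<rho>)\<close>; the average on it is at most 2^n h,
  and elsewhere |f| is at most h. This gives 2^n 6^n = 12^n plus 2^n, rounded up.\<close>

lemma local_average_le:
  assumes cs: "\<And>P. P \<in> F \<Longrightarrow> s P > 0 \<and> P \<subseteq> cube (c P) (s P / 2) \<and> emeasure lborel P = ennreal (s P ^ CARD('n))
      \<and> I P \<le> ennreal (2 ^ CARD('n) * h * s P ^ CARD('n))"
    and x: "\<And>P. P \<in> F \<Longrightarrow> x \<notin> cube (c P) (\<kappa> * s P)" and \<kappa>: "\<kappa> \<ge> 1" and \<rho>: "\<rho> > 0"
  shows "(\<integral>\<^sup>+y. u y * indicator (cube x \<rho>) y \<partial>lborel) \<le> ennreal (2 * 12 ^ CARD('n) * h * \<rho> ^ CARD('n))"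
proof -
  define G where "G = {P \<in> F. P \<inter> cube x \<rho> \<noteq> {}}"
  have G: "finite G" "G \<subseteq> F" using finite_F by (auto simp: G_def)
  have sub: "P \<subseteq> cube x (3 * \<rho>)" if P: "P \<in> G" for P
  proof
    fix y assume y: "y \<in> P"
    have PF: "P \<in> F" using P G by blast
    note c = cs[OF PF]
    obtain p where p: "p \<in> P" "p \<in> cube x \<rho>" using P unfolding G_def by blast
    obtain i where i: "\<bar>x $ i - c P $ i\<bar> > \<kappa> * s P" using x[OF PF] by (auto simp: mem_cube not_le)
    have "s P \<le> \<kappa> * s P" using c \<kappa> by simp
    have pc: "\<bar>p $ i - c P $ i\<bar> \<le> s P / 2" for i using p(1) c by (auto simp: mem_cube)
    have px: "\<bar>p $ i - x $ i\<bar> \<le> \<rho>" for i using p(2) by (simp add: mem_cube)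
    have s: "s P \<le> 2 * \<rho>" using i \<open>s P \<le> \<kappa> * s P\<close> pc[of i] px[of i] by linarith
    have "\<bar>y $ i - x $ i\<bar> \<le> 3 * \<rho>" for i
    proof -
      have "\<bar>y $ i - c P $ i\<bar> \<le> s P / 2" using y c by (auto simp: mem_cube)
      thus ?thesis using pc[of i] px[of i] s by linarith
    qed
    thus "y \<in> cube x (3 * \<rho>)" by (simp add: mem_cube)
  qed
  have mG: "P \<in> sets lborel" if "P \<in> G" for P using F_measurable that G by blast
  have dG: "disjoint_family_on (\<lambda>P. P) G" by (rule disjoint_family_on_mono[OF G(2) F_disjoint])
  have "(\<integral>\<^sup>+y. u y * indicator (cube x \<rho>) y \<partial>lborel)
      \<le> (\<integral>\<^sup>+y. ennreal h * indicator (cube x \<rho>) y + (\<Sum>P\<in>G. u y * indicator P y) \<partial>lborel)"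
  proof (intro nn_integral_mono)
    fix y
    show "u y * indicator (cube x \<rho>) y \<le> ennreal h * indicator (cube x \<rho>) y + (\<Sum>P\<in>G. u y * indicator P y)"
    proof (cases "y \<in> cube x \<rho>")
      case True
      show ?thesis
      proof (cases "y \<in> \<Union>F")
        case True
        then obtain P where P: "P \<in> F" "y \<in> P" by blast
        hence PG: "P \<in> G" using \<open>y \<in> cube x \<rho>\<close> by (auto simp: G_def)
        have "u y * indicator (cube x \<rho>) y \<le> u y * indicator P y" using P by (simp add: indicator_def)
        also have "\<dots> \<le> (\<Sum>P\<in>G. u y * indicator P y)" by (rule member_le_sum[OF PG _ G(1)]) simp
        also have "\<dots> \<le> ennreal h * indicator (cube x \<rho>) y + (\<Sum>P\<in>G. u y * indicator P y)"
          by (simp add: add_increasing)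
        finally show ?thesis .
      next
        case False
        hence "u y * indicator (cube x \<rho>) y \<le> ennreal h * indicator (cube x \<rho>) y"
          by (intro mult_right_mono ennreal_leI f_le_off_F) auto
        thus ?thesis by (simp add: add_increasing2)
      qed
    qed simp
  qed
  also have "\<dots> = ennreal h * emeasure lborel (cube x \<rho>) + (\<Sum>P\<in>G. I P)"
    using mG unfolding I_def
    by (subst nn_integral_add) (auto simp: nn_integral_cmult_indicator nn_integral_sum)
  also have "\<dots> \<le> ennreal h * emeasure lborel (cube x \<rho>) + ennreal (2 ^ CARD('n) * h) * emeasure lborel (cube x (3 * \<rho>))"
  proof (rule add_left_mono)
    have "(\<Sum>P\<in>G. I P) \<le> (\<Sum>P\<in>G. ennreal (2 ^ CARD('n) * h) * emeasure lborel P)"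
    proof (rule sum_mono)
      fix P assume "P \<in> G"
      hence "P \<in> F" using G by blast
      from cs[OF this] h show "I P \<le> ennreal (2 ^ CARD('n) * h) * emeasure lborel P"
        by (simp add: ennreal_mult[symmetric])
    qed
    also have "\<dots> = ennreal (2 ^ CARD('n) * h) * (\<Sum>P\<in>G. emeasure lborel P)"
      by (rule sum_distrib_left[symmetric])
    also have "(\<Sum>P\<in>G. emeasure lborel P) \<le> emeasure lborel (cube x (3 * \<rho>))"
    proof -
      have "(\<Sum>P\<in>G. \<integral>\<^sup>+y. 1 * indicator P y \<partial>lborel) \<le> (\<integral>\<^sup>+y. 1 * indicator (cube x (3 * \<rho>)) y \<partial>lborel)"
        by (rule nn_integral_disjoint_sum_le[OF G(1) dG mG sub]) auto
      moreover have "(\<Sum>P\<in>G. \<integral>\<^sup>+y. 1 * indicator P y \<partial>lborel) = (\<Sum>P\<in>G. emeasure lborel P)"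
        using mG by (intro sum.cong) auto
      ultimately show ?thesis by simp
    qed
    finally show "(\<Sum>P\<in>G. I P) \<le> ennreal (2 ^ CARD('n) * h) * emeasure lborel (cube x (3 * \<rho>))"
      by (simp add: mult_left_mono)
  qed
  also have "\<dots> = ennreal (h * (2 * \<rho>) ^ CARD('n) + 2 ^ CARD('n) * h * (2 * (3 * \<rho>)) ^ CARD('n))"
    using \<rho> h by (simp add: emeasure_cube ennreal_mult[symmetric] ennreal_plus[symmetric] del: ennreal_plus)
  also have "\<dots> \<le> ennreal (2 * 12 ^ CARD('n) * h * \<rho> ^ CARD('n))"
  proof (rule ennreal_leI)
    have "h * (2 * \<rho>) ^ CARD('n) = 2 ^ CARD('n) * (h * \<rho> ^ CARD('n))" by (simp add: power_mult_distrib)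
    also have "\<dots> \<le> 12 ^ CARD('n) * (h * \<rho> ^ CARD('n))"
      using h \<rho> by (intro mult_right_mono power_mono) auto
    finally have 1: "h * (2 * \<rho>) ^ CARD('n) \<le> 12 ^ CARD('n) * (h * \<rho> ^ CARD('n))" .
    have "2 ^ CARD('n) * h * (2 * (3 * \<rho>)) ^ CARD('n) = (2 ^ CARD('n) * 6 ^ CARD('n)) * (h * \<rho> ^ CARD('n))"
      by (simp add: power_mult_distrib[of 6 \<rho>])
    also have "(2 ^ CARD('n) * 6 ^ CARD('n) :: real) = 12 ^ CARD('n)"
      by (simp add: power_mult_distrib[symmetric])
    finally have 2: "2 ^ CARD('n) * h * (2 * (3 * \<rho>)) ^ CARD('n) = 12 ^ CARD('n) * (h * \<rho> ^ CARD('n))" .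
    have "2 * 12 ^ CARD('n) * h * \<rho> ^ CARD('n) = 12 ^ CARD('n) * (h * \<rho> ^ CARD('n)) + 12 ^ CARD('n) * (h * \<rho> ^ CARD('n))"
      by (simp only: mult_2 mult.assoc distrib_right)
    with 1 show "h * (2 * \<rho>) ^ CARD('n) + 2 ^ CARD('n) * h * (2 * (3 * \<rho>)) ^ CARD('n) \<le> 2 * 12 ^ CARD('n) * h * \<rho> ^ CARD('n)"
      unfolding 2 by (simp only: add_right_mono)
  qed
  finally show ?thesis .
qed

end

text \<open>Packaged with existential quantifiers so that a choice over all arguments is possible.
  \<open>s\<close> and \<open>c\<close> are side and centre of a cube around the stopping cube; the
  dilation factor \<open>\<kappa>\<close> stays free, to be matched with the kernel
  estimates.\<close>

lemma cz_decomposition: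
  fixes f :: "real^'n \<Rightarrow> complex"
  assumes "L > 0" "h > 0" "f \<in> bdd_supp" "\<And>x y. y \<in> dcube a L K0 x \<Longrightarrow> f y = f x"
    "(LINT x|lborel. norm (f x)) \<le> h * L ^ CARD('n)"
  shows "\<exists>(F :: (real^'n) set set) b c s. finite F \<and>
    (\<forall>P\<in>F. b P \<in> bdd_supp \<and> s P > 0 \<and> (\<forall>y. b P y \<noteq> 0 \<longrightarrow> y \<in> cube (c P) (s P / 2)) \<and>
      (LINT y|lborel. b P y) = 0) \<and>
    (\<Sum>P\<in>F. LINT y|lborel. norm (b P y)) \<le> 2 * (LINT x|lborel. norm (f x)) \<and>
    (\<Sum>P\<in>F. s P ^ CARD('n)) \<le> (LINT x|lborel. norm (f x)) / h \<and>
    (\<forall>x. norm (f x - (\<Sum>P\<in>F. b P x)) \<le> 2 ^ CARD('n) * h) \<and>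
    (\<forall>\<kappa>\<ge>1. \<forall>x. (\<forall>P\<in>F. x \<notin> cube (c P) (\<kappa> * s P)) \<longrightarrow> (\<forall>\<rho>>0.
      (\<integral>\<^sup>+y. ennreal (norm (f y)) * indicator (cube x \<rho>) y \<partial>lborel) \<le> ennreal (2 * 12 ^ CARD('n) * h * \<rho> ^ CARD('n))))"
proof -
  interpret cz_step f a L h K0 by standard (use assms in auto)
  have "\<forall>P\<in>F. \<exists>ws. snd ws > 0 \<and> P \<subseteq> cube (fst ws) (snd ws / 2) \<and> emeasure lborel P = ennreal (snd ws ^ CARD('n))
    \<and> ennreal (h * snd ws ^ CARD('n)) \<le> I P \<and> I P \<le> ennreal (2 ^ CARD('n) * h * snd ws ^ CARD('n))"
    using F_D by fastforce
  from bchoice[OF this] obtain ws where ws: "\<forall>P\<in>F. snd (ws P) > 0 \<and> P \<subseteq> cube (fst (ws P)) (snd (ws P) / 2) \<and>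
      emeasure lborel P = ennreal (snd (ws P) ^ CARD('n)) \<and> ennreal (h * snd (ws P) ^ CARD('n)) \<le> I P \<and>
      I P \<le> ennreal (2 ^ CARD('n) * h * snd (ws P) ^ CARD('n))" by (rule exE)
  define c s where "c P = fst (ws P)" and "s P = snd (ws P)" for P
  have cs: "s P > 0" "P \<subseteq> cube (c P) (s P / 2)" "emeasure lborel P = ennreal (s P ^ CARD('n))"
     "ennreal (h * s P ^ CARD('n)) \<le> I P" "I P \<le> ennreal (2 ^ CARD('n) * h * s P ^ CARD('n))" if "P \<in> F" for P
    using ws that by (simp_all add: c_def s_def)
  let ?nf = "LINT x|lborel. norm (f x)"
  have "ennreal (\<Sum>P\<in>F. LINT y|lborel. norm (bad P y)) = (\<Sum>P\<in>F. ennreal (LINT y|lborel. norm (bad P y)))"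
    by (intro sum_ennreal[symmetric]) simp
  also have "\<dots> = (\<Sum>P\<in>F. \<integral>\<^sup>+y. ennreal (norm (bad P y)) \<partial>lborel)"
    by (intro sum.cong refl nn_integral_eq_integral[symmetric] integrable_norm integrable_bdd_supp bad_bdd_supp) auto
  also have "\<dots> \<le> (\<Sum>P\<in>F. 2 * I P)" by (intro sum_mono bad_nn_integral_le)
  also have "\<dots> = 2 * (\<Sum>P\<in>F. I P)" by (rule sum_distrib_left[symmetric])
  also have "\<dots> \<le> 2 * ennreal ?nf" using sum_I_le[OF finite_F order_refl] by (intro mult_left_mono) (auto simp: nn_f)
  also have "\<dots> = ennreal (2 * ?nf)" by (simp add: ennreal_mult)
  finally have 1: "(\<Sum>P\<in>F. LINT y|lborel. norm (bad P y)) \<le> 2 * ?nf"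
    by (subst (asm) ennreal_le_iff) simp_all
  have "ennreal (\<Sum>P\<in>F. h * s P ^ CARD('n)) = (\<Sum>P\<in>F. ennreal (h * s P ^ CARD('n)))"
    using cs(1) assms(2) by (intro sum_ennreal[symmetric]) (auto intro: less_imp_le)
  also have "\<dots> \<le> (\<Sum>P\<in>F. I P)" by (intro sum_mono cs)
  also have "\<dots> \<le> ennreal ?nf" using sum_I_le[OF finite_F order_refl] by (simp add: nn_f)
  finally have "(\<Sum>P\<in>F. h * s P ^ CARD('n)) \<le> ?nf" by (subst (asm) ennreal_le_iff) simp_all
  hence 2: "(\<Sum>P\<in>F. s P ^ CARD('n)) \<le> ?nf / h"
    using assms(2) by (simp add: sum_distrib_left[symmetric] field_simps)
  have supp: "y \<in> cube (c P) (s P / 2)" if "P \<in> F" "bad P y \<noteq> 0" for P y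
    using cs(2)[OF that(1)] that(2) by (auto simp: bad_def split: if_splits)
  have loc: "(\<integral>\<^sup>+y. ennreal (norm (f y)) * indicator (cube x \<rho>) y \<partial>lborel) \<le> ennreal (2 * 12 ^ CARD('n) * h * \<rho> ^ CARD('n))"
    if "\<kappa> \<ge> 1" "\<forall>P\<in>F. x \<notin> cube (c P) (\<kappa> * s P)" "\<rho> > 0" for \<kappa> x \<rho>
    by (rule local_average_le[where s = s and c = c and \<kappa> = \<kappa>]) (use cs that in auto)
  show ?thesis
    by (intro exI[of _ F] exI[of _ bad] exI[of _ c] exI[of _ s] conjI ballI allI impI
        finite_F 1 2 good_le bad_bdd_supp bad_integral_0 cs(1) supp loc) auto
qed

section \<open>Contribution of the bad parts\<close>

lemma frac_cancel_middle: "a \<noteq> 0 \<Longrightarrow> (1 / (b * a)) * (c * (a * v)) = c * v / (b :: real)"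
  by simp

lemma ennreal_plus3:
  "0 \<le> a \<Longrightarrow> 0 \<le> b \<Longrightarrow> 0 \<le> c \<Longrightarrow> ennreal a + ennreal b + ennreal c = ennreal (a + b + c)"
  by simp

lemma prod_mono_ennreal:
  fixes u v :: "'i \<Rightarrow> ennreal"
  assumes "\<And>j. j \<in> S \<Longrightarrow> u j \<le> v j"
  shows "prod u S \<le> prod v S"
  using assms by (induction S rule: infinite_finite_induct) (auto intro: mult_mono)

context multilinear_Lp
begin

lemma Lp_bdd_supp: "f \<in> bdd_supp \<Longrightarrow> f \<in> Lp_space (qs j)"
  by (rule Lp_space_bdd_supp[OF _ qs_pos])

lemma E_linear:
  assumes "\<And>j. w j \<in> Lp_space (qs j)" "g \<in> Lp_space (qs i)" "h \<in> Lp_space (qs i)"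
  shows "AE x in lebesgue. E (w(i := \<lambda>x. a * g x + b * h x)) x = a * E (w(i := g)) x + b * E (w(i := h)) x"
  using multilin assms unfolding multilinear_op_def by blast

lemma E_sum:
  assumes w: "\<And>j. w j \<in> bdd_supp" and "finite F" and b: "\<And>P. P \<in> F \<Longrightarrow> b P \<in> bdd_supp"
  shows "(\<lambda>x. \<Sum>P\<in>F. b P x) \<in> bdd_supp \<and>
    (AE x in lebesgue. E (w(i := \<lambda>x. \<Sum>P\<in>F. b P x)) x = (\<Sum>P\<in>F. E (w(i := b P)) x))"
  using assms(2) b
proof (induction F rule: finite_induct)
  case empty
  have z: "(\<lambda>x::real^'n. 0) \<in> bdd_supp" by (rule bdd_suppI[of _ 0 0]) auto
  have "AE x in lebesgue. E (w(i := \<lambda>x. 0 * w i x + 0 * w i x)) x = 0 * E (w(i := w i)) x + 0 * E (w(i := w i)) x"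
    by (intro E_linear Lp_bdd_supp w)
  thus ?case using z by (simp only: sum.empty mult_zero_left add_0_left simp_thms)
next
  case (insert P F)
  have bP: "b P \<in> bdd_supp" using insert.prems by simp
  have bF: "(\<lambda>x. \<Sum>P\<in>F. b P x) \<in> bdd_supp"
    and AEF: "AE x in lebesgue. E (w(i := \<lambda>x. \<Sum>P\<in>F. b P x)) x = (\<Sum>P\<in>F. E (w(i := b P)) x)"
    using insert.IH insert.prems by blast+
  have "(\<lambda>x. 0 - b P x) \<in> bdd_supp"
    by (rule bdd_supp_diff[OF _ bP]) (rule bdd_suppI[of _ 0 0], auto)
  from bdd_supp_diff[OF bF this] have "(\<lambda>x. \<Sum>P\<in>insert P F. b P x) \<in> bdd_supp"
    using insert.hyps by (simp add: add.commute)
  moreover have "AE x in lebesgue. E (w(i := \<lambda>x. 1 * b P x + 1 * (\<Sum>P\<in>F. b P x))) x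
      = 1 * E (w(i := b P)) x + 1 * E (w(i := \<lambda>x. \<Sum>P\<in>F. b P x)) x"
    by (intro E_linear Lp_bdd_supp w bP bF)
  hence "AE x in lebesgue. E (w(i := \<lambda>x. \<Sum>P\<in>insert P F. b P x)) x = (\<Sum>P\<in>insert P F. E (w(i := b P)) x)"
    using AEF insert.hyps by (auto elim!: AE_mp)
  ultimately show ?case ..
qed

text \<open>Passing from \<open>f\<close> to \<open>g\<close> slot by slot leaves one error per
  slot, in which the treated slots hold \<open>g\<close> and the remaining ones \<open>f\<close>.
  Errors may be small only after subtracting constants \<open>c i J\<close>; the first conjunct
  records that no constant arises if none was subtracted. It is used for the bad parts, with
  constants 0, and for the far parts, with kernel integrals at the centre of a cube.\<close>

lemma E_telescope:
  fixes f g :: "'m \<Rightarrow> real^'n \<Rightarrow> complex"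
  assumes f: "\<And>j. f j \<in> bdd_supp" and g: "\<And>j. g j \<in> bdd_supp"
    and le: "\<And>i J. i \<notin> J \<Longrightarrow> AE x in lebesgue. Q x \<longrightarrow>
       norm (E ((\<lambda>j. if j \<in> J then g j else f j)(i := \<lambda>x. f i x - g i x)) x - c i J) \<le> B i x"
    and "finite I"
  shows "\<exists>c'. (c = (\<lambda>_ _. 0) \<longrightarrow> c' = 0) \<and> (AE x in lebesgue. Q x \<longrightarrow>
     norm (E f x - E (\<lambda>j. if j \<in> I then g j else f j) x - c') \<le> (\<Sum>i\<in>I. B i x))"
  using \<open>finite I\<close>
proof induction
  case empty
  show ?case by (intro exI[of _ 0]) simp
next
  case (insert i I)
  let ?w = "\<lambda>I j. if j \<in> I then g j else f j"
  obtain c' where c': "c = (\<lambda>_ _. 0) \<longrightarrow> c' = 0"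
    "AE x in lebesgue. Q x \<longrightarrow> norm (E f x - E (?w I) x - c') \<le> (\<Sum>i\<in>I. B i x)"
    using insert.IH by blast
  have w: "?w (insert i I) j \<in> Lp_space (qs j)" for j using f g by (simp add: Lp_bdd_supp)
  have upd: "(?w (insert i I))(i := \<lambda>x. f i x - ?w (insert i I) i x) = (?w I)(i := \<lambda>x. f i x - g i x)"
    "(?w (insert i I))(i := f i) = ?w I"
    using insert.hyps by (auto simp: fun_eq_iff)
  have "AE x in lebesgue. E ((?w I)(i := \<lambda>x. f i x - g i x)) x = E (?w I) x - E (?w (insert i I)) x"
    using E_diff[of "?w (insert i I)" "f i" i, OF w Lp_bdd_supp[OF f]] unfolding upd .
  with c'(2) le[OF insert.hyps(2)]
  have "AE x in lebesgue. Q x \<longrightarrow> norm (E f x - E (?w (insert i I)) x - (c' + c i I)) \<le> (\<Sum>i\<in>insert i I. B i x)"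
  proof eventually_elim
    case (elim x)
    show ?case
    proof
      assume "Q x"
      have "E f x - E (?w (insert i I)) x - (c' + c i I) =
        (E f x - E (?w I) x - c') + (E ((?w I)(i := \<lambda>x. f i x - g i x)) x - c i I)"
        using elim(3) by simp
      also have "norm \<dots> \<le> (\<Sum>i\<in>I. B i x) + B i x"
        using elim(1,2) \<open>Q x\<close> by (intro norm_triangle_mono) blast+
      finally show "norm (E f x - E (?w (insert i I)) x - (c' + c i I)) \<le> (\<Sum>i\<in>insert i I. B i x)"
        using insert.hyps by (simp add: add.commute)
    qed
  qed
  thus ?case using c'(1) by (intro exI[of _ "c' + c i I"]) auto
qed

end

context CZ_data_dim
begin

lemma nn: "nn = real CARD('n)" "nn > 0" "nn \<ge> 1"
  by (auto simp: nn_eq Suc_le_eq)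

text \<open>The decay |x - c|^(-n-\<epsilon>) is integrable away from the centre, and the factor
  s^\<epsilon> makes the result scale invariant. In 8^n one factor 2^n is the volume of cubes, one
  comes from the shells and one from the halved distance.\<close>

lemma tail_integral_le:
  fixes c :: "real^'n"
  assumes s: "s > 0" and \<beta>: "\<beta> \<ge> 0"
  shows "(\<integral>\<^sup>+x. indicator {x. 2 * nn * s \<le> norm (x - c)} x *
      ennreal (\<beta> * (nn * s / 2) powr \<epsilon> * (norm (x - c) / 2) powr - (nn + \<epsilon>)) \<partial>lborel)
    \<le> ennreal (\<beta> * (8 powr nn / (1 - 2 powr - \<epsilon>)))"
proof -
  let ?r = "2 * nn * s"
  have r: "?r > 0" using s nn(2) by (intro mult_pos_pos) auto
  have sh: "(\<integral>\<^sup>+x. 1 * (indicator {x. ?r \<le> norm (x - c)} x * ennreal (norm (x - c) powr - (nn + \<epsilon>))) \<partial>lborel)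
      \<le> ennreal (2 powr nn * 2 powr nn / (1 - 2 powr - \<epsilon>) * ?r powr (nn - (nn + \<epsilon>)))"
  proof (rule shell_estimate)
    fix \<rho> assume "?r \<le> \<rho>"
    hence \<rho>: "\<rho> > 0" using r by linarith
    have "(\<integral>\<^sup>+x. 1 * indicator {x. norm (x - c) \<le> \<rho>} x \<partial>lborel) \<le> (\<integral>\<^sup>+x. indicator (cube c \<rho>) x \<partial>lborel)"
      by (intro nn_integral_mono) (auto simp: indicator_def norm_le_imp_mem_cube)
    also have "\<dots> = ennreal ((2 * \<rho>) ^ CARD('n))" using \<rho> by (simp add: emeasure_cube)
    also have "(2 * \<rho>) ^ CARD('n) = (2 * \<rho>) powr nn" using \<rho> by (subst powr_realpow[symmetric]) (auto simp: nn(1))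
    also have "\<dots> = 2 powr nn * \<rho> powr nn" by (rule powr_mult)
    finally show "(\<integral>\<^sup>+x. 1 * indicator {x. norm (x - c) \<le> \<rho>} x \<partial>lborel) \<le> ennreal (2 powr nn * \<rho> powr nn)" .
  next
    show "0 \<le> nn + \<epsilon>" using nn(2) eps by linarith
  qed (use r eps in auto)
  let ?k = "\<beta> * (nn * s / 2) powr \<epsilon> * 2 powr (nn + \<epsilon>)"
  have "(norm (x - c) / 2) powr - (nn + \<epsilon>) = norm (x - c) powr - (nn + \<epsilon>) * 2 powr (nn + \<epsilon>)" for x
    by (subst powr_divide) (simp only: powr_minus divide_inverse inverse_inverse_eq)
  hence eq: "ennreal (\<beta> * (nn * s / 2) powr \<epsilon> * (norm (x - c) / 2) powr - (nn + \<epsilon>))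
     = ennreal ?k * ennreal (norm (x - c) powr - (nn + \<epsilon>))" for x
    using \<beta> by (subst ennreal_mult[symmetric]) (auto simp: mult_ac)
  have "(\<integral>\<^sup>+x. indicator {x. ?r \<le> norm (x - c)} x *
      ennreal (\<beta> * (nn * s / 2) powr \<epsilon> * (norm (x - c) / 2) powr - (nn + \<epsilon>)) \<partial>lborel)
    = (\<integral>\<^sup>+x. ennreal ?k * (1 * (indicator {x. ?r \<le> norm (x - c)} x * ennreal (norm (x - c) powr - (nn + \<epsilon>)))) \<partial>lborel)"
    unfolding eq by (intro nn_integral_cong) (simp only: mult_ac mult_1)
  also have "\<dots> = ennreal ?k * (\<integral>\<^sup>+x. 1 * (indicator {x. ?r \<le> norm (x - c)} x * ennreal (norm (x - c) powr - (nn + \<epsilon>))) \<partial>lborel)"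
    by (rule nn_integral_cmult) measurable
  also have "\<dots> \<le> ennreal ?k * ennreal (2 powr nn * 2 powr nn / (1 - 2 powr - \<epsilon>) * ?r powr (nn - (nn + \<epsilon>)))"
    by (rule mult_left_mono[OF sh]) simp
  also have "\<dots> = ennreal (?k * (2 powr nn * 2 powr nn / (1 - 2 powr - \<epsilon>) * ?r powr (nn - (nn + \<epsilon>))))"
    using \<beta> by (intro ennreal_mult'[symmetric]) auto
  also have "\<dots> \<le> ennreal (\<beta> * (8 powr nn / (1 - 2 powr - \<epsilon>)))"
  proof (rule ennreal_leI)
    have "(nn * s / 2) powr \<epsilon> * 2 powr \<epsilon> \<le> ?r powr \<epsilon>"
    proof -
      have "(nn * s / 2) powr \<epsilon> * 2 powr \<epsilon> = (nn * s) powr \<epsilon>"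
        by (subst powr_mult[symmetric]) simp
      also have "\<dots> \<le> ?r powr \<epsilon>" using r s eps nn(2) by (intro powr_mono2) auto
      finally show ?thesis .
    qed
    hence "(nn * s / 2) powr \<epsilon> * 2 powr \<epsilon> * ?r powr - \<epsilon> \<le> ?r powr \<epsilon> * ?r powr - \<epsilon>"
      by (rule mult_right_mono) simp
    also have "\<dots> = ?r powr 0" by (simp only: powr_add[symmetric] add.right_inverse)
    also have "\<dots> = 1" using less_imp_neq[OF r] by (simp only: powr_zero_eq_one if_False eq_commute[of 0])
    finally have 1: "(nn * s / 2) powr \<epsilon> * 2 powr \<epsilon> * ?r powr - \<epsilon> \<le> 1" .
    have 8: "8 powr nn = 2 powr nn * 2 powr nn * (2 powr nn :: real)"
      by (simp add: powr_mult[symmetric])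
    have "?k * (2 powr nn * 2 powr nn / (1 - 2 powr - \<epsilon>) * ?r powr (nn - (nn + \<epsilon>)))
       = (\<beta> * (8 powr nn / (1 - 2 powr - \<epsilon>))) * ((nn * s / 2) powr \<epsilon> * 2 powr \<epsilon> * ?r powr - \<epsilon>)"
      by (simp add: powr_add[of 2 nn \<epsilon>] 8)
    also have "\<dots> \<le> (\<beta> * (8 powr nn / (1 - 2 powr - \<epsilon>))) * 1"
      using \<beta> geometric_pos by (intro mult_left_mono[OF 1] mult_nonneg_nonneg divide_nonneg_pos) auto
    finally show "?k * (2 powr nn * 2 powr nn / (1 - 2 powr - \<epsilon>) * ?r powr (nn - (nn + \<epsilon>)))
       \<le> \<beta> * (8 powr nn / (1 - 2 powr - \<epsilon>))" by simp
  qed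
  finally show ?thesis .
qed

text \<open>Slot \<open>i\<close> enters with its full L^1 norm, without growth in \<rho>, and every
  other slot with H_j \<rho>^n; hence the mass exponent mn - n in the cancellation estimate. The
  radius n s / 2 covers a cube of side s, and 2 n s is more than the three radii that cancellation
  requires.\<close>

lemma single_bad_bound:
  assumes w: "\<And>j. w j \<in> bdd_supp" and s: "s > 0"
    and supp: "\<And>y. w i y \<noteq> 0 \<Longrightarrow> y \<in> cube c (s / 2)" and zero: "(LINT y|lborel. w i y) = 0"
    and H: "\<And>j. H j \<ge> 0"
    and Q: "\<And>x j \<rho>. Q x \<Longrightarrow> j \<noteq> i \<Longrightarrow> \<rho> > 0 \<Longrightarrow>
      (\<integral>\<^sup>+y. ennreal (norm (w j y)) * indicator (cube x \<rho>) y \<partial>lborel) \<le> ennreal (H j * \<rho> powr nn)"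
  shows "AE x in lebesgue. Q x \<longrightarrow> x \<notin> cube c (2 * nn * s) \<longrightarrow>
    norm (E w x) \<le> ker_const * (\<Prod>j\<in>UNIV - {i}. H j) *
      ((LINT y|lborel. norm (w i y)) * (nn * s / 2) powr \<epsilon> * (norm (x - c) / 2) powr - (nn + \<epsilon>))"
proof -
  obtain \<eta> :: "real^'n \<Rightarrow> complex" where \<eta>: "\<eta> \<in> flat_smooth"
      "{x. \<eta> x \<noteq> 0} = box (\<chi> i. c $ i - s) (\<chi> i. c $ i + s)"
    using flat_smooth_bump_box by blast
  have \<eta>0: "w i y = 0" if "\<eta> y = 0" for y
  proof (rule ccontr)
    assume "w i y \<noteq> 0"
    from supp[OF this] have y: "\<bar>y $ l - c $ l\<bar> \<le> s / 2" for l by (simp add: mem_cube)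
    have "c $ l - s < y $ l \<and> y $ l < c $ l + s" for l using y[of l] s by linarith
    hence "y \<in> box (\<chi> i. c $ i - s) (\<chi> i. c $ i + s)" by (simp add: mem_box_cart)
    thus False using \<eta>(2) that by blast
  qed
  have b\<eta>: "bounded {x. \<eta> x \<noteq> 0}" unfolding \<eta>(2) by (rule bounded_box)
  have cl: "closure {x. \<eta> x \<noteq> 0} \<subseteq> cube c s"
    unfolding \<eta>(2) cube_def by (intro closure_minimal box_subset_cbox closed_cbox)
  let ?N = "LINT y|lborel. norm (w i y)"
  let ?\<kappa> = "?N * (\<Prod>j\<in>UNIV - {i}. H j)"
  have AE: "AE x in lebesgue. x \<notin> closure {x. \<eta> x \<noteq> 0} \<longrightarrow>
      E w x = (LINT y|lborel. K (kernel_pt x y) * (\<Prod>j\<in>UNIV. w j (y $ j)))"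
    by (rule kernel_rep[of w \<eta> i, OF w \<eta>(1) b\<eta> \<eta>0])
  have P0: "(\<Prod>j\<in>UNIV - {i}. H j) \<ge> 0" using H by (intro prod_nonneg) auto
  show ?thesis using AE
  proof eventually_elim
    case (elim x)
    show ?case
    proof (intro impI)
      assume Qx: "Q x" and x: "x \<notin> cube c (2 * nn * s)"
      have far: "norm (x - c) > 2 * nn * s" using norm_le_imp_mem_cube[of x c "2 * nn * s"] x by linarith
      have sn: "s \<le> 2 * nn * s" using s nn(3) by simp
      have "x \<notin> cube c s"
      proof
        assume "x \<in> cube c s"
        hence "x \<in> cube c (2 * nn * s)" using sn by (auto simp: mem_cube intro: order_trans)
        thus False using x by blast
      qed
      hence Ew: "E w x = (LINT y|lborel. K (kernel_pt x y) * (\<Prod>j\<in>UNIV. w j (y $ j)))"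
        using elim cl by blast
      have "norm (LINT y|lborel. K (kernel_pt x y) * (\<Prod>j\<in>UNIV. w j (y $ j)))
        \<le> ker_const * ?\<kappa> * (nn * s / 2) powr \<epsilon> * (norm (x - c) / 2) powr ((MN - nn) - MN - \<epsilon>)"
      proof (rule kernel_cancel[where i = i])
        show "0 < nn * s / 2" using s nn(2) by simp
        show "0 \<le> ?\<kappa>" using P0 by simp
        show "MN - nn \<le> MN" using nn(2) by linarith
        show "norm (y - c) \<le> nn * s / 2" if "w i y \<noteq> 0" for y
          using mem_cube_imp_norm_le[OF supp[OF that]] by (simp add: nn(1))
        have "3 * (nn * s / 2) \<le> 2 * nn * s" using s nn(2) by simp
        thus "3 * (nn * s / 2) \<le> norm (x - c)" using far by linarith
        fix \<rho> :: real assume \<rho>: "\<rho> > 0"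
        let ?J = "\<lambda>j. \<integral>\<^sup>+y. ennreal (norm (w j y)) * indicator (cube x \<rho>) y \<partial>lborel"
        have "(\<Prod>j\<in>UNIV. ?J j) = ?J i * (\<Prod>j\<in>UNIV - {i}. ?J j)" by (rule prod.remove) auto
        also have "\<dots> \<le> ennreal ?N * (\<Prod>j\<in>UNIV - {i}. ennreal (H j * \<rho> powr nn))"
        proof (intro mult_mono prod_mono_ennreal)
          have "?J i \<le> (\<integral>\<^sup>+y. ennreal (norm (w i y)) \<partial>lborel)"
            by (intro nn_integral_mono) (auto simp: indicator_def)
          also have "\<dots> = ennreal ?N"
            by (intro nn_integral_eq_integral integrable_norm integrable_bdd_supp w) auto
          finally show "?J i \<le> ennreal ?N" .
        qed (use Q[OF Qx _ \<rho>] in auto)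
        also have "(\<Prod>j\<in>UNIV - {i}. ennreal (H j * \<rho> powr nn)) = ennreal (\<Prod>j\<in>UNIV - {i}. H j * \<rho> powr nn)"
          using H by (intro prod_ennreal) auto
        also have "(\<Prod>j\<in>UNIV - {i}. H j * \<rho> powr nn) = (\<Prod>j\<in>UNIV - {i}. H j) * \<rho> powr (MN - nn)"
        proof -
          have "(\<rho> powr nn) ^ (CARD('m) - 1) = (\<rho> powr nn) powr real (CARD('m) - 1)"
            by (rule powr_realpow[symmetric]) (use \<rho> in simp)
          also have "\<dots> = \<rho> powr (nn * real (CARD('m) - 1))" by (rule powr_powr)
          also have "nn * real (CARD('m) - 1) = MN - nn"
            by (subst of_nat_diff) (auto simp: Suc_le_eq right_diff_distrib MN nn_eq)
          finally show ?thesis by (simp add: prod.distrib card_Diff_singleton)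
        qed
        also have "ennreal ?N * ennreal ((\<Prod>j\<in>UNIV - {i}. H j) * \<rho> powr (MN - nn)) = ennreal (?\<kappa> * \<rho> powr (MN - nn))"
          using P0 by (subst ennreal_mult[symmetric]) (auto simp: mult_ac)
        finally show "(\<Prod>j\<in>UNIV. ?J j) \<le> ennreal (?\<kappa> * \<rho> powr (MN - nn))" .
      qed (use w zero in auto)
      also have "(MN - nn) - MN - \<epsilon> = - (nn + \<epsilon>)" by simp
      finally show "norm (E w x) \<le> ker_const * (\<Prod>j\<in>UNIV - {i}. H j) *
          (?N * (nn * s / 2) powr \<epsilon> * (norm (x - c) / 2) powr - (nn + \<epsilon>))"
        unfolding Ew by (simp only: mult_ac)
    qed
  qed
qed

section \<open>Weak-type bound for step functions\<close>

definition tail_const :: real where "tail_const = 8 powr nn / (1 - 2 powr - \<epsilon>)"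

lemma tail_const_pos: "tail_const > 0"
  unfolding tail_const_def using geometric_pos by (intro divide_pos_pos) auto

text \<open>Markov's inequality for the q-th power. From |g_j|^(q_j) at most G_j^(q_j - 1) |g_j|
  each integral is at most G_j^(q_j) V, and since the exponents q / q_j add up to 1, exactly the
  first power of \<open>V\<close> survives.\<close>

lemma strong_type_bound:
  fixes g :: "'m \<Rightarrow> real^'n \<Rightarrow> complex"
  assumes g: "\<And>j. g j \<in> bdd_supp" and G: "\<And>j. G j > 0" "\<And>j x. norm (g j x) \<le> G j" and V: "V > 0"
    and gV: "\<And>j. (LINT x|lborel. norm (g j x)) \<le> G j * V" and B: "B > 0"
  shows "emeasure lebesgue {x. norm (E g x) > B * (\<Prod>j\<in>UNIV. G j)} \<le> ennreal (C powr q * V / B powr q)"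
proof -
  let ?I = "LINT x|lebesgue. norm (E g x) powr q"
  let ?T = "B * (\<Prod>j\<in>UNIV. G j)"
  have T: "?T > 0" using B G by (intro mult_pos_pos prod_pos) auto
  have gL: "\<And>j. g j \<in> Lp_space (qs j)" by (intro Lp_bdd_supp g)
  have [measurable]: "E g \<in> borel_measurable lebesgue" by (rule E_measurable[OF gL])
  have gi: "(LINT x|lebesgue. norm (g j x) powr qs j) \<le> G j powr qs j * V" for j
  proof -
    have bm: "g j \<in> borel_measurable borel" by (rule bdd_supp_measurable[OF g])
    have "(LINT x|lebesgue. norm (g j x) powr qs j) = (LINT x|lborel. norm (g j x) powr qs j)"
      by (rule integral_completion) (use bm in measurable)
    also have "\<dots> \<le> (LINT x|lborel. G j powr (qs j - 1) * norm (g j x))"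
    proof (rule integral_mono)
      show "integrable lborel (\<lambda>x. norm (g j x) powr qs j)"
        using gL[of j] bm by (simp add: Lp_space_def integrable_completion)
      show "integrable lborel (\<lambda>x. G j powr (qs j - 1) * norm (g j x))"
        by (intro integrable_mult_right integrable_norm integrable_bdd_supp g)
      show "norm (g j x) powr qs j \<le> G j powr (qs j - 1) * norm (g j x)" for x
      proof (cases "g j x = 0")
        case False
        have "norm (g j x) powr qs j = norm (g j x) powr (qs j - 1) * norm (g j x) powr 1"
          by (subst powr_add[symmetric]) simp
        also have "\<dots> \<le> G j powr (qs j - 1) * norm (g j x) powr 1"
          using G(2)[of j x] qs[of j] by (intro mult_right_mono powr_mono2) auto
        finally show ?thesis by simp
      qed simp
    qed
    also have "\<dots> = G j powr (qs j - 1) * (LINT x|lborel. norm (g j x))" by simp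
    also have "\<dots> \<le> G j powr (qs j - 1) * (G j * V)" by (intro mult_left_mono gV) simp
    also have "\<dots> = G j powr (qs j - 1) * G j powr 1 * V" using G(1)[of j] by simp
    also have "G j powr (qs j - 1) * G j powr 1 = G j powr qs j" by (subst powr_add[symmetric]) simp
    finally show ?thesis .
  qed
  have "?I \<le> C powr q * (\<Prod>j\<in>UNIV. (LINT x|lebesgue. norm (g j x) powr qs j) powr (q / qs j))"
    by (rule E_integral_le[OF gL])
  also have "\<dots> \<le> C powr q * (\<Prod>j\<in>UNIV. (G j powr q) * V powr (q / qs j))"
  proof (intro mult_left_mono prod_mono conjI)
    fix j
    have "(LINT x|lebesgue. norm (g j x) powr qs j) powr (q / qs j) \<le> (G j powr qs j * V) powr (q / qs j)"
      using gi[of j] q_pos qs_pos[of j] by (intro powr_mono2) auto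
    also have "\<dots> = (G j powr q) * V powr (q / qs j)"
      using qs_pos[of j] by (simp add: powr_mult powr_powr)
    finally show "(LINT x|lebesgue. norm (g j x) powr qs j) powr (q / qs j) \<le> (G j powr q) * V powr (q / qs j)" .
  qed auto
  also have "(\<Prod>j\<in>UNIV. (G j powr q) * V powr (q / qs j)) = (\<Prod>j\<in>UNIV. G j) powr q * V"
  proof -
    have "(\<Prod>j\<in>UNIV. V powr (q / qs j)) = V powr (\<Sum>j\<in>UNIV. q / qs j)"
      using V by (intro powr_sum[symmetric]) auto
    also have "(\<Sum>j\<in>UNIV. q / qs j) = q * (\<Sum>j\<in>UNIV. 1 / qs j)" by (simp add: sum_distrib_left)
    also have "\<dots> = 1" using q_pos by (simp flip: q_eq)
    finally show ?thesis using V by (simp add: prod.distrib prod_powr_distrib)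
  qed
  finally have I: "?I \<le> C powr q * ((\<Prod>j\<in>UNIV. G j) powr q * V)" .
  have "emeasure lebesgue {x. norm (E g x) > ?T} \<le> emeasure lebesgue {x \<in> space lebesgue. norm (E g x) powr q \<ge> ?T powr q}"
  proof (rule emeasure_mono)
    have "?T powr q \<le> norm (E g x) powr q" if "norm (E g x) > ?T" for x
      by (rule powr_mono2[OF less_imp_le[OF q_pos] less_imp_le[OF T] less_imp_le[OF that]])
    thus "{x. norm (E g x) > ?T} \<subseteq> {x \<in> space lebesgue. norm (E g x) powr q \<ge> ?T powr q}" by simp blast
  qed measurable
  also have "\<dots> \<le> ennreal ((1 / ?T powr q) * ?I)"
  proof (rule integral_Markov_inequality)
    show "integrable lebesgue (\<lambda>x. norm (E g x) powr q)"
      using conjunct1[OF bdd[OF gL]] unfolding Lp_space_def by blast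
    show "0 < ?T powr q" using T by (simp only: powr_gt_zero less_imp_neq[symmetric] not_False_eq_True)
    show "AE x in lebesgue. 0 \<le> norm (E g x) powr q" by (intro AE_I2 powr_ge_zero)
  qed
  also have "\<dots> \<le> ennreal (C powr q * V / B powr q)"
  proof (rule ennreal_leI)
    have "(\<Prod>j\<in>UNIV. G j) > 0" by (intro prod_pos ballI G(1))
    hence "(\<Prod>j\<in>UNIV. G j) powr q \<noteq> 0"
      by (simp only: powr_eq_0_iff less_imp_neq[symmetric] not_False_eq_True)
    from frac_cancel_middle[OF this, of "B powr q" "C powr q" V]
    have eq: "(1 / ?T powr q) * (C powr q * ((\<Prod>j\<in>UNIV. G j) powr q * V)) = C powr q * V / B powr q"
      by (simp only: powr_mult)
    have "(1 / ?T powr q) * ?I \<le> (1 / ?T powr q) * (C powr q * ((\<Prod>j\<in>UNIV. G j) powr q * V))"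
      by (rule mult_left_mono[OF I]) simp
    thus "(1 / ?T powr q) * ?I \<le> C powr q * V / B powr q" by (simp only: eq)
  qed
  finally show ?thesis .
qed

text \<open>Each argument is decomposed at its own height \<Lambda> Av_j, so that products of
  heights reproduce the product of the \<open>Av j\<close>. The exceptional set consists of the
  dilated stopping cubes, the points where the bad tails of some slot reach its height, and the
  points where the good tuple gives a large value. \<open>\<Lambda>\<close> and \<open>B\<close>
  remain free, to make this set as small as desired.\<close>

lemma weak_type_step_aux:
  fixes f :: "'m \<Rightarrow> real^'n \<Rightarrow> complex"
  assumes L: "L > 0" and Av: "\<And>j. Av j > 0" and f: "\<And>j. f j \<in> bdd_supp"
    and step: "\<And>j x y. y \<in> dcube a L K0 x \<Longrightarrow> f j y = f j x"
    and nf: "\<And>j. (LINT x|lborel. norm (f j x)) \<le> Av j * L ^ CARD('n)"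
    and \<Lambda>: "\<Lambda> \<ge> 1" and B: "B > 0"
  shows "\<exists>Z\<in>sets lebesgue. emeasure lebesgue Z \<le>
      ennreal ((real CARD('m) * (4 * nn) ^ CARD('n) / \<Lambda> + real CARD('m) * (2 * tail_const / \<Lambda>) + 3 * C powr q / B powr q) * L ^ CARD('n)) \<and>
    (AE x in lebesgue. x \<notin> Z \<longrightarrow> norm (E f x) \<le>
      (B * (2 ^ CARD('n) * \<Lambda>) ^ CARD('m) + real CARD('m) * ker_const * (2 * 12 ^ CARD('n) * \<Lambda>) ^ CARD('m)) * (\<Prod>j\<in>UNIV. Av j))"
proof -
  let ?n = "CARD('n)" and ?m = "CARD('m)"
  define h where "h j = \<Lambda> * Av j" for j
  have h: "h j > 0" for j using \<Lambda> Av[of j] by (simp add: h_def)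
  have Avh: "Av j \<le> h j" for j using \<Lambda> Av[of j] by (simp add: h_def)
  let ?nf = "\<lambda>j. LINT x|lborel. norm (f j x)"
  have Ln: "L ^ ?n > 0" using L by simp
  define Q where "Q j F b c s \<longleftrightarrow> finite F \<and>
    (\<forall>P\<in>F. b P \<in> bdd_supp \<and> s P > 0 \<and> (\<forall>y. b P y \<noteq> 0 \<longrightarrow> y \<in> cube (c P) (s P / 2)) \<and>
      (LINT y|lborel. b P y) = 0) \<and>
    (\<Sum>P\<in>F. LINT y|lborel. norm (b P y)) \<le> 2 * ?nf j \<and>
    (\<Sum>P\<in>F. s P ^ CARD('n)) \<le> ?nf j / h j \<and>
    (\<forall>x. norm (f j x - (\<Sum>P\<in>F. b P x)) \<le> 2 ^ CARD('n) * h j) \<and>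
    (\<forall>\<kappa>\<ge>1. \<forall>x. (\<forall>P\<in>F. x \<notin> cube (c P) (\<kappa> * s P)) \<longrightarrow> (\<forall>\<rho>>0.
      (\<integral>\<^sup>+y. ennreal (norm (f j y)) * indicator (cube x \<rho>) y \<partial>lborel) \<le> ennreal (2 * 12 ^ CARD('n) * h j * \<rho> ^ CARD('n))))"
    for j and F :: "(real^'n) set set" and b c s
  have "\<exists>F b c s. Q j F b c s" for j
  proof -
    have "?nf j \<le> h j * L ^ ?n"
      using nf[of j] Avh[of j] Ln by (meson less_imp_le mult_right_mono order_trans)
    thus ?thesis unfolding Q_def by (intro cz_decomposition[of L "h j" "f j" a K0] L h f step)
  qed
  hence "\<forall>j. \<exists>F b c s. Q j F b c s" by (rule allI)
  from choice[OF this] obtain F where "\<forall>j. \<exists>b c s. Q j (F j) b c s" by (rule exE)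
  from choice[OF this] obtain b where "\<forall>j. \<exists>c s. Q j (F j) (b j) c s" by (rule exE)
  from choice[OF this] obtain c where "\<forall>j. \<exists>s. Q j (F j) (b j) (c j) s" by (rule exE)
  from choice[OF this] obtain s where Q: "\<forall>j. Q j (F j) (b j) (c j) (s j)" by (rule exE)
  have F: "finite (F j)" for j using Q unfolding Q_def by blast
  have b: "b j P \<in> bdd_supp" "s j P > 0" "b j P y \<noteq> 0 \<Longrightarrow> y \<in> cube (c j P) (s j P / 2)"
    "(LINT y|lborel. b j P y) = 0" if "P \<in> F j" for j P y
    using Q that unfolding Q_def by blast+
  have sb: "(\<Sum>P\<in>F j. LINT y|lborel. norm (b j P y)) \<le> 2 * ?nf j" for j using Q unfolding Q_def by blast
  have ss: "(\<Sum>P\<in>F j. s j P ^ ?n) \<le> ?nf j / h j" for j using Q unfolding Q_def by blast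
  have good: "norm (f j x - (\<Sum>P\<in>F j. b j P x)) \<le> 2 ^ ?n * h j" for j x using Q unfolding Q_def by blast
  have loc: "(\<integral>\<^sup>+y. ennreal (norm (f j y)) * indicator (cube x \<rho>) y \<partial>lborel) \<le> ennreal (2 * 12 ^ ?n * h j * \<rho> ^ ?n)"
    if "\<kappa> \<ge> 1" "\<forall>P\<in>F j. x \<notin> cube (c j P) (\<kappa> * s j P)" "\<rho> > 0" for j \<kappa> x \<rho>
    using Q that unfolding Q_def by blast
  define g where "g j x = f j x - (\<Sum>P\<in>F j. b j P x)" for j x
  have sum_b: "(\<lambda>x. \<Sum>P\<in>F j. b j P x) \<in> bdd_supp" for j
    by (rule conjunct1[OF E_sum[of f "F j" "b j", OF f F b(1)]])
  have g: "g j \<in> bdd_supp" for j unfolding g_def[abs_def] by (rule bdd_supp_diff[OF f sum_b])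
  have g_le: "norm (g j x) \<le> 2 ^ ?n * h j" for j x unfolding g_def by (rule good)
  have ng: "(LINT x|lborel. norm (g j x)) \<le> 3 * ?nf j" for j
  proof -
    have "(LINT x|lborel. norm (g j x)) \<le> (LINT x|lborel. norm (f j x) + (\<Sum>P\<in>F j. norm (b j P x)))"
    proof (rule integral_mono)
      show "integrable lborel (\<lambda>x. norm (g j x))" by (intro integrable_norm integrable_bdd_supp g)
      show "integrable lborel (\<lambda>x. norm (f j x) + (\<Sum>P\<in>F j. norm (b j P x)))"
        by (intro Bochner_Integration.integrable_add Bochner_Integration.integrable_sum integrable_norm integrable_bdd_supp f b)
      show "norm (g j x) \<le> norm (f j x) + (\<Sum>P\<in>F j. norm (b j P x))" for x
        unfolding g_def by (rule order_trans[OF norm_triangle_ineq4]) (intro add_left_mono norm_sum)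
    qed
    also have "\<dots> = ?nf j + (\<Sum>P\<in>F j. LINT y|lborel. norm (b j P y))"
      by (subst Bochner_Integration.integral_add; (subst Bochner_Integration.integral_sum)?)
        (auto intro!: Bochner_Integration.integrable_sum integrable_norm integrable_bdd_supp f b)
    finally show ?thesis using sb[of j] by linarith
  qed
  \<comment> \<open>One bound for the averages of \<open>f j\<close> off \<open>\<Omega>\<close> and
    of \<open>g j\<close> everywhere, because the telescoped tuples mix the two.\<close>
  define H where "H j = 2 * 12 ^ ?n * h j" for j
  have H: "H j > 0" for j using h[of j] by (simp add: H_def)
  define \<Omega> where "\<Omega> = (\<Union>j. \<Union>P\<in>F j. cube (c j P) (2 * nn * s j P))"
  have \<Omega>_meas [measurable]: "\<Omega> \<in> sets borel" unfolding \<Omega>_def using F by (intro sets.finite_UN) auto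
  have nn2: "2 * nn \<ge> 1" using nn(3) by linarith
  have loc_f: "(\<integral>\<^sup>+y. ennreal (norm (f j y)) * indicator (cube x \<rho>) y \<partial>lborel) \<le> ennreal (H j * \<rho> powr nn)"
    if "x \<notin> \<Omega>" "\<rho> > 0" for j x \<rho>
  proof -
    have "\<rho> ^ ?n = \<rho> powr nn" using that(2) by (simp add: nn(1) powr_realpow)
    thus ?thesis using loc[OF nn2, of j x \<rho>] that unfolding H_def \<Omega>_def by auto
  qed
  have loc_g: "(\<integral>\<^sup>+y. ennreal (norm (g j y)) * indicator (cube x \<rho>) y \<partial>lborel) \<le> ennreal (H j * \<rho> powr nn)"
    if "\<rho> > 0" for j x \<rho>
  proof -
    have "(\<integral>\<^sup>+y. ennreal (norm (g j y)) * indicator (cube x \<rho>) y \<partial>lborel)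
      \<le> (\<integral>\<^sup>+y. ennreal (2 ^ ?n * h j) * indicator (cube x \<rho>) y \<partial>lborel)"
      by (intro nn_integral_mono mult_right_mono ennreal_leI g_le) simp
    also have "\<dots> = ennreal (2 ^ ?n * h j * (2 * \<rho>) ^ ?n)"
      using that h[of j] by (simp add: nn_integral_cmult_indicator emeasure_cube ennreal_mult)
    also have "\<dots> \<le> ennreal (H j * \<rho> powr nn)"
    proof (rule ennreal_leI)
      have "2 ^ ?n * h j * (2 * \<rho>) ^ ?n = (2 ^ ?n * 2 ^ ?n) * (h j * \<rho> ^ ?n)"
        by (simp add: power_mult_distrib)
      also have "(2 ^ ?n * 2 ^ ?n :: real) = 4 ^ ?n" by (simp add: power_mult_distrib[symmetric])
      also have "4 ^ ?n * (h j * \<rho> ^ ?n) \<le> (2 * 12 ^ ?n) * (h j * \<rho> ^ ?n)"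
      proof (rule mult_right_mono)
        have "(4::real) ^ ?n \<le> 12 ^ ?n" by (intro power_mono) auto
        moreover have "(0::real) \<le> 12 ^ ?n" by simp
        ultimately show "(4::real) ^ ?n \<le> 2 * 12 ^ ?n" by linarith
      qed (use that h[of j] in auto)
      also have "\<dots> = H j * \<rho> powr nn" using that by (simp add: H_def nn(1) powr_realpow)
      finally show "2 ^ ?n * h j * (2 * \<rho>) ^ ?n \<le> H j * \<rho> powr nn" .
    qed
    finally show ?thesis .
  qed
  \<comment> \<open>\<open>t i P\<close> majorises, up to a constant, the effect of one bad function
    of slot \<open>i\<close> outside its dilated cube.\<close>
  define t where "t i P x = (LINT y|lborel. norm (b i P y)) * (nn * s i P / 2) powr \<epsilon> * (norm (x - c i P) / 2) powr - (nn + \<epsilon>)"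
    for i P x
  define J where "J i x = (\<Sum>P\<in>F i. t i P x)" for i x
  have t0: "t i P x \<ge> 0" for i P x by (simp add: t_def)
  have J0: "J i x \<ge> 0" for i x unfolding J_def by (intro sum_nonneg t0)
  have t_meas [measurable]: "t i P \<in> borel_measurable borel" for i P unfolding t_def[abs_def] by measurable
  have J_meas [measurable]: "J i \<in> borel_measurable borel" for i unfolding J_def[abs_def] by measurable
  define PH where "PH i = (\<Prod>j\<in>UNIV - {i}. H j)" for i
  have PH0: "PH i \<ge> 0" for i unfolding PH_def using H by (intro prod_nonneg) (auto intro: less_imp_le)
  \<comment> \<open>Slot \<open>i\<close> carries the sum of its bad functions. Finite additivity
    splits it, and each summand is estimated off \<open>\<Omega>\<close>, where all other slots,
    decomposed or not, have controlled averages.\<close>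
  have tele: "AE x in lebesgue. x \<notin> \<Omega> \<longrightarrow>
       norm (E ((\<lambda>j. if j \<in> I then g j else f j)(i := \<lambda>x. f i x - g i x)) x - 0) \<le> ker_const * PH i * J i x"
    if i: "i \<notin> I" for i I
  proof -
    let ?w = "\<lambda>j. if j \<in> I then g j else f j"
    have w: "?w j \<in> bdd_supp" for j using f g by simp
    have dif: "(\<lambda>x. f i x - g i x) = (\<lambda>x. \<Sum>P\<in>F i. b i P x)" by (simp add: g_def)
    have lin: "AE x in lebesgue. E (?w(i := \<lambda>x. \<Sum>P\<in>F i. b i P x)) x = (\<Sum>P\<in>F i. E (?w(i := b i P)) x)"
      by (rule conjunct2[OF E_sum[of ?w "F i" "b i", OF w F b(1)]])
    have each: "AE x in lebesgue. x \<notin> \<Omega> \<longrightarrow> norm (E (?w(i := b i P)) x) \<le> ker_const * PH i * t i P x" if P: "P \<in> F i" for P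
    proof -
      have "AE x in lebesgue. x \<notin> \<Omega> \<longrightarrow> x \<notin> cube (c i P) (2 * nn * s i P) \<longrightarrow>
        norm (E (?w(i := b i P)) x) \<le> ker_const * (\<Prod>j\<in>UNIV - {i}. H j) *
          ((LINT y|lborel. norm ((?w(i := b i P)) i y)) * (nn * s i P / 2) powr \<epsilon> * (norm (x - c i P) / 2) powr - (nn + \<epsilon>))"
      proof (rule single_bad_bound)
        show "(?w(i := b i P)) j \<in> bdd_supp" for j using w b(1)[OF P] by simp
        show "0 < s i P" by (rule b(2)[OF P])
        show "y \<in> cube (c i P) (s i P / 2)" if "(?w(i := b i P)) i y \<noteq> 0" for y using that b(3)[OF P] by simp
        show "(LINT y|lborel. (?w(i := b i P)) i y) = 0" using b(4)[OF P] by simp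
        show "0 \<le> H j" for j using H[of j] by simp
        show "(\<integral>\<^sup>+y. ennreal (norm ((?w(i := b i P)) j y)) * indicator (cube x \<rho>) y \<partial>lborel) \<le> ennreal (H j * \<rho> powr nn)"
          if "x \<notin> \<Omega>" "j \<noteq> i" "\<rho> > 0" for x j \<rho>
          using loc_f[OF that(1,3), of j] loc_g[OF that(3), of j x] that(2) by simp
      qed
      moreover have "x \<notin> \<Omega> \<Longrightarrow> x \<notin> cube (c i P) (2 * nn * s i P)" for x using P unfolding \<Omega>_def by blast
      ultimately show ?thesis by (simp add: PH_def t_def)
    qed
    have "AE x in lebesgue. \<forall>P\<in>F i. x \<notin> \<Omega> \<longrightarrow> norm (E (?w(i := b i P)) x) \<le> ker_const * PH i * t i P x"
      using each by (simp only: AE_finite_all[OF F]) blast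
    with lin show ?thesis unfolding dif
    proof eventually_elim
      case (elim x)
      show ?case
      proof
        assume x: "x \<notin> \<Omega>"
        have "norm (\<Sum>P\<in>F i. E (?w(i := b i P)) x) \<le> (\<Sum>P\<in>F i. ker_const * PH i * t i P x)"
          using elim(2) x by (intro sum_norm_le) blast
        also have "\<dots> = ker_const * PH i * J i x" unfolding J_def by (rule sum_distrib_left[symmetric])
        finally show "norm (E (?w(i := \<lambda>x. \<Sum>P\<in>F i. b i P x)) x - 0) \<le> ker_const * PH i * J i x"
          unfolding elim(1) diff_zero .
      qed
    qed
  qed
  have "\<exists>c'. ((\<lambda>_ _. 0 :: complex) = (\<lambda>(_::'m) (_::'m set). 0 :: complex) \<longrightarrow> c' = 0) \<and> (AE x in lebesgue. x \<notin> \<Omega> \<longrightarrow>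
     norm (E f x - E (\<lambda>j. if j \<in> UNIV then g j else f j) x - c') \<le> (\<Sum>i\<in>UNIV. ker_const * PH i * J i x))"
    by (rule E_telescope[of f g _ "\<lambda>_ _. 0", OF f g tele]) auto
  hence AE1: "AE x in lebesgue. x \<notin> \<Omega> \<longrightarrow> norm (E f x - E g x) \<le> (\<Sum>i\<in>UNIV. ker_const * PH i * J i x)"
    by auto
  \<comment> \<open>The shape required by Markov's inequality for the tails of slot \<open>i\<close>
    at level \<open>h i\<close>, restricted to the complement of \<open>\<Omega>\<close>.\<close>
  define Zi where "Zi i = {x \<in> UNIV. 1 \<le> ennreal (1 / h i) * (indicator (- \<Omega>) x * ennreal (J i x))}" for i
  have Zi_meas [measurable]: "Zi i \<in> sets borel" for i unfolding Zi_def by measurable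
  have em_Zi: "emeasure lborel (Zi i) \<le> ennreal (2 * tail_const / \<Lambda> * L ^ ?n)" for i
  proof -
    have "emeasure lborel (Zi i) = emeasure lborel ({x \<in> UNIV. 1 \<le> ennreal (1 / h i) * (indicator (- \<Omega>) x * ennreal (J i x))})"
      by (simp add: Zi_def)
    also have "\<dots> \<le> ennreal (1 / h i) * (\<integral>\<^sup>+x. (indicator (- \<Omega>) x * ennreal (J i x)) * indicator UNIV x \<partial>lborel)"
      by (rule nn_integral_Markov_inequality) measurable
    also have "(\<integral>\<^sup>+x. (indicator (- \<Omega>) x * ennreal (J i x)) * indicator UNIV x \<partial>lborel)
      \<le> (\<integral>\<^sup>+x. (\<Sum>P\<in>F i. indicator {x. 2 * nn * s i P \<le> norm (x - c i P)} x * ennreal (t i P x)) \<partial>lborel)"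
    proof (rule nn_integral_mono)
      fix x
      show "(indicator (- \<Omega>) x * ennreal (J i x)) * indicator UNIV x
        \<le> (\<Sum>P\<in>F i. indicator {x. 2 * nn * s i P \<le> norm (x - c i P)} x * ennreal (t i P x))"
      proof (cases "x \<in> \<Omega>")
        case False
        have "2 * nn * s i P \<le> norm (x - c i P)" if "P \<in> F i" for P
        proof -
          have "x \<notin> cube (c i P) (2 * nn * s i P)" using False that unfolding \<Omega>_def by blast
          thus ?thesis using norm_le_imp_mem_cube[of x "c i P" "2 * nn * s i P"] by linarith
        qed
        hence "(\<Sum>P\<in>F i. indicator {x. 2 * nn * s i P \<le> norm (x - c i P)} x * ennreal (t i P x)) = (\<Sum>P\<in>F i. ennreal (t i P x))"
          by (intro sum.cong) auto
        also have "\<dots> = ennreal (J i x)" unfolding J_def by (intro sum_ennreal t0)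
        finally show ?thesis using False by simp
      qed simp
    qed
    also have "\<dots> = (\<Sum>P\<in>F i. \<integral>\<^sup>+x. indicator {x. 2 * nn * s i P \<le> norm (x - c i P)} x * ennreal (t i P x) \<partial>lborel)"
      by (rule nn_integral_sum) measurable
    also have "\<dots> \<le> (\<Sum>P\<in>F i. ennreal ((LINT y|lborel. norm (b i P y)) * tail_const))"
      unfolding t_def tail_const_def by (intro sum_mono tail_integral_le b) simp_all
    also have "\<dots> = ennreal (\<Sum>P\<in>F i. (LINT y|lborel. norm (b i P y)) * tail_const)"
      using tail_const_pos by (intro sum_ennreal) simp
    also have "\<dots> \<le> ennreal (2 * (Av i * L ^ ?n) * tail_const)"
    proof (rule ennreal_leI)
      have "(\<Sum>P\<in>F i. (LINT y|lborel. norm (b i P y)) * tail_const) = (\<Sum>P\<in>F i. LINT y|lborel. norm (b i P y)) * tail_const"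
        by (rule sum_distrib_right[symmetric])
      also have "\<dots> \<le> 2 * (Av i * L ^ ?n) * tail_const"
        using sb[of i] nf[of i] tail_const_pos by (intro mult_right_mono) linarith+
      finally show "(\<Sum>P\<in>F i. (LINT y|lborel. norm (b i P y)) * tail_const) \<le> 2 * (Av i * L ^ ?n) * tail_const" .
    qed
    finally have "emeasure lborel (Zi i) \<le> ennreal (1 / h i) * ennreal (2 * (Av i * L ^ ?n) * tail_const)"
      by (simp add: mult_left_mono)
    also have "\<dots> = ennreal (1 / h i * (2 * (Av i * L ^ ?n) * tail_const))"
      using h[of i] by (intro ennreal_mult'[symmetric]) simp
    also have "1 / h i * (2 * (Av i * L ^ ?n) * tail_const) = 2 * tail_const / \<Lambda> * L ^ ?n"
      using Av[of i] \<Lambda> by (simp add: h_def field_simps)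
    finally show ?thesis .
  qed
  \<comment> \<open>The sum of s^n in slot j is at most the L^1 norm divided by the height, that is
    L^n / \<Lambda>; the dilated cubes have side 4 n s.\<close>
  have em_\<Omega>: "emeasure lborel \<Omega> \<le> ennreal (real ?m * (4 * nn) ^ ?n / \<Lambda> * L ^ ?n)"
  proof -
    have "emeasure lborel \<Omega> \<le> (\<Sum>j\<in>UNIV. emeasure lborel (\<Union>P\<in>F j. cube (c j P) (2 * nn * s j P)))"
      unfolding \<Omega>_def using F by (intro emeasure_subadditive_finite) (auto intro!: sets.finite_UN)
    also have "\<dots> \<le> (\<Sum>j\<in>(UNIV::'m set). ennreal ((4 * nn) ^ ?n / \<Lambda> * L ^ ?n))"
    proof (rule sum_mono)
      fix j
      have "emeasure lborel (\<Union>P\<in>F j. cube (c j P) (2 * nn * s j P)) \<le> (\<Sum>P\<in>F j. emeasure lborel (cube (c j P) (2 * nn * s j P)))"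
        using F by (intro emeasure_subadditive_finite) auto
      also have "\<dots> = (\<Sum>P\<in>F j. ennreal ((4 * nn) ^ ?n * s j P ^ ?n))"
      proof (rule sum.cong[OF refl])
        fix P assume P: "P \<in> F j"
        have "2 * nn * s j P > 0" using b(2)[OF P] nn(2) by simp
        from emeasure_cube[OF less_imp_le[OF this], of "c j P"]
        have "emeasure lborel (cube (c j P) (2 * nn * s j P)) = ennreal ((2 * (2 * nn * s j P)) ^ ?n)" .
        also have "2 * (2 * nn * s j P) = (4 * nn) * s j P" by simp
        finally show "emeasure lborel (cube (c j P) (2 * nn * s j P)) = ennreal ((4 * nn) ^ ?n * s j P ^ ?n)"
          unfolding power_mult_distrib .
      qed
      also have "\<dots> = ennreal (\<Sum>P\<in>F j. (4 * nn) ^ ?n * s j P ^ ?n)"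
      proof (rule sum_ennreal)
        fix P assume P: "P \<in> F j"
        have "(4 * nn) ^ ?n > 0" "s j P ^ ?n > 0" using nn(2) b(2)[OF P] by simp_all
        thus "0 \<le> (4 * nn) ^ ?n * s j P ^ ?n" by simp
      qed
      also have "\<dots> \<le> ennreal ((4 * nn) ^ ?n / \<Lambda> * L ^ ?n)"
      proof (rule ennreal_leI)
        have "(\<Sum>P\<in>F j. (4 * nn) ^ ?n * s j P ^ ?n) = (4 * nn) ^ ?n * (\<Sum>P\<in>F j. s j P ^ ?n)"
          by (rule sum_distrib_left[symmetric])
        also have "\<dots> \<le> (4 * nn) ^ ?n * (Av j * L ^ ?n / h j)"
          using nn(2) ss[of j] divide_right_mono[OF nf[of j], of "h j"] h[of j]
          by (intro mult_left_mono zero_le_power) linarith+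
        also have "\<dots> = (4 * nn) ^ ?n / \<Lambda> * L ^ ?n" using Av[of j] \<Lambda> by (simp add: h_def)
        finally show "(\<Sum>P\<in>F j. (4 * nn) ^ ?n * s j P ^ ?n) \<le> (4 * nn) ^ ?n / \<Lambda> * L ^ ?n" .
      qed
      finally show "emeasure lborel (\<Union>P\<in>F j. cube (c j P) (2 * nn * s j P)) \<le> ennreal ((4 * nn) ^ ?n / \<Lambda> * L ^ ?n)" .
    qed
    also have "\<dots> = ennreal (real ?m * ((4 * nn) ^ ?n / \<Lambda> * L ^ ?n))"
      using nn(2) \<Lambda> L by (subst ennreal_mult) (auto simp: ennreal_of_nat_eq_real_of_nat)
    finally show ?thesis by (simp add: mult.assoc)
  qed
  define Zg where "Zg = {x. norm (E g x) > B * (\<Prod>j\<in>UNIV. 2 ^ ?n * h j)}"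
  have [measurable]: "E g \<in> borel_measurable lebesgue" by (intro E_measurable Lp_bdd_supp g)
  have "Zg = {x \<in> space lebesgue. norm (E g x) > B * (\<Prod>j\<in>UNIV. 2 ^ ?n * h j)}" by (simp add: Zg_def)
  also have "\<dots> \<in> sets lebesgue" by measurable
  finally have Zg_meas: "Zg \<in> sets lebesgue" .
  have em_Zg: "emeasure lebesgue Zg \<le> ennreal (C powr q * (3 * L ^ ?n) / B powr q)"
    unfolding Zg_def
  proof (rule strong_type_bound[OF g _ g_le _ _ B])
    show "0 < 2 ^ ?n * h j" for j using h[of j] by simp
    show "0 < 3 * L ^ ?n" using Ln by simp
    show "(LINT x|lborel. norm (g j x)) \<le> 2 ^ ?n * h j * (3 * L ^ ?n)" for j
    proof -
      have "(LINT x|lborel. norm (g j x)) \<le> 3 * (Av j * L ^ ?n)" using ng[of j] nf[of j] by linarith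
      also have "\<dots> = 1 * Av j * (3 * L ^ ?n)" by simp
      also have "\<dots> \<le> 2 ^ ?n * h j * (3 * L ^ ?n)"
        using Avh[of j] Av[of j] L by (intro mult_right_mono mult_mono one_le_power) auto
      finally show ?thesis .
    qed
  qed
  let ?Z = "\<Omega> \<union> (\<Union>i. Zi i) \<union> Zg"
  have leb: "A \<in> sets lebesgue" "emeasure lebesgue A = emeasure lborel A" if "A \<in> sets borel" for A :: "(real^'n) set"
    using that by (auto simp: emeasure_completion)
  have UZ: "(\<Union>i. Zi i) \<in> sets borel" by (intro sets.finite_UN) auto
  show ?thesis
  proof (intro bexI[of _ ?Z] conjI)
    show "?Z \<in> sets lebesgue" using leb(1)[OF \<Omega>_meas] leb(1)[OF UZ] Zg_meas by (intro sets.Un)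
    have "emeasure lebesgue ?Z \<le> emeasure lebesgue (\<Omega> \<union> (\<Union>i. Zi i)) + emeasure lebesgue Zg"
      using leb(1)[OF \<Omega>_meas] leb(1)[OF UZ] Zg_meas by (intro emeasure_subadditive sets.Un)
    also have "\<dots> \<le> (emeasure lebesgue \<Omega> + emeasure lebesgue (\<Union>i. Zi i)) + emeasure lebesgue Zg"
      using leb(1)[OF \<Omega>_meas] leb(1)[OF UZ] by (intro add_right_mono emeasure_subadditive)
    also have "\<dots> \<le> (ennreal (real ?m * (4 * nn) ^ ?n / \<Lambda> * L ^ ?n) + (\<Sum>i\<in>(UNIV::'m set). ennreal (2 * tail_const / \<Lambda> * L ^ ?n))) + ennreal (C powr q * (3 * L ^ ?n) / B powr q)"
    proof (intro add_mono em_Zg)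
      show "emeasure lebesgue \<Omega> \<le> ennreal (real ?m * (4 * nn) ^ ?n / \<Lambda> * L ^ ?n)"
        using em_\<Omega> leb(2)[OF \<Omega>_meas] by simp
      have "emeasure lborel (\<Union>i. Zi i) \<le> (\<Sum>i\<in>UNIV. emeasure lborel (Zi i))"
        by (intro emeasure_subadditive_finite) auto
      also have "\<dots> \<le> (\<Sum>i\<in>(UNIV::'m set). ennreal (2 * tail_const / \<Lambda> * L ^ ?n))"
        by (intro sum_mono em_Zi)
      finally show "emeasure lebesgue (\<Union>i. Zi i) \<le> (\<Sum>i\<in>(UNIV::'m set). ennreal (2 * tail_const / \<Lambda> * L ^ ?n))"
        using leb(2)[OF UZ] by simp
    qed
    also have "(\<Sum>i\<in>(UNIV::'m set). ennreal (2 * tail_const / \<Lambda> * L ^ ?n)) = ennreal (real ?m * (2 * tail_const / \<Lambda> * L ^ ?n))"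
      using tail_const_pos \<Lambda> L by (subst ennreal_mult) (auto simp: ennreal_of_nat_eq_real_of_nat)
    also have "ennreal (real ?m * (4 * nn) ^ ?n / \<Lambda> * L ^ ?n) + ennreal (real ?m * (2 * tail_const / \<Lambda> * L ^ ?n)) + ennreal (C powr q * (3 * L ^ ?n) / B powr q)
       = ennreal (real ?m * (4 * nn) ^ ?n / \<Lambda> * L ^ ?n + real ?m * (2 * tail_const / \<Lambda> * L ^ ?n) + C powr q * (3 * L ^ ?n) / B powr q)"
      using nn(2) \<Lambda> L tail_const_pos by (intro ennreal_plus3 mult_nonneg_nonneg divide_nonneg_nonneg) auto
    also have "real ?m * (4 * nn) ^ ?n / \<Lambda> * L ^ ?n + real ?m * (2 * tail_const / \<Lambda> * L ^ ?n) + C powr q * (3 * L ^ ?n) / B powr q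
      = (real ?m * (4 * nn) ^ ?n / \<Lambda> + real ?m * (2 * tail_const / \<Lambda>) + 3 * C powr q / B powr q) * L ^ ?n"
    proof -
      have "a / l * x + k * (t / l * x) + c * (3 * x) / d = (a / l + k * (t / l) + 3 * c / d) * x"
        for a l x k t c d :: real by (simp add: algebra_simps)
      thus ?thesis .
    qed
    finally show "emeasure lebesgue ?Z \<le> ennreal ((real ?m * (4 * nn) ^ ?n / \<Lambda> + real ?m * (2 * tail_const / \<Lambda>) + 3 * C powr q / B powr q) * L ^ ?n)" .
    show "AE x in lebesgue. x \<notin> ?Z \<longrightarrow> norm (E f x) \<le>
      (B * (2 ^ ?n * \<Lambda>) ^ ?m + real ?m * ker_const * (2 * 12 ^ ?n * \<Lambda>) ^ ?m) * (\<Prod>j\<in>UNIV. Av j)"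
      using AE1
    proof eventually_elim
      case (elim x)
      show ?case
      proof
        assume x: "x \<notin> ?Z"
        have Ji: "J i x \<le> H i" for i
        proof -
          have "x \<notin> Zi i" "x \<notin> \<Omega>" using x by blast+
          hence "ennreal (1 / h i) * ennreal (J i x) < 1" by (simp add: Zi_def not_le)
          hence "ennreal (1 / h i * J i x) < 1" using h[of i] by (subst ennreal_mult') auto
          hence "1 / h i * J i x < 1" by (simp add: ennreal_less_one_iff)
          hence "J i x < h i" using h[of i] by (simp add: field_simps)
          also have "1 * h i \<le> 2 * 12 ^ ?n * h i"
          proof (rule mult_right_mono)
            have "(1::real) \<le> 12 ^ ?n" by (rule one_le_power) simp
            thus "(1::real) \<le> 2 * 12 ^ ?n" by linarith
          qed (use h[of i] in simp)
          finally show ?thesis by (simp add: H_def)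
        qed
        have "norm (E f x) \<le> norm (E g x) + norm (E f x - E g x)" by (rule norm_triangle_sub)
        also have "norm (E g x) \<le> B * (\<Prod>j\<in>UNIV. 2 ^ ?n * h j)" using x unfolding Zg_def by simp
        also have "(\<Prod>j\<in>UNIV. 2 ^ ?n * h j) = (2 ^ ?n * \<Lambda>) ^ ?m * (\<Prod>j\<in>UNIV. Av j)"
          by (simp add: h_def prod.distrib mult.assoc[symmetric] power_mult_distrib)
        also have "norm (E f x - E g x) \<le> (\<Sum>i\<in>UNIV. ker_const * PH i * J i x)" using elim x by blast
        also have "\<dots> \<le> (\<Sum>i\<in>(UNIV::'m set). ker_const * (\<Prod>j\<in>UNIV. H j))"
        proof (rule sum_mono)
          fix i
          have "ker_const * PH i * J i x \<le> ker_const * PH i * H i"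
            using ker_const_pos PH0 by (intro mult_left_mono Ji mult_nonneg_nonneg) auto
          also have "\<dots> = ker_const * (\<Prod>j\<in>UNIV. H j)"
            unfolding PH_def by (subst prod.remove[of UNIV i]) auto
          finally show "ker_const * PH i * J i x \<le> ker_const * (\<Prod>j\<in>UNIV. H j)" .
        qed
        also have "\<dots> = real ?m * ker_const * (2 * 12 ^ ?n * \<Lambda>) ^ ?m * (\<Prod>j\<in>UNIV. Av j)"
          by (simp add: H_def h_def prod.distrib mult.assoc[symmetric] power_mult_distrib)
        also have "B * ((2 ^ ?n * \<Lambda>) ^ ?m * (\<Prod>j\<in>UNIV. Av j)) + real ?m * ker_const * (2 * 12 ^ ?n * \<Lambda>) ^ ?m * (\<Prod>j\<in>UNIV. Av j)
          = (B * (2 ^ ?n * \<Lambda>) ^ ?m + real ?m * ker_const * (2 * 12 ^ ?n * \<Lambda>) ^ ?m) * (\<Prod>j\<in>UNIV. Av j)"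
          by (simp only: distrib_right mult.assoc)
        finally show "norm (E f x) \<le> (B * (2 ^ ?n * \<Lambda>) ^ ?m + real ?m * ker_const * (2 * 12 ^ ?n * \<Lambda>) ^ ?m) * (\<Prod>j\<in>UNIV. Av j)"
          by simp
      qed
    qed
  qed
qed

end

section \<open>The weak-type endpoint estimate\<close>

text \<open>A sample point depending on the cell alone, in the grid with corner 0.\<close>

definition dcorner :: "real \<Rightarrow> nat \<Rightarrow> real^'n \<Rightarrow> real^'n" where
  "dcorner L k x = (\<chi> i. L / 2 ^ k * of_int (dindex 0 L k x i))"

lemma dcorner_cong: "y \<in> dcube 0 L k x \<Longrightarrow> dcorner L k y = dcorner L k x"
  by (simp add: dcorner_def dcube_def)

lemma dcorner_mem: "L > 0 \<Longrightarrow> dcorner L k x \<in> dcube 0 L k (x :: real^'n)"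
  by (subst mem_dcube_iff) (simp_all add: dcorner_def)

lemma dcorner_measurable [measurable]: "dcorner L k \<in> borel_measurable (borel :: (real^'n) measure)"
proof (subst borel_measurable_euclidean_space, intro ballI)
  fix b :: "real^'n" assume "b \<in> Basis"
  then obtain j where b: "b = axis j 1" by (auto simp: Basis_vec_def)
  have "(\<lambda>x. L / 2 ^ k * of_int \<lfloor>(x $ j - (0::real^'n) $ j) * 2 ^ k / L\<rfloor>) \<in> borel_measurable (borel :: (real^'n) measure)"
    by measurable
  thus "(\<lambda>x. dcorner L k x \<bullet> b) \<in> borel_measurable borel"
    by (simp add: b inner_axis dcorner_def dindex_def)
qed

text \<open>Uniform continuity on a ball one unit larger than the support: point and corner are less
  than 1 apart, so if one of them leaves that ball, both are outside the support.\<close>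

lemma dyadic_uniform_approx:
  fixes F :: "real^'n \<Rightarrow> complex"
  assumes L: "L > 0" and F: "continuous_on UNIV F" and supp: "\<And>x. F x \<noteq> 0 \<Longrightarrow> norm x \<le> r" and e: "e > 0"
  shows "\<exists>k. \<forall>x. norm (F (dcorner L k x) - F x) \<le> e"
proof -
  have "uniformly_continuous_on (cball 0 (r + 1)) F"
    by (rule compact_uniformly_continuous[OF continuous_on_subset[OF F]]) simp_all
  then obtain d where d: "d > 0" "\<And>x y. x \<in> cball 0 (r + 1) \<Longrightarrow> y \<in> cball 0 (r + 1) \<Longrightarrow> dist y x < d \<Longrightarrow> dist (F y) (F x) < e"
    using e unfolding uniformly_continuous_on_def by metis
  obtain k where k: "\<And>x. dcube (0 :: real^'n) L k x \<subseteq> ball x (min d 1)"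
    using dcube_subset_ball[OF L, of "min d 1" "0 :: real^'n"] d(1) by auto
  have "norm (F (dcorner L k x) - F x) \<le> e" for x
  proof -
    let ?y = "dcorner L k x"
    have "?y \<in> ball x (min d 1)" using k[of x] dcorner_mem[OF L, of k x] by blast
    hence y: "dist x ?y < d" "dist x ?y < 1" by simp_all
    have nd: "norm x \<le> norm ?y + dist x ?y" "norm ?y \<le> norm x + dist x ?y"
      using norm_triangle_sub[of x ?y] norm_triangle_sub[of ?y x] by (simp_all add: dist_norm norm_minus_commute)
    show ?thesis
    proof (cases "x \<in> cball 0 (r + 1) \<and> ?y \<in> cball 0 (r + 1)")
      case True
      hence "dist (F ?y) (F x) < e" using d(2)[of x ?y] y(1) by (simp add: dist_commute)
      thus ?thesis by (simp add: dist_norm)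
    next
      case False
      hence "norm x > r + 1 \<or> norm ?y > r + 1" by (simp add: not_le)
      hence "\<not> norm x \<le> r" "\<not> norm ?y \<le> r" using nd y(2) by linarith+
      hence "F x = 0" "F ?y = 0" using supp[of x] supp[of ?y] by blast+
      thus ?thesis using e by simp
    qed
  qed
  thus ?thesis by blast
qed

text \<open>Smooth approximants are sampled at the corners of a grid fine enough for the error
  1/(k+1). This makes them step functions and preserves the limit, the bound and a bounded
  support.\<close>

lemma step_approx:
  fixes f :: "real^'n \<Rightarrow> complex"
  assumes f: "f \<in> bdd_supp" and L: "L > 0"
  shows "\<exists>S B r. (\<forall>k. S k \<in> bdd_supp) \<and> (\<forall>k::nat. \<exists>K0. \<forall>x y. y \<in> dcube 0 L K0 x \<longrightarrow> S k y = S k x) \<and>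
    (\<forall>k x. norm (S k x) \<le> B) \<and> (\<forall>k x. S k x \<noteq> 0 \<longrightarrow> norm x \<le> r) \<and>
    (AE x in lborel. (\<lambda>k. S k x) \<longlonglongrightarrow> f x)"
proof -
  obtain \<eta> where \<eta>: "\<eta> \<in> flat_smooth" "bounded {x. \<eta> x \<noteq> 0}" "\<And>x. \<eta> x = 0 \<Longrightarrow> f x = 0"
    using bdd_supp_bump[OF f] by blast
  obtain B0 where B0: "\<And>x. norm (f x) \<le> B0" by (rule bdd_suppE[OF f]) (rule that)
  have "\<exists>F B. (\<forall>k. F k \<in> flat_smooth) \<and> (\<forall>k x. \<eta> x = 0 \<longrightarrow> F k x = 0) \<and>
     (\<forall>k x. norm (F k x) \<le> B) \<and> (AE x in lebesgue. (\<lambda>k. F k x) \<longlonglongrightarrow> f x)"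
    by (rule flat_smooth_approx[OF \<eta>(1,2) bdd_supp_measurable[OF f] B0 \<eta>(3)])
  then obtain F B where "(\<forall>k. F k \<in> flat_smooth) \<and> (\<forall>k x. \<eta> x = 0 \<longrightarrow> F k x = 0) \<and>
     (\<forall>k x. norm (F k x) \<le> B) \<and> (AE x in lebesgue. (\<lambda>k. F k x) \<longlonglongrightarrow> f x)" by (elim exE)
  hence F: "\<And>k. F k \<in> flat_smooth" "\<And>k x. \<eta> x = 0 \<Longrightarrow> F k x = 0" "\<And>k x. norm (F k x) \<le> B"
     "AE x in lborel. (\<lambda>k. F k x) \<longlonglongrightarrow> f x" by (auto simp: AE_completion_iff)
  obtain r where "\<And>x. \<eta> x \<noteq> 0 \<Longrightarrow> norm x \<le> r" using \<eta>(2) unfolding bounded_iff by blast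
  hence r: "norm x \<le> r" if "F k x \<noteq> 0" for k x using F(2)[of x k] that by blast
  have cont: "continuous_on UNIV (F k)" for k by (rule flat_smooth_continuous_on[OF F(1)])
  have "\<exists>j. \<forall>x. norm (F k (dcorner L j x) - F k x) \<le> 1 / real (Suc k)" for k
    by (rule dyadic_uniform_approx[OF L cont r]) simp_all
  hence "\<forall>k. \<exists>j. \<forall>x. norm (F k (dcorner L j x) - F k x) \<le> 1 / real (Suc k)" by (rule allI)
  from choice[OF this] obtain j where j: "\<forall>k x. norm (F k (dcorner L (j k) x) - F k x) \<le> 1 / real (Suc k)"
    by (rule exE)
  define S where "S k x = F k (dcorner L (j k) x)" for k x
  have supp: "norm x \<le> r + real CARD('n) * L" if "S k x \<noteq> 0" for k x
  proof -
    have 1: "norm (dcorner L (j k) x) \<le> r" using r that unfolding S_def by blast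
    have 2: "norm (dcorner L (j k) x - x) \<le> real CARD('n) * (L / 2 ^ j k)"
      by (rule norm_dcube_le[OF L dcorner_mem[OF L]])
    have "L / 2 ^ j k \<le> L / 1" using L by (intro divide_left_mono one_le_power) auto
    hence 3: "real CARD('n) * (L / 2 ^ j k) \<le> real CARD('n) * L" by (intro mult_left_mono) simp_all
    have "norm x \<le> norm (dcorner L (j k) x) + norm (dcorner L (j k) x - x)"
      using norm_triangle_sub[of x "dcorner L (j k) x"] by (simp add: norm_minus_commute)
    thus ?thesis using 1 2 3 by linarith
  qed
  have "(\<lambda>k. S k x) \<longlonglongrightarrow> f x" if lim: "(\<lambda>k. F k x) \<longlonglongrightarrow> f x" for x
  proof -
    have "(\<lambda>k. S k x - F k x) \<longlonglongrightarrow> 0"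
    proof (rule Lim_null_comparison)
      show "\<forall>\<^sub>F k in sequentially. norm (S k x - F k x) \<le> inverse (real (Suc k))"
        unfolding S_def using j by (simp add: inverse_eq_divide)
      show "(\<lambda>k. inverse (real (Suc k))) \<longlonglongrightarrow> 0" by (rule LIMSEQ_inverse_real_of_nat)
    qed
    from tendsto_add[OF this lim] show ?thesis by simp
  qed
  hence lim: "AE x in lborel. (\<lambda>k. S k x) \<longlonglongrightarrow> f x" using F(4) by (auto elim: AE_mp)
  have meas: "S k \<in> borel_measurable borel" for k
    unfolding S_def[abs_def] by (rule measurable_compose[OF dcorner_measurable borel_measurable_continuous_onI[OF cont]])
  have bd: "norm (S k x) \<le> B" for k x unfolding S_def by (rule F(3))
  have step: "S k y = S k x" if "y \<in> dcube 0 L (j k) x" for k x y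
    unfolding S_def dcorner_cong[OF that] ..
  have mem: "S k \<in> bdd_supp" for k
  proof (rule bdd_suppI)
    show "norm x \<le> r + real CARD('n) * L" if "S k x \<noteq> 0" for x using that by (rule supp)
  qed (rule meas, rule bd)
  have all: "(\<forall>k. S k \<in> bdd_supp) \<and> (\<forall>k. \<exists>K0. \<forall>x y. y \<in> dcube 0 L K0 x \<longrightarrow> S k y = S k x) \<and>
    (\<forall>k x. norm (S k x) \<le> B) \<and> (\<forall>k x. S k x \<noteq> 0 \<longrightarrow> norm x \<le> r + real CARD('n) * L) \<and>
    (AE x in lborel. (\<lambda>k. S k x) \<longlonglongrightarrow> f x)"
  proof (intro conjI allI impI)
    show "\<exists>K0. \<forall>x y. y \<in> dcube 0 L K0 x \<longrightarrow> S k y = S k x" for k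
      by (rule exI[of _ "j k"]) (intro allI impI step)
    show "norm x \<le> r + real CARD('n) * L" if "S k x \<noteq> 0" for k x using that by (rule supp)
  qed (rule mem, rule bd, rule lim)
  show ?thesis by (rule exI[of _ S], rule exI[of _ B], rule exI[of _ "r + real CARD('n) * L"], rule all)
qed

context multilinear_Lp
begin

lemma E_zero:
  assumes f: "\<And>j. f j \<in> bdd_supp" and i: "AE x in lebesgue. f i x = 0"
  shows "AE x in lebesgue. E f x = 0"
proof -
  have z: "(\<lambda>x::real^'n. 0) \<in> bdd_supp" by (rule bdd_suppI[of _ 0 0]) auto
  \<comment> \<open>An empty sum puts 0 into slot \<open>i\<close>, and additivity gives the value
    0.\<close>
  have "AE x in lebesgue. E (f(i := \<lambda>x. \<Sum>P\<in>({}::nat set). 0)) x = (\<Sum>P\<in>({}::nat set). E (f(i := \<lambda>x. 0)) x)"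
    by (rule conjunct2[OF E_sum[of f "{}::nat set" "\<lambda>_ x. 0" i]]) (use f in simp_all)
  hence 1: "AE x in lebesgue. E (f(i := \<lambda>x. 0)) x = 0" by (simp only: sum.empty)
  have 2: "AE x in lebesgue. E f x = E (f(i := \<lambda>x. 0)) x"
  proof (rule E_AE_cong)
    show "f j \<in> Lp_space (qs j)" "(f(i := \<lambda>x. 0)) j \<in> Lp_space (qs j)" for j
      using f z by (simp_all add: Lp_bdd_supp)
    show "AE x in lebesgue. f j x = (f(i := \<lambda>x. 0)) j x" for j
      using i by (cases "j = i") simp_all
  qed
  from 1 2 show ?thesis by eventually_elim simp
qed

end

text \<open>Continuity of the measure along increasing tail intersections. A point outside the lower
  limit escapes infinitely many of the sets, which is enough to carry a pointwise bound to the
  limit.\<close>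

lemma liminf_set_emeasure_le:
  fixes Z :: "nat \<Rightarrow> 'a set"
  assumes Z: "\<And>k. Z k \<in> sets M" and le: "\<And>k. emeasure M (Z k) \<le> c"
  shows "(\<Union>N. \<Inter>k\<in>{N..}. Z k) \<in> sets M" "emeasure M (\<Union>N. \<Inter>k\<in>{N..}. Z k) \<le> c"
proof -
  define A where "A N = (\<Inter>k\<in>{N..}. Z k)" for N :: nat
  have A: "A N \<in> sets M" for N unfolding A_def using Z by (intro sets.countable_INT) auto
  have inc: "incseq A" unfolding A_def incseq_def by (auto intro: order_trans)
  show "(\<Union>N. \<Inter>k\<in>{N..}. Z k) \<in> sets M" unfolding A_def[symmetric] using A by (intro sets.countable_UN) auto
  have "emeasure M (\<Union>N. A N) = (SUP N. emeasure M (A N))"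
    by (rule SUP_emeasure_incseq[symmetric]) (use A inc in auto)
  also have "\<dots> \<le> c"
  proof (rule SUP_least)
    fix N
    have "emeasure M (A N) \<le> emeasure M (Z N)" unfolding A_def using Z by (intro emeasure_mono) auto
    thus "emeasure M (A N) \<le> c" using le[of N] by (rule order_trans)
  qed
  finally show "emeasure M (\<Union>N. \<Inter>k\<in>{N..}. Z k) \<le> c" unfolding A_def .
qed

lemma third_le_aux: "\<delta> > 0 \<Longrightarrow> c \<ge> 0 \<Longrightarrow> 3 * c / \<delta> \<le> l \<Longrightarrow> l > 0 \<Longrightarrow> c / l \<le> \<delta> / (3::real)"
  by (simp add: field_simps)

lemma third_le_aux2: "\<delta> > 0 \<Longrightarrow> c \<ge> 0 \<Longrightarrow> 3 * c / (9 * c / \<delta> + 1) \<le> \<delta> / (3::real)"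
  by (simp add: field_simps add_pos_nonneg)

context CZ_data_dim
begin

text \<open>\<open>\<Lambda>\<close> and \<open>B\<close> are chosen so large that the dilated
  cubes, the bad tails and the good part take at most \<delta> / 3 each.\<close>

lemma weak_type_step:
  assumes \<delta>: "\<delta> > 0"
  shows "\<exists>C0>0. \<forall>L K0 Av. \<forall>f :: 'm \<Rightarrow> real^'n \<Rightarrow> complex. L > 0 \<longrightarrow> (\<forall>j. Av j > 0) \<longrightarrow> (\<forall>j. f j \<in> bdd_supp) \<longrightarrow>
    (\<forall>j x y. y \<in> dcube 0 L K0 x \<longrightarrow> f j y = f j x) \<longrightarrow> (\<forall>j. (LINT x|lborel. norm (f j x)) \<le> Av j * L ^ CARD('n)) \<longrightarrow>
    (\<exists>Z\<in>sets lebesgue. emeasure lebesgue Z \<le> ennreal (\<delta> * L ^ CARD('n)) \<and>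
      (AE x in lebesgue. x \<notin> Z \<longrightarrow> norm (E f x) \<le> C0 * (\<Prod>j\<in>UNIV. Av j)))"
proof -
  define c1 where "c1 = real CARD('m) * (4 * nn) ^ CARD('n)"
  define c2 where "c2 = real CARD('m) * (2 * tail_const)"
  define \<Lambda> where "\<Lambda> = max 1 (max (3 * c1 / \<delta>) (3 * c2 / \<delta>))"
  \<comment> \<open>The summand 1 keeps \<open>B\<close> positive when \<open>C\<close> is
    0.\<close>
  define B where "B = (9 * C powr q / \<delta> + 1) powr (1 / q)"
  have c: "c1 \<ge> 0" "c2 \<ge> 0" unfolding c1_def c2_def using nn(2) tail_const_pos by simp_all
  have \<Lambda>: "\<Lambda> \<ge> 1" "3 * c1 / \<delta> \<le> \<Lambda>" "3 * c2 / \<delta> \<le> \<Lambda>" unfolding \<Lambda>_def by (simp_all add: le_max_iff_disj)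
  have Bpos: "9 * C powr q / \<delta> + 1 > 0" using \<delta> by (intro add_nonneg_pos divide_nonneg_pos) simp_all
  have B: "B > 0" unfolding B_def using Bpos by (simp only: powr_gt_zero less_imp_neq[symmetric] not_False_eq_True)
  have Bq: "B powr q = 9 * C powr q / \<delta> + 1"
    unfolding B_def powr_powr using q_pos Bpos by simp
  have i1: "c1 / \<Lambda> \<le> \<delta> / 3" by (rule third_le_aux[OF \<delta> c(1) \<Lambda>(2)]) (use \<Lambda>(1) in linarith)
  have i2: "c2 / \<Lambda> \<le> \<delta> / 3" by (rule third_le_aux[OF \<delta> c(2) \<Lambda>(3)]) (use \<Lambda>(1) in linarith)
  have i3: "3 * C powr q / B powr q \<le> \<delta> / 3" unfolding Bq by (rule third_le_aux2[OF \<delta>]) simp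
  have tot: "real CARD('m) * (4 * nn) ^ CARD('n) / \<Lambda> + real CARD('m) * (2 * tail_const / \<Lambda>) + 3 * C powr q / B powr q \<le> \<delta>"
  proof -
    have "real CARD('m) * (2 * tail_const / \<Lambda>) = c2 / \<Lambda>" unfolding c2_def by simp
    thus ?thesis using i1 i2 i3 unfolding c1_def[symmetric] by linarith
  qed
  let ?C0 = "B * (2 ^ CARD('n) * \<Lambda>) ^ CARD('m) + real CARD('m) * ker_const * (2 * 12 ^ CARD('n) * \<Lambda>) ^ CARD('m)"
  have C0_pos: "?C0 > 0"
  proof (rule add_pos_nonneg)
    show "0 < B * (2 ^ CARD('n) * \<Lambda>) ^ CARD('m)" using B \<Lambda>(1) by (intro mult_pos_pos zero_less_power) auto
    show "0 \<le> real CARD('m) * ker_const * (2 * 12 ^ CARD('n) * \<Lambda>) ^ CARD('m)"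
      using ker_const_pos \<Lambda>(1) by (intro mult_nonneg_nonneg zero_le_power) auto
  qed
  have main: "\<exists>Z\<in>sets lebesgue. emeasure lebesgue Z \<le> ennreal (\<delta> * L ^ CARD('n)) \<and>
      (AE x in lebesgue. x \<notin> Z \<longrightarrow> norm (E f x) \<le> ?C0 * (\<Prod>j\<in>UNIV. Av j))"
    if a: "L > 0" "\<forall>j. Av j > 0" "\<forall>j. f j \<in> bdd_supp" "\<forall>j x y. y \<in> dcube 0 L K0 x \<longrightarrow> f j y = f j x"
      "\<forall>j. (LINT x|lborel. norm (f j x)) \<le> Av j * L ^ CARD('n)" for L K0 Av and f :: "'m \<Rightarrow> real^'n \<Rightarrow> complex"
  proof -
    have "\<exists>Z\<in>sets lebesgue. emeasure lebesgue Z \<le>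
      ennreal ((real CARD('m) * (4 * nn) ^ CARD('n) / \<Lambda> + real CARD('m) * (2 * tail_const / \<Lambda>) + 3 * C powr q / B powr q) * L ^ CARD('n)) \<and>
      (AE x in lebesgue. x \<notin> Z \<longrightarrow> norm (E f x) \<le> ?C0 * (\<Prod>j\<in>UNIV. Av j))"
      by (rule weak_type_step_aux[of L Av f 0 K0 \<Lambda> B]) (use a \<Lambda>(1) B in blast)+
    then obtain Z where Z: "Z \<in> sets lebesgue" "emeasure lebesgue Z \<le>
      ennreal ((real CARD('m) * (4 * nn) ^ CARD('n) / \<Lambda> + real CARD('m) * (2 * tail_const / \<Lambda>) + 3 * C powr q / B powr q) * L ^ CARD('n))"
      "AE x in lebesgue. x \<notin> Z \<longrightarrow> norm (E f x) \<le> ?C0 * (\<Prod>j\<in>UNIV. Av j)" by (elim bexE conjE)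
    have "0 \<le> L ^ CARD('n)" using a(1) by simp
    have le: "emeasure lebesgue Z \<le> ennreal (\<delta> * L ^ CARD('n))"
    proof (rule order_trans[OF Z(2)], rule ennreal_leI, rule mult_right_mono)
      show "0 \<le> L ^ CARD('n)" using a(1) by simp
    qed (rule tot)
    show ?thesis by (rule bexI[of _ Z], rule conjI, rule le, rule Z(3), rule Z(1))
  qed
  show ?thesis
  proof (intro exI[of _ ?C0] conjI allI impI)
    show "?C0 > 0" by (rule C0_pos)
    fix L :: real and K0 :: nat and Av :: "'m \<Rightarrow> real" and f :: "'m \<Rightarrow> real^'n \<Rightarrow> complex"
    assume "L > 0" "\<forall>j. Av j > 0" "\<forall>j. f j \<in> bdd_supp" "\<forall>j x y. y \<in> dcube 0 L K0 x \<longrightarrow> f j y = f j x"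
      "\<forall>j. (LINT x|lborel. norm (f j x)) \<le> Av j * L ^ CARD('n)"
    thus "\<exists>Z\<in>sets lebesgue. emeasure lebesgue Z \<le> ennreal (\<delta> * L ^ CARD('n)) \<and>
      (AE x in lebesgue. x \<notin> Z \<longrightarrow> norm (E f x) \<le> ?C0 * (\<Prod>j\<in>UNIV. Av j))" by (rule main)
  qed
qed

text \<open>The step hypothesis is removed by approximation: the L^1 norms of the step functions are
  eventually below twice the given bounds, whence the factor 2^m, and the exceptional set is the
  lower limit of theirs.\<close>

lemma weak_type:
  assumes \<delta>: "\<delta> > 0"
  shows "\<exists>C0>0. \<forall>L Av. \<forall>f :: 'm \<Rightarrow> real^'n \<Rightarrow> complex. L > 0 \<longrightarrow> (\<forall>j. Av j > 0) \<longrightarrow> (\<forall>j. f j \<in> bdd_supp) \<longrightarrow>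
    (\<forall>j. (LINT x|lborel. norm (f j x)) \<le> Av j * L ^ CARD('n)) \<longrightarrow>
    (\<exists>Z\<in>sets lebesgue. emeasure lebesgue Z \<le> ennreal (\<delta> * L ^ CARD('n)) \<and>
      (AE x in lebesgue. x \<notin> Z \<longrightarrow> norm (E f x) \<le> C0 * (\<Prod>j\<in>UNIV. Av j)))"
proof -
  define PW where "PW C0 L K0 Av f \<longleftrightarrow> L > 0 \<longrightarrow> (\<forall>j. Av j > 0) \<longrightarrow> (\<forall>j. f j \<in> bdd_supp) \<longrightarrow>
    (\<forall>j x y. y \<in> dcube 0 L K0 x \<longrightarrow> f j y = f j x) \<longrightarrow> (\<forall>j. (LINT x|lborel. norm (f j x)) \<le> Av j * L ^ CARD('n)) \<longrightarrow>
    (\<exists>Z\<in>sets lebesgue. emeasure lebesgue Z \<le> ennreal (\<delta> * L ^ CARD('n)) \<and>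
      (AE x in lebesgue. x \<notin> Z \<longrightarrow> norm (E f x) \<le> C0 * (\<Prod>j\<in>UNIV. Av j)))"
    for C0 L K0 Av and f :: "'m \<Rightarrow> real^'n \<Rightarrow> complex"
  have "\<exists>C0>0. \<forall>L K0 Av f. PW C0 L K0 Av f" unfolding PW_def by (rule weak_type_step[OF \<delta>])
  then obtain C0 where C0: "C0 > 0" and PW: "\<forall>L K0 Av f. PW C0 L K0 Av f" by (elim exE conjE)
  note W = PW[rule_format, unfolded PW_def, THEN mp, THEN mp, THEN mp, THEN mp, THEN mp]
  have main: "\<exists>Z\<in>sets lebesgue. emeasure lebesgue Z \<le> ennreal (\<delta> * L ^ CARD('n)) \<and>
      (AE x in lebesgue. x \<notin> Z \<longrightarrow> norm (E f x) \<le> C0 * 2 ^ CARD('m) * (\<Prod>j\<in>UNIV. Av j))"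
    if L: "L > 0" and Av: "\<forall>j. Av j > 0" and f: "\<forall>j. f j \<in> bdd_supp"
      and nf: "\<forall>j. (LINT x|lborel. norm (f j x)) \<le> Av j * L ^ CARD('n)" for L Av and f :: "'m \<Rightarrow> real^'n \<Rightarrow> complex"
  proof -
    define P where "P j S B r \<longleftrightarrow> (\<forall>k. S k \<in> bdd_supp) \<and> (\<forall>k::nat. \<exists>K0. \<forall>x y. y \<in> dcube 0 L K0 x \<longrightarrow> S k y = S k x) \<and>
      (\<forall>k x. norm (S k x) \<le> B) \<and> (\<forall>k x. S k x \<noteq> 0 \<longrightarrow> norm x \<le> r) \<and>
      (AE x in lborel. (\<lambda>k. S k x) \<longlonglongrightarrow> f j x)" for j S and B r :: real
    have "\<forall>j. \<exists>S B r. P j S B r" unfolding P_def using step_approx[OF spec[OF f] L] by (rule allI)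
    from choice[OF this] obtain S where "\<forall>j. \<exists>B r. P j (S j) B r" by (rule exE)
    from choice[OF this] obtain Bf where "\<forall>j. \<exists>r. P j (S j) (Bf j) r" by (rule exE)
    from choice[OF this] obtain rf where P: "\<forall>j. P j (S j) (Bf j) (rf j)" by (rule exE)
    have S: "S j k \<in> bdd_supp" "\<exists>K0. \<forall>x y. y \<in> dcube 0 L K0 x \<longrightarrow> S j k y = S j k x" "norm (S j k x) \<le> Bf j"
      "S j k x \<noteq> 0 \<Longrightarrow> norm x \<le> rf j" for j k x
      using spec[OF P, of j] unfolding P_def by blast+
    have S_lim: "AE x in lborel. (\<lambda>k. S j k x) \<longlonglongrightarrow> f j x" for j
      using spec[OF P, of j] unfolding P_def by (elim conjE)
    define B r where "B = (\<Sum>j\<in>UNIV. \<bar>Bf j\<bar>)" and "r = (\<Sum>j\<in>UNIV. \<bar>rf j\<bar>)"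
    have mem: "\<bar>Bf j\<bar> \<le> B" "\<bar>rf j\<bar> \<le> r" for j unfolding B_def r_def by (intro member_le_sum; simp)+
    have SB: "norm (S j k x) \<le> B" for j k x using S(3)[of j k x] mem(1)[of j] by linarith
    have Sr: "norm x \<le> r" if "S j k x \<noteq> 0" for j k x using S(4)[OF that] mem(2)[of j] by linarith
    have "(\<lambda>k. LINT x|lborel. norm (S j k x)) \<longlonglongrightarrow> (LINT x|lborel. norm (f j x))" for j
    proof (rule integral_dominated_convergence[where w = "\<lambda>x. B * indicator (cball 0 r) x"])
      show "(\<lambda>x. norm (f j x)) \<in> borel_measurable lborel" "(\<lambda>x. norm (S j k x)) \<in> borel_measurable lborel" for k
        using bdd_supp_measurable[OF spec[OF f, of j]] bdd_supp_measurable[OF S(1)[of j k]] by simp_all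
      show "integrable lborel (\<lambda>x::real^'n. B * indicator (cball 0 r) x)"
        using emeasure_bounded_finite[OF bounded_cball, of "0::real^'n" r]
        by (intro integrable_mult_right integrable_real_indicator) simp_all
      show "AE x in lborel. (\<lambda>k. norm (S j k x)) \<longlonglongrightarrow> norm (f j x)"
        using S_lim[of j] by eventually_elim (rule tendsto_norm)
      have "norm (norm (S j k x)) \<le> B * indicator (cball 0 r) x" for k x
        using SB[of j k x] Sr[of j k x] by (cases "S j k x = 0") (auto simp: indicator_def)
      thus "AE x in lborel. norm (norm (S j k x)) \<le> B * indicator (cball 0 r) x" for k by (rule AE_I2)
    qed
    hence "\<forall>\<^sub>F k in sequentially. (LINT x|lborel. norm (S j k x)) < 2 * Av j * L ^ CARD('n)" for j
    proof (rule order_tendstoD(2))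
      have "Av j * L ^ CARD('n) > 0" using spec[OF Av, of j] L by simp
      thus "(LINT x|lborel. norm (f j x)) < 2 * Av j * L ^ CARD('n)" using spec[OF nf, of j] by linarith
    qed
    hence "\<forall>\<^sub>F k in sequentially. \<forall>j. (LINT x|lborel. norm (S j k x)) < 2 * Av j * L ^ CARD('n)"
      by (rule eventually_all_finite)
    then obtain k0 where k0: "\<And>k j. k \<ge> k0 \<Longrightarrow> (LINT x|lborel. norm (S j k x)) < 2 * Av j * L ^ CARD('n)"
      unfolding eventually_sequentially by blast
    define F where "F k = (\<lambda>j. S j (k + k0))" for k
    have "\<exists>s. strict_mono s \<and> (AE x in lebesgue. (\<lambda>k. E (F (s k)) x) \<longlonglongrightarrow> E f x)"
    proof (rule E_AE_subseq[of F f B r])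
      show "F k j \<in> bdd_supp" "f j \<in> bdd_supp" "norm (F k j x) \<le> B" for k j x
        unfolding F_def by (fact S(1), fact spec[OF f], fact SB)
      show "norm x \<le> r" if "F k j x \<noteq> 0" for k j x using that unfolding F_def by (rule Sr)
      show "AE x in lebesgue. (\<lambda>k. F k j x) \<longlonglongrightarrow> f j x" for j
        unfolding AE_completion_iff F_def using S_lim[of j] by eventually_elim (rule LIMSEQ_ignore_initial_segment)
    qed
    then obtain s where s: "strict_mono s" "AE x in lebesgue. (\<lambda>k. E (F (s k)) x) \<longlonglongrightarrow> E f x" by blast
    let ?Cp = "C0 * (\<Prod>j\<in>UNIV. 2 * Av j)"
    have "\<exists>Z. Z \<in> sets lebesgue \<and> emeasure lebesgue Z \<le> ennreal (\<delta> * L ^ CARD('n)) \<and>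
      (AE x in lebesgue. x \<notin> Z \<longrightarrow> norm (E (F k) x) \<le> ?Cp)" for k
    proof -
      have "\<forall>j. \<exists>K0. \<forall>x y. y \<in> dcube 0 L K0 x \<longrightarrow> S j (k + k0) y = S j (k + k0) x" using S(2) by blast
      from choice[OF this] obtain Kf where Kf: "\<forall>j x y. y \<in> dcube 0 L (Kf j) x \<longrightarrow> S j (k + k0) y = S j (k + k0) x"
        by (rule exE)
      \<comment> \<open>A common generation on whose cubes all m step functions are
        constant.\<close>
      define K0 where "K0 = Max (range Kf)"
      have K0: "Kf j \<le> K0" for j unfolding K0_def by (intro Max_ge) auto
      have "\<exists>Z\<in>sets lebesgue. emeasure lebesgue Z \<le> ennreal (\<delta> * L ^ CARD('n)) \<and>
        (AE x in lebesgue. x \<notin> Z \<longrightarrow> norm (E (F k) x) \<le> ?Cp)"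
      proof (rule W[OF L, of "\<lambda>j. 2 * Av j" "F k" K0])
        show "\<forall>j. 0 < 2 * Av j" using Av by simp
        show "\<forall>j. F k j \<in> bdd_supp" unfolding F_def using S(1) by blast
        show "\<forall>j x y. y \<in> dcube 0 L K0 x \<longrightarrow> F k j y = F k j x"
          unfolding F_def using Kf dcube_antimono[OF K0] by blast
        show "\<forall>j. (LINT x|lborel. norm (F k j x)) \<le> 2 * Av j * L ^ CARD('n)"
          unfolding F_def using k0[of "k + k0"] by (auto intro: less_imp_le)
      qed
      thus ?thesis by blast
    qed
    hence "\<forall>k. \<exists>Z. Z \<in> sets lebesgue \<and> emeasure lebesgue Z \<le> ennreal (\<delta> * L ^ CARD('n)) \<and>
      (AE x in lebesgue. x \<notin> Z \<longrightarrow> norm (E (F k) x) \<le> ?Cp)" by (rule allI)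
    from choice[OF this] obtain Z where Z: "\<forall>k. Z k \<in> sets lebesgue \<and> emeasure lebesgue (Z k) \<le> ennreal (\<delta> * L ^ CARD('n)) \<and>
      (AE x in lebesgue. x \<notin> Z k \<longrightarrow> norm (E (F k) x) \<le> ?Cp)" by (rule exE)
    let ?Z = "\<Union>N. \<Inter>k\<in>{N..}. Z (s k)"
    have Z1: "?Z \<in> sets lebesgue" "emeasure lebesgue ?Z \<le> ennreal (\<delta> * L ^ CARD('n))"
      by (rule liminf_set_emeasure_le; use Z in blast)+
    have "AE x in lebesgue. \<forall>k. x \<notin> Z k \<longrightarrow> norm (E (F k) x) \<le> ?Cp"
      unfolding AE_all_countable using Z by blast
    with s(2) have AE: "AE x in lebesgue. x \<notin> ?Z \<longrightarrow> norm (E f x) \<le> ?Cp"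
    proof eventually_elim
      case (elim x)
      show ?case
      proof (intro impI, rule ccontr)
        assume x: "x \<notin> ?Z" and "\<not> norm (E f x) \<le> ?Cp"
        hence "norm (E f x) > ?Cp" by simp
        with tendsto_norm[OF elim(1)] have "\<forall>\<^sub>F k in sequentially. norm (E (F (s k)) x) > ?Cp"
          by (rule order_tendstoD(1))
        then obtain N where N: "\<And>k. k \<ge> N \<Longrightarrow> norm (E (F (s k)) x) > ?Cp" unfolding eventually_sequentially by blast
        \<comment> \<open>Outside the lower limit some index beyond \<open>N\<close> still obeys the
          bound, against the strict inequality that the limit would force.\<close>
        have "\<exists>k\<in>{N..}. x \<notin> Z (s k)" using x by blast
        then obtain k where k: "k \<ge> N" "x \<notin> Z (s k)" by auto
        from elim(2) k(2) have "norm (E (F (s k)) x) \<le> ?Cp" by blast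
        with N[OF k(1)] show False by linarith
      qed
    qed
    have "?Cp = C0 * 2 ^ CARD('m) * (\<Prod>j\<in>UNIV. Av j)" by (simp add: prod.distrib)
    from AE[unfolded this] have AE': "AE x in lebesgue. x \<notin> ?Z \<longrightarrow> norm (E f x) \<le> C0 * 2 ^ CARD('m) * (\<Prod>j\<in>UNIV. Av j)" .
    show ?thesis by (rule bexI[of _ ?Z], rule conjI, rule Z1(2), rule AE', rule Z1(1))
  qed
  show ?thesis
  proof (intro exI[of _ "C0 * 2 ^ CARD('m)"] conjI allI impI)
    show "C0 * 2 ^ CARD('m) > 0" using C0 by simp
    fix L :: real and Av :: "'m \<Rightarrow> real" and f :: "'m \<Rightarrow> real^'n \<Rightarrow> complex"
    assume "L > 0" "\<forall>j. Av j > 0" "\<forall>j. f j \<in> bdd_supp"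
      "\<forall>j. (LINT x|lborel. norm (f j x)) \<le> Av j * L ^ CARD('n)"
    thus "\<exists>Z\<in>sets lebesgue. emeasure lebesgue Z \<le> ennreal (\<delta> * L ^ CARD('n)) \<and>
      (AE x in lebesgue. x \<notin> Z \<longrightarrow> norm (E f x) \<le> C0 * 2 ^ CARD('m) * (\<Prod>j\<in>UNIV. Av j))" by (rule main)
  qed
qed

end

section \<open>Stopping cubes and exponential decay\<close>

text \<open>\<open>a\<close> is any lower bound of \<open>M\<close> on the cube and plays the part
  of the infimum. The fraction 2^(-n-3) is fixed for the iteration: an open enlargement costs a
  factor 2, and stopping cubes of density 2^(-n-1) then fill at most half of the cube.\<close>

definition osc_bound :: "(real^'n \<Rightarrow> complex) \<Rightarrow> (real^'n \<Rightarrow> ennreal) \<Rightarrow> real \<Rightarrow> real^'n \<Rightarrow> real \<Rightarrow> complex \<Rightarrow> bool" where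
  "osc_bound u M C z l c \<longleftrightarrow> (\<exists>Z\<in>sets lebesgue. emeasure lebesgue Z \<le> ennreal ((2 * l) ^ CARD('n) / 2 ^ (CARD('n) + 3)) \<and>
     (\<exists>a\<ge>0. (\<forall>x\<in>cube z l. ennreal a \<le> M x) \<and> (\<forall>x\<in>cube z l - Z. norm (u x - c) \<le> C * a)))"

text \<open>Cubes stop when the density of \<open>G\<close> exceeds 2^(-n-1). The parent did not
  stop, so the density in a stopping cube is at most 1/2 and points off \<open>G\<close> remain
  there; the density from below bounds the volume of the cube by 2^(n+1) times that of its part of
  \<open>G\<close>. Openness puts a small cube of density 1 around every point of \<open>G\<close>.
  \<open>R\<close> is the half-open form of \<open>cube z l\<close>.\<close>

lemma stopping_cover:
  fixes G :: "(real^'n) set" and z :: "real^'n"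
  assumes l: "l > 0" and G: "open G" and mG: "emeasure lebesgue G \<le> ennreal ((2 * l) ^ CARD('n) / 2 ^ (CARD('n) + 2))"
  defines "a \<equiv> (\<chi> i. z $ i - l)"
  defines "R \<equiv> dcube a (2 * l) 0 z"
  shows "\<exists>F. countable F \<and> disjoint_family_on (\<lambda>P. P) F \<and>
    (\<forall>P\<in>F. P \<subseteq> R \<and> P \<in> sets borel \<and>
      (\<exists>w s. s > 0 \<and> P \<subseteq> cube w s \<and> emeasure lborel P = ennreal ((2 * s) ^ CARD('n)) \<and>
        emeasure lborel (G \<inter> P) \<le> ennreal ((2 * s) ^ CARD('n) / 2) \<and>
        emeasure lborel P \<le> ennreal (2 ^ (CARD('n) + 1)) * emeasure lborel (G \<inter> P))) \<and>
    G \<inter> R \<subseteq> \<Union>F"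
proof -
  let ?n = "CARD('n)"
  define L where "L = 2 * l"
  have L: "L > 0" using l by (simp add: L_def)
  define \<theta> :: real where "\<theta> = 1 / 2 ^ (?n + 1)"
  have \<theta>: "\<theta> > 0" "\<theta> < 1" unfolding \<theta>_def by (auto simp: divide_less_eq) (metis less_1_mult one_less_numeral_iff one_less_power semiring_norm(76) zero_less_card_finite)
  define Bad where "Bad P \<longleftrightarrow> emeasure lborel (G \<inter> P) > ennreal \<theta> * emeasure lborel P" for P
  define F where "F = {P \<in> stopping a L Bad. P \<inter> R \<noteq> {}}"
  have [measurable]: "G \<in> sets borel" using G by simp
  have mG': "emeasure lborel G \<le> ennreal (L ^ ?n / 2 ^ (?n + 2))"
    using mG by (simp add: L_def emeasure_completion)
  have R: "R = dcube a L 0 z" by (simp add: R_def L_def)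
  have R_notbad: "\<not> Bad R"
  proof -
    have "emeasure lborel (G \<inter> R) \<le> emeasure lborel G" by (intro emeasure_mono) auto
    also have "\<dots> \<le> ennreal (L ^ ?n / 2 ^ (?n + 2))" by (rule mG')
    also have "\<dots> \<le> ennreal (\<theta> * L ^ ?n)"
      using L by (intro ennreal_leI) (simp add: \<theta>_def field_simps)
    also have "\<dots> = ennreal \<theta> * emeasure lborel R"
      using \<theta> L unfolding R by (simp add: emeasure_dcube ennreal_mult)
    finally show ?thesis by (simp add: Bad_def not_less)
  qed
  have F_props: "P \<subseteq> R \<and> P \<in> sets borel \<and>
      (\<exists>w s. s > 0 \<and> P \<subseteq> cube w s \<and> emeasure lborel P = ennreal ((2 * s) ^ ?n) \<and>
        emeasure lborel (G \<inter> P) \<le> ennreal ((2 * s) ^ ?n / 2) \<and>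
        emeasure lborel P \<le> ennreal (2 ^ (?n + 1)) * emeasure lborel (G \<inter> P))" if P: "P \<in> F" for P
  proof -
    have "\<exists>k x. P = dcube a L k x \<and> Bad (dcube a L k x) \<and> (\<forall>j<k. \<not> Bad (dcube a L j x))"
    proof -
      have "P \<in> stopping a L Bad" using P by (simp add: F_def)
      thus ?thesis by (auto simp: stopping_def)
    qed
    then obtain k x where Px: "P = dcube a L k x" "Bad (dcube a L k x)" "\<forall>j<k. \<not> Bad (dcube a L j x)"
      by (elim exE conjE)
    have "P \<inter> R \<noteq> {}" using P by (simp add: F_def)
    then obtain p where p: "p \<in> P" "p \<in> R" by blast
    have "dcube a L 0 x = R"
    proof -
      have "p \<in> dcube a L 0 x" using dcube_antimono[of 0 k a L x] p(1) unfolding Px(1) by blast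
      thus ?thesis using dcube_cong[of p a L 0 x] dcube_cong[of p a L 0 z] p(2) unfolding R by simp
    qed
    hence PR: "P \<subseteq> R" using dcube_antimono[of 0 k a L x] Px(1) by auto
    have k0: "k \<noteq> 0"
    proof
      assume "k = 0"
      from Px(2)[unfolded this \<open>dcube a L 0 x = R\<close>] R_notbad show False by contradiction
    qed
    then obtain k' where k': "k = Suc k'" using not0_implies_Suc by blast
    define s where "s = L / 2 ^ k / 2"
    have s: "s > 0" using L by (simp add: s_def)
    have s2: "2 * s = L / 2 ^ k" by (simp add: s_def)
    obtain w where w: "P \<subseteq> cube w s" using dcube_cube[OF L, of a k x] unfolding Px(1) s_def by blast
    have em: "emeasure lborel P = ennreal ((2 * s) ^ ?n)" unfolding Px(1) s2 by (rule emeasure_dcube[OF L])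
    have "emeasure lborel (G \<inter> P) \<le> emeasure lborel (G \<inter> dcube a L k' x)"
      using dcube_antimono[of k' k a L x] unfolding Px(1) k' by (intro emeasure_mono) auto
    also have "\<dots> \<le> ennreal \<theta> * emeasure lborel (dcube a L k' x)"
      using Px(3) k' by (simp add: Bad_def not_less)
    also have "\<dots> = ennreal \<theta> * ennreal ((2 * (2 * s)) ^ ?n)"
      unfolding s2 k' by (simp add: emeasure_dcube[OF L])
    also have "\<dots> = ennreal (\<theta> * (2 * (2 * s)) ^ ?n)" using \<theta>(1) by (intro ennreal_mult'[symmetric]) simp
    also have "\<theta> * (2 * (2 * s)) ^ ?n = (2 * s) ^ ?n / 2"
      unfolding power_mult_distrib[of 2 "2 * s"] by (simp add: \<theta>_def)
    finally have half: "emeasure lborel (G \<inter> P) \<le> ennreal ((2 * s) ^ ?n / 2)" .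
    have "ennreal \<theta> * emeasure lborel P \<le> emeasure lborel (G \<inter> P)"
      using Px(2) unfolding Px(1) Bad_def by (rule less_imp_le)
    hence "ennreal (2 ^ (?n + 1)) * (ennreal \<theta> * emeasure lborel P) \<le> ennreal (2 ^ (?n + 1)) * emeasure lborel (G \<inter> P)"
      by (rule mult_left_mono) simp
    moreover have "ennreal (2 ^ (?n + 1)) * (ennreal \<theta> * emeasure lborel P) = emeasure lborel P"
    proof -
      have "ennreal (2 ^ (?n + 1)) * ennreal \<theta> = ennreal (2 ^ (?n + 1) * \<theta>)" by (intro ennreal_mult'[symmetric]) simp
      also have "2 ^ (?n + 1) * \<theta> = 1" by (simp add: \<theta>_def)
      finally show ?thesis by (simp add: mult.assoc[symmetric])
    qed
    ultimately have big: "emeasure lborel P \<le> ennreal (2 ^ (?n + 1)) * emeasure lborel (G \<inter> P)" by (simp only:)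
    have "P \<in> sets borel" unfolding Px(1) by (rule dcube_measurable)
    thus ?thesis using PR s w em half big by blast
  qed
  have cover: "G \<inter> R \<subseteq> \<Union>F"
  proof
    fix x assume x: "x \<in> G \<inter> R"
    then obtain e where e: "e > 0" "ball x e \<subseteq> G" using G openE by blast
    obtain k where k: "dcube a L k x \<subseteq> G" using dcube_subset_ball[OF L e(1), of a] e(2) by blast
    hence "G \<inter> dcube a L k x = dcube a L k x" by blast
    moreover have "ennreal \<theta> * emeasure lborel (dcube a L k x) < emeasure lborel (dcube a L k x)"
      using \<theta> L by (simp add: emeasure_dcube ennreal_mult[symmetric] ennreal_less_iff)
    ultimately have "Bad (dcube a L k x)" by (simp add: Bad_def)
    hence "x \<in> \<Union> (stopping a L Bad)" unfolding Union_stopping by blast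
    thus "x \<in> \<Union>F" using x unfolding F_def by blast
  qed
  have "countable F" unfolding F_def by (rule countable_subset[OF _ countable_stopping[of a L Bad]]) blast
  moreover have "disjoint_family_on (\<lambda>P. P) F"
    by (rule disjoint_family_on_mono[OF _ stopping_disjoint[of a L Bad]]) (auto simp: F_def)
  ultimately show ?thesis using F_props cover by blast
qed

lemma half_plus_eighth_less:
  assumes "V > (0::real)" "V \<le> V / 2 + V / 2 ^ (n + 3)"
  shows False
proof -
  have "V / 2 ^ (n + 3) \<le> V / 2 ^ 3"
    using assms(1) by (intro divide_left_mono power_increasing mult_pos_pos zero_less_power) auto
  hence "V / 2 ^ (n + 3) \<le> V / 8" by simp
  with assms show False by linarith
qed

lemma ennreal_plus_plus:
  "0 \<le> a \<Longrightarrow> 0 \<le> b \<Longrightarrow> 0 \<le> c \<Longrightarrow> ennreal a + (ennreal b + ennreal c) = ennreal (a + (b + c))"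
  by simp

lemma ennreal_divide_power2: "V > 0 \<Longrightarrow> ennreal (V / 2 ^ N) = ennreal V / 2 ^ N"
  by (simp add: divide_ennreal[symmetric] ennreal_power[symmetric])

lemma ennreal_power2_cancel:
  assumes "V > 0"
  shows "(ennreal (2 ^ (n + 1)) / 2 ^ N) * ennreal (V / 2 ^ (n + 2)) = ennreal (V / 2 ^ Suc N)"
proof -
  have "(ennreal (2 ^ (n + 1)) / 2 ^ N) * ennreal (V / 2 ^ (n + 2)) = ennreal (2 ^ (n + 1) / 2 ^ N) * ennreal (V / 2 ^ (n + 2))"
    by (subst ennreal_divide_power2) simp_all
  also have "\<dots> = ennreal (2 ^ (n + 1) / 2 ^ N * (V / 2 ^ (n + 2)))"
    by (intro ennreal_mult'[symmetric]) simp
  also have "2 ^ (n + 1) / 2 ^ N * (V / 2 ^ (n + 2)) = V / 2 ^ Suc N" by (simp add: power_add)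
  finally show ?thesis .
qed

text \<open>Induction on the number of halvings, for all cubes and constants at once. The
  exceptional set is covered by stopping cubes P, and the induction hypothesis is applied on each
  with its own constant c'. A point of P that is exceptional for neither constant gives |c' - c| at
  most C a + C a', hence at most 2 C M x for x in P: the level rises from 2 N + 1 to 2 N +
  3.\<close>

lemma osc_decay:
  fixes u :: "real^'n \<Rightarrow> complex" and M :: "real^'n \<Rightarrow> ennreal"
  assumes C: "C \<ge> 0" and osc: "\<And>z l. l > 0 \<Longrightarrow> \<exists>c. osc_bound u M C z l c"
  shows "l > 0 \<Longrightarrow> osc_bound u M C z l c \<Longrightarrow>
    \<exists>Z\<in>sets lebesgue. emeasure lebesgue Z \<le> ennreal ((2 * l) ^ CARD('n) / 2 ^ N) \<and>
      (\<forall>x\<in>cube z l - Z. ennreal (norm (u x - c)) \<le> ennreal (C * (2 * real N + 1)) * M x)"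
proof (induction N arbitrary: z l c)
  case 0
  then obtain Z a where Z: "Z \<in> sets lebesgue" "emeasure lebesgue Z \<le> ennreal ((2 * l) ^ CARD('n) / 2 ^ (CARD('n) + 3))"
    and a: "a \<ge> 0" "\<forall>x\<in>cube z l. ennreal a \<le> M x" "\<forall>x\<in>cube z l - Z. norm (u x - c) \<le> C * a"
    unfolding osc_bound_def by blast
  show ?case
  proof (intro bexI[OF _ Z(1)] conjI ballI)
    have "(2 * l) ^ CARD('n) / 2 ^ (CARD('n) + 3) \<le> (2 * l) ^ CARD('n) / 1"
      using 0(1) by (intro divide_left_mono one_le_power) auto
    hence "ennreal ((2 * l) ^ CARD('n) / 2 ^ (CARD('n) + 3)) \<le> ennreal ((2 * l) ^ CARD('n) / 2 ^ 0)"
      by (intro ennreal_leI) simp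
    with Z(2) show "emeasure lebesgue Z \<le> ennreal ((2 * l) ^ CARD('n) / 2 ^ 0)" by (rule order_trans)
    fix x assume x: "x \<in> cube z l - Z"
    have "ennreal (norm (u x - c)) \<le> ennreal (C * a)" using a(3) x by (intro ennreal_leI) blast
    also have "\<dots> = ennreal C * ennreal a" using C by (rule ennreal_mult')
    also have "\<dots> \<le> ennreal C * M x" using a(2) x by (intro mult_left_mono) auto
    finally show "ennreal (norm (u x - c)) \<le> ennreal (C * (2 * real 0 + 1)) * M x" by simp
  qed
next
  case (Suc N)
  let ?n = "CARD('n)"
  let ?V = "(2 * l) ^ ?n"
  have V: "?V > 0" using Suc.prems(1) by simp
  obtain Z a where Z: "Z \<in> sets lebesgue" "emeasure lebesgue Z \<le> ennreal (?V / 2 ^ (?n + 3))"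
    and a: "a \<ge> 0" "\<forall>x\<in>cube z l. ennreal a \<le> M x" "\<forall>x\<in>cube z l - Z. norm (u x - c) \<le> C * a"
    using Suc.prems(2) unfolding osc_bound_def by blast
  \<comment> \<open>Stopping cubes require an open set; outer regularity at most doubles the bound
    on the measure.\<close>
  have "?V / 2 ^ (?n + 3) > 0" using V by (intro divide_pos_pos) simp_all
  then obtain G where G: "open G" "Z \<subseteq> G" "emeasure lebesgue (G - Z) < ennreal (?V / 2 ^ (?n + 3))"
    using sets_lebesgue_outer_open[OF Z(1)] by metis
  have mG: "emeasure lebesgue G \<le> ennreal (?V / 2 ^ (?n + 2))"
  proof -
    have "emeasure lebesgue G = emeasure lebesgue (Z \<union> (G - Z))" using G(2) by (simp add: Un_absorb1)
    also have "\<dots> \<le> emeasure lebesgue Z + emeasure lebesgue (G - Z)"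
      using Z(1) G(1) by (intro emeasure_subadditive sets.Diff) auto
    also have "\<dots> \<le> ennreal (?V / 2 ^ (?n + 3)) + ennreal (?V / 2 ^ (?n + 3))"
      by (intro add_mono Z(2) less_imp_le[OF G(3)])
    also have "\<dots> = ennreal (?V / 2 ^ (?n + 3) + ?V / 2 ^ (?n + 3))" using V by (intro ennreal_plus[symmetric]) auto
    also have "?V / 2 ^ (?n + 3) + ?V / 2 ^ (?n + 3) = ?V / 2 ^ (?n + 2)" by (simp add: power_add field_simps)
    finally show ?thesis .
  qed
  define R where "R = dcube (\<chi> i. z $ i - l) (2 * l) 0 z"
  have R_meas: "R \<in> sets borel" unfolding R_def by (rule dcube_measurable)
  have memR: "y \<in> R \<longleftrightarrow> (\<forall>i. z $ i - l \<le> y $ i \<and> y $ i < z $ i + l)" for y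
  proof -
    have "dindex (\<chi> i. z $ i - l) (2 * l) 0 z i = 0" for i
      using Suc.prems(1) unfolding dindex_def by (simp add: floor_eq_iff)
    thus ?thesis unfolding R_def using Suc.prems(1) by (subst mem_dcube_iff) (auto simp: algebra_simps)
  qed
  have RQ: "R \<subseteq> cube z l" unfolding cube_def by (simp add: subset_iff memR mem_box_cart less_imp_le)
  have emR: "emeasure lborel R = ennreal ?V"
    unfolding R_def using Suc.prems(1) emeasure_dcube[of "2 * l" "\<chi> i. z $ i - l" 0 z] by simp
  define Q where "Q P \<longleftrightarrow> P \<subseteq> R \<and> P \<in> sets borel \<and>
      (\<exists>w s. s > 0 \<and> P \<subseteq> cube w s \<and> emeasure lborel P = ennreal ((2 * s) ^ ?n) \<and>
        emeasure lborel (G \<inter> P) \<le> ennreal ((2 * s) ^ ?n / 2) \<and>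
        emeasure lborel P \<le> ennreal (2 ^ (?n + 1)) * emeasure lborel (G \<inter> P))" for P
  have "\<exists>F. countable F \<and> disjoint_family_on (\<lambda>P. P) F \<and> (\<forall>P\<in>F. Q P) \<and> G \<inter> R \<subseteq> \<Union>F"
    unfolding Q_def R_def by (rule stopping_cover[OF Suc.prems(1) G(1) mG])
  then obtain F where F: "countable F" "disjoint_family_on (\<lambda>P. P) F" "G \<inter> R \<subseteq> \<Union>F" and
    FQ: "\<forall>P\<in>F. Q P" by (elim exE conjE)
  note FP = bspec[OF FQ, unfolded Q_def]
  have each: "\<exists>Y\<in>sets lebesgue. emeasure lebesgue Y \<le> emeasure lborel P / 2 ^ N \<and>
      (\<forall>x\<in>P - Y. ennreal (norm (u x - c)) \<le> ennreal (C * (2 * real (Suc N) + 1)) * M x)" if P: "P \<in> F" for P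
  proof -
    obtain w s where s: "s > 0" "P \<subseteq> cube w s" "emeasure lborel P = ennreal ((2 * s) ^ ?n)"
      "emeasure lborel (G \<inter> P) \<le> ennreal ((2 * s) ^ ?n / 2)" using FP[OF P] by blast
    have PR: "P \<subseteq> R" "P \<in> sets borel" using FP[OF P] by blast+
    obtain c' where c': "osc_bound u M C w s c'" using osc[OF s(1)] by blast
    then obtain Z' a' where Z': "Z' \<in> sets lebesgue" "emeasure lebesgue Z' \<le> ennreal ((2 * s) ^ ?n / 2 ^ (?n + 3))"
      and a': "a' \<ge> 0" "\<forall>x\<in>cube w s. ennreal a' \<le> M x" "\<forall>x\<in>cube w s - Z'. norm (u x - c') \<le> C * a'"
      unfolding osc_bound_def by blast
    obtain Y where Y: "Y \<in> sets lebesgue" "emeasure lebesgue Y \<le> ennreal ((2 * s) ^ ?n / 2 ^ N)"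
      "\<forall>x\<in>cube w s - Y. ennreal (norm (u x - c')) \<le> ennreal (C * (2 * real N + 1)) * M x"
      using Suc.IH[OF s(1) c'] by blast
    have sV: "(2 * s) ^ ?n > 0" using s(1) by simp
    \<comment> \<open>At most half of P lies in \<open>G\<close> and at most an eighth of its
      measure in \<open>Z'\<close>, so a point good for both constants remains.\<close>
    have "\<exists>y\<in>P. y \<notin> G \<and> y \<notin> Z'"
    proof (rule ccontr)
      assume "\<not> (\<exists>y\<in>P. y \<notin> G \<and> y \<notin> Z')"
      hence sub: "P \<subseteq> (G \<inter> P) \<union> Z'" by blast
      have GP: "G \<inter> P \<in> sets borel" using G(1) PR(2) by (intro sets.Int) auto
      have "emeasure lebesgue P \<le> emeasure lebesgue ((G \<inter> P) \<union> Z')"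
        using sub GP Z'(1) by (intro emeasure_mono sets.Un) auto
      also have "\<dots> \<le> emeasure lebesgue (G \<inter> P) + emeasure lebesgue Z'"
        using GP Z'(1) by (intro emeasure_subadditive) auto
      also have "\<dots> \<le> ennreal ((2 * s) ^ ?n / 2) + ennreal ((2 * s) ^ ?n / 2 ^ (?n + 3))"
        using s(4) GP by (intro add_mono Z'(2)) (simp add: emeasure_completion)
      also have "\<dots> = ennreal ((2 * s) ^ ?n / 2 + (2 * s) ^ ?n / 2 ^ (?n + 3))"
        using sV by (intro ennreal_plus[symmetric]) auto
      finally have fin: "emeasure lebesgue P \<le> ennreal ((2 * s) ^ ?n / 2 + (2 * s) ^ ?n / 2 ^ (?n + 3))" .
      have "emeasure lebesgue P = ennreal ((2 * s) ^ ?n)" using PR(2) by (simp add: emeasure_completion s(3))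
      with fin have fin': "ennreal ((2 * s) ^ ?n) \<le> ennreal ((2 * s) ^ ?n / 2 + (2 * s) ^ ?n / 2 ^ (?n + 3))"
        by (simp only:)
      have "0 \<le> (2 * s) ^ ?n / 2 + (2 * s) ^ ?n / 2 ^ (?n + 3)"
        using sV by (intro add_nonneg_nonneg divide_nonneg_pos less_imp_le[OF sV]) simp_all
      from fin'[unfolded ennreal_le_iff[OF this]]
      have le: "(2 * s) ^ ?n \<le> (2 * s) ^ ?n / 2 + (2 * s) ^ ?n / 2 ^ (?n + 3)" .
      from half_plus_eighth_less[OF sV le] show False .
    qed
    then obtain y where y: "y \<in> P" "y \<notin> G" "y \<notin> Z'" by blast
    have "norm (u y - c) \<le> C * a" using a(3) y PR(1) RQ G(2) by blast
    moreover have "norm (u y - c') \<le> C * a'" using a'(3) y s(2) by blast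
    ultimately have cc: "norm (c' - c) \<le> C * a + C * a'"
      using norm_triangle_ineq4[of "u y - c" "u y - c'"] by simp
    show ?thesis
    proof (intro bexI[OF _ Y(1)] conjI ballI)
      show "emeasure lebesgue Y \<le> emeasure lborel P / 2 ^ N"
        using Y(2) unfolding s(3) ennreal_divide_power2[OF sV] .
      fix x assume x: "x \<in> P - Y"
      have Ma: "ennreal a \<le> M x" "ennreal a' \<le> M x" using a(2) a'(2) x s(2) PR(1) RQ by blast+
      have "norm (u x - c) \<le> norm (u x - c') + (C * a + C * a')"
        using norm_triangle_ineq[of "u x - c'" "c' - c"] cc by simp
      hence "ennreal (norm (u x - c)) \<le> ennreal (norm (u x - c') + (C * a + C * a'))" by (rule ennreal_leI)
      also have "\<dots> = ennreal (norm (u x - c')) + (ennreal C * ennreal a + ennreal C * ennreal a')"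
        using C a(1) a'(1) by (simp add: ennreal_mult)
      also have "\<dots> \<le> ennreal (C * (2 * real N + 1)) * M x + (ennreal C * M x + ennreal C * M x)"
        using Y(3) x s(2) by (intro add_mono mult_left_mono Ma) auto
      also have "\<dots> = (ennreal (C * (2 * real N + 1)) + (ennreal C + ennreal C)) * M x"
        by (simp only: distrib_right)
      also have "ennreal (C * (2 * real N + 1)) + (ennreal C + ennreal C) = ennreal (C * (2 * real N + 1) + (C + C))"
        by (rule ennreal_plus_plus[OF mult_nonneg_nonneg[OF C] C C]) simp
      also have "C * (2 * real N + 1) + (C + C) = C * (2 * real (Suc N) + 1)" by (simp add: algebra_simps)
      finally show "ennreal (norm (u x - c)) \<le> ennreal (C * (2 * real (Suc N) + 1)) * M x" .
    qed
  qed
  hence "\<forall>P\<in>F. \<exists>Y. Y \<in> sets lebesgue \<and> emeasure lebesgue Y \<le> emeasure lborel P / 2 ^ N \<and>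
      (\<forall>x\<in>P - Y. ennreal (norm (u x - c)) \<le> ennreal (C * (2 * real (Suc N) + 1)) * M x)" by blast
  from bchoice[OF this] obtain Y where Y: "\<forall>P\<in>F. Y P \<in> sets lebesgue \<and> emeasure lebesgue (Y P) \<le> emeasure lborel P / 2 ^ N \<and>
      (\<forall>x\<in>P - Y P. ennreal (norm (u x - c)) \<le> ennreal (C * (2 * real (Suc N) + 1)) * M x)" by (rule exE)
  define W where "W = (\<Union>P\<in>F. Y P \<inter> P)"
  have Pleb: "P \<in> sets lebesgue" if "P \<in> F" for P using FP[OF that] by auto
  have YP: "Y P \<inter> P \<in> sets lebesgue" if "P \<in> F" for P using Y Pleb[OF that] that by (intro sets.Int) auto
  have W_meas: "W \<in> sets lebesgue" unfolding W_def by (rule sets.countable_UN''[OF F(1) YP])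
  have "emeasure lebesgue W = (\<integral>\<^sup>+P. emeasure lebesgue (Y P \<inter> P) \<partial>count_space F)"
    unfolding W_def
  proof (rule emeasure_UN_countable[OF YP F(1)])
    show "disjoint_family_on (\<lambda>P. Y P \<inter> P) F" using F(2) unfolding disjoint_family_on_def by blast
  qed
  also have "\<dots> \<le> (\<integral>\<^sup>+P. (ennreal (2 ^ (?n + 1)) / 2 ^ N) * emeasure lborel (G \<inter> P) \<partial>count_space F)"
  proof (rule nn_integral_mono)
    fix P assume "P \<in> space (count_space F)"
    hence P: "P \<in> F" by simp
    have "emeasure lebesgue (Y P \<inter> P) \<le> emeasure lebesgue (Y P)" using Y P by (intro emeasure_mono) auto
    also have "\<dots> \<le> emeasure lborel P / 2 ^ N" using Y P by blast
    also have "\<dots> \<le> (ennreal (2 ^ (?n + 1)) * emeasure lborel (G \<inter> P)) / 2 ^ N"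
      using FP[OF P] by (intro divide_right_mono_ennreal) blast
    also have "\<dots> = (ennreal (2 ^ (?n + 1)) / 2 ^ N) * emeasure lborel (G \<inter> P)"
      by (simp add: divide_ennreal_def mult_ac)
    finally show "emeasure lebesgue (Y P \<inter> P) \<le> (ennreal (2 ^ (?n + 1)) / 2 ^ N) * emeasure lborel (G \<inter> P)" .
  qed
  also have "\<dots> = (ennreal (2 ^ (?n + 1)) / 2 ^ N) * (\<integral>\<^sup>+P. emeasure lborel (G \<inter> P) \<partial>count_space F)"
    by (rule nn_integral_cmult) simp
  also have "(\<integral>\<^sup>+P. emeasure lborel (G \<inter> P) \<partial>count_space F) = emeasure lborel (\<Union>P\<in>F. G \<inter> P)"
  proof (rule emeasure_UN_countable[OF _ F(1), symmetric])
    show "G \<inter> P \<in> sets lborel" if "P \<in> F" for P using G(1) FP[OF that] by (intro sets.Int) auto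
    show "disjoint_family_on (\<lambda>P. G \<inter> P) F" using F(2) unfolding disjoint_family_on_def by blast
  qed
  finally have W0: "emeasure lebesgue W \<le> (ennreal (2 ^ (?n + 1)) / 2 ^ N) * emeasure lborel (\<Union>P\<in>F. G \<inter> P)" .
  have "emeasure lborel (\<Union>P\<in>F. G \<inter> P) \<le> emeasure lborel G" using G(1) by (intro emeasure_mono) auto
  also have "emeasure lborel G = emeasure lebesgue G" using G(1) by (simp add: emeasure_completion)
  also have "\<dots> \<le> ennreal (?V / 2 ^ (?n + 2))" by (rule mG)
  finally have "(ennreal (2 ^ (?n + 1)) / 2 ^ N) * emeasure lborel (\<Union>P\<in>F. G \<inter> P)
      \<le> (ennreal (2 ^ (?n + 1)) / 2 ^ N) * ennreal (?V / 2 ^ (?n + 2))"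
    by (rule mult_left_mono) simp
  with W0 have W1: "emeasure lebesgue W \<le> (ennreal (2 ^ (?n + 1)) / 2 ^ N) * ennreal (?V / 2 ^ (?n + 2))"
    by (rule order_trans)
  \<comment> \<open>2^(n+1) times V / 2^(n+2) is V / 2: the gained halving. The factor 2^(-N) is the
    induction hypothesis.\<close>
  have W2: "emeasure lebesgue W \<le> ennreal (?V / 2 ^ Suc N)"
    using W1 unfolding ennreal_power2_cancel[OF V] .
  have cube_leb: "cube z l \<in> sets lebesgue" "R \<in> sets lebesgue" using R_meas by (auto simp: cube_def)
  \<comment> \<open>The half-open cube omits only faces of the closed one.\<close>
  have null: "emeasure lebesgue (cube z l - R) = 0"
  proof -
    have "emeasure lebesgue (cube z l - R) = emeasure lebesgue (cube z l) - emeasure lebesgue R"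
      using RQ cube_leb emR R_meas by (intro emeasure_Diff) (auto simp: emeasure_completion)
    also have "\<dots> = ennreal ?V - ennreal ?V"
      using emR R_meas Suc.prems(1) by (simp add: emeasure_completion emeasure_cube)
    finally show ?thesis by simp
  qed
  show ?case
  proof (intro bexI[of _ "(cube z l - R) \<union> W"] conjI ballI)
    show "(cube z l - R) \<union> W \<in> sets lebesgue" using cube_leb W_meas by (intro sets.Un sets.Diff)
    have "emeasure lebesgue ((cube z l - R) \<union> W) \<le> emeasure lebesgue (cube z l - R) + emeasure lebesgue W"
      using cube_leb W_meas by (intro emeasure_subadditive sets.Diff)
    thus "emeasure lebesgue ((cube z l - R) \<union> W) \<le> ennreal (?V / 2 ^ Suc N)"
      using W2 null by simp
    fix x assume x: "x \<in> cube z l - ((cube z l - R) \<union> W)"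
    show "ennreal (norm (u x - c)) \<le> ennreal (C * (2 * real (Suc N) + 1)) * M x"
    proof (cases "x \<in> G")
      case True
      then obtain P where P: "P \<in> F" "x \<in> P" using F(3) x by blast
      hence "x \<in> P - Y P" using x unfolding W_def by blast
      thus ?thesis using Y P(1) by blast
    next
      case False
      hence "norm (u x - c) \<le> C * a" using a(3) x G(2) by blast
      hence "ennreal (norm (u x - c)) \<le> ennreal (C * a)" by (rule ennreal_leI)
      also have "\<dots> = ennreal C * ennreal a" using C by (rule ennreal_mult')
      also have "\<dots> \<le> ennreal (C * (2 * real (Suc N) + 1)) * M x"
      proof (rule mult_mono)
        have "C * 1 \<le> C * (2 * real (Suc N) + 1)" using C by (intro mult_left_mono) auto
        thus "ennreal C \<le> ennreal (C * (2 * real (Suc N) + 1))" by (intro ennreal_leI) simp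
        show "ennreal a \<le> M x" using a(2) x by blast
      qed auto
      finally show ?thesis .
    qed
  qed
qed

section \<open>Local oscillation estimate\<close>

lemma measure_cube: "\<rho> \<ge> 0 \<Longrightarrow> measure lebesgue (cube (w :: real^'n) \<rho>) = (2 * \<rho>) ^ CARD('n)"
proof -
  assume \<rho>: "\<rho> \<ge> 0"
  have "emeasure lebesgue (cube w \<rho>) = emeasure lborel (cube w \<rho>)"
    by (simp add: emeasure_completion)
  also have "\<dots> = ennreal ((2 * \<rho>) ^ CARD('n))" by (rule emeasure_cube[OF \<rho>])
  finally have em: "emeasure lebesgue (cube w \<rho>) = ennreal ((2 * \<rho>) ^ CARD('n))" .
  show ?thesis
    by (rule measure_eq_emeasure_eq_ennreal[OF _ em]) (use \<rho> in simp)
qed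

lemma cube_mono: "\<rho> \<le> \<rho>' \<Longrightarrow> cube w \<rho> \<subseteq> cube w \<rho>'"
  unfolding subset_iff mem_cube by (blast intro: order_trans)

context CZ_data_dim
begin

text \<open>The weak-type estimate as a predicate on its two constants, so that one constant can be
  fixed for all tuples and cubes.\<close>

definition wt_const :: "real \<Rightarrow> real \<Rightarrow> bool" where
  "wt_const \<delta> C0 \<longleftrightarrow> C0 > 0 \<and> (\<forall>L Av. \<forall>f :: 'm \<Rightarrow> real^'n \<Rightarrow> complex. L > 0 \<longrightarrow> (\<forall>j. Av j > 0) \<longrightarrow> (\<forall>j. f j \<in> bdd_supp) \<longrightarrow>
    (\<forall>j. (LINT x|lborel. norm (f j x)) \<le> Av j * L ^ CARD('n)) \<longrightarrow>
    (\<exists>Z\<in>sets lebesgue. emeasure lebesgue Z \<le> ennreal (\<delta> * L ^ CARD('n)) \<and>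
      (AE x in lebesgue. x \<notin> Z \<longrightarrow> norm (E f x) \<le> C0 * (\<Prod>j\<in>UNIV. Av j))))"

text \<open>\<open>a\<close> controls only the product of the L^1 norms, so each argument is
  normalised by its own average. A vanishing norm would make this impossible and is treated apart:
  \<open>E g\<close> is then 0 almost everywhere.\<close>

lemma local_part_bound:
  fixes g :: "'m \<Rightarrow> real^'n \<Rightarrow> complex"
  assumes wt: "wt_const \<delta> C0" and g: "\<And>j. g j \<in> bdd_supp" and L: "L > 0" and a: "a \<ge> 0"
    and le: "(\<Prod>j\<in>UNIV. \<integral>\<^sup>+y. ennreal (norm (g j y)) \<partial>lborel) \<le> ennreal (a * L powr MN)"
  shows "\<exists>Z\<in>sets lebesgue. emeasure lebesgue Z \<le> ennreal (\<delta> * L ^ CARD('n)) \<and>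
      (AE x in lebesgue. x \<notin> Z \<longrightarrow> norm (E g x) \<le> C0 * a)"
proof -
  let ?ng = "\<lambda>j. LINT x|lborel. norm (g j x)"
  have C0: "C0 > 0" using wt unfolding wt_const_def by (rule conjunct1)
  have int: "integrable lborel (\<lambda>x. norm (g j x))" for j by (intro integrable_norm integrable_bdd_supp g)
  have ng0: "?ng j \<ge> 0" for j by simp
  show ?thesis
  proof (cases "\<exists>i. ?ng i = 0")
    case True
    then obtain i where i: "?ng i = 0" by (rule exE)
    have "AE x in lborel. norm (g i x) = 0"
      using i integral_nonneg_eq_0_iff_AE[OF int[of i]] by simp
    hence "AE x in lebesgue. g i x = 0" unfolding AE_completion_iff by eventually_elim simp
    hence z: "AE x in lebesgue. E g x = 0" by (rule E_zero[of g i, OF g])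
    have "AE x in lebesgue. x \<notin> {} \<longrightarrow> norm (E g x) \<le> C0 * a"
      using z by eventually_elim (use C0 a in simp)
    thus ?thesis by (intro bexI[of _ "{}"] conjI) simp_all
  next
    case False
    hence pos: "?ng j > 0" for j using ng0[of j] by (simp add: less_le)
    define Av where "Av j = ?ng j / L ^ CARD('n)" for j
    have Av: "Av j > 0" for j unfolding Av_def using pos L by (intro divide_pos_pos) simp_all
    have AvL: "?ng j \<le> Av j * L ^ CARD('n)" for j unfolding Av_def using L by simp
    have "\<exists>Z\<in>sets lebesgue. emeasure lebesgue Z \<le> ennreal (\<delta> * L ^ CARD('n)) \<and>
      (AE x in lebesgue. x \<notin> Z \<longrightarrow> norm (E g x) \<le> C0 * (\<Prod>j\<in>UNIV. Av j))"
      by (rule conjunct2[OF wt[unfolded wt_const_def], rule_format]) (use L Av g AvL in simp_all)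
    then obtain Z where Z: "Z \<in> sets lebesgue" "emeasure lebesgue Z \<le> ennreal (\<delta> * L ^ CARD('n))"
      "AE x in lebesgue. x \<notin> Z \<longrightarrow> norm (E g x) \<le> C0 * (\<Prod>j\<in>UNIV. Av j)" by (elim bexE conjE)
    have "(\<Prod>j\<in>UNIV. \<integral>\<^sup>+y. ennreal (norm (g j y)) \<partial>lborel) = (\<Prod>j\<in>UNIV. ennreal (?ng j))"
      by (intro prod.cong refl nn_integral_eq_integral int) simp
    also have "\<dots> = ennreal (\<Prod>j\<in>UNIV. ?ng j)" by (rule prod_ennreal) simp
    finally have "ennreal (\<Prod>j\<in>UNIV. ?ng j) \<le> ennreal (a * L powr MN)" using le by simp
    hence pr: "(\<Prod>j\<in>UNIV. ?ng j) \<le> a * L powr MN"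
      using ennreal_le_iff[of "a * L powr MN"] a by simp
    have LMN: "L powr MN = (L ^ CARD('n)) ^ CARD('m)"
      unfolding MN using L by (subst powr_realpow) (simp_all add: power_mult[symmetric] mult.commute)
    have Lp: "(L ^ CARD('n)) ^ CARD('m) > 0" using L by simp
    have "(\<Prod>j\<in>UNIV. Av j) = (\<Prod>j\<in>UNIV. ?ng j) / (L ^ CARD('n)) ^ CARD('m)"
      unfolding Av_def by (simp add: prod_dividef)
    also have "\<dots> \<le> a" using pr Lp unfolding LMN by (simp add: pos_divide_le_eq)
    finally have "C0 * (\<Prod>j\<in>UNIV. Av j) \<le> C0 * a" using C0 by (intro mult_left_mono) simp_all
    with Z(3) have "AE x in lebesgue. x \<notin> Z \<longrightarrow> norm (E g x) \<le> C0 * a" by (auto elim!: AE_mp)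
    thus ?thesis using Z(1,2) by blast
  qed
qed

text \<open>Each telescoped tuple has a slot supported at distance at least 2 n l from the centre,
  whereas points of \<open>cube z l\<close> are within n l of it: just the factor 1/2 of the
  regularity estimate. The constants are the kernel integrals at the centre.\<close>

lemma far_part_bound:
  fixes f g :: "'m \<Rightarrow> real^'n \<Rightarrow> complex"
  assumes f: "\<And>j. f j \<in> bdd_supp" and l: "l > 0" and a: "a \<ge> 0"
    and g_def: "g = (\<lambda>j x. if x \<in> cube z (2 * nn * l) then f j x else 0)"
    and le: "\<And>\<rho>. \<rho> \<ge> l \<Longrightarrow> (\<Prod>j\<in>UNIV. \<integral>\<^sup>+y. ennreal (norm (f j y)) * indicator (cube z \<rho>) y \<partial>lborel) \<le> ennreal (a * (2 * \<rho>) powr MN)"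
  shows "\<exists>c. AE x in lebesgue. x \<in> cube z l \<longrightarrow> norm (E f x - E g x - c) \<le> real CARD('m) * ker_const * 2 powr MN * a"
proof -
  let ?r = "2 * nn * l"
  let ?\<kappa> = "a * 2 powr MN"
  have r: "?r > 0" using l nn(2) by simp
  have lr: "l < ?r" using l nn(3) by simp
  have g: "g j \<in> bdd_supp" for j unfolding g_def by (intro bdd_supp_restrict f cube_measurable)
  have gf: "norm (g j x) \<le> norm (f j x)" "norm (f j x - g j x) \<le> norm (f j x)" for j x unfolding g_def by simp_all
  have fg0: "f j x - g j x = 0" if "x \<in> cube z ?r" for j x using that unfolding g_def by simp
  define w where "w i J = (\<lambda>j. if j \<in> J then g j else f j)(i := \<lambda>x. f i x - g i x)" for i :: 'm and J
  define c where "c i J = (LINT y|lborel. K (kernel_pt z y) * (\<Prod>j\<in>UNIV. w i J j (y $ j)))" for i J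
  have w: "w i J j \<in> bdd_supp" for i J j unfolding w_def using f g bdd_supp_diff[OF f g] by simp
  have wf: "norm (w i J j x) \<le> norm (f j x)" for i J j x unfolding w_def using gf by simp
  have wi: "w i J i x = f i x - g i x" for i J x unfolding w_def by simp
  have tele: "AE x in lebesgue. x \<in> cube z l \<longrightarrow>
       norm (E ((\<lambda>j. if j \<in> J then g j else f j)(i := \<lambda>x. f i x - g i x)) x - c i J) \<le> ker_const * ?\<kappa>"
    for i J
  proof -
    obtain B rr where fb: "B > 0" "rr > 0" "\<And>x. norm (w i J i x) \<le> B" "\<And>x. w i J i x \<noteq> 0 \<Longrightarrow> norm x \<le> rr"
      by (rule bdd_suppE[OF w[of i J i]]) (rule that)
    \<comment> \<open>A bump covering the slot but vanishing on the dilated cube, so that the kernel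
      formula is valid on \<open>cube z l\<close>.\<close>
    obtain \<eta> :: "real^'n \<Rightarrow> complex" where \<eta>: "\<eta> \<in> flat_smooth"
      "{x. \<eta> x \<noteq> 0} = box (\<chi> i. - (rr + 1)) (\<chi> i. rr + 1) - cube z ?r"
      using flat_smooth_bump_box_diff[of "\<chi> i. - (rr + 1)" "\<chi> i. rr + 1"] unfolding cube_def by blast
    have \<eta>0: "w i J i x = 0" if "\<eta> x = 0" for x
    proof (rule ccontr)
      assume nz: "w i J i x \<noteq> 0"
      have "x \<notin> cube z ?r" using nz fg0[of x i] unfolding wi by blast
      moreover have "norm x \<le> rr" by (rule fb(4)[OF nz])
      hence "- (rr + 1) < x $ i \<and> x $ i < rr + 1" for i using component_le_norm_cart[of x i] by linarith
      hence "x \<in> box (\<chi> i. - (rr + 1)) (\<chi> i. rr + 1)" by (simp add: mem_box_cart)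
      ultimately have "x \<in> {x. \<eta> x \<noteq> 0}" unfolding \<eta>(2) by blast
      thus False using that by simp
    qed
    have b\<eta>: "bounded {x. \<eta> x \<noteq> 0}" unfolding \<eta>(2) by (rule bounded_subset[OF bounded_box]) blast
    have rep: "AE x in lebesgue. x \<notin> closure {x. \<eta> x \<noteq> 0} \<longrightarrow>
        E (w i J) x = (LINT y|lborel. K (kernel_pt x y) * (\<Prod>j\<in>UNIV. w i J j (y $ j)))"
      by (rule kernel_rep[of "w i J" \<eta> i, OF w \<eta>(1) b\<eta> \<eta>0])
    have "AE x in lebesgue. x \<in> cube z l \<longrightarrow> norm (E (w i J) x - c i J) \<le> ker_const * ?\<kappa>"
      using rep
    proof eventually_elim
      case (elim x)
      show ?case
      proof
        assume x: "x \<in> cube z l"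
        let ?U = "box (\<chi> i. z $ i - ?r) (\<chi> i. z $ i + ?r)"
        have "?U \<subseteq> cube z ?r" unfolding cube_def by (rule box_subset_cbox)
        hence "?U \<inter> {x. \<eta> x \<noteq> 0} = {}" unfolding \<eta>(2) by (intro equals0I) (elim IntE DiffE, drule (1) subsetD, erule notE)
        hence "?U \<inter> closure {x. \<eta> x \<noteq> 0} = {}" by (rule open_Int_closure_eq_empty[OF open_box, THEN iffD2])
        moreover have "x \<in> ?U"
        proof -
          have xl: "\<bar>x $ i - z $ i\<bar> \<le> l" for i using x by (simp add: mem_cube)
          have "z $ i - ?r < x $ i \<and> x $ i < z $ i + ?r" for i using xl[of i] lr by linarith
          thus ?thesis by (simp add: mem_box_cart)
        qed
        ultimately have xcl: "x \<notin> closure {x. \<eta> x \<noteq> 0}" by blast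
        have "norm ((LINT y|lborel. K (kernel_pt x y) * (\<Prod>j\<in>UNIV. w i J j (y $ j)))
            - (LINT y|lborel. K (kernel_pt z y) * (\<Prod>j\<in>UNIV. w i J j (y $ j)))) \<le> ker_const * ?\<kappa>"
        proof (rule kernel_diff_far[where r = ?r and i = i])
          show "w i J j \<in> bdd_supp" for j by (rule w)
          show "0 < ?r" by (rule r)
          show "0 \<le> ?\<kappa>" using a by simp
          show "norm (x - z) \<le> ?r / 2" using mem_cube_imp_norm_le[OF x] by (simp add: nn(1))
          show "?r \<le> norm (y - z)" if "w i J i y \<noteq> 0" for y
          proof -
            have "y \<notin> cube z ?r" using that fg0[of y i] unfolding wi by blast
            thus ?thesis using norm_le_imp_mem_cube[of y z ?r] by linarith
          qed
          fix \<rho> assume \<rho>: "?r \<le> \<rho>"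
          have "(\<Prod>j\<in>UNIV. \<integral>\<^sup>+y. ennreal (norm (w i J j y)) * indicator (cube z \<rho>) y \<partial>lborel)
            \<le> (\<Prod>j\<in>UNIV. \<integral>\<^sup>+y. ennreal (norm (f j y)) * indicator (cube z \<rho>) y \<partial>lborel)"
            by (intro prod_mono_ennreal nn_integral_mono mult_right_mono ennreal_leI wf) simp
          also have "\<dots> \<le> ennreal (a * (2 * \<rho>) powr MN)" using \<rho> lr by (intro le) linarith
          also have "a * (2 * \<rho>) powr MN = ?\<kappa> * \<rho> powr MN" by (simp add: powr_mult)
          finally show "(\<Prod>j\<in>UNIV. \<integral>\<^sup>+y. ennreal (norm (w i J j y)) * indicator (cube z \<rho>) y \<partial>lborel) \<le> ennreal (?\<kappa> * \<rho> powr MN)" .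
        qed
        thus "norm (E (w i J) x - c i J) \<le> ker_const * ?\<kappa>"
          unfolding c_def elim[rule_format, OF xcl] .
      qed
    qed
    thus ?thesis unfolding w_def .
  qed
  have "\<exists>c'. (c = (\<lambda>_ _. 0) \<longrightarrow> c' = 0) \<and> (AE x in lebesgue. x \<in> cube z l \<longrightarrow>
     norm (E f x - E (\<lambda>j. if j \<in> UNIV then g j else f j) x - c') \<le> (\<Sum>i\<in>(UNIV::'m set). ker_const * ?\<kappa>))"
    by (rule E_telescope[OF f g tele]) simp
  then obtain c' where "AE x in lebesgue. x \<in> cube z l \<longrightarrow>
     norm (E f x - E (\<lambda>j. if j \<in> UNIV then g j else f j) x - c') \<le> (\<Sum>i\<in>(UNIV::'m set). ker_const * ?\<kappa>)"
    by (elim exE conjE)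
  hence "AE x in lebesgue. x \<in> cube z l \<longrightarrow> norm (E f x - E g x - c') \<le> real CARD('m) * ker_const * 2 powr MN * a"
    by (simp add: mult_ac)
  thus ?thesis by (rule exI)
qed

text \<open>The iteration compares constants at individual points, so the bound must hold pointwise
  off the exceptional set; the null set is added to \<open>Z\<close>.\<close>

lemma osc_boundI:
  fixes u :: "real^'n \<Rightarrow> complex"
  assumes Z: "Z \<in> sets lebesgue" "emeasure lebesgue Z \<le> ennreal ((2 * l) ^ CARD('n) / 2 ^ (CARD('n) + 3))"
    and a: "a \<ge> 0" "\<And>x. x \<in> cube z l \<Longrightarrow> ennreal a \<le> M x"
    and AE: "AE x in lebesgue. x \<notin> Z \<longrightarrow> x \<in> cube z l \<longrightarrow> norm (u x - c) \<le> C1 * a"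
  shows "osc_bound u M C1 z l c"
proof -
  obtain N where N: "N \<in> null_sets lebesgue" "{x. \<not> (x \<notin> Z \<longrightarrow> x \<in> cube z l \<longrightarrow> norm (u x - c) \<le> C1 * a)} \<subseteq> N"
    using AE unfolding eventually_ae_filter by auto
  have "emeasure lebesgue (Z \<union> N) = emeasure lebesgue Z" by (rule emeasure_Un_null_set[OF Z(1) N(1)])
  hence em: "emeasure lebesgue (Z \<union> N) \<le> ennreal ((2 * l) ^ CARD('n) / 2 ^ (CARD('n) + 3))" using Z(2) by simp
  have "Z \<union> N \<in> sets lebesgue" using Z(1) N(1) by (intro sets.Un) auto
  moreover have "\<forall>x\<in>cube z l - (Z \<union> N). norm (u x - c) \<le> C1 * a" using N(2) by blast
  moreover have "\<forall>x\<in>cube z l. ennreal a \<le> M x" using a(2) by blast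
  ultimately show ?thesis unfolding osc_bound_def using em a(1) by blast
qed

text \<open>Sum of the local and the far estimate. The second conclusion serves to start the
  iteration: if all arguments live in the dilated cube, there is no far part and the constant is
  0.\<close>

lemma oscillation:
  "\<exists>C1>0. \<forall>(f :: 'm \<Rightarrow> real^'n \<Rightarrow> complex) M z l a. (\<forall>j. f j \<in> bdd_supp) \<longrightarrow> l > 0 \<longrightarrow> a \<ge> 0 \<longrightarrow>
    (\<forall>x\<in>cube z l. ennreal a \<le> M x) \<longrightarrow>
    (\<forall>\<rho>\<ge>l. (\<Prod>j\<in>UNIV. \<integral>\<^sup>+y. ennreal (norm (f j y)) * indicator (cube z \<rho>) y \<partial>lborel) \<le> ennreal (a * (2 * \<rho>) powr MN)) \<longrightarrow>
    (\<exists>c. osc_bound (E f) M C1 z l c) \<and>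
    ((\<forall>j x. f j x \<noteq> 0 \<longrightarrow> x \<in> cube z (2 * nn * l)) \<longrightarrow> osc_bound (E f) M C1 z l 0)"
proof -
  \<comment> \<open>The local part lives on a cube of side 4 n l and volume (2 n)^n (2 l)^n; this
    value turns the weak-type fraction of it into 2^(-n-3) of the volume of
    \<open>cube z l\<close>.\<close>
  define \<delta> where "\<delta> = 1 / ((2 * nn) ^ CARD('n) * 2 ^ (CARD('n) + 3))"
  have \<delta>: "\<delta> > 0" unfolding \<delta>_def using nn(2) by simp
  obtain C0 where wt: "wt_const \<delta> C0" using weak_type[OF \<delta>] unfolding wt_const_def by (elim exE)
  have C0: "C0 > 0" using wt unfolding wt_const_def by (rule conjunct1)
  define D where "D = real CARD('m) * ker_const * 2 powr MN"
  have D: "D > 0" unfolding D_def using ker_const_pos by simp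
  have main: "(\<exists>c. osc_bound (E f) M (C0 + D) z l c) \<and>
    ((\<forall>j x. f j x \<noteq> 0 \<longrightarrow> x \<in> cube z (2 * nn * l)) \<longrightarrow> osc_bound (E f) M (C0 + D) z l 0)"
    if f: "\<And>j. f j \<in> bdd_supp" and l: "l > 0" and a: "a \<ge> 0" "\<And>x. x \<in> cube z l \<Longrightarrow> ennreal a \<le> M x"
      and le: "\<And>\<rho>. \<rho> \<ge> l \<Longrightarrow> (\<Prod>j\<in>UNIV. \<integral>\<^sup>+y. ennreal (norm (f j y)) * indicator (cube z \<rho>) y \<partial>lborel) \<le> ennreal (a * (2 * \<rho>) powr MN)"
    for f :: "'m \<Rightarrow> real^'n \<Rightarrow> complex" and M z l a
  proof -
    let ?r = "2 * nn * l"
    have r: "?r > 0" using l nn(2) by simp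
    have lr: "l \<le> ?r" using l nn(3) by simp
    define g where "g = (\<lambda>j x. if x \<in> cube z ?r then f j x else 0)"
    have g: "g j \<in> bdd_supp" for j unfolding g_def by (intro bdd_supp_restrict f cube_measurable)
    have "(\<integral>\<^sup>+y. ennreal (norm (g j y)) \<partial>lborel) = (\<integral>\<^sup>+y. ennreal (norm (f j y)) * indicator (cube z ?r) y \<partial>lborel)" for j
      unfolding g_def by (intro nn_integral_cong) (simp add: indicator_def)
    hence "(\<Prod>j\<in>UNIV. \<integral>\<^sup>+y. ennreal (norm (g j y)) \<partial>lborel) \<le> ennreal (a * (2 * ?r) powr MN)"
      using le[OF lr] by (simp only:)
    from local_part_bound[OF wt g _ a(1) this] r obtain Z where Z: "Z \<in> sets lebesgue"
      "emeasure lebesgue Z \<le> ennreal (\<delta> * (2 * ?r) ^ CARD('n))"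
      "AE x in lebesgue. x \<notin> Z \<longrightarrow> norm (E g x) \<le> C0 * a" by auto
    have Zle: "emeasure lebesgue Z \<le> ennreal ((2 * l) ^ CARD('n) / 2 ^ (CARD('n) + 3))"
    proof -
      have "2 * ?r = (2 * nn) * (2 * l)" by simp
      hence "\<delta> * (2 * ?r) ^ CARD('n) = \<delta> * ((2 * nn) ^ CARD('n) * (2 * l) ^ CARD('n))"
        by (simp only: power_mult_distrib)
      also have "\<dots> = (2 * l) ^ CARD('n) / 2 ^ (CARD('n) + 3)"
      proof -
        have "1 / (p * s) * (p * v) = v / s" if "p \<noteq> 0" for p s v :: real using that by simp
        moreover have "(2 * nn) ^ CARD('n) \<noteq> 0" using nn(2) by simp
        ultimately show ?thesis unfolding \<delta>_def by blast
      qed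
      finally show ?thesis using Z(2) by simp
    qed
    obtain c where c: "AE x in lebesgue. x \<in> cube z l \<longrightarrow> norm (E f x - E g x - c) \<le> D * a"
      using far_part_bound[OF f l a(1) g_def le] unfolding D_def by blast
    have "AE x in lebesgue. x \<notin> Z \<longrightarrow> x \<in> cube z l \<longrightarrow> norm (E f x - c) \<le> (C0 + D) * a"
      using Z(3) c
    proof eventually_elim
      case (elim x)
      show ?case
      proof (intro impI)
        assume "x \<notin> Z" "x \<in> cube z l"
        hence "norm (E g x) \<le> C0 * a" "norm (E f x - E g x - c) \<le> D * a" using elim by blast+
        moreover have "norm (E f x - c) \<le> norm (E g x) + norm (E f x - E g x - c)"
          using norm_triangle_ineq[of "E g x" "E f x - E g x - c"] by simp
        ultimately show "norm (E f x - c) \<le> (C0 + D) * a" unfolding distrib_right by linarith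
      qed
    qed
    from osc_boundI[OF Z(1) Zle a this] have 1: "osc_bound (E f) M (C0 + D) z l c" .
    have 2: "osc_bound (E f) M (C0 + D) z l 0" if supp: "\<forall>j x. f j x \<noteq> 0 \<longrightarrow> x \<in> cube z ?r"
    proof -
      have "g = f" unfolding g_def using supp by (intro ext) auto
      have "AE x in lebesgue. x \<notin> Z \<longrightarrow> x \<in> cube z l \<longrightarrow> norm (E f x - 0) \<le> (C0 + D) * a"
        using Z(3)[unfolded \<open>g = f\<close>]
      proof eventually_elim
        case (elim x)
        have "C0 * a \<le> (C0 + D) * a" using a(1) D by (intro mult_right_mono) simp_all
        thus ?case using elim by auto
      qed
      from osc_boundI[OF Z(1) Zle a this] show ?thesis .
    qed
    show ?thesis using 1 2 by blast
  qed
  have "C0 + D > 0" using C0 D by simp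
  thus ?thesis using main by (intro exI[of _ "C0 + D"] conjI) auto
qed

end

section \<open>The exponential estimate\<close>

text \<open>The complement of the essential support is a possibly uncountable union of open sets. By
  Lindelof's theorem countably many of them suffice, so the exceptional null sets can be
  united.\<close>

lemma AE_not_ess_supp: "AE x in lebesgue. x \<notin> ess_supp (f :: real^'n \<Rightarrow> complex) \<longrightarrow> f x = 0"
proof -
  define \<U> where "\<U> = {U. open U \<and> (AE x in lebesgue. x \<in> U \<longrightarrow> f x = 0)}"
  have op: "open U" if "U \<in> \<U>" for U using that by (simp add: \<U>_def)
  obtain \<V> where V: "\<V> \<subseteq> \<U>" "countable \<V>" "\<Union>\<V> = \<Union>\<U>"    by (rule Lindelof[of \<U>]) (erule op, rule that)
  have "AE x in lebesgue. x \<in> U \<longrightarrow> f x = 0" if "U \<in> \<V>" for U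
    using subsetD[OF V(1) that] by (simp add: \<U>_def)
  hence "AE x in lebesgue. \<forall>U\<in>\<V>. x \<in> U \<longrightarrow> f x = 0"
    unfolding AE_ball_countable[OF V(2)] by blast
  thus ?thesis
  proof eventually_elim
    case (elim x)
    have "x \<notin> ess_supp f \<longleftrightarrow> x \<in> \<Union>\<V>" unfolding V(3) ess_supp_def \<U>_def by (simp only: Compl_iff not_not)
    thus ?case using elim by blast
  qed
qed

text \<open>Passing to a Borel version and truncating to the cube and to the essential bound alters
  the function on a null set only.\<close>

lemma bdd_supp_representative:
  fixes f :: "real^'n \<Rightarrow> complex"
  assumes f: "f \<in> Linfty_c" and supp: "ess_supp f \<subseteq> cube z l"
  shows "\<exists>g\<in>bdd_supp. (AE x in lebesgue. f x = g x) \<and> (\<forall>x. g x \<noteq> 0 \<longrightarrow> x \<in> cube z l)"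
proof -
  have fm: "f \<in> borel_measurable lebesgue" using f by (simp add: Linfty_c_def)
  obtain B where B: "AE x in lebesgue. norm (f x) \<le> B" using f unfolding Linfty_c_def by blast
  obtain g where g: "g \<in> borel_measurable lborel" "AE x in lborel. f x = g x"
    using completion_ex_complex[OF fm] by blast
  have gB: "g \<in> borel_measurable borel" using g(1) by simp
  define g' where "g' x = (if x \<in> cube z l \<and> norm (g x) \<le> B then g x else 0)" for x
  have "bounded (cube z l)" unfolding cube_def by (rule bounded_cbox)
  then obtain r where r: "\<And>x. x \<in> cube z l \<Longrightarrow> norm x \<le> r" unfolding bounded_iff by blast
  have meas: "g' \<in> borel_measurable borel" unfolding g'_def using gB by measurable
  have "g' \<in> bdd_supp"
  proof (rule bdd_suppI[OF meas])
    show "norm (g' x) \<le> \<bar>B\<bar>" for x unfolding g'_def by auto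
    show "norm x \<le> r" if "g' x \<noteq> 0" for x using that r[of x] unfolding g'_def by (auto split: if_splits)
  qed
  moreover have "AE x in lebesgue. f x = g' x"
    using AE_completion[OF g(2)] B AE_not_ess_supp[of f]
  proof eventually_elim
    case (elim x)
    show ?case
    proof (cases "x \<in> cube z l")
      case True
      thus ?thesis using elim(1,2) by (simp add: g'_def)
    next
      case False
      hence "f x = 0" using elim(3) supp by blast
      thus ?thesis using False by (simp add: g'_def)
    qed
  qed
  moreover have "\<forall>x. g' x \<noteq> 0 \<longrightarrow> x \<in> cube z l" unfolding g'_def by auto
  ultimately show ?thesis by blast
qed

lemma multi_maximal_cong:
  assumes "\<And>j. AE x in lebesgue. f j x = g j x"
  shows "multi_maximal f = multi_maximal g"
proof -
  have "(\<integral>\<^sup>+y\<in>Q. ennreal (norm (f j y)) \<partial>lebesgue) = (\<integral>\<^sup>+y\<in>Q. ennreal (norm (g j y)) \<partial>lebesgue)" for j Q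
    by (rule nn_integral_cong_AE) (use assms[of j] in \<open>eventually_elim, simp\<close>)
  thus ?thesis unfolding multi_maximal_def by (simp only:)
qed

lemma ennreal_divide_mult_cancel: "v > 0 \<Longrightarrow> x / ennreal v * ennreal v = x"
  by (simp add: ennreal_divide_times ennreal_divide_self)

lemma ennreal_divide_le:
  assumes "v > 0" "x \<le> b * ennreal v"
  shows "x / ennreal v \<le> b"
proof -
  have "x / ennreal v \<le> b * ennreal v / ennreal v" by (rule divide_right_mono_ennreal[OF assms(2)])
  also have "\<dots> = b" by (rule mult_divide_eq_ennreal) (use assms(1) in simp_all)
  finally show ?thesis .
qed

lemma emeasure_lebesgue_cube: "\<rho> \<ge> 0 \<Longrightarrow> emeasure lebesgue (cube (w :: real^'n) \<rho>) = ennreal ((2 * \<rho>) ^ CARD('n))"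
proof -
  assume \<rho>: "\<rho> \<ge> 0"
  have "emeasure lebesgue (cube w \<rho>) = emeasure lborel (cube w \<rho>)" by (simp add: emeasure_completion)
  also have "\<dots> = ennreal ((2 * \<rho>) ^ CARD('n))" by (rule emeasure_cube[OF \<rho>])
  finally show ?thesis .
qed

text \<open>Needed to treat the infimum over a cube as a real number.\<close>

lemma multi_maximal_finite:
  fixes f :: "'m::finite \<Rightarrow> real^'n \<Rightarrow> complex"
  assumes f: "\<And>j. f j \<in> bdd_supp"
  shows "multi_maximal f x < top"
proof -
  obtain B r where B: "B > 0" "r > 0" "\<And>j x. norm (f j x) \<le> B" "\<And>j x. f j x \<noteq> 0 \<Longrightarrow> norm x \<le> r"
    by (rule bdd_supp_common_bound[of f, OF f]) (rule that)
  have "multi_maximal f x \<le> (\<Prod>j\<in>(UNIV::'m set). ennreal B)"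
    unfolding multi_maximal_def
  proof (rule SUP_least, rule prod_mono_ennreal)
    fix Q j assume "Q \<in> {Q. is_cube Q \<and> x \<in> Q}"
    hence "is_cube Q" by simp
    then obtain w \<rho> where w: "\<rho> > 0" "Q = cube w \<rho>" by (rule is_cubeE)
    let ?v = "(2 * \<rho>) ^ CARD('n)"
    have v: "?v > 0" using w(1) by simp
    have em: "emeasure lebesgue Q = ennreal ?v" unfolding w(2) using w(1) by (intro emeasure_lebesgue_cube) simp
    have Qm: "Q \<in> sets lebesgue" unfolding w(2) by (simp add: cube_def)
    have "(\<integral>\<^sup>+y\<in>Q. ennreal (norm (f j y)) \<partial>lebesgue) \<le> (\<integral>\<^sup>+y. ennreal B * indicator Q y \<partial>lebesgue)"
      by (intro nn_integral_mono mult_right_mono ennreal_leI B(3)) simp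
    also have "\<dots> = ennreal B * ennreal ?v" using Qm by (simp add: nn_integral_cmult_indicator em)
    finally show "(\<integral>\<^sup>+y\<in>Q. ennreal (norm (f j y)) \<partial>lebesgue) / emeasure lebesgue Q \<le> ennreal B"
      unfolding em by (rule ennreal_divide_le[OF v])
  qed
  also have "(\<Prod>j\<in>(UNIV::'m set). ennreal B) = ennreal (\<Prod>j\<in>(UNIV::'m set). B)"
    by (rule prod_ennreal) (use B(1) in simp)
  finally show ?thesis using ennreal_less_top by (rule le_less_trans)
qed

text \<open>\<open>a\<close> is the infimum of the maximal function on the cube. A concentric cube
  of half side at least \<open>l\<close> competes in the supremum at every point of
  \<open>cube z l\<close>, so its product of averages stays below the infimum.\<close>

lemma multi_maximal_lower_bound:
  fixes f :: "'m::finite \<Rightarrow> real^'n \<Rightarrow> complex"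
  assumes f: "\<And>j. f j \<in> bdd_supp" and l: "l > 0"
  shows "\<exists>a\<ge>0. (\<forall>x\<in>cube z l. ennreal a \<le> multi_maximal f x) \<and>
    (\<forall>\<rho>\<ge>l. (\<Prod>j\<in>UNIV. \<integral>\<^sup>+y. ennreal (norm (f j y)) * indicator (cube z \<rho>) y \<partial>lborel)
       \<le> ennreal (a * (2 * \<rho>) powr (real (CARD('m) * CARD('n)))))"
proof -
  define b where "b = (INF x\<in>cube z l. multi_maximal f x)"
  define a where "a = enn2real b"
  have z: "z \<in> cube z l" using l by (simp add: mem_cube)
  have "b \<le> multi_maximal f z" unfolding b_def by (rule INF_lower[OF z])
  hence "b < top" using multi_maximal_finite[of f z, OF f] by (rule le_less_trans)
  hence ab: "ennreal a = b" unfolding a_def by (rule ennreal_enn2real)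
  have a0: "a \<ge> 0" unfolding a_def by (rule enn2real_nonneg)
  have low: "ennreal a \<le> multi_maximal f x" if "x \<in> cube z l" for x
    unfolding ab b_def by (rule INF_lower[OF that])
  have "(\<Prod>j\<in>UNIV. \<integral>\<^sup>+y. ennreal (norm (f j y)) * indicator (cube z \<rho>) y \<partial>lborel)
       \<le> ennreal (a * (2 * \<rho>) powr (real (CARD('m) * CARD('n))))" if \<rho>: "\<rho> \<ge> l" for \<rho>
  proof -
    let ?v = "(2 * \<rho>) ^ CARD('n)"
    have \<rho>0: "\<rho> > 0" using \<rho> l by linarith
    have v: "?v > 0" using \<rho>0 by simp
    have em: "emeasure lebesgue (cube z \<rho>) = ennreal ?v" using \<rho>0 by (intro emeasure_lebesgue_cube) simp
    let ?I = "\<lambda>j. \<integral>\<^sup>+y. ennreal (norm (f j y)) * indicator (cube z \<rho>) y \<partial>lborel"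
    let ?A = "\<lambda>j. (\<integral>\<^sup>+y\<in>cube z \<rho>. ennreal (norm (f j y)) \<partial>lebesgue) / emeasure lebesgue (cube z \<rho>)"
    have "(\<Prod>j\<in>UNIV. ?A j) \<le> b"
      unfolding b_def
    proof (rule INF_greatest)
      fix x assume "x \<in> cube z l"
      hence "x \<in> cube z \<rho>" using cube_mono[OF \<rho>] by blast
      hence "cube z \<rho> \<in> {Q. is_cube Q \<and> x \<in> Q}" using is_cube_cube[OF \<rho>0] by simp
      thus "(\<Prod>j\<in>UNIV. ?A j) \<le> multi_maximal f x" unfolding multi_maximal_def by (rule SUP_upper)
    qed
    hence le: "(\<Prod>j\<in>UNIV. ?A j) \<le> ennreal a" by (simp only: ab)
    have "?I j = ?A j * ennreal ?v" for j
      unfolding em ennreal_divide_mult_cancel[OF v] nn_integral_completion ..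
    hence "(\<Prod>j\<in>UNIV. ?I j) = (\<Prod>j\<in>UNIV. ?A j) * ennreal ?v ^ CARD('m)"
      by (simp only: prod.distrib prod_constant)
    also have "\<dots> \<le> ennreal a * ennreal ?v ^ CARD('m)" by (rule mult_right_mono[OF le]) simp
    also have "\<dots> = ennreal a * ennreal (?v ^ CARD('m))" using v by (simp only: ennreal_power less_imp_le)
    also have "\<dots> = ennreal (a * ?v ^ CARD('m))" by (rule ennreal_mult'[OF a0, symmetric])
    also have "?v ^ CARD('m) = (2 * \<rho>) powr (real (CARD('m) * CARD('n)))"
    proof -
      have "(2 * \<rho>) powr (real (CARD('m) * CARD('n))) = (2 * \<rho>) ^ (CARD('m) * CARD('n))"
        by (rule powr_realpow) (use \<rho>0 in simp)
      thus ?thesis by (simp only: power_mult[symmetric] mult.commute)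
    qed
    finally show ?thesis .
  qed
  thus ?thesis using a0 low by blast
qed

text \<open>\<open>N\<close> is the largest number of halvings whose level C (2 N + 1) fits below
  \<open>t\<close>. It is at least t / (2 C) - 2, and the lost 2 in the exponent of 2 is the factor
  4.\<close>

lemma exp_decay_choice:
  assumes C: "C > 0" and t: "t \<ge> C"
  shows "\<exists>N::nat. C * (2 * real N + 1) \<le> t \<and> 1 / 2 ^ N \<le> 4 * exp (- (ln 2 / (2 * C)) * t)"
proof -
  define s where "s = t / (2 * C)"
  have s: "s \<ge> 1 / 2" unfolding s_def using C t by (simp add: field_simps)
  define N where "N = nat \<lfloor>s - 1 / 2\<rfloor>"
  have N: "real N \<le> s - 1 / 2" "s - 1 / 2 < real N + 1" unfolding N_def using s by linarith+
  have ts: "t = 2 * C * s" unfolding s_def using C by simp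
  have "C * (2 * real N + 1) \<le> C * (2 * s)" using N(1) C by (intro mult_left_mono) linarith+
  hence 1: "C * (2 * real N + 1) \<le> t" unfolding ts by (simp add: mult_ac)
  have "(2::real) ^ N = exp (ln 2 * real N)" by (simp add: powr_realpow[symmetric] powr_def mult.commute)
  hence "1 / (2::real) ^ N = exp (- (ln 2 * real N))" by (simp add: exp_minus inverse_eq_divide)
  also have "\<dots> \<le> exp (2 * ln 2 - ln 2 * s)"
  proof -
    have "ln 2 * (s - 2) \<le> ln 2 * real N" using N(2) by (intro mult_left_mono) (linarith, simp)
    thus ?thesis by (simp add: algebra_simps)
  qed
  also have "\<dots> = exp (2 * ln 2) * exp (- (ln 2 * s))" by (simp add: exp_add[symmetric])
  finally have e: "1 / 2 ^ N \<le> exp (2 * ln 2) * exp (- (ln 2 * s))" .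
  have four: "exp (2 * ln 2) = (4::real)" by (simp add: exp_double power2_eq_square)
  have st: "- (ln 2 * s) = - (ln 2 / (2 * C)) * t" unfolding s_def by simp
  show ?thesis by (rule exI[of _ N]) (rule conjI[OF 1 e[unfolded four st]])
qed

text \<open>Below level C no iteration fits, but then the claimed fraction is at least 1 and the
  trivial bound by the measure of the cube suffices.\<close>

lemma exp_small_t:
  fixes C t :: real
  assumes C: "C > 0" and t: "t < C"
  shows "1 \<le> 4 * exp (- (ln 2 / (2 * C)) * t)"
proof -
  have l2: "ln 2 > (0::real)" by simp
  have k: "0 < ln 2 / (2 * C)" by (rule divide_pos_pos[OF l2]) (use C in simp)
  have "(ln 2 / (2 * C)) * t \<le> (ln 2 / (2 * C)) * C"
    by (rule mult_left_mono[OF less_imp_le[OF t] less_imp_le[OF k]])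
  also have "(ln 2 / (2 * C)) * C = ln 2 / 2" using C by (simp add: field_simps)
  finally have le: "(ln 2 / (2 * C)) * t \<le> ln 2 / 2" .
  have "- ln 2 \<le> - (ln 2 / (2 * C)) * t" using le l2 unfolding mult_minus_left by linarith
  hence "exp (- ln 2) \<le> exp (- (ln 2 / (2 * C)) * t)" by (simp only: exp_le_cancel_iff)
  moreover have "exp (- ln 2) = (1/2::real)"
    by (simp only: exp_minus exp_ln zero_less_numeral inverse_eq_divide)
  ultimately show ?thesis by linarith
qed

text \<open>\<open>measure\<close> is 0 on sets outside the sigma-algebra, so a measurable superset
  bounds it without a proof that \<open>A\<close> is measurable.\<close>

lemma measure_le_of_subset:
  assumes sub: "A \<subseteq> Z" and Z: "Z \<in> sets M" "emeasure M Z \<le> ennreal c" and c: "c \<ge> 0"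
  shows "measure M A \<le> c"
proof (cases "A \<in> sets M")
  case True
  have "emeasure M A \<le> ennreal c" using emeasure_mono[OF sub Z(1)] Z(2) by (rule order_trans)
  thus ?thesis unfolding measure_def by (intro enn2real_leI[OF c])
qed (use c in \<open>simp add: measure_notin_sets\<close>)

theorem theorem2p3:
  fixes T :: "('m::finite \<Rightarrow> real^'n \<Rightarrow> complex) \<Rightarrow> (real^'n \<Rightarrow> complex) \<Rightarrow> complex"
  assumes "CZ_operator T"
  shows "\<exists>\<alpha> c. \<alpha> > 0 \<and> c > 0 \<and>
    (\<forall>qs q E. bounded_extension T qs q E \<longrightarrow>
      (\<forall>Q f. is_cube Q \<longrightarrow> (\<forall>j. f j \<in> Linfty_c \<and> ess_supp (f j) \<subseteq> Q) \<longrightarrow>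
        (\<forall>t>0. measure lebesgue {x \<in> Q. ennreal (norm (E f x)) > ennreal t * multi_maximal f x}
                 \<le> c * exp (- \<alpha> * t) * measure lebesgue Q)))"
proof -
  obtain qs q E K where ext: "bounded_extension T qs q E" and K: "CZ_kernel K" and
    rep: "\<And>f. (\<forall>j. f j \<in> schwartz) \<Longrightarrow> AE x in lebesgue. x \<notin> (\<Inter>j. ess_supp (f j)) \<longrightarrow>
      E f x = (LINT y::real^'n^'m|lebesgue. K (case_option x (\<lambda>j. y $ j)) * (\<Prod>j\<in>UNIV. f j (y $ j)))"
    using assms unfolding CZ_operator_def by (elim conjE exE) (rule that, assumption, assumption, blast)
  obtain C where ml: "multilinear_Lp E qs q C" using bounded_extension_multilinear_Lp[OF ext] by (rule exE)
  obtain A \<epsilon> where A: "A > 0" "\<epsilon> > 0"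
    and size: "\<forall>y. off_diagonal y \<longrightarrow> norm (K y) \<le> A / kernel_dist y ^ (CARD('m) * CARD('n))"
    and reg: "\<forall>y j z. off_diagonal y \<longrightarrow> norm (y j - z) \<le> 1/2 * (MAX k\<in>UNIV. norm (y j - y k)) \<longrightarrow>
      norm (K y - K (y(j := z))) \<le> A * norm (y j - z) powr \<epsilon> / kernel_dist y powr (real (CARD('m) * CARD('n)) + \<epsilon>)"
    using K unfolding CZ_kernel_def by (elim exE conjE) (rule that)
  interpret CZ_data_dim E qs q C K A \<epsilon> "real (CARD('m) * CARD('n))" "real CARD('n)"
  proof (intro CZ_data_dim.intro CZ_data.intro CZ_data_axioms.intro CZ_data_dim_axioms.intro ml A refl)
    show "norm (K y) \<le> A / kernel_dist y ^ (CARD('m) * CARD('n))" if "off_diagonal y" for y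
      by (rule size[THEN spec, THEN mp, OF that])
    show "norm (K y - K (y(j := z))) \<le> A * norm (y j - z) powr \<epsilon> / kernel_dist y powr (real (CARD('m) * CARD('n)) + \<epsilon>)"
      if "off_diagonal y" "norm (y j - z) \<le> 1/2 * (MAX k. norm (y j - y k))" for y j z
      by (rule reg[THEN spec, THEN spec, THEN spec, THEN mp, THEN mp, OF that])
    show "AE x in lebesgue. x \<notin> (\<Inter>j. ess_supp (f j)) \<longrightarrow>
        E f x = (LINT y::real^'n^'m|lebesgue. K (kernel_pt x y) * (\<Prod>j\<in>UNIV. f j (y $ j)))"
      if "\<And>j. f j \<in> schwartz" for f using that by (intro rep allI)
  qed
  obtain C1 where C1: "C1 > 0" and osc: "\<forall>(f :: 'm \<Rightarrow> real^'n \<Rightarrow> complex) M z l a. (\<forall>j. f j \<in> bdd_supp) \<longrightarrow> l > 0 \<longrightarrow> a \<ge> 0 \<longrightarrow>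
    (\<forall>x\<in>cube z l. ennreal a \<le> M x) \<longrightarrow>
    (\<forall>\<rho>\<ge>l. (\<Prod>j\<in>UNIV. \<integral>\<^sup>+y. ennreal (norm (f j y)) * indicator (cube z \<rho>) y \<partial>lborel) \<le> ennreal (a * (2 * \<rho>) powr real (CARD('m) * CARD('n)))) \<longrightarrow>
    (\<exists>c. osc_bound (E f) M C1 z l c) \<and>
    ((\<forall>j x. f j x \<noteq> 0 \<longrightarrow> x \<in> cube z (2 * real CARD('n) * l)) \<longrightarrow> osc_bound (E f) M C1 z l 0)"
    using oscillation by (elim exE conjE)
  \<comment> \<open>One halving of the measure costs 2 C1 in the level.\<close>
  define \<alpha> where "\<alpha> = ln 2 / (2 * C1)"
  have \<alpha>: "\<alpha> > 0" unfolding \<alpha>_def using C1 by simp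
  have main: "measure lebesgue {x \<in> Q. ennreal (norm (E' f x)) > ennreal t * multi_maximal f x}
      \<le> 4 * exp (- \<alpha> * t) * measure lebesgue Q"
    if ext': "bounded_extension T qs' q' E'" and Q: "is_cube Q" and f: "\<forall>j. f j \<in> Linfty_c \<and> ess_supp (f j) \<subseteq> Q" and t: "t > 0"
    for qs' q' E' Q f t
  proof -
    obtain z l where l: "l > 0" and Qz: "Q = cube z l" using Q by (rule is_cubeE)
    let ?V = "(2 * l) ^ CARD('n)"
    have V: "?V > 0" using l by simp
    have mQ: "measure lebesgue Q = ?V" unfolding Qz using l by (intro measure_cube) simp
    have Qm: "Q \<in> sets lebesgue" unfolding Qz by (simp add: cube_def)
    have emQ: "emeasure lebesgue Q = ennreal ?V" unfolding Qz using l by (intro emeasure_lebesgue_cube) simp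
    let ?S = "{x \<in> Q. ennreal (norm (E' f x)) > ennreal t * multi_maximal f x}"
    show ?thesis
    proof (cases "t < C1")
      case True
      have "measure lebesgue ?S \<le> ?V"
        by (rule measure_le_of_subset[OF _ Qm]) (use emQ V in auto)
      also have "\<dots> = 1 * ?V" by simp
      also have "\<dots> \<le> 4 * exp (- \<alpha> * t) * ?V"
        using exp_small_t[OF C1 True] V unfolding \<alpha>_def by (intro mult_right_mono) simp_all
      finally show ?thesis unfolding mQ .
    next
      case False
      obtain C' where ml': "multilinear_Lp E' qs' q' C'" using bounded_extension_multilinear_Lp[OF ext'] by (rule exE)
      interpret e': multilinear_Lp E' qs' q' C' by (rule ml')
      have "\<forall>j. \<exists>g. g \<in> bdd_supp \<and> (AE x in lebesgue. f j x = g x) \<and> (\<forall>x. g x \<noteq> 0 \<longrightarrow> x \<in> cube z l)"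
        using bdd_supp_representative f unfolding Qz by blast
      from choice[OF this] obtain g where g: "\<forall>j. g j \<in> bdd_supp \<and> (AE x in lebesgue. f j x = g j x) \<and> (\<forall>x. g j x \<noteq> 0 \<longrightarrow> x \<in> cube z l)"
        by (rule exE)
      have gb: "g j \<in> bdd_supp" and fg: "AE x in lebesgue. f j x = g j x" and gs: "g j x \<noteq> 0 \<Longrightarrow> x \<in> cube z l" for j x
        using g by blast+
      have gL: "g j \<in> Lp_space (qs' j)" for j by (rule e'.Lp_bdd_supp[OF gb])
      have fL: "f j \<in> Lp_space (qs' j)" for j
      proof -
        have fm: "f j \<in> borel_measurable lebesgue" using f by (simp add: Linfty_c_def)
        have gm: "g j \<in> borel_measurable lebesgue" using gL[of j] by (simp add: Lp_space_def)
        have "integrable lebesgue (\<lambda>x. norm (f j x) powr qs' j) \<longleftrightarrow> integrable lebesgue (\<lambda>x. norm (g j x) powr qs' j)"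
          using fm gm fg[of j] by (intro integrable_cong_AE) (measurable, auto)
        thus ?thesis using gL[of j] fm by (simp add: Lp_space_def)
      qed
      \<comment> \<open>The arbitrary extension at \<open>f\<close> is reduced to the fixed
        extension at the Borel representatives, off one null set.\<close>
      have "AE x in lebesgue. E' f x = E' g x" by (rule e'.E_AE_cong[OF fL gL fg])
      moreover have "AE x in lebesgue. E' g x = E g x" by (rule bounded_extension_unique[OF ext' ext gb])
      ultimately have "AE x in lebesgue. E' f x = E g x" by eventually_elim simp
      then obtain N0 where N0: "N0 \<in> null_sets lebesgue" "{x. \<not> E' f x = E g x} \<subseteq> N0"
        unfolding eventually_ae_filter by auto
      have Mfg: "multi_maximal f = multi_maximal g" by (rule multi_maximal_cong[OF fg])
      \<comment> \<open>The oscillation bound on every cube, with the maximal function of the whole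
        tuple as majorant.\<close>
      have osc': "(\<exists>c. osc_bound (E g) (multi_maximal g) C1 w r c) \<and>
          ((\<forall>j x. g j x \<noteq> 0 \<longrightarrow> x \<in> cube w (2 * real CARD('n) * r)) \<longrightarrow> osc_bound (E g) (multi_maximal g) C1 w r 0)"
        if r: "r > 0" for w r
      proof -
        obtain a where a: "a \<ge> 0" "\<forall>x\<in>cube w r. ennreal a \<le> multi_maximal g x"
          "\<forall>\<rho>\<ge>r. (\<Prod>j\<in>UNIV. \<integral>\<^sup>+y. ennreal (norm (g j y)) * indicator (cube w \<rho>) y \<partial>lborel)
             \<le> ennreal (a * (2 * \<rho>) powr (real (CARD('m) * CARD('n))))"
          using multi_maximal_lower_bound[of g r w, OF gb r] by (elim exE conjE)
        show ?thesis by (rule osc[rule_format, of g r a w]) (use gb r a in blast)+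
      qed
      \<comment> \<open>\<open>Q\<close> lies in its own dilate by 2 n, so no argument has a far
        part and the iteration starts with the constant 0.\<close>
      have "1 \<le> CARD('n)" using zero_less_card_finite[where 'a='n] by linarith
      hence "1 \<le> 2 * real CARD('n)" by linarith
      from mult_right_mono[OF this less_imp_le[OF l]] have "l \<le> 2 * real CARD('n) * l" by (simp only: mult_1)
      hence "\<forall>j x. g j x \<noteq> 0 \<longrightarrow> x \<in> cube z (2 * real CARD('n) * l)"
        using gs subsetD[OF cube_mono] by blast
      with osc'[OF l, of z] have start: "osc_bound (E g) (multi_maximal g) C1 z l 0" by blast
      obtain N :: nat where N: "C1 * (2 * real N + 1) \<le> t" "1 / 2 ^ N \<le> 4 * exp (- (ln 2 / (2 * C1)) * t)"
        using exp_decay_choice[OF C1, of t] False by auto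
      have "\<exists>Z\<in>sets lebesgue. emeasure lebesgue Z \<le> ennreal (?V / 2 ^ N) \<and>
          (\<forall>x\<in>cube z l - Z. ennreal (norm (E g x - 0)) \<le> ennreal (C1 * (2 * real N + 1)) * multi_maximal g x)"
        by (rule osc_decay[OF less_imp_le[OF C1] conjunct1[OF osc'] l start])
      then obtain Z where Z: "Z \<in> sets lebesgue" "emeasure lebesgue Z \<le> ennreal (?V / 2 ^ N)"
        "\<forall>x\<in>cube z l - Z. ennreal (norm (E g x - 0)) \<le> ennreal (C1 * (2 * real N + 1)) * multi_maximal g x"
        by (elim bexE conjE)
      have sub: "?S \<subseteq> Z \<union> N0"
      proof
        fix x assume x: "x \<in> ?S"
        show "x \<in> Z \<union> N0"
        proof (rule ccontr)
          assume nx: "x \<notin> Z \<union> N0"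
          hence eq: "E' f x = E g x" using N0(2) by blast
          have "x \<in> cube z l - Z" using nx x unfolding Qz by blast
          with Z(3) have "ennreal (norm (E g x - 0)) \<le> ennreal (C1 * (2 * real N + 1)) * multi_maximal g x"
            by (rule bspec)
          also have "ennreal (C1 * (2 * real N + 1)) * multi_maximal g x \<le> ennreal t * multi_maximal g x"
            by (rule mult_right_mono[OF ennreal_leI[OF N(1)] zero_le])
          finally have "ennreal (norm (E' f x)) \<le> ennreal t * multi_maximal f x"
            unfolding Mfg eq diff_zero .
          moreover have "ennreal (norm (E' f x)) > ennreal t * multi_maximal f x" using x by (simp only: mem_Collect_eq)
          ultimately show False by (rule leD[THEN notE])
        qed
      qed
      have "emeasure lebesgue (Z \<union> N0) = emeasure lebesgue Z" by (rule emeasure_Un_null_set[OF Z(1) N0(1)])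
      hence em: "emeasure lebesgue (Z \<union> N0) \<le> ennreal (?V / 2 ^ N)" using Z(2) by simp
      have "Z \<union> N0 \<in> sets lebesgue" using Z(1) N0(1) by (intro sets.Un) auto
      from measure_le_of_subset[OF sub this em] V have "measure lebesgue ?S \<le> ?V / 2 ^ N" by simp
      also have "\<dots> = 1 / 2 ^ N * ?V" by simp
      also have "\<dots> \<le> 4 * exp (- \<alpha> * t) * ?V"
        using N(2) V unfolding \<alpha>_def by (intro mult_right_mono) simp_all
      finally show ?thesis unfolding mQ .
    qed
  qed
  show ?thesis
  proof (rule exI[of _ \<alpha>], rule exI[of _ 4], intro conjI allI impI)
    show "\<alpha> > 0" by (rule \<alpha>)
    show "(4::real) > 0" by simp
    show "measure lebesgue {x \<in> Q. ennreal (norm (E' f x)) > ennreal t * multi_maximal f x}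
      \<le> 4 * exp (- \<alpha> * t) * measure lebesgue Q"
      if "bounded_extension T qs' q' E'" "is_cube Q" "\<forall>j. f j \<in> Linfty_c \<and> ess_supp (f j) \<subseteq> Q" "t > 0"
      for qs' q' E' Q f t using that by (rule main)
  qed
qed

end
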